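(* Let $\beta>0$ and $\tau_1,\tau_2>0$ be fixed, and for $i\in\{L,G,J\}$ let $X_n^{i,\beta}:=\log(\det W_n^{i,\beta})-\mu^i_{\beta,n}$. Let $i\in\{L,G,J\}$. For every fixed $x>0$, as $n\to\infty$, $$\mathbb{P}\left[X_n^{i,\beta}\ge\frac{2x\log n}\beta\right]=\frac{e^{-\frac{x^2\log n}\beta}}{x\sqrt{\frac{4\pi\log n}\beta}}\,\psi^{i,\beta}(x)\,(1+o(1)),$$ and for every fixed $x\in(-\frac\beta2,0)$, as $n\to\infty$, $$\mathbb{P}\left[X_n^{i,\beta}\le\frac{2x\log n}\beta\right]=\frac{e^{-\frac{x^2\log n}\beta}}{|x|\sqrt{\frac{4\pi\log n}\beta}}\,\psi^{i,\beta}(x)\,(1+o(1)).$$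
   Context: Random determinants. (L) $\det W_n^{L,\beta}=\prod_{k=1}^n\lambda_k$, where $(\lambda_1,\dots,\lambda_n)$ has density on $(0,\infty)^n$ proportional to $\prod_{j<k}|\lambda_k-\lambda_j|^\beta\prod_{k=1}^n\lambda_k^{\beta/2-1}e^{-\lambda_k/2}$ ($\beta$-Laguerre ensemble). (G) $\det W_n^{G,\beta}$ is a random variable distributed as $\prod_{k=2}^n\rho_k$ with $\rho_k$ independent, $\rho_k\sim\mathrm{Beta}\left(\frac\beta2(n-k+1),\frac\beta2(k-1)\right)$ ($\beta$-Uniform Gram ensemble). (J) With $n_1=\lfloor n\tau_1\rfloor$, $n_2=\lfloor n\tau_2\rfloor$, $m=\min(n_1,n_2)$, $M=\max(n_1,n_2)$: $\det W_n^{J,\beta}=\prod_{k=1}^m\lambda_k$, where $(\lambda_1,\dots,\lambda_m)$ has density on $(0,1)^m$ proportional to $\prod_{j<k}|\lambda_k-\lambda_j|^\beta\prod_{k=1}^m\lambda_k^{\beta/2-1}(1-\lambda_k)^{\frac\beta2(M-m+1)-1}$ ($\beta$-Jacobi ensemble). Centerings: $\mu^L_{\beta,n}=(\frac12-\frac1\beta)\log n-n+n\log(\beta n)$; $\mu^G_{\beta,n}=(\frac12-\frac1\beta)\log n-n+\frac1\beta$; $\mu^J_{\beta,n}=(\frac12-\frac1\beta)\log n+(\frac12-\frac1\beta)\log\left(\frac{\tau_1\tau_2}{\tau_1+\tau_2}\right)-\varepsilon(\lfloor n\tau_1\rfloor,\lfloor n\tau_2\rfloor)-\varepsilon(\lfloor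 n\tau_2\rfloor,\lfloor n\tau_1\rfloor)$ with $\varepsilon(x,y)=x\log(1+\frac yx)$. Limiting functions: $\psi^{L,\beta}(z)=\exp(\Upsilon(z))$, $\psi^{G,\beta}(z)=\exp(\Upsilon(z)-\frac{z^2}\beta)$, $\psi^{J,\beta}(z)=\exp\left(\Upsilon(z)+\frac{z^2}\beta\log\left(\frac{\tau_1\tau_2}{\tau_1+\tau_2}\right)\right)$, where for $\mathrm{Re}(z)>-\beta/2$ $$\Upsilon(z)=\frac\beta2\log G\left(\frac{2z}\beta+1\right)-\left(z-\frac12\right)\log\Gamma\left(\frac{2z}\beta+1\right)+\int_0^\infty\frac{\varphi(s)(e^{-sz}-1)}{e^{s\beta/2}-1}ds+\frac{z^2}\beta+\frac z2,$$ $\varphi(s)=\left(\frac12-\frac1s+\frac1{e^s-1}\right)\frac1s$, and $G$ is the Barnes $G$-function (entire, $G(1)=1$, $G(z+1)=G(z)\Gamma(z)$, $G(1+z)=(2\pi)^{z/2}e^{-(z+1)z/2}\prod_{j\ge1}\{(1+\frac zj)^j(1+\frac1j)^{z^2/2}e^{-z}\}$); $\log G,\log\Gamma$ are the analytic branches on the right half-plane that are real on $(0,\infty)$. *)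

theory Defs
  imports "HOL-Probability.Probability" "HOL-Library.Landau_Symbols"
begin

section \<open>The random determinants\<close>

definition normalized_density :: "'a measure \<Rightarrow> ('a \<Rightarrow> real) \<Rightarrow> 'a measure" where
  "normalized_density M w = density M (\<lambda>x. ennreal (w x) / (\<integral>\<^sup>+y. ennreal (w y) \<partial>M))"

text \<open>The number of points of an ensemble varies with \<open>n\<close>, so a configuration of \<open>n\<close> points is a
  function on the index set \<open>{1..n}\<close>, with the product of Lebesgue measures as reference measure.\<close>

definition vandermonde_abs :: "nat \<Rightarrow> (nat \<Rightarrow> real) \<Rightarrow> real" where
  "vandermonde_abs n l = (\<Prod>k\<in>{1..n}. \<Prod>j\<in>{1..<k}. \<bar>l k - l j\<bar>)"

definition laguerre_weight :: "real \<Rightarrow> nat \<Rightarrow> (nat \<Rightarrow> real) \<Rightarrow> real" where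
  "laguerre_weight \<beta> n l =
     (if \<forall>k\<in>{1..n}. 0 < l k
      then vandermonde_abs n l powr \<beta> * (\<Prod>k\<in>{1..n}. l k powr (\<beta> / 2 - 1) * exp (- l k / 2))
      else 0)"

definition laguerre_ensemble :: "real \<Rightarrow> nat \<Rightarrow> (nat \<Rightarrow> real) measure" where
  "laguerre_ensemble \<beta> n =
     normalized_density (\<Pi>\<^sub>M k\<in>{1..n}. lborel) (laguerre_weight \<beta> n)"

definition jacobi_weight :: "real \<Rightarrow> nat \<Rightarrow> nat \<Rightarrow> (nat \<Rightarrow> real) \<Rightarrow> real" where
  "jacobi_weight \<beta> m M l =
     (if \<forall>k\<in>{1..m}. 0 < l k \<and> l k < 1
      then vandermonde_abs m l powr \<beta> *
        (\<Prod>k\<in>{1..m}. l k powr (\<beta> / 2 - 1) *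
           (1 - l k) powr (\<beta> / 2 * (real M - real m + 1) - 1))
      else 0)"

definition jacobi_ensemble :: "real \<Rightarrow> nat \<Rightarrow> nat \<Rightarrow> (nat \<Rightarrow> real) measure" where
  "jacobi_ensemble \<beta> m M =
     normalized_density (\<Pi>\<^sub>M k\<in>{1..m}. lborel) (jacobi_weight \<beta> m M)"

definition beta_density :: "real \<Rightarrow> real \<Rightarrow> real \<Rightarrow> real" where
  "beta_density a b x =
     (if 0 < x \<and> x < 1 then x powr (a - 1) * (1 - x) powr (b - 1) / Beta a b else 0)"

definition beta_distribution :: "real \<Rightarrow> real \<Rightarrow> real measure" where
  "beta_distribution a b = density lborel (\<lambda>x. ennreal (beta_density a b x))"

datatype ensemble = Laguerre | Gram | Jacobi

definition floor_dim :: "real \<Rightarrow> nat \<Rightarrow> nat" where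
  "floor_dim \<tau> n = nat \<lfloor>real n * \<tau>\<rfloor>"

text \<open>The law of \<open>det W\<^sub>n\<close>; the parameters \<open>\<tau>\<^sub>1\<close> and \<open>\<tau>\<^sub>2\<close> only matter for the Jacobi ensemble.\<close>

fun det_law :: "ensemble \<Rightarrow> real \<Rightarrow> real \<Rightarrow> real \<Rightarrow> nat \<Rightarrow> real measure" where
  "det_law Laguerre \<beta> \<tau>1 \<tau>2 n =
     distr (laguerre_ensemble \<beta> n) borel (\<lambda>l. \<Prod>k\<in>{1..n}. l k)"
| "det_law Gram \<beta> \<tau>1 \<tau>2 n =
     distr (\<Pi>\<^sub>M k\<in>{2..n}. beta_distribution (\<beta> / 2 * (real n - real k + 1)) (\<beta> / 2 * (real k - 1)))
       borel (\<lambda>\<rho>. \<Prod>k\<in>{2..n}. \<rho> k)"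
| "det_law Jacobi \<beta> \<tau>1 \<tau>2 n =
     (let m = min (floor_dim \<tau>1 n) (floor_dim \<tau>2 n); M = max (floor_dim \<tau>1 n) (floor_dim \<tau>2 n)
      in distr (jacobi_ensemble \<beta> m M) borel (\<lambda>l. \<Prod>k\<in>{1..m}. l k))"


section \<open>Centerings\<close>

definition eps :: "real \<Rightarrow> real \<Rightarrow> real" where
  "eps x y = x * ln (1 + y / x)"

fun centering :: "ensemble \<Rightarrow> real \<Rightarrow> real \<Rightarrow> real \<Rightarrow> nat \<Rightarrow> real" where
  "centering Laguerre \<beta> \<tau>1 \<tau>2 n =
     (1/2 - 1/\<beta>) * ln (real n) - real n + real n * ln (\<beta> * real n)"
| "centering Gram \<beta> \<tau>1 \<tau>2 n =
     (1/2 - 1/\<beta>) * ln (real n) - real n + 1/\<beta>"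
| "centering Jacobi \<beta> \<tau>1 \<tau>2 n =
     (1/2 - 1/\<beta>) * ln (real n) + (1/2 - 1/\<beta>) * ln (\<tau>1 * \<tau>2 / (\<tau>1 + \<tau>2))
       - eps (real (floor_dim \<tau>1 n)) (real (floor_dim \<tau>2 n)) - eps (real (floor_dim \<tau>2 n)) (real (floor_dim \<tau>1 n))"


section \<open>Limiting functions\<close>

text \<open>The Barnes \<open>G\<close>-function on the real line. The product formula expresses \<open>G(1 + z)\<close>, so it is
  used at \<open>z = w - 1\<close>.\<close>

definition barnes_G :: "real \<Rightarrow> real" where
  "barnes_G w = (let z = w - 1 in
     (2 * pi) powr (z / 2) * exp (- ((z + 1) * z / 2)) *
     (\<Prod>i. (1 + z / real (Suc i)) ^ Suc i * (1 + 1 / real (Suc i)) powr (z\<^sup>2 / 2) * exp (- z)))"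

definition phi :: "real \<Rightarrow> real" where
  "phi s = (1/2 - 1/s + 1 / (exp s - 1)) * (1/s)"

text \<open>Only real arguments \<open>z > -\<beta>/2\<close> are needed. There \<open>2z/\<beta> + 1\<close> is positive, so the analytic
  branches of \<open>log G\<close> and \<open>log \<Gamma>\<close> on the right half-plane are the real logarithms.\<close>

definition Upsilon :: "real \<Rightarrow> real \<Rightarrow> real" where
  "Upsilon \<beta> z =
     \<beta> / 2 * ln (barnes_G (2 * z / \<beta> + 1))
     - (z - 1/2) * ln (Gamma (2 * z / \<beta> + 1))
     + (LINT s:{0<..}|lborel. phi s * (exp (- (s * z)) - 1) / (exp (s * \<beta> / 2) - 1))
     + z\<^sup>2 / \<beta> + z / 2"

fun psi :: "ensemble \<Rightarrow> real \<Rightarrow> real \<Rightarrow> real \<Rightarrow> real \<Rightarrow> real" where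
  "psi Laguerre \<beta> \<tau>1 \<tau>2 z = exp (Upsilon \<beta> z)"
| "psi Gram \<beta> \<tau>1 \<tau>2 z = exp (Upsilon \<beta> z - z\<^sup>2 / \<beta>)"
| "psi Jacobi \<beta> \<tau>1 \<tau>2 z = exp (Upsilon \<beta> z + z\<^sup>2 / \<beta> * ln (\<tau>1 * \<tau>2 / (\<tau>1 + \<tau>2)))"

end

theory Submission
  imports Defs "HOL-Real_Asymp.Real_Asymp"
begin

text \<open>The tails of \<open>X\<close> are read off from the Mellin transform of the determinant near the line \<open>Re z = x\<close>.

The Mellin transform is explicit. With \<open>a\<^sub>k = \<beta> k / 2\<close>, the moment of order \<open>z\<close> of the determinant is a product of
quotients \<open>\<Gamma>(a\<^sub>k + z) / \<Gamma>(a\<^sub>k)\<close>, divided for the Gram and the Jacobi ensembles by the corresponding quotients at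
points \<open>c\<^sub>k \<ge> a\<^sub>k\<close>, and multiplied by \<open>2\<close> to the power \<open>n z\<close> for the Laguerre ensemble (\<open>det_law_has_mellin\<close>). For the Gram ensemble this is a product of moments of Beta variables. For
the Laguerre and Jacobi ensembles it is Selberg's integral with a complex exponent \<open>s\<close>. Aomoto's integration
by parts gives the ratio of its values at \<open>s + 1\<close> and \<open>s\<close> (\<open>moment_recurrence\<close>), so that its quotient by the
product of Gamma functions has period 1. The quotient is constant because, after a large shift of the
exponent, the determinant concentrates around its mean (\<open>selberg_eq\<close>).

On the real axis, Binet's formula for \<open>ln \<Gamma>\<close> and the products for \<open>G\<close> and \<open>\<Gamma>\<close> show that the logarithm of the
exponential moment of order \<open>z\<close> of \<open>X\<close> is \<open>z\<^sup>2 t / 2 + ln (\<psi> z) + o(1)\<close> with \<open>t = 2 ln n / \<beta>\<close> (\<open>log_mellin_LIMSEQ\<close>): up to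
the factor \<open>\<psi>\<close>, the variable \<open>X\<close> is Gaussian with variance \<open>t\<close>.

Fix \<open>x \<noteq> 0\<close> and weight the law of \<open>X\<close> with \<open>exp (x X)\<close>. Under the weighted law, \<open>X - t x\<close> has a bounded mean and
a variance \<open>t + O(1)\<close>, and the logarithm of its characteristic function is quadratic up to an error \<open>O(|u|\<^sup>3)\<close>
uniform in \<open>n\<close>, because the second derivatives of the digamma function at the points \<open>a\<^sub>k\<close> are summable
(\<open>complex_log_mellin_cubic_Taylor\<close>, \<open>mellin_mean_variance_bounded\<close>). For \<open>|u| \<ge> 1\<close> the characteristic function is at most
\<open>C exp (- t / 2) / (1 + u\<^sup>2)\<close>, because the modulus of every Gamma quotient decreases in \<open>|u|\<close> and the first one decays
at least like \<open>1 / u\<^sup>2\<close> (\<open>det_mellin_vertical_decay\<close>). Levy's inversion formula then shows that every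
interval of fixed length with \<open>t x\<close> as an end point has under the weighted law a mass asymptotic to its length
divided by \<open>sqrt (2 \<pi> t)\<close>; integrating \<open>exp (- \<bar>x\<bar> y)\<close> against this constant density over \<open>y \<ge> 0\<close> gives
\<open>1 / (\<bar>x\<bar> sqrt (2 \<pi> t))\<close> (\<open>tilted_tail_LIMSEQ\<close>). Removing the weight multiplies this by \<open>\<psi> x exp (- t x\<^sup>2 / 2)\<close>, which is the claim.
The two tails differ only in the sign of \<open>X - t x\<close>.\<close>

section \<open>Powers of the discriminant and integration by parts\<close>

text \<open>The product over ordered pairs counts every pair of indices twice, so that \<open>disc_pow \<gamma>\<close> is the power \<open>2 \<gamma>\<close> of
the absolute Vandermonde determinant. Taken over ordered pairs, the product is visibly symmetric.\<close>

definition disc_pow :: "real \<Rightarrow> 'i set \<Rightarrow> ('i \<Rightarrow> real) \<Rightarrow> real" where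
  "disc_pow \<gamma> I l = (\<Prod>i\<in>I. \<Prod>j\<in>I - {i}. \<bar>l i - l j\<bar> powr \<gamma>)"

lemma disc_pow_nonneg: "0 \<le> disc_pow \<gamma> I l"
  unfolding disc_pow_def by (intro prod_nonneg) auto

lemma disc_pow_insert:
  assumes "finite J" "p \<notin> J"
  shows "disc_pow \<gamma> (insert p J) l = (\<Prod>j\<in>J. \<bar>l p - l j\<bar> powr (2 * \<gamma>)) * disc_pow \<gamma> J l"
proof -
  have *: "(\<Prod>j\<in>insert p J - {i}. \<bar>l i - l j\<bar> powr \<gamma>) =
     \<bar>l p - l i\<bar> powr \<gamma> * (\<Prod>j\<in>J - {i}. \<bar>l i - l j\<bar> powr \<gamma>)" if "i \<in> J" for i
  proof -
    have "insert p J - {i} = insert p (J - {i})" using that assms by auto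
    then show ?thesis using assms by (simp add: abs_minus_commute)
  qed
  have "disc_pow \<gamma> (insert p J) l =
      (\<Prod>j\<in>J. \<bar>l p - l j\<bar> powr \<gamma>) * (\<Prod>i\<in>J. \<Prod>j\<in>insert p J - {i}. \<bar>l i - l j\<bar> powr \<gamma>)"
    unfolding disc_pow_def using assms by (subst prod.insert) simp_all
  also have "\<dots> = (\<Prod>j\<in>J. \<bar>l p - l j\<bar> powr \<gamma>) *
      ((\<Prod>j\<in>J. \<bar>l p - l j\<bar> powr \<gamma>) * disc_pow \<gamma> J l)"
    by (simp add: * prod.distrib disc_pow_def)
  also have "\<dots> = (\<Prod>j\<in>J. \<bar>l p - l j\<bar> powr (2 * \<gamma>)) * disc_pow \<gamma> J l"
    unfolding mult_2 powr_add prod.distrib by (rule mult.assoc[symmetric])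
  finally show ?thesis .
qed

lemma disc_pow_permute:
  assumes "\<pi> permutes I"
  shows "disc_pow \<gamma> I (l \<circ> \<pi>) = disc_pow \<gamma> I l"
proof -
  have "disc_pow \<gamma> I (l \<circ> \<pi>) = (\<Prod>i\<in>I. \<Prod>j\<in>I - {\<pi> i}. \<bar>l (\<pi> i) - l j\<bar> powr \<gamma>)"
    unfolding disc_pow_def
  proof (rule prod.cong[OF refl])
    fix i assume "i \<in> I"
    have "bij_betw \<pi> (I - {i}) (I - {\<pi> i})"
      using assms \<open>i \<in> I\<close> by (intro bij_betw_DiffI) (auto intro: permutes_imp_bij simp: permutes_in_image)
    from prod.reindex_bij_betw[OF this, of "\<lambda>j. \<bar>l (\<pi> i) - l j\<bar> powr \<gamma>"]
    show "(\<Prod>j\<in>I - {i}. \<bar>(l \<circ> \<pi>) i - (l \<circ> \<pi>) j\<bar> powr \<gamma>) = (\<Prod>j\<in>I - {\<pi> i}. \<bar>l (\<pi> i) - l j\<bar> powr \<gamma>)"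
      by simp
  qed
  also have "\<dots> = disc_pow \<gamma> I l"
    unfolding disc_pow_def
    by (rule prod.reindex_bij_betw[OF permutes_imp_bij[OF assms],
          of "\<lambda>i. \<Prod>j\<in>I - {i}. \<bar>l i - l j\<bar> powr \<gamma>"])
  finally show ?thesis .
qed

lemma disc_pow_eq_0:
  assumes "finite I" "i \<in> I" "j \<in> I" "i \<noteq> j" "l i = l j"
  shows "disc_pow \<gamma> I l = 0"
proof -
  have "(\<Prod>j\<in>I - {i}. \<bar>l i - l j\<bar> powr \<gamma>) = 0"
    using assms by (subst prod_zero_iff) auto
  then show ?thesis unfolding disc_pow_def using assms by (subst prod_zero_iff) auto
qed

lemma powr_le_power_ceiling:
  fixes z \<gamma> :: real
  assumes "1 \<le> z" "\<gamma> \<le> real B"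
  shows "z powr \<gamma> \<le> z ^ B"
  using powr_mono[OF assms(2,1)] assms(1) by (simp add: powr_realpow)

text \<open>The factors of the bound depend on one variable each, which makes every integrability question below a
question about one-dimensional integrals with polynomial weights.\<close>

lemma dist_powr_le:
  fixes x y \<gamma> :: real
  assumes "0 \<le> \<gamma>" "\<gamma> \<le> real B"
  shows "\<bar>x - y\<bar> powr \<gamma> \<le> (1 + \<bar>x\<bar>) ^ B * (1 + \<bar>y\<bar>) ^ B"
proof -
  have *: "\<bar>x - y\<bar> \<le> (1 + \<bar>x\<bar>) * (1 + \<bar>y\<bar>)"
  proof -
    have "0 \<le> \<bar>x\<bar> * \<bar>y\<bar>" by simp
    then show ?thesis unfolding distrib_left distrib_right by linarith
  qed
  have "1 \<le> (1 + \<bar>x\<bar>) * (1 + \<bar>y\<bar>)"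
    by (intro mult_ge1_I) auto
  then have "((1 + \<bar>x\<bar>) * (1 + \<bar>y\<bar>)) powr \<gamma> \<le> ((1 + \<bar>x\<bar>) * (1 + \<bar>y\<bar>)) ^ B"
    by (rule powr_le_power_ceiling) fact
  moreover have "\<bar>x - y\<bar> powr \<gamma> \<le> ((1 + \<bar>x\<bar>) * (1 + \<bar>y\<bar>)) powr \<gamma>"
    using * assms by (intro powr_mono2) auto
  ultimately show ?thesis by (simp add: power_mult_distrib)
qed

lemma disc_pow_le:
  assumes "finite I" "0 \<le> \<gamma>" "\<gamma> \<le> real B"
  shows "disc_pow \<gamma> I l \<le> (\<Prod>i\<in>I. (1 + \<bar>l i\<bar>) ^ (2 * B * card I))"
proof -
  let ?w = "\<lambda>i. (1 + \<bar>l i\<bar>) ^ B"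
  have "disc_pow \<gamma> I l \<le> (\<Prod>i\<in>I. \<Prod>j\<in>I - {i}. ?w i * ?w j)"
    unfolding disc_pow_def using dist_powr_le[OF assms(2,3)]
    by (intro prod_mono conjI prod_nonneg) auto
  also have "\<dots> \<le> (\<Prod>i\<in>I. \<Prod>j\<in>I. ?w i * ?w j)"
  proof (rule prod_mono, intro conjI)
    fix i assume i: "i \<in> I"
    have "1 * (\<Prod>j\<in>I - {i}. ?w i * ?w j) \<le> (?w i * ?w i) * (\<Prod>j\<in>I - {i}. ?w i * ?w j)"
      by (intro mult_right_mono prod_nonneg mult_ge1_I) (auto simp: one_le_power)
    also have "\<dots> = (\<Prod>j\<in>I. ?w i * ?w j)"
      using i assms by (subst prod.remove[of I i]) auto
    finally show "(\<Prod>j\<in>I - {i}. ?w i * ?w j) \<le> (\<Prod>j\<in>I. ?w i * ?w j)" by simp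
  qed (auto intro!: prod_nonneg)
  also have "\<dots> = (\<Prod>i\<in>I. (1 + \<bar>l i\<bar>) ^ (2 * B * card I))"
    by (simp add: prod.distrib prod_power_distrib mult_2 distrib_right power_add power_mult mult.assoc)
  finally show ?thesis .
qed

lemma product_sigma_finite_lborel: "product_sigma_finite (\<lambda>_. lborel :: real measure)"
  by standard

lemmas lborel_PiM_eqI = product_sigma_finite.PiM_eqI[OF product_sigma_finite_lborel]
  and lborel_emeasure_PiM = product_sigma_finite.emeasure_PiM[OF product_sigma_finite_lborel]
  and lborel_product_integrable_prod = product_sigma_finite.product_integrable_prod[OF product_sigma_finite_lborel]
  and lborel_product_nn_integral_insert = product_sigma_finite.product_nn_integral_insert[OF product_sigma_finite_lborel]
  and lborel_product_integral_insert = product_sigma_finite.product_integral_insert[OF product_sigma_finite_lborel]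

lemma measurable_comp_permute [measurable]:
  assumes "\<pi> permutes I"
  shows "(\<lambda>l. l \<circ> \<pi>) \<in> measurable (Pi\<^sub>M I (\<lambda>_. lborel :: real measure)) (Pi\<^sub>M I (\<lambda>_. lborel))"
  unfolding comp_def
proof (rule measurable_PiM_single')
  fix i assume "i \<in> I"
  then have "\<pi> i \<in> I" using assms by (simp add: permutes_in_image)
  then show "(\<lambda>l. l (\<pi> i)) \<in> measurable (Pi\<^sub>M I (\<lambda>_. lborel :: real measure)) lborel"
    by (rule measurable_component_singleton)
next
  show "(\<lambda>l x. l (\<pi> x)) \<in> space (Pi\<^sub>M I (\<lambda>_. lborel :: real measure)) \<rightarrow> (\<Pi>\<^sub>E i\<in>I. space lborel)"
    using assms by (auto simp: space_PiM PiE_def extensional_def permutes_def)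
qed

lemma distr_PiM_permute:
  assumes "finite I" "\<pi> permutes I"
  shows "distr (Pi\<^sub>M I (\<lambda>_. lborel :: real measure)) (Pi\<^sub>M I (\<lambda>_. lborel)) (\<lambda>l. l \<circ> \<pi>) = Pi\<^sub>M I (\<lambda>_. lborel)"
proof (rule lborel_PiM_eqI)
  fix A :: "_ \<Rightarrow> real set" assume A: "\<And>i. i \<in> I \<Longrightarrow> A i \<in> sets lborel"
  note [measurable] = measurable_comp_permute[OF assms(2)]
  have inv: "inv \<pi> permutes I" using assms(2) by (rule permutes_inv)
  have A': "A (inv \<pi> i) \<in> sets borel" if "i \<in> I" for i
    using A[of "inv \<pi> i"] that inv by (simp add: permutes_in_image)
  have "(\<lambda>l. l \<circ> \<pi>) -` Pi\<^sub>E I A \<inter> space (Pi\<^sub>M I (\<lambda>_. lborel)) = Pi\<^sub>E I (\<lambda>i. A (inv \<pi> i))"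
  proof (intro equalityI subsetI)
    fix l assume l: "l \<in> (\<lambda>l. l \<circ> \<pi>) -` Pi\<^sub>E I A \<inter> space (Pi\<^sub>M I (\<lambda>_. lborel))"
    have "l i \<in> A (inv \<pi> i)" if "i \<in> I" for i
    proof -
      have "inv \<pi> i \<in> I" using that inv by (simp add: permutes_in_image)
      then have "l (\<pi> (inv \<pi> i)) \<in> A (inv \<pi> i)" using l by (auto simp: PiE_def)
      then show ?thesis using permutes_inverses(1)[OF assms(2)] by simp
    qed
    then show "l \<in> Pi\<^sub>E I (\<lambda>i. A (inv \<pi> i))" using l by (auto simp: space_PiM PiE_def)
  next
    fix l assume l: "l \<in> Pi\<^sub>E I (\<lambda>i. A (inv \<pi> i))"
    have "l (\<pi> i) \<in> A i" if "i \<in> I" for i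
    proof -
      have "\<pi> i \<in> I" using that assms by (simp add: permutes_in_image)
      then have "l (\<pi> i) \<in> A (inv \<pi> (\<pi> i))" using l by (auto simp: PiE_def)
      then show ?thesis using permutes_inverses(2)[OF assms(2)] by simp
    qed
    moreover have "l (\<pi> i) = undefined" if "i \<notin> I" for i
      using l that assms(2) by (auto simp: PiE_def extensional_def permutes_def)
    ultimately show "l \<in> (\<lambda>l. l \<circ> \<pi>) -` Pi\<^sub>E I A \<inter> space (Pi\<^sub>M I (\<lambda>_. lborel))"
      using l by (auto simp: space_PiM PiE_def extensional_def)
  qed
  then have "emeasure (distr (Pi\<^sub>M I (\<lambda>_. lborel)) (Pi\<^sub>M I (\<lambda>_. lborel)) (\<lambda>l. l \<circ> \<pi>)) (Pi\<^sub>E I A) =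
      emeasure (Pi\<^sub>M I (\<lambda>_. lborel)) (Pi\<^sub>E I (\<lambda>i. A (inv \<pi> i)))"
    using A assms by (subst emeasure_distr) (auto intro!: sets_PiM_I_finite)
  also have "\<dots> = (\<Prod>i\<in>I. emeasure lborel (A (inv \<pi> i)))"
    using A' assms by (intro lborel_emeasure_PiM) auto
  also have "\<dots> = (\<Prod>i\<in>I. emeasure lborel (A i))"
    by (rule prod.reindex_bij_betw[OF permutes_imp_bij[OF inv]])
  finally show "emeasure (distr (Pi\<^sub>M I (\<lambda>_. lborel)) (Pi\<^sub>M I (\<lambda>_. lborel)) (\<lambda>l. l \<circ> \<pi>)) (Pi\<^sub>E I A) =
      (\<Prod>i\<in>I. emeasure lborel (A i))" .
qed (use assms in auto)

lemma integral_PiM_permute: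
  fixes f :: "('i \<Rightarrow> real) \<Rightarrow> complex"
  assumes "finite I" "\<pi> permutes I" and f: "f \<in> borel_measurable (Pi\<^sub>M I (\<lambda>_. lborel))"
  shows "(LINT l|Pi\<^sub>M I (\<lambda>_. lborel). f (l \<circ> \<pi>)) = (LINT l|Pi\<^sub>M I (\<lambda>_. lborel). f l)"
    and "integrable (Pi\<^sub>M I (\<lambda>_. lborel)) (\<lambda>l. f (l \<circ> \<pi>)) \<longleftrightarrow> integrable (Pi\<^sub>M I (\<lambda>_. lborel)) f"
  using integral_distr[OF measurable_comp_permute[OF assms(2)] f]
    integrable_distr_eq[OF measurable_comp_permute[OF assms(2)] f]
  by (simp_all add: distr_PiM_permute[OF assms(1,2)])

text \<open>The finite exceptional set accommodates \<open>\<bar>t - y\<bar> powr (2 * \<gamma>)\<close>, which for small \<open>\<gamma>\<close> is continuous but not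
differentiable at \<open>y\<close>.\<close>

lemma integral_derivative_eq_0:
  fixes F f :: "real \<Rightarrow> complex"
  assumes int: "integrable lborel f" and cont: "continuous_on UNIV F" and "finite E"
    and deriv: "\<And>t. t \<notin> E \<Longrightarrow> (F has_vector_derivative f t) (at t)"
    and lim: "(F \<longlongrightarrow> 0) at_top" "(F \<longlongrightarrow> 0) at_bot"
  shows "(LINT t|lborel. f t) = 0"
proof -
  have 1: "(LINT t|lborel. indicator {- real n..real n} t *\<^sub>R f t) = F (real n) - F (- real n)" for n
  proof -
    have si: "set_integrable lborel {- real n..real n} f"
      unfolding set_integrable_def using int by (intro integrable_mult_indicator) auto
    have "(f has_integral (F (real n) - F (- real n))) {- real n..real n}"
      using assms by (intro fundamental_theorem_of_calculus_interior_strong[OF \<open>finite E\<close>])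
        (auto intro: continuous_on_subset)
    then have "integral {- real n..real n} f = F (real n) - F (- real n)" by (rule integral_unique)
    then show ?thesis
      using set_borel_integral_eq_integral(2)[OF si] by (simp add: set_lebesgue_integral_def)
  qed
  have "(\<lambda>n. LINT t|lborel. indicator {- real n..real n} t *\<^sub>R f t) \<longlonglongrightarrow> (LINT t|lborel. f t)"
  proof (rule integral_dominated_convergence[where w = "\<lambda>t. norm (f t)"])
    have "(\<lambda>n. indicator {- real n..real n} t *\<^sub>R f t) \<longlonglongrightarrow> f t" for t
    proof (rule tendsto_eventually)
      have "eventually (\<lambda>n. \<bar>t\<bar> \<le> real n) sequentially"
        using filterlim_at_top filterlim_real_sequentially by blast
      then show "eventually (\<lambda>n. indicator {- real n..real n} t *\<^sub>R f t = f t) sequentially"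
        by eventually_elim (auto simp: indicator_def abs_le_iff)
    qed
    then show "AE t in lborel. (\<lambda>n. indicator {- real n..real n} t *\<^sub>R f t) \<longlonglongrightarrow> f t" by simp
  qed (use int in \<open>auto simp: indicator_def\<close>)
  moreover have "(\<lambda>n. F (real n) - F (- real n)) \<longlonglongrightarrow> 0 - 0"
    using filterlim_compose[OF lim(1) filterlim_real_sequentially]
      filterlim_compose[OF lim(2) filterlim_compose[OF filterlim_uminus_at_bot_at_top filterlim_real_sequentially]]
    by (intro tendsto_diff) auto
  ultimately show ?thesis unfolding 1 by (metis LIMSEQ_unique diff_zero)
qed

section \<open>Weights of Pearson type\<close>

text \<open>Up to a factor, the derivative of \<open>\<bar>x\<bar> powr (2 * \<gamma>)\<close> in absolute value: an integrable singularity at \<open>0\<close>.\<close>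

definition sing_kernel :: "real \<Rightarrow> real \<Rightarrow> real" where
  "sing_kernel \<gamma> x = \<bar>x\<bar> powr (2 * \<gamma>) / \<bar>x\<bar>"

lemma sing_kernel_nonneg: "0 \<le> sing_kernel \<gamma> x"
  by (simp add: sing_kernel_def)

lemma sing_kernel_measurable [measurable]: "sing_kernel \<gamma> \<in> borel_measurable borel"
  unfolding sing_kernel_def by measurable

lemma sing_kernel_le:
  assumes "0 < \<gamma>" "2 * \<gamma> \<le> real B"
  shows "sing_kernel \<gamma> (t - y) \<le>
     indicator {-1..1} (t - y) * \<bar>t - y\<bar> powr (2 * \<gamma> - 1) + (1 + \<bar>t\<bar>) ^ B * (1 + \<bar>y\<bar>) ^ B"
proof (cases "\<bar>t - y\<bar> \<le> 1")
  case True
  have "sing_kernel \<gamma> (t - y) = \<bar>t - y\<bar> powr (2 * \<gamma> - 1)"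
    by (cases "t = y") (auto simp: sing_kernel_def powr_diff)
  then show ?thesis using True by (auto simp: indicator_def abs_le_iff)
next
  case False
  have "sing_kernel \<gamma> (t - y) \<le> \<bar>t - y\<bar> powr (2 * \<gamma>)"
    unfolding sing_kernel_def using False
    by (intro divide_le_eq[THEN iffD2]) (auto simp: mult_le_cancel_left1)
  also have "\<dots> \<le> (1 + \<bar>t\<bar>) ^ B * (1 + \<bar>y\<bar>) ^ B"
    using dist_powr_le[of "2 * \<gamma>" B t y] assms by simp
  finally show ?thesis using False by (auto simp: indicator_def)
qed

lemma nn_integral_abs_powr_near_0:
  assumes "0 < \<gamma>"
  shows "(\<integral>\<^sup>+t. ennreal (indicator {-1..1} t * \<bar>t\<bar> powr (2 * \<gamma> - 1)) \<partial>lborel) < \<infinity>"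
proof -
  have 1: "((\<lambda>t. t powr (2 * \<gamma> - 1)) has_integral 1 powr (2 * \<gamma>) / (2 * \<gamma>)) {0..1}"
    using has_integral_powr_from_0[of "2 * \<gamma> - 1" 1] assms by simp
  have "(\<integral>\<^sup>+t. ennreal (indicator {0..1} t * \<bar>t\<bar> powr (2 * \<gamma> - 1)) \<partial>lborel) =
      (\<integral>\<^sup>+t. ennreal (indicator {0..1} t * t powr (2 * \<gamma> - 1)) \<partial>lborel)"
    by (intro nn_integral_cong) (auto simp: indicator_def)
  also have "\<dots> = ennreal (1 / (2 * \<gamma>))"
    using nn_integral_has_integral_lebesgue[OF _ 1] by simp
  finally have 2: "(\<integral>\<^sup>+t. ennreal (indicator {0..1} t * \<bar>t\<bar> powr (2 * \<gamma> - 1)) \<partial>lborel) < \<infinity>" by simp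
  have 3: "(\<integral>\<^sup>+t. ennreal (indicator {-1..0} t * \<bar>t\<bar> powr (2 * \<gamma> - 1)) \<partial>lborel) =
       (\<integral>\<^sup>+t. ennreal (indicator {0..1} t * \<bar>t\<bar> powr (2 * \<gamma> - 1)) \<partial>lborel)"
    by (subst nn_integral_real_affine[where c = "-1" and t = 0])
      (auto intro!: nn_integral_cong simp: indicator_def)
  have "(\<integral>\<^sup>+t. ennreal (indicator {-1..1} t * \<bar>t\<bar> powr (2 * \<gamma> - 1)) \<partial>lborel) \<le>
      (\<integral>\<^sup>+t. ennreal (indicator {-1..0} t * \<bar>t\<bar> powr (2 * \<gamma> - 1)) +
         ennreal (indicator {0..1} t * \<bar>t\<bar> powr (2 * \<gamma> - 1)) \<partial>lborel)"
    by (intro nn_integral_mono) (auto simp: indicator_def simp flip: ennreal_plus)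
  also have "\<dots> = (\<integral>\<^sup>+t. ennreal (indicator {-1..0} t * \<bar>t\<bar> powr (2 * \<gamma> - 1)) \<partial>lborel) +
      (\<integral>\<^sup>+t. ennreal (indicator {0..1} t * \<bar>t\<bar> powr (2 * \<gamma> - 1)) \<partial>lborel)"
    by (intro nn_integral_add) auto
  also have "\<dots> < \<infinity>" using 2 3 by (simp add: ennreal_add_eq_top less_top)
  finally show ?thesis .
qed

text \<open>The name refers to Pearson's differential equation, in which \<open>(p q)'\<close> is a multiple of \<open>q\<close> by an affine function;
here \<open>p t = t - \<kappa> t\<^sup>2\<close>. The values \<open>\<kappa> = 0\<close> and \<open>\<kappa> = 1\<close> cover the Laguerre weight and the Jacobi weight, and the complex
parameter \<open>s\<close> fixes the behaviour \<open>t powr (s - 1)\<close> of the weight at \<open>0\<close>. As \<open>q\<close> may be unbounded at the ends of its support, bounds are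
required only for \<open>p q\<close>.\<close>

locale pearson_weight =
  fixes q :: "real \<Rightarrow> complex" and s c :: complex and \<kappa> :: real
  assumes q_measurable [measurable]: "q \<in> borel_measurable borel"
    and q_integrable: "\<And>k. integrable lborel (\<lambda>t. norm (q t) * (1 + \<bar>t\<bar>) ^ k)"
    and Q_cont: "continuous_on UNIV (\<lambda>t. of_real (t - \<kappa> * t\<^sup>2) * q t)"
    and Q_deriv: "\<exists>E. finite E \<and> (\<forall>t. t \<notin> E \<longrightarrow>
        ((\<lambda>t. of_real (t - \<kappa> * t\<^sup>2) * q t) has_vector_derivative (s - c * of_real t) * q t) (at t))"
    and Q_bounded: "\<And>k. \<exists>C. \<forall>t. norm (of_real (t - \<kappa> * t\<^sup>2) * q t) * (1 + \<bar>t\<bar>) ^ k \<le> C"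
begin

definition Q :: "real \<Rightarrow> complex" where "Q t = of_real (t - \<kappa> * t\<^sup>2) * q t"

lemma Q_measurable [measurable]: "Q \<in> borel_measurable borel"
  unfolding Q_def by measurable

lemma Q_integrable: "integrable lborel (\<lambda>t. norm (Q t) * (1 + \<bar>t\<bar>) ^ k)"
proof (rule Bochner_Integration.integrable_bound)
  show "integrable lborel (\<lambda>t. (1 + \<bar>\<kappa>\<bar>) * (norm (q t) * (1 + \<bar>t\<bar>) ^ (k + 2)))"
    by (intro integrable_mult_right q_integrable)
  have "norm (Q t) * (1 + \<bar>t\<bar>) ^ k \<le> (1 + \<bar>\<kappa>\<bar>) * (norm (q t) * (1 + \<bar>t\<bar>) ^ (k + 2))" for t
  proof -
    have "\<bar>t - \<kappa> * t\<^sup>2\<bar> \<le> \<bar>t\<bar> + \<bar>\<kappa>\<bar> * t\<^sup>2"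
      by (rule order_trans[OF abs_triangle_ineq4]) (simp add: abs_mult)
    also have "\<dots> \<le> (1 + \<bar>\<kappa>\<bar>) * (1 + \<bar>t\<bar>)\<^sup>2"
    proof -
      have "\<bar>t\<bar> \<le> (1 + \<bar>t\<bar>)\<^sup>2" "t\<^sup>2 \<le> (1 + \<bar>t\<bar>)\<^sup>2"
        by (auto simp: power2_eq_square algebra_simps)
      then show ?thesis by (simp add: distrib_right add_mono mult_left_mono)
    qed
    finally have "\<bar>t - \<kappa> * t\<^sup>2\<bar> * (norm (q t) * (1 + \<bar>t\<bar>) ^ k) \<le>
        (1 + \<bar>\<kappa>\<bar>) * (1 + \<bar>t\<bar>)\<^sup>2 * (norm (q t) * (1 + \<bar>t\<bar>) ^ k)"
      by (intro mult_right_mono) auto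
    then show ?thesis unfolding Q_def norm_mult norm_of_real by (simp only: power_add mult_ac)
  qed
  then show "AE t in lborel. norm (norm (Q t) * (1 + \<bar>t\<bar>) ^ k) \<le>
      norm ((1 + \<bar>\<kappa>\<bar>) * (norm (q t) * (1 + \<bar>t\<bar>) ^ (k + 2)))"
    by (intro AE_I2) (auto simp: abs_mult)
qed measurable

text \<open>Near the singularity \<open>Q\<close> is bounded and the kernel is integrable; away from it the kernel grows at most
polynomially and \<open>Q\<close> has all moments.\<close>

lemma Q_sing_kernel_le:
  assumes "0 < \<gamma>" "2 * \<gamma> \<le> real B"
  shows "\<exists>C\<ge>0. \<forall>y. (\<integral>\<^sup>+t. ennreal (norm (Q t) * (1 + \<bar>t\<bar>) ^ K * sing_kernel \<gamma> (t - y)) \<partial>lborel) \<le>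
    ennreal (C * (1 + \<bar>y\<bar>) ^ B)"
proof -
  obtain C0 where C0: "\<And>t. norm (Q t) * (1 + \<bar>t\<bar>) ^ K \<le> C0"
    using Q_bounded[of K] unfolding Q_def by auto
  have C0_nonneg: "0 \<le> C0" by (rule order_trans[OF _ C0[of 0]]) auto
  define N where "N = (\<integral>\<^sup>+t. ennreal (indicator {-1..1} t * \<bar>t\<bar> powr (2 * \<gamma> - 1)) \<partial>lborel)"
  define J where "J = (LINT t|lborel. norm (Q t) * (1 + \<bar>t\<bar>) ^ (K + B))"
  have J: "0 \<le> J" unfolding J_def by (intro Bochner_Integration.integral_nonneg) auto
  have "N < \<infinity>" unfolding N_def by (rule nn_integral_abs_powr_near_0) fact
  then obtain n where n: "N = ennreal n" "0 \<le> n" by (cases N) auto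
  have "(\<integral>\<^sup>+t. ennreal (norm (Q t) * (1 + \<bar>t\<bar>) ^ K * sing_kernel \<gamma> (t - y)) \<partial>lborel) \<le>
     ennreal ((C0 * n + J) * (1 + \<bar>y\<bar>) ^ B)" for y
  proof -
    have "(\<integral>\<^sup>+t. ennreal (norm (Q t) * (1 + \<bar>t\<bar>) ^ K * sing_kernel \<gamma> (t - y)) \<partial>lborel) \<le>
      (\<integral>\<^sup>+t. ennreal C0 * ennreal (indicator {-1..1} (t - y) * \<bar>t - y\<bar> powr (2 * \<gamma> - 1)) +
          ennreal ((1 + \<bar>y\<bar>) ^ B) * ennreal (norm (Q t) * (1 + \<bar>t\<bar>) ^ (K + B)) \<partial>lborel)"
    proof (rule nn_integral_mono)
      fix t
      let ?a = "norm (Q t) * (1 + \<bar>t\<bar>) ^ K" and ?h = "indicator {-1..1} (t - y) * \<bar>t - y\<bar> powr (2 * \<gamma> - 1)"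
      have h: "0 \<le> ?h" by simp
      have "?a * sing_kernel \<gamma> (t - y) \<le> ?a * (?h + (1 + \<bar>t\<bar>) ^ B * (1 + \<bar>y\<bar>) ^ B)"
        using sing_kernel_le[OF assms, of t y] by (intro mult_left_mono) auto
      also have "\<dots> \<le> C0 * ?h + (1 + \<bar>y\<bar>) ^ B * (norm (Q t) * (1 + \<bar>t\<bar>) ^ (K + B))"
        using mult_right_mono[OF C0 h, of t] by (simp add: distrib_left power_add mult_ac)
      finally show "ennreal (?a * sing_kernel \<gamma> (t - y)) \<le> ennreal C0 * ennreal ?h +
          ennreal ((1 + \<bar>y\<bar>) ^ B) * ennreal (norm (Q t) * (1 + \<bar>t\<bar>) ^ (K + B))"
        using C0_nonneg by (subst ennreal_mult[symmetric], simp, simp)+ (simp flip: ennreal_plus add: ennreal_leI)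
    qed
    also have "\<dots> = ennreal C0 * (\<integral>\<^sup>+t. ennreal (indicator {-1..1} (t - y) * \<bar>t - y\<bar> powr (2 * \<gamma> - 1)) \<partial>lborel) +
        ennreal ((1 + \<bar>y\<bar>) ^ B) * (\<integral>\<^sup>+t. ennreal (norm (Q t) * (1 + \<bar>t\<bar>) ^ (K + B)) \<partial>lborel)"
      by (simp add: nn_integral_add nn_integral_cmult)
    also have "(\<integral>\<^sup>+t. ennreal (indicator {-1..1} (t - y) * \<bar>t - y\<bar> powr (2 * \<gamma> - 1)) \<partial>lborel) = N"
      unfolding N_def by (subst nn_integral_real_affine[where c = 1 and t = y]) auto
    also have "(\<integral>\<^sup>+t. ennreal (norm (Q t) * (1 + \<bar>t\<bar>) ^ (K + B)) \<partial>lborel) = ennreal J"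
      unfolding J_def by (intro nn_integral_eq_integral Q_integrable) auto
    also have "ennreal C0 * N + ennreal ((1 + \<bar>y\<bar>) ^ B) * ennreal J = ennreal (C0 * n + (1 + \<bar>y\<bar>) ^ B * J)"
      using n C0_nonneg J by (simp flip: ennreal_mult ennreal_plus)
    also have "\<dots> \<le> ennreal ((C0 * n + J) * (1 + \<bar>y\<bar>) ^ B)"
    proof (rule ennreal_leI)
      have "1 \<le> (1 + \<bar>y\<bar>) ^ B" by (simp add: one_le_power)
      then have "C0 * n * 1 \<le> C0 * n * (1 + \<bar>y\<bar>) ^ B"
        using n C0_nonneg by (intro mult_left_mono) auto
      then show "C0 * n + (1 + \<bar>y\<bar>) ^ B * J \<le> (C0 * n + J) * (1 + \<bar>y\<bar>) ^ B"
        by (simp add: algebra_simps)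
    qed
    finally show ?thesis .
  qed
  then show ?thesis using n C0_nonneg J by (intro exI[of _ "C0 * n + J"]) auto
qed

lemma Q_tendsto_0:
  assumes g: "\<And>t. \<bar>g t\<bar> \<le> C * (1 + \<bar>t\<bar>) ^ k"
  shows "((\<lambda>t. Q t * of_real (g t)) \<longlongrightarrow> 0) at_top" and "((\<lambda>t. Q t * of_real (g t)) \<longlongrightarrow> 0) at_bot"
proof -
  obtain C0 where C0: "\<And>t. norm (Q t) * (1 + \<bar>t\<bar>) ^ (k + 1) \<le> C0"
    using Q_bounded[of "k + 1"] unfolding Q_def by auto
  have "0 \<le> \<bar>g 0\<bar>" by simp
  with g[of 0] have C: "0 \<le> C" by simp
  have b: "norm (Q t * of_real (g t)) \<le> C * C0 / (1 + \<bar>t\<bar>)" for t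
  proof -
    have "norm (Q t * of_real (g t)) \<le> norm (Q t) * (C * (1 + \<bar>t\<bar>) ^ k)"
      unfolding norm_mult norm_of_real by (intro mult_left_mono g) auto
    also have "\<dots> = C * (norm (Q t) * (1 + \<bar>t\<bar>) ^ (k + 1)) / (1 + \<bar>t\<bar>)"
      by (simp add: field_simps)
    also have "\<dots> \<le> C * C0 / (1 + \<bar>t\<bar>)"
      by (intro divide_right_mono mult_left_mono C0 C) auto
    finally show ?thesis .
  qed
  have "((\<lambda>t. C * C0 / (1 + \<bar>t\<bar>)) \<longlongrightarrow> 0) at_top" "((\<lambda>t. C * C0 / (1 + \<bar>t\<bar>)) \<longlongrightarrow> 0) at_bot"
    by (auto intro!: tendsto_divide_0[OF tendsto_const] filterlim_at_top_imp_at_infinity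
      filterlim_tendsto_add_at_top[OF tendsto_const] filterlim_abs_real
      filterlim_compose[OF filterlim_abs_real filterlim_ident])
     (simp_all add: filterlim_at_bot_mirror filterlim_abs_real)
  then show "((\<lambda>t. Q t * of_real (g t)) \<longlongrightarrow> 0) at_top" "((\<lambda>t. Q t * of_real (g t)) \<longlongrightarrow> 0) at_bot"
    using b by - (rule Lim_null_comparison[OF always_eventually]; blast)+
qed

end

section \<open>Aomoto's recursion\<close>

lemma abs_powr_has_real_derivative:
  fixes t y \<gamma> :: real
  assumes "t \<noteq> y"
  shows "((\<lambda>t. \<bar>t - y\<bar> powr (2 * \<gamma>)) has_real_derivative 2 * \<gamma> / (t - y) * \<bar>t - y\<bar> powr (2 * \<gamma>)) (at t)"
proof -
  have eq: "\<bar>x\<bar> powr (2 * \<gamma>) = (x\<^sup>2) powr \<gamma>" for x :: real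
    by (simp add: powr_powr[symmetric] powr_numeral)
  have "((\<lambda>t. ((t - y)\<^sup>2) powr \<gamma>) has_real_derivative 2 * \<gamma> / (t - y) * ((t - y)\<^sup>2) powr \<gamma>) (at t)"
  proof -
    have pos: "0 < (t - y)\<^sup>2" using assms by simp
    have "((\<lambda>t. ((t - y)\<^sup>2) powr \<gamma>) has_real_derivative \<gamma> * ((t - y)\<^sup>2) powr (\<gamma> - 1) * (2 * (t - y))) (at t)"
      using pos by (auto intro!: derivative_eq_intros)
    also have "\<gamma> * ((t - y)\<^sup>2) powr (\<gamma> - 1) * (2 * (t - y)) =
        2 * \<gamma> * ((t - y)\<^sup>2) powr \<gamma> * ((t - y) / (t - y)\<^sup>2)"
      using pos by (simp add: powr_diff)
    also have "(t - y) / (t - y)\<^sup>2 = 1 / (t - y)" by (simp add: power2_eq_square)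
    finally show ?thesis by simp
  qed
  then show ?thesis by (simp add: eq)
qed

lemma component_borel_measurable:
  "i \<in> I \<Longrightarrow> (\<lambda>l. l i) \<in> borel_measurable (Pi\<^sub>M I (\<lambda>_. lborel :: real measure))"
  using measurable_component_singleton[of i I "\<lambda>_. lborel :: real measure"] by simp

lemma prod_of_real_measurable:
  assumes "A \<subseteq> I"
  shows "(\<lambda>l. \<Prod>i\<in>A. complex_of_real (l i)) \<in> borel_measurable (Pi\<^sub>M I (\<lambda>_. lborel))"
proof (rule borel_measurable_prod)
  fix i assume "i \<in> A"
  then have [measurable]: "(\<lambda>l. l i) \<in> borel_measurable (Pi\<^sub>M I (\<lambda>_. lborel :: real measure))"
    using assms by (intro component_borel_measurable) auto
  show "(\<lambda>l. complex_of_real (l i)) \<in> borel_measurable (Pi\<^sub>M I (\<lambda>_. lborel))" by measurable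
qed

context pearson_weight
begin

definition weight :: "real \<Rightarrow> 'i set \<Rightarrow> ('i \<Rightarrow> real) \<Rightarrow> complex" where
  "weight \<gamma> I l = (\<Prod>i\<in>I. q (l i)) * of_real (disc_pow \<gamma> I l)"

text \<open>The integral of the product of the variables in \<open>A\<close> against the unnormalised ensemble on \<open>I\<close>. By symmetry it
depends only on the size of \<open>A\<close>, which is what the recursion lowers.\<close>

definition moment :: "real \<Rightarrow> 'i set \<Rightarrow> 'i set \<Rightarrow> complex" where
  "moment \<gamma> I A = (LINT l|Pi\<^sub>M I (\<lambda>_. lborel). (\<Prod>i\<in>A. of_real (l i)) * weight \<gamma> I l)"

text \<open>The interaction of particles \<open>p\<close> and \<open>j\<close>: differentiating the discriminant in \<open>l p\<close> produces a factor
\<open>2 \<gamma> / (l p - l j)\<close>, and \<open>p q\<close> carries the factor \<open>l p - \<kappa> (l p)\<^sup>2\<close>.\<close>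

definition pair_term :: "real \<Rightarrow> 'i set \<Rightarrow> 'i \<Rightarrow> 'i \<Rightarrow> 'i set \<Rightarrow> ('i \<Rightarrow> real) \<Rightarrow> complex" where
  "pair_term \<gamma> I p j A l =
     (\<Prod>i\<in>A - {p}. of_real (l i)) * of_real ((l p - \<kappa> * (l p)\<^sup>2) / (l p - l j)) * weight \<gamma> I l"

lemma weight_measurable [measurable]:
  "finite I \<Longrightarrow> weight \<gamma> I \<in> borel_measurable (Pi\<^sub>M I (\<lambda>_. lborel))"
  unfolding weight_def disc_pow_def by measurable

lemma integrable_dominated_prod:
  fixes f :: "('i \<Rightarrow> real) \<Rightarrow> complex"
  assumes "finite I" and [measurable]: "f \<in> borel_measurable (Pi\<^sub>M I (\<lambda>_. lborel))"
    and "\<And>l. norm (f l) \<le> C * (\<Prod>i\<in>I. norm (q (l i)) * (1 + \<bar>l i\<bar>) ^ D)"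
  shows "integrable (Pi\<^sub>M I (\<lambda>_. lborel)) f"
proof (rule Bochner_Integration.integrable_bound)
  show "integrable (Pi\<^sub>M I (\<lambda>_. lborel)) (\<lambda>l. C * (\<Prod>i\<in>I. norm (q (l i)) * (1 + \<bar>l i\<bar>) ^ D))"
    by (intro integrable_mult_right lborel_product_integrable_prod assms q_integrable)
  show "AE l in Pi\<^sub>M I (\<lambda>_. lborel). norm (f l) \<le> norm (C * (\<Prod>i\<in>I. norm (q (l i)) * (1 + \<bar>l i\<bar>) ^ D))"
    by (intro AE_I2 order_trans[OF assms(3)]) (simp only: real_norm_def abs_ge_self)
qed measurable

lemma prod_abs_le:
  fixes l :: "'i \<Rightarrow> real"
  assumes "finite J" "A \<subseteq> J"
  shows "(\<Prod>i\<in>A. \<bar>l i\<bar>) \<le> (\<Prod>i\<in>J. 1 + \<bar>l i\<bar>)"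
proof -
  have "(\<Prod>i\<in>A. \<bar>l i\<bar>) \<le> (\<Prod>i\<in>A. 1 + \<bar>l i\<bar>)" by (intro prod_mono) auto
  also have "\<dots> \<le> (\<Prod>i\<in>J. 1 + \<bar>l i\<bar>)" using assms by (intro prod_mono2) auto
  finally show ?thesis .
qed

lemma integrable_moment:
  assumes "finite I" "0 < \<gamma>" "A \<subseteq> I"
  shows "integrable (Pi\<^sub>M I (\<lambda>_. lborel)) (\<lambda>l. (\<Prod>i\<in>A. of_real (l i)) * weight \<gamma> I l)"
proof -
  define B where "B = nat \<lceil>\<gamma>\<rceil>"
  have B: "\<gamma> \<le> real B" unfolding B_def by linarith
  have [measurable]: "(\<lambda>l. \<Prod>i\<in>A. complex_of_real (l i)) \<in> borel_measurable (Pi\<^sub>M I (\<lambda>_. lborel))"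
    by (rule prod_of_real_measurable[OF assms(3)])
  note [measurable] = weight_measurable[OF assms(1), of \<gamma>]
  show ?thesis
  proof (rule integrable_dominated_prod[where C = 1 and D = "1 + 2 * B * card I"])
    fix l :: "'a \<Rightarrow> real"
    have "norm ((\<Prod>i\<in>A. of_real (l i)) * weight \<gamma> I l) =
        (\<Prod>i\<in>A. \<bar>l i\<bar>) * ((\<Prod>i\<in>I. norm (q (l i))) * disc_pow \<gamma> I l)"
      by (simp add: weight_def norm_mult prod_norm[symmetric] disc_pow_nonneg)
    also have "\<dots> \<le> (\<Prod>i\<in>I. 1 + \<bar>l i\<bar>) * ((\<Prod>i\<in>I. norm (q (l i))) * (\<Prod>i\<in>I. (1 + \<bar>l i\<bar>) ^ (2 * B * card I)))"
      using assms B by (intro mult_mono prod_abs_le disc_pow_le mult_nonneg_nonneg prod_nonneg disc_pow_nonneg) auto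
    also have "\<dots> = 1 * (\<Prod>i\<in>I. norm (q (l i)) * (1 + \<bar>l i\<bar>) ^ (1 + 2 * B * card I))"
      by (simp add: prod.distrib mult_ac)
    finally show "norm ((\<Prod>i\<in>A. of_real (l i)) * weight \<gamma> I l) \<le> \<dots>" .
  qed (use assms in auto)
qed

lemma prod_dist_powr_le:
  fixes l :: "'i \<Rightarrow> real"
  assumes "finite J" "0 \<le> \<gamma>" "2 * \<gamma> \<le> real B" "J' \<subseteq> J"
  shows "(\<Prod>k\<in>J'. \<bar>t - l k\<bar> powr (2 * \<gamma>)) \<le> (1 + \<bar>t\<bar>) ^ (B * card J) * (\<Prod>k\<in>J. (1 + \<bar>l k\<bar>) ^ B)"
proof -
  have fin: "finite J'" using assms finite_subset by auto
  have "(\<Prod>k\<in>J'. \<bar>t - l k\<bar> powr (2 * \<gamma>)) \<le> (\<Prod>k\<in>J'. (1 + \<bar>t\<bar>) ^ B * (1 + \<bar>l k\<bar>) ^ B)"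
    using dist_powr_le[of "2 * \<gamma>" B] assms by (intro prod_mono) auto
  also have "\<dots> \<le> (\<Prod>k\<in>J. (1 + \<bar>t\<bar>) ^ B * (1 + \<bar>l k\<bar>) ^ B)"
    using assms by (intro prod_mono2) (auto intro!: mult_ge1_I one_le_power)
  also have "\<dots> = (1 + \<bar>t\<bar>) ^ (B * card J) * (\<Prod>k\<in>J. (1 + \<bar>l k\<bar>) ^ B)"
    by (simp add: prod.distrib power_mult)
  finally show ?thesis .
qed

lemma pair_term_le:
  assumes "finite J" "p \<notin> J" "j \<in> J" "A \<subseteq> insert p J" "0 < \<gamma>"
  shows "\<exists>K D. \<forall>l. norm (pair_term \<gamma> (insert p J) p j A l) \<le>
       (norm (Q (l p)) * (1 + \<bar>l p\<bar>) ^ K * sing_kernel \<gamma> (l p - l j)) * (\<Prod>i\<in>J. norm (q (l i)) * (1 + \<bar>l i\<bar>) ^ D)"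
proof -
  define B where "B = nat \<lceil>2 * \<gamma>\<rceil>"
  have B: "2 * \<gamma> \<le> real B" "\<gamma> \<le> real B" unfolding B_def using assms(5) by linarith+
  define D where "D = 1 + B + 2 * B * card J"
  have "norm (pair_term \<gamma> (insert p J) p j A l) \<le>
       (norm (Q (l p)) * (1 + \<bar>l p\<bar>) ^ (B * card J) * sing_kernel \<gamma> (l p - l j)) * (\<Prod>i\<in>J. norm (q (l i)) * (1 + \<bar>l i\<bar>) ^ D)" for l
  proof -
    have J: "J = insert j (J - {j})" using assms by auto
    have P: "(\<Prod>k\<in>J. \<bar>l p - l k\<bar> powr (2 * \<gamma>)) =
        \<bar>l p - l j\<bar> powr (2 * \<gamma>) * (\<Prod>k\<in>J - {j}. \<bar>l p - l k\<bar> powr (2 * \<gamma>))"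
      using assms by (subst J, subst prod.insert) auto
    have "norm (pair_term \<gamma> (insert p J) p j A l) =
        (\<Prod>i\<in>A - {p}. \<bar>l i\<bar>) * (norm (Q (l p)) * sing_kernel \<gamma> (l p - l j)) * (\<Prod>i\<in>J. norm (q (l i))) *
          (\<Prod>k\<in>J - {j}. \<bar>l p - l k\<bar> powr (2 * \<gamma>)) * disc_pow \<gamma> J l"
      using assms
      by (simp add: pair_term_def weight_def norm_mult norm_divide prod_norm[symmetric] disc_pow_nonneg
          disc_pow_insert P Q_def sing_kernel_def abs_mult abs_prod del: of_real_diff of_real_mult of_real_power)
    also have "\<dots> \<le> (\<Prod>i\<in>J. 1 + \<bar>l i\<bar>) * (norm (Q (l p)) * sing_kernel \<gamma> (l p - l j)) * (\<Prod>i\<in>J. norm (q (l i))) *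
          ((1 + \<bar>l p\<bar>) ^ (B * card J) * (\<Prod>k\<in>J. (1 + \<bar>l k\<bar>) ^ B)) * (\<Prod>i\<in>J. (1 + \<bar>l i\<bar>) ^ (2 * B * card J))"
      using assms B
      by (intro mult_mono prod_abs_le disc_pow_le prod_dist_powr_le mult_nonneg_nonneg prod_nonneg disc_pow_nonneg
           sing_kernel_nonneg) auto
    also have "\<dots> = (norm (Q (l p)) * (1 + \<bar>l p\<bar>) ^ (B * card J) * sing_kernel \<gamma> (l p - l j)) *
        (\<Prod>i\<in>J. norm (q (l i)) * (1 + \<bar>l i\<bar>) ^ D)"
      by (simp add: D_def power_add prod.distrib mult_ac)
    finally show ?thesis .
  qed
  then show ?thesis by (intro exI allI)
qed

lemma pair_term_measurable [measurable]:
  assumes "finite I" "p \<in> I" "j \<in> I" "A \<subseteq> I"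
  shows "pair_term \<gamma> I p j A \<in> borel_measurable (Pi\<^sub>M I (\<lambda>_. lborel))"
proof -
  have [measurable]: "(\<lambda>l. \<Prod>i\<in>A - {p}. complex_of_real (l i)) \<in> borel_measurable (Pi\<^sub>M I (\<lambda>_. lborel))"
    using assms by (intro prod_of_real_measurable) auto
  note [measurable] = weight_measurable[OF assms(1), of \<gamma>]
  have [measurable]: "(\<lambda>l. l p) \<in> borel_measurable (Pi\<^sub>M I (\<lambda>_. lborel))" "(\<lambda>l. l j) \<in> borel_measurable (Pi\<^sub>M I (\<lambda>_. lborel))"
    using assms by (auto intro: component_borel_measurable)
  show ?thesis unfolding pair_term_def by measurable
qed

text \<open>The pole at \<open>l p = l j\<close> is compensated by the discriminant only up to an integrable singularity, so the integral
over \<open>l p\<close> is bounded first, polynomially in \<open>l j\<close>.\<close>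

lemma integrable_pair_term:
  assumes "finite J" "p \<notin> J" "j \<in> J" "A \<subseteq> insert p J" "0 < \<gamma>"
  shows "integrable (Pi\<^sub>M (insert p J) (\<lambda>_. lborel)) (pair_term \<gamma> (insert p J) p j A)"
proof -
  obtain K D where KD: "\<forall>l. norm (pair_term \<gamma> (insert p J) p j A l) \<le>
       (norm (Q (l p)) * (1 + \<bar>l p\<bar>) ^ K * sing_kernel \<gamma> (l p - l j)) * (\<Prod>i\<in>J. norm (q (l i)) * (1 + \<bar>l i\<bar>) ^ D)"
    using pair_term_le[OF assms] by (elim exE)
  define B where "B = nat \<lceil>2 * \<gamma>\<rceil>"
  have B: "2 * \<gamma> \<le> real B" unfolding B_def by linarith
  obtain C where C: "0 \<le> C"
    "\<forall>y. (\<integral>\<^sup>+t. ennreal (norm (Q t) * (1 + \<bar>t\<bar>) ^ K * sing_kernel \<gamma> (t - y)) \<partial>lborel) \<le> ennreal (C * (1 + \<bar>y\<bar>) ^ B)"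
    using Q_sing_kernel_le[OF assms(5) B, of K] by (elim exE conjE)
  define R where "R = (\<lambda>D l. \<Prod>i\<in>J. norm (q (l i)) * (1 + \<bar>l i\<bar>) ^ D)"
  have R: "0 \<le> R D l" for D l unfolding R_def by (intro prod_nonneg) auto
  have KD: "norm (pair_term \<gamma> (insert p J) p j A l) \<le>
       (norm (Q (l p)) * (1 + \<bar>l p\<bar>) ^ K * sing_kernel \<gamma> (l p - l j)) * R D l" for l
    using KD[rule_format, of l] by (simp only: R_def)
  have [measurable]: "pair_term \<gamma> (insert p J) p j A \<in> borel_measurable (Pi\<^sub>M (insert p J) (\<lambda>_. lborel))"
    using assms by (intro pair_term_measurable) auto
  have R_step: "R D l * (1 + \<bar>l j\<bar>) ^ B \<le> R (D + B) l" for l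
  proof -
    have "(1 + \<bar>l j\<bar>) ^ B \<le> (\<Prod>i\<in>J. (1 + \<bar>l i\<bar>) ^ B)"
      using prod_mono2[of J "{j}" "\<lambda>i. (1 + \<bar>l i\<bar>) ^ B"] assms by simp
    then have "R D l * (1 + \<bar>l j\<bar>) ^ B \<le> R D l * (\<Prod>i\<in>J. (1 + \<bar>l i\<bar>) ^ B)"
      by (intro mult_left_mono R)
    also have "R D l * (\<Prod>i\<in>J. (1 + \<bar>l i\<bar>) ^ B) = R (D + B) l"
      unfolding R_def by (subst prod.distrib[symmetric]) (simp add: power_add mult.assoc)
    finally show ?thesis .
  qed
  have "(\<integral>\<^sup>+l. ennreal (norm (pair_term \<gamma> (insert p J) p j A l)) \<partial>Pi\<^sub>M (insert p J) (\<lambda>_. lborel)) =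
      (\<integral>\<^sup>+l. \<integral>\<^sup>+t. ennreal (norm (pair_term \<gamma> (insert p J) p j A (l(p := t)))) \<partial>lborel \<partial>Pi\<^sub>M J (\<lambda>_. lborel))"
    by (rule lborel_product_nn_integral_insert[OF assms(1,2)]) measurable
  also have "\<dots> \<le> (\<integral>\<^sup>+l. ennreal (C * R (D + B) l) \<partial>Pi\<^sub>M J (\<lambda>_. lborel))"
  proof (rule nn_integral_mono)
    fix l :: "'a \<Rightarrow> real"
    have "(\<integral>\<^sup>+t. ennreal (norm (pair_term \<gamma> (insert p J) p j A (l(p := t)))) \<partial>lborel) \<le>
        (\<integral>\<^sup>+t. ennreal (R D l) * ennreal (norm (Q t) * (1 + \<bar>t\<bar>) ^ K * sing_kernel \<gamma> (t - l j)) \<partial>lborel)"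
    proof (rule nn_integral_mono)
      fix t :: real
      have "R D (l(p := t)) = R D l" unfolding R_def using assms by (intro prod.cong) auto
      moreover have "(l(p := t)) j = l j" using assms by auto
      ultimately have "norm (pair_term \<gamma> (insert p J) p j A (l(p := t))) \<le>
          (norm (Q t) * (1 + \<bar>t\<bar>) ^ K * sing_kernel \<gamma> (t - l j)) * R D l"
        using KD[of "l(p := t)"] by (simp only: fun_upd_same)
      then have "norm (pair_term \<gamma> (insert p J) p j A (l(p := t))) \<le>
          R D l * (norm (Q t) * (1 + \<bar>t\<bar>) ^ K * sing_kernel \<gamma> (t - l j))"
        by (simp only: mult.commute)
      then show "ennreal (norm (pair_term \<gamma> (insert p J) p j A (l(p := t)))) \<le>
          ennreal (R D l) * ennreal (norm (Q t) * (1 + \<bar>t\<bar>) ^ K * sing_kernel \<gamma> (t - l j))"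
        by (subst ennreal_mult'[OF R, symmetric]) (rule ennreal_leI)
    qed
    also have "\<dots> = ennreal (R D l) * (\<integral>\<^sup>+t. ennreal (norm (Q t) * (1 + \<bar>t\<bar>) ^ K * sing_kernel \<gamma> (t - l j)) \<partial>lborel)"
      by (rule nn_integral_cmult) measurable
    also have "\<dots> \<le> ennreal (R D l) * ennreal (C * (1 + \<bar>l j\<bar>) ^ B)"
      by (rule mult_left_mono[OF C(2)[rule_format]]) simp
    also have "\<dots> = ennreal (C * (R D l * (1 + \<bar>l j\<bar>) ^ B))"
      by (subst ennreal_mult'[OF R, symmetric]) (simp only: mult.left_commute)
    also have "\<dots> \<le> ennreal (C * R (D + B) l)"
      by (rule ennreal_leI) (rule mult_left_mono[OF R_step C(1)])
    finally show "(\<integral>\<^sup>+t. ennreal (norm (pair_term \<gamma> (insert p J) p j A (l(p := t)))) \<partial>lborel) \<le>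
       ennreal (C * R (D + B) l)" .
  qed
  also have "\<dots> = ennreal (LINT l|Pi\<^sub>M J (\<lambda>_. lborel). C * R (D + B) l)"
  proof (rule nn_integral_eq_integral)
    show "integrable (Pi\<^sub>M J (\<lambda>_. lborel)) (\<lambda>l. C * R (D + B) l)"
      unfolding R_def by (intro integrable_mult_right lborel_product_integrable_prod assms(1) q_integrable)
    show "AE l in Pi\<^sub>M J (\<lambda>_. lborel). 0 \<le> C * R (D + B) l"
      using mult_nonneg_nonneg[OF C(1) R] by (intro AE_I2) simp
  qed
  also have "\<dots> < \<infinity>" by simp
  finally show ?thesis by (rule integrableI_bounded[rotated]) measurable
qed

lemma weight_insert:
  assumes "finite J" "p \<notin> J"
  shows "weight \<gamma> (insert p J) (l(p := t)) =
     q t * of_real (\<Prod>k\<in>J. \<bar>t - l k\<bar> powr (2 * \<gamma>)) * weight \<gamma> J l"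
proof -
  have ne: "k \<noteq> p" if "k \<in> J" for k using that assms by auto
  have 1: "(\<Prod>i\<in>J. q ((l(p := t)) i)) = (\<Prod>i\<in>J. q (l i))"
    by (intro prod.cong) (auto simp: ne)
  have 2: "disc_pow \<gamma> J (l(p := t)) = disc_pow \<gamma> J l"
    unfolding disc_pow_def by (intro prod.cong refl) (auto simp: ne)
  have 3: "(\<Prod>k\<in>J. \<bar>(l(p := t)) p - (l(p := t)) k\<bar> powr (2 * \<gamma>)) = (\<Prod>k\<in>J. \<bar>t - l k\<bar> powr (2 * \<gamma>))"
    by (intro prod.cong refl) (auto simp: ne)
  show ?thesis
    unfolding weight_def prod.insert[OF assms] disc_pow_insert[OF assms] 1 2 3 by simp
qed

lemma integral_derivative_weight_eq_0:
  fixes l :: "'i \<Rightarrow> real"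
  assumes "finite J" "0 < \<gamma>"
  defines "P \<equiv> \<lambda>t. \<Prod>k\<in>J. \<bar>t - l k\<bar> powr (2 * \<gamma>)"
  shows "(LINT t|lborel. (s - c * of_real t) * q t * of_real (P t) +
     (\<Sum>j\<in>J. of_real (2 * \<gamma> / (t - l j)) * Q t * of_real (P t))) = 0" (is "(LINT t|lborel. ?f t) = 0")
proof -
  define B where "B = nat \<lceil>2 * \<gamma>\<rceil>"
  have B: "2 * \<gamma> \<le> real B" unfolding B_def by linarith
  define CP where "CP = (\<Prod>k\<in>J. (1 + \<bar>l k\<bar>) ^ B)"
  have CP: "0 \<le> CP" unfolding CP_def by (intro prod_nonneg) auto
  define n where "n = B * card J"
  have P_le: "P t \<le> CP * (1 + \<bar>t\<bar>) ^ n" for t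
    unfolding P_def CP_def n_def using prod_dist_powr_le[OF assms(1) _ B order_refl, of t l] assms(2)
    by (simp add: mult.commute)
  have P_nonneg: "0 \<le> P t" for t unfolding P_def by (intro prod_nonneg) auto
  have [measurable]: "P \<in> borel_measurable borel" unfolding P_def by measurable
  obtain E where E: "finite E" "\<And>t. t \<notin> E \<Longrightarrow> (Q has_vector_derivative (s - c * of_real t) * q t) (at t)"
    using Q_deriv unfolding Q_def by blast
  show ?thesis
  proof (rule integral_derivative_eq_0)
    show "finite (E \<union> l ` J)" using E assms by auto
    have "((\<lambda>t. Q t * of_real (P t)) \<longlongrightarrow> 0) at_top \<and> ((\<lambda>t. Q t * of_real (P t)) \<longlongrightarrow> 0) at_bot"
      using Q_tendsto_0[of P CP n] P_le P_nonneg by auto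
    then show "((\<lambda>t. Q t * of_real (P t)) \<longlongrightarrow> 0) at_top" "((\<lambda>t. Q t * of_real (P t)) \<longlongrightarrow> 0) at_bot" by auto
    have "continuous_on UNIV P" unfolding P_def
      using assms(2) by (intro continuous_on_prod continuous_on_powr' continuous_intros) auto
    then show "continuous_on UNIV (\<lambda>t. Q t * of_real (P t))"
      using Q_cont unfolding Q_def[abs_def, symmetric] by (intro continuous_on_mult continuous_on_of_real) auto
    fix t assume t: "t \<notin> E \<union> l ` J"
    have ne: "t \<noteq> l k" if "k \<in> J" for k using t that by auto
    have "(P has_real_derivative P t * (\<Sum>j\<in>J. 2 * \<gamma> / (t - l j) * \<bar>t - l j\<bar> powr (2 * \<gamma>) / \<bar>t - l j\<bar> powr (2 * \<gamma>))) (at t)"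
      unfolding P_def using ne
      by (intro has_field_derivative_prod' abs_powr_has_real_derivative) auto
    also have "(\<Sum>j\<in>J. 2 * \<gamma> / (t - l j) * \<bar>t - l j\<bar> powr (2 * \<gamma>) / \<bar>t - l j\<bar> powr (2 * \<gamma>)) = (\<Sum>j\<in>J. 2 * \<gamma> / (t - l j))"
      using ne by (intro sum.cong) auto
    finally have "((\<lambda>t. of_real (P t)) has_vector_derivative (of_real (P t * (\<Sum>j\<in>J. 2 * \<gamma> / (t - l j))) :: complex)) (at t)"
      by (rule has_vector_derivative_of_real)
    then have "((\<lambda>t. Q t * of_real (P t)) has_vector_derivative
        (Q t * of_real (P t * (\<Sum>j\<in>J. 2 * \<gamma> / (t - l j))) + (s - c * of_real t) * q t * of_real (P t))) (at t)"
      using E(2)[of t] t by (intro has_vector_derivative_mult) auto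
    also have "(Q t * of_real (P t * (\<Sum>j\<in>J. 2 * \<gamma> / (t - l j))) + (s - c * of_real t) * q t * of_real (P t)) = ?f t"
      by (simp add: sum_distrib_left sum_distrib_right mult_ac)
    finally show "((\<lambda>t. Q t * of_real (P t)) has_vector_derivative ?f t) (at t)" .
  next
    show "integrable lborel ?f"
    proof (intro Bochner_Integration.integrable_add Bochner_Integration.integrable_sum)
      show "integrable lborel (\<lambda>t. (s - c * of_real t) * q t * of_real (P t))"
      proof (rule Bochner_Integration.integrable_bound)
        show "integrable lborel (\<lambda>t. (norm s + norm c) * CP * (norm (q t) * (1 + \<bar>t\<bar>) ^ (n + 1)))"
          by (intro integrable_mult_right q_integrable)
        have le: "norm ((s - c * of_real t) * q t * of_real (P t)) \<le> (norm s + norm c) * CP * (norm (q t) * (1 + \<bar>t\<bar>) ^ (n + 1))" for t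
        proof -
          have "norm (s - c * of_real t) \<le> norm s + norm c * \<bar>t\<bar>"
            by (rule order_trans[OF norm_triangle_ineq4]) (simp add: norm_mult)
          also have "\<dots> \<le> (norm s + norm c) * (1 + \<bar>t\<bar>)" by (simp add: algebra_simps)
          finally have "norm (s - c * of_real t) * norm (q t) * P t \<le>
              ((norm s + norm c) * (1 + \<bar>t\<bar>)) * norm (q t) * (CP * (1 + \<bar>t\<bar>) ^ n)"
            using P_le P_nonneg by (intro mult_mono) auto
          also have "\<dots> = (norm s + norm c) * CP * (norm (q t) * (1 + \<bar>t\<bar>) ^ (n + 1))"
            by (simp add: mult_ac)
          finally show ?thesis using P_nonneg[of t] by (simp add: norm_mult)
        qed
        show "AE t in lborel. norm ((s - c * of_real t) * q t * of_real (P t)) \<le> norm ((norm s + norm c) * CP * (norm (q t) * (1 + \<bar>t\<bar>) ^ (n + 1)))"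
          by (intro AE_I2 order_trans[OF le]) (simp only: real_norm_def abs_ge_self)
      qed measurable
    next
      fix j assume j: "j \<in> J"
      obtain C where C: "0 \<le> C"
          "\<forall>y. (\<integral>\<^sup>+t. ennreal (norm (Q t) * (1 + \<bar>t\<bar>) ^ n * sing_kernel \<gamma> (t - y)) \<partial>lborel) \<le> ennreal (C * (1 + \<bar>y\<bar>) ^ B)"
        using Q_sing_kernel_le[OF assms(2) B, of n] by (elim exE conjE)
      show "integrable lborel (\<lambda>t. of_real (2 * \<gamma> / (t - l j)) * Q t * of_real (P t))"
      proof (rule integrableI_bounded)
        have "norm (of_real (2 * \<gamma> / (t - l j)) * Q t * of_real (P t)) \<le>
            (2 * \<gamma> * CP) * (norm (Q t) * (1 + \<bar>t\<bar>) ^ n * sing_kernel \<gamma> (t - l j))" for t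
        proof -
          have J: "J = insert j (J - {j})" using j by auto
          have Pj: "P t = \<bar>t - l j\<bar> powr (2 * \<gamma>) * (\<Prod>k\<in>J - {j}. \<bar>t - l k\<bar> powr (2 * \<gamma>))"
            unfolding P_def using assms by (subst J, subst prod.insert) auto
          have le: "(\<Prod>k\<in>J - {j}. \<bar>t - l k\<bar> powr (2 * \<gamma>)) \<le> (1 + \<bar>t\<bar>) ^ n * CP"
            unfolding CP_def n_def using assms(1,2) B by (intro prod_dist_powr_le) auto
          have "norm (of_real (2 * \<gamma> / (t - l j)) * Q t * of_real (P t)) =
            2 * \<gamma> * norm (Q t) * sing_kernel \<gamma> (t - l j) * (\<Prod>k\<in>J - {j}. \<bar>t - l k\<bar> powr (2 * \<gamma>))"
            using assms(2) P_nonneg[of t] unfolding sing_kernel_def norm_mult norm_of_real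
            by (simp add: Pj abs_mult abs_prod)
          also have "\<dots> \<le> 2 * \<gamma> * norm (Q t) * sing_kernel \<gamma> (t - l j) * ((1 + \<bar>t\<bar>) ^ n * CP)"
            using assms(2) by (intro mult_left_mono le mult_nonneg_nonneg sing_kernel_nonneg) auto
          also have "\<dots> = (2 * \<gamma> * CP) * (norm (Q t) * (1 + \<bar>t\<bar>) ^ n * sing_kernel \<gamma> (t - l j))"
            by (simp add: mult_ac)
          finally show ?thesis .
        qed
        then have "(\<integral>\<^sup>+t. ennreal (norm (of_real (2 * \<gamma> / (t - l j)) * Q t * of_real (P t))) \<partial>lborel) \<le>
            (\<integral>\<^sup>+t. ennreal (2 * \<gamma> * CP) * ennreal (norm (Q t) * (1 + \<bar>t\<bar>) ^ n * sing_kernel \<gamma> (t - l j)) \<partial>lborel)"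
          using assms(2) CP by (intro nn_integral_mono, subst ennreal_mult'[symmetric]) (auto intro: ennreal_leI)
        also have "\<dots> = ennreal (2 * \<gamma> * CP) * (\<integral>\<^sup>+t. ennreal (norm (Q t) * (1 + \<bar>t\<bar>) ^ n * sing_kernel \<gamma> (t - l j)) \<partial>lborel)"
          by (rule nn_integral_cmult) measurable
        also have "\<dots> \<le> ennreal (2 * \<gamma> * CP) * ennreal (C * (1 + \<bar>l j\<bar>) ^ B)"
          by (rule mult_left_mono[OF C(2)[rule_format]]) simp
        also have "\<dots> < \<infinity>" by (simp add: ennreal_mult_less_top)
        finally show "(\<integral>\<^sup>+t. ennreal (norm (of_real (2 * \<gamma> / (t - l j)) * Q t * of_real (P t))) \<partial>lborel) < \<infinity>" .
      qed measurable
    qed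
  qed
qed

text \<open>The integral over \<open>l p\<close> of the derivative of \<open>p q\<close> times the discriminant vanishes for every position of the
other particles; Fubini's theorem then integrates these out.\<close>

lemma moment_ibp:
  assumes "finite J" "p \<notin> J" "A \<subseteq> insert p J" "p \<in> A" "0 < \<gamma>"
  shows "s * moment \<gamma> (insert p J) (A - {p}) - c * moment \<gamma> (insert p J) A +
     2 * of_real \<gamma> * (\<Sum>j\<in>J. LINT l|Pi\<^sub>M (insert p J) (\<lambda>_. lborel). pair_term \<gamma> (insert p J) p j A l) = 0"
proof -
  let ?I = "insert p J"
  let ?M = "Pi\<^sub>M ?I (\<lambda>_. lborel :: real measure)"
  let ?T = "\<lambda>A l. (\<Prod>i\<in>A. complex_of_real (l i))"
  define H where "H = (\<lambda>l. s * (?T (A - {p}) l * weight \<gamma> ?I l) - c * (?T A l * weight \<gamma> ?I l) +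
     2 * of_real \<gamma> * (\<Sum>j\<in>J. pair_term \<gamma> ?I p j A l))"
  have int1: "integrable ?M (\<lambda>l. ?T (A - {p}) l * weight \<gamma> ?I l)" "integrable ?M (\<lambda>l. ?T A l * weight \<gamma> ?I l)"
    using assms by (auto intro!: integrable_moment)
  have int2: "integrable ?M (pair_term \<gamma> ?I p j A)" if "j \<in> J" for j
    using assms that by (intro integrable_pair_term) auto
  have int: "integrable ?M H"
    unfolding H_def using int1 int2
    by (intro Bochner_Integration.integrable_add Bochner_Integration.integrable_diff
      integrable_mult_right Bochner_Integration.integrable_sum) auto
  have inner: "(LINT t|lborel. H (l(p := t))) = 0" for l :: "'a \<Rightarrow> real"
  proof -
    define P where "P = (\<lambda>t. \<Prod>k\<in>J. \<bar>t - l k\<bar> powr (2 * \<gamma>))"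
    have Pt: "(\<Prod>k\<in>J. \<bar>t - l k\<bar> powr (2 * \<gamma>)) = P t" for t by (simp add: P_def)
    define K where "K = ?T (A - {p}) l * weight \<gamma> J l"
    have ne: "k \<noteq> p" if "k \<in> J" for k using that assms by auto
    have T1: "?T (A - {p}) (l(p := t)) = ?T (A - {p}) l" for t
      by (intro prod.cong) auto
    have T2: "?T A (l(p := t)) = of_real t * ?T (A - {p}) l" for t
    proof -
      have "finite A" using assms finite_subset by blast
      then show ?thesis
        using prod.remove[of A p "\<lambda>i. complex_of_real ((l(p := t)) i)"] assms T1 by simp
    qed
    have "H (l(p := t)) = K * ((s - c * of_real t) * q t * of_real (P t) +
       (\<Sum>j\<in>J. of_real (2 * \<gamma> / (t - l j)) * Q t * of_real (P t)))" for t
    proof -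
      have "pair_term \<gamma> ?I p j A (l(p := t)) = K * (of_real (1 / (t - l j)) * Q t * of_real (P t))" if "j \<in> J" for j
        unfolding pair_term_def T1 weight_insert[OF assms(1,2)] Pt K_def Q_def
        using ne[OF that] by (simp add: mult_ac)
      then have "2 * of_real \<gamma> * (\<Sum>j\<in>J. pair_term \<gamma> ?I p j A (l(p := t))) =
          K * (\<Sum>j\<in>J. of_real (2 * \<gamma> / (t - l j)) * Q t * of_real (P t))"
        by (simp add: sum_distrib_left mult_ac)
      moreover have "s * (?T (A - {p}) (l(p := t)) * weight \<gamma> ?I (l(p := t))) - c * (?T A (l(p := t)) * weight \<gamma> ?I (l(p := t))) =
          K * ((s - c * of_real t) * q t * of_real (P t))"
        unfolding T1 T2 weight_insert[OF assms(1,2)] Pt K_def by (simp add: algebra_simps)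
      ultimately show ?thesis unfolding H_def by (simp only: distrib_left)
    qed
    then show ?thesis
      using integral_derivative_weight_eq_0[OF assms(1,5), of l] unfolding P_def by simp
  qed
  have "(LINT l|?M. H l) = (LINT l|Pi\<^sub>M J (\<lambda>_. lborel). LINT t|lborel. H (l(p := t)))"
    by (rule lborel_product_integral_insert[OF assms(1,2) int])
  also have "\<dots> = 0" using inner by simp
  finally have "(LINT l|?M. H l) = 0" .
  moreover have "(LINT l|?M. H l) = s * moment \<gamma> ?I (A - {p}) - c * moment \<gamma> ?I A +
     2 * of_real \<gamma> * (\<Sum>j\<in>J. LINT l|?M. pair_term \<gamma> ?I p j A l)"
    unfolding H_def moment_def using int1 int2
    by (simp add: Bochner_Integration.integral_add Bochner_Integration.integral_diff Bochner_Integration.integral_sum)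
  ultimately show ?thesis by simp
qed

lemma weight_permute:
  assumes "\<pi> permutes I"
  shows "weight \<gamma> I (l \<circ> \<pi>) = weight \<gamma> I l"
  unfolding weight_def disc_pow_permute[OF assms]
  using prod.reindex_bij_betw[OF permutes_imp_bij[OF assms], of "\<lambda>i. q (l i)"] by simp

text \<open>Exchanging \<open>x = l p\<close> and \<open>y = l j\<close> changes the sign of the pole, which therefore cancels:
\<open>y (x - \<kappa> x\<^sup>2) / (x - y) + x (y - \<kappa> y\<^sup>2) / (y - x) = - \<kappa> x y\<close>.\<close>

lemma pair_term_swap_in:
  assumes "finite I" "p \<in> A" "j \<in> A" "j \<noteq> p" "A \<subseteq> I"
  defines "\<pi> \<equiv> Transposition.transpose p j"
  shows "pair_term \<gamma> I p j A l + pair_term \<gamma> I p j A (l \<circ> \<pi>) =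
    - of_real \<kappa> * ((\<Prod>i\<in>A. of_real (l i)) * weight \<gamma> I l)"
proof -
  have "\<pi> permutes I" unfolding \<pi>_def using assms by (intro permutes_swap_id) auto
  note w = weight_permute[OF this]
  have fin: "finite A" using assms finite_subset by blast
  define R where "R = (\<Prod>i\<in>A - {p} - {j}. complex_of_real (l i))"
  have 1: "(\<Prod>i\<in>A - {p}. complex_of_real (l i)) = of_real (l j) * R"
    unfolding R_def using assms fin by (intro prod.remove) auto
  have 2: "(\<Prod>i\<in>A - {p}. complex_of_real ((l \<circ> \<pi>) i)) = of_real (l p) * R"
  proof -
    have "(\<Prod>i\<in>A - {p}. complex_of_real ((l \<circ> \<pi>) i)) = of_real ((l \<circ> \<pi>) j) * (\<Prod>i\<in>A - {p} - {j}. complex_of_real ((l \<circ> \<pi>) i))"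
      using assms fin by (intro prod.remove) auto
    also have "(\<Prod>i\<in>A - {p} - {j}. complex_of_real ((l \<circ> \<pi>) i)) = R"
      unfolding R_def \<pi>_def by (intro prod.cong) (auto simp: Transposition.transpose_def)
    finally show ?thesis by (simp add: \<pi>_def)
  qed
  have 3: "(\<Prod>i\<in>A. complex_of_real (l i)) = of_real (l p) * (of_real (l j) * R)"
    using prod.remove[OF fin assms(2), of "\<lambda>i. complex_of_real (l i)"] 1 by simp
  have 4: "(l \<circ> \<pi>) p = l j" "(l \<circ> \<pi>) j = l p" by (auto simp: \<pi>_def)
  show ?thesis
  proof (cases "l p = l j")
    case True
    then have "weight \<gamma> I l = 0"
      using assms disc_pow_eq_0[of I p j l \<gamma>] by (auto simp: weight_def)
    then show ?thesis by (simp add: pair_term_def w)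
  next
    case False
    then have ne: "complex_of_real (l p) - of_real (l j) \<noteq> 0" "complex_of_real (l j) - of_real (l p) \<noteq> 0" by auto
    show ?thesis
      unfolding pair_term_def w 1 2 3 4 using ne
      by (simp add: divide_simps) (simp add: algebra_simps power2_eq_square)
  qed
qed

text \<open>If \<open>j\<close> is not among the selected particles, the exchange gives
\<open>((x - \<kappa> x\<^sup>2) - (y - \<kappa> y\<^sup>2)) / (x - y) = 1 - \<kappa> x - \<kappa> y\<close>.\<close>

lemma pair_term_swap_out:
  assumes "finite I" "p \<in> A" "j \<in> I" "j \<notin> A" "A \<subseteq> I"
  defines "\<pi> \<equiv> Transposition.transpose p j"
  shows "pair_term \<gamma> I p j A l + pair_term \<gamma> I p j A (l \<circ> \<pi>) =
    (\<Prod>i\<in>A - {p}. of_real (l i)) * weight \<gamma> I l - of_real \<kappa> * ((\<Prod>i\<in>A. of_real (l i)) * weight \<gamma> I l)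
     - of_real \<kappa> * ((\<Prod>i\<in>A. of_real ((l \<circ> \<pi>) i)) * weight \<gamma> I (l \<circ> \<pi>))"
proof -
  have "\<pi> permutes I" unfolding \<pi>_def using assms by (intro permutes_swap_id) auto
  note w = weight_permute[OF this]
  have fin: "finite A" using assms finite_subset by blast
  have jp: "j \<noteq> p" using assms by auto
  define R where "R = (\<Prod>i\<in>A - {p}. complex_of_real (l i))"
  have 2: "(\<Prod>i\<in>A - {p}. complex_of_real ((l \<circ> \<pi>) i)) = R"
    unfolding R_def \<pi>_def using assms by (intro prod.cong) (auto simp: Transposition.transpose_def)
  have 3: "(\<Prod>i\<in>A. complex_of_real (l i)) = of_real (l p) * R"
    unfolding R_def by (rule prod.remove[OF fin assms(2)])
  have 4: "(l \<circ> \<pi>) p = l j" "(l \<circ> \<pi>) j = l p" by (auto simp: \<pi>_def)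
  have 5: "(\<Prod>i\<in>A. complex_of_real ((l \<circ> \<pi>) i)) = of_real (l j) * R"
    using prod.remove[OF fin assms(2), of "\<lambda>i. complex_of_real ((l \<circ> \<pi>) i)"] 2 4 by simp
  show ?thesis
  proof (cases "l p = l j")
    case True
    then have "weight \<gamma> I l = 0"
      using assms jp disc_pow_eq_0[of I p j l \<gamma>] by (auto simp: weight_def)
    then show ?thesis by (simp add: pair_term_def w)
  next
    case False
    then have ne: "complex_of_real (l p) - of_real (l j) \<noteq> 0" "complex_of_real (l j) - of_real (l p) \<noteq> 0" by auto
    show ?thesis
      unfolding pair_term_def w 2 3 4 5 R_def[symmetric] using ne
      by (simp add: divide_simps) (simp add: algebra_simps power2_eq_square)
  qed
qed

text \<open>The ensemble is invariant under exchanging \<open>p\<close> and \<open>j\<close>, so twice the integral of \<open>pair_term\<close> is the integral of its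
symmetrisation.\<close>

lemma
  assumes "finite I" "0 < \<gamma>" "p \<in> A" "A \<subseteq> I" "j \<in> I" "j \<noteq> p"
  shows integral_pair_term_in: "j \<in> A \<Longrightarrow> 2 * (LINT l|Pi\<^sub>M I (\<lambda>_. lborel). pair_term \<gamma> I p j A l) = - of_real \<kappa> * moment \<gamma> I A"
    and integral_pair_term_out: "j \<notin> A \<Longrightarrow> 2 * (LINT l|Pi\<^sub>M I (\<lambda>_. lborel). pair_term \<gamma> I p j A l) =
       moment \<gamma> I (A - {p}) - 2 * of_real \<kappa> * moment \<gamma> I A"
proof -
  let ?M = "Pi\<^sub>M I (\<lambda>_. lborel :: real measure)"
  define \<pi> where "\<pi> = Transposition.transpose p j"
  have perm: "\<pi> permutes I" unfolding \<pi>_def using assms by (intro permutes_swap_id) auto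
  have I: "I = insert p (I - {p})" using assms by auto
  have "integrable (Pi\<^sub>M (insert p (I - {p})) (\<lambda>_. lborel)) (pair_term \<gamma> (insert p (I - {p})) p j A)"
    using assms by (intro integrable_pair_term) auto
  then have int: "integrable ?M (pair_term \<gamma> I p j A)" using I by simp
  have meas: "pair_term \<gamma> I p j A \<in> borel_measurable ?M" using int by auto
  have int': "integrable ?M (\<lambda>l. pair_term \<gamma> I p j A (l \<circ> \<pi>))"
    using int integral_PiM_permute(2)[OF assms(1) perm meas] by simp
  have *: "2 * (LINT l|?M. pair_term \<gamma> I p j A l) = (LINT l|?M. pair_term \<gamma> I p j A l + pair_term \<gamma> I p j A (l \<circ> \<pi>))"
    using int int' integral_PiM_permute(1)[OF assms(1) perm meas] by (simp add: Bochner_Integration.integral_add)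
  have intA: "integrable ?M (\<lambda>l. (\<Prod>i\<in>A. complex_of_real (l i)) * weight \<gamma> I l)"
    and intB: "integrable ?M (\<lambda>l. (\<Prod>i\<in>A - {p}. complex_of_real (l i)) * weight \<gamma> I l)"
    using assms by (auto intro!: integrable_moment)
  have measA: "(\<lambda>l. (\<Prod>i\<in>A. complex_of_real (l i)) * weight \<gamma> I l) \<in> borel_measurable ?M"
    using intA by auto
  have intA': "integrable ?M (\<lambda>l. (\<Prod>i\<in>A. complex_of_real ((l \<circ> \<pi>) i)) * weight \<gamma> I (l \<circ> \<pi>))"
    using intA integral_PiM_permute(2)[OF assms(1) perm measA] by simp
  have momA': "(LINT l|?M. (\<Prod>i\<in>A. complex_of_real ((l \<circ> \<pi>) i)) * weight \<gamma> I (l \<circ> \<pi>)) = moment \<gamma> I A"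
    unfolding moment_def by (rule integral_PiM_permute(1)[OF assms(1) perm measA])
  show "2 * (LINT l|?M. pair_term \<gamma> I p j A l) = - of_real \<kappa> * moment \<gamma> I A" if "j \<in> A"
    unfolding * \<pi>_def pair_term_swap_in[OF assms(1,3) that assms(6,4)] moment_def by simp
  show "2 * (LINT l|?M. pair_term \<gamma> I p j A l) = moment \<gamma> I (A - {p}) - 2 * of_real \<kappa> * moment \<gamma> I A" if "j \<notin> A"
  proof -
    have "2 * (LINT l|?M. pair_term \<gamma> I p j A l) =
      (LINT l|?M. (\<Prod>i\<in>A - {p}. of_real (l i)) * weight \<gamma> I l - of_real \<kappa> * ((\<Prod>i\<in>A. of_real (l i)) * weight \<gamma> I l)
     - of_real \<kappa> * ((\<Prod>i\<in>A. of_real ((l \<circ> \<pi>) i)) * weight \<gamma> I (l \<circ> \<pi>)))"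
      unfolding * \<pi>_def pair_term_swap_out[OF assms(1,3,5) that assms(4)] ..
    also have "\<dots> = moment \<gamma> I (A - {p}) - of_real \<kappa> * moment \<gamma> I A - of_real \<kappa> * moment \<gamma> I A"
      using intA intB intA' momA'
      by (subst Bochner_Integration.integral_diff)
        (auto simp: moment_def Bochner_Integration.integral_diff)
    finally show ?thesis by simp
  qed
qed

text \<open>Aomoto's recursion: insert the symmetrised integrals of the \<open>r - 1\<close> interactions inside \<open>A\<close> and the \<open>n - r\<close>
interactions with the outside into the integration by parts.\<close>

lemma moment_recurrence:
  assumes "finite I" "0 < \<gamma>" "p \<in> A" "A \<subseteq> I"
  defines "n \<equiv> real (card I)" and "r \<equiv> real (card A)"
  shows "(s + of_real (\<gamma> * (n - r))) * moment \<gamma> I (A - {p}) =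
    (c + of_real (\<kappa> * \<gamma> * (2 * n - r - 1))) * moment \<gamma> I A"
proof -
  let ?P = "\<lambda>j. LINT l|Pi\<^sub>M I (\<lambda>_. lborel). pair_term \<gamma> I p j A l"
  define J where "J = I - {p}"
  have I: "I = insert p J" and J: "finite J" "p \<notin> J" using assms by (auto simp: J_def)
  have fin: "finite A" using assms finite_subset by blast
  have "0 = s * moment \<gamma> I (A - {p}) - c * moment \<gamma> I A + of_real \<gamma> * (\<Sum>j\<in>J. 2 * ?P j)"
    using moment_ibp[OF J _ assms(3,2)] assms(4) unfolding I[symmetric] by (simp add: sum_distrib_left mult_ac)
  also have "(\<Sum>j\<in>J. 2 * ?P j) = (\<Sum>j\<in>A - {p}. 2 * ?P j) + (\<Sum>j\<in>I - A. 2 * ?P j)"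
  proof -
    have "J = (A - {p}) \<union> (I - A)" using assms(3,4) unfolding J_def by auto
    then show ?thesis using assms fin by (simp only: , subst sum.union_disjoint) auto
  qed
  also have "(\<Sum>j\<in>A - {p}. 2 * ?P j) = (\<Sum>j\<in>A - {p}. - of_real \<kappa> * moment \<gamma> I A)"
    using assms by (intro sum.cong refl integral_pair_term_in) auto
  also have "(\<Sum>j\<in>I - A. 2 * ?P j) = (\<Sum>j\<in>I - A. moment \<gamma> I (A - {p}) - 2 * of_real \<kappa> * moment \<gamma> I A)"
    using assms by (intro sum.cong refl integral_pair_term_out) auto
  also have "(\<Sum>j\<in>A - {p}. - of_real \<kappa> * moment \<gamma> I A) = of_real (r - 1) * (- of_real \<kappa> * moment \<gamma> I A)"
  proof -
    have "card A \<ge> 1" using assms fin card_gt_0_iff[of A] by auto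
    then have "of_nat (card (A - {p})) = complex_of_real (r - 1)"
      using assms fin by (simp add: r_def of_nat_diff)
    then show ?thesis by (simp only: sum_constant)
  qed
  also have "(\<Sum>j\<in>I - A. moment \<gamma> I (A - {p}) - 2 * of_real \<kappa> * moment \<gamma> I A) =
      of_real (n - r) * (moment \<gamma> I (A - {p}) - 2 * of_real \<kappa> * moment \<gamma> I A)"
  proof -
    have "of_nat (card (I - A)) = complex_of_real (n - r)"
      using assms fin card_mono[of I A] by (simp add: r_def n_def card_Diff_subset of_nat_diff)
    then show ?thesis by (simp only: sum_constant)
  qed
  finally show ?thesis by (simp add: algebra_simps)
qed

lemma moment_prod:
  assumes "finite I" "0 < \<gamma>" "A \<subseteq> I"
  defines "n \<equiv> real (card I)"
  shows "moment \<gamma> I A * (\<Prod>r=1..card A. c + of_real (\<kappa> * \<gamma> * (2 * n - real r - 1))) =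
    moment \<gamma> I {} * (\<Prod>r=1..card A. s + of_real (\<gamma> * (n - real r)))"
proof -
  have "finite A" using assms finite_subset by blast
  then show ?thesis using assms(3)
  proof (induction A rule: finite_induct)
    case (insert p A)
    let ?d = "\<lambda>r. c + of_real (\<kappa> * \<gamma> * (2 * n - real r - 1))" and ?e = "\<lambda>r. s + of_real (\<gamma> * (n - real r))"
    have card: "card (insert p A) = Suc (card A)" using insert by simp
    have "moment \<gamma> I (insert p A) * (\<Prod>r=1..card (insert p A). ?d r) =
       (?d (Suc (card A)) * moment \<gamma> I (insert p A)) * (\<Prod>r=1..card A. ?d r)"
      unfolding card by (simp add: mult_ac)
    also have "?d (Suc (card A)) * moment \<gamma> I (insert p A) = ?e (Suc (card A)) * moment \<gamma> I A"
      using moment_recurrence[OF assms(1,2), of p "insert p A"] insert unfolding card n_def[symmetric] by simp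
    also have "?e (Suc (card A)) * moment \<gamma> I A * (\<Prod>r=1..card A. ?d r) =
        ?e (Suc (card A)) * (moment \<gamma> I {} * (\<Prod>r=1..card A. ?e r))"
      using insert by (simp add: mult.assoc)
    also have "\<dots> = moment \<gamma> I {} * (\<Prod>r=1..card (insert p A). ?e r)"
      unfolding card by (simp add: mult_ac)
    finally show ?case .
  qed simp
qed

lemma full_moment:
  assumes "finite I" "0 < \<gamma>"
  defines "n \<equiv> card I"
  shows "moment \<gamma> I I * (\<Prod>k<n. c + of_real (\<kappa> * \<gamma> * (real n + real k - 1))) =
    moment \<gamma> I {} * (\<Prod>k<n. s + of_real (\<gamma> * real k))"
proof -
  have reindex: "(\<Prod>r=1..n. f (real n - real r)) = (\<Prod>k<n. f (real k))" for f :: "real \<Rightarrow> complex"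
    by (rule prod.reindex_bij_witness[of _ "\<lambda>k. n - k" "\<lambda>r. n - r"]) (auto simp: of_nat_diff)
  have 1: "(\<Prod>r=1..n. s + of_real (\<gamma> * (real n - real r))) = (\<Prod>k<n. s + of_real (\<gamma> * real k))"
    by (rule reindex[of "\<lambda>x. s + of_real (\<gamma> * x)"])
  have "(\<Prod>r=1..n. c + of_real (\<kappa> * \<gamma> * (2 * real n - real r - 1))) =
     (\<Prod>r=1..n. c + of_real (\<kappa> * \<gamma> * (real n + (real n - real r) - 1)))"
    by (simp add: algebra_simps)
  also have "\<dots> = (\<Prod>k<n. c + of_real (\<kappa> * \<gamma> * (real n + real k - 1)))"
    by (rule reindex[of "\<lambda>x. c + of_real (\<kappa> * \<gamma> * (real n + x - 1))"])
  finally show ?thesis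
    using moment_prod[OF assms(1,2) order_refl] 1 unfolding n_def[symmetric] by simp
qed

end

section \<open>Families of Pearson weights with a complex exponent\<close>

text \<open>The support is encoded by the value \<open>0\<close> on the closed left half-line and by the cofactor \<open>r\<close>.\<close>

definition power_weight :: "(real \<Rightarrow> real) \<Rightarrow> complex \<Rightarrow> real \<Rightarrow> complex" where
  "power_weight r s t = (if 0 < t then of_real t powr (s - 1) * of_real (r t) else 0)"

lemma norm_of_real_powr:
  fixes t :: real and s :: complex
  assumes "0 < t"
  shows "norm (of_real t powr s) = t powr Re s"
  using assms by (simp add: norm_powr_real_powr)

text \<open>Splits a polynomial weight into two pure powers, which only shift the exponent of a power weight.\<close>

lemma one_plus_power_le:
  fixes t :: real
  assumes "0 \<le> t"
  shows "(1 + t) ^ k \<le> 2 ^ k * (1 + t ^ k)"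
proof -
  have "(1 + t) ^ k \<le> (2 * max 1 t) ^ k" using assms by (intro power_mono) auto
  also have "\<dots> = 2 ^ k * max 1 t ^ k" by (rule power_mult_distrib)
  also have "max 1 t ^ k \<le> 1 + t ^ k" using assms by (auto simp: max_def)
  finally show ?thesis by simp
qed

text \<open>Conditions on the cofactor \<open>r\<close> under which \<open>power_weight r s\<close> satisfies Pearson's equation for every \<open>s\<close> with
positive real part, with \<open>c = \<kappa> s + b\<close>. Positivity near \<open>0\<close> keeps the Selberg integral away from \<open>0\<close>.\<close>

locale pearson_family =
  fixes r :: "real \<Rightarrow> real" and \<kappa> b :: real
  assumes \<kappa>_nonneg: "0 \<le> \<kappa>" and b_pos: "0 < b"
    and r_measurable [measurable]: "r \<in> borel_measurable borel"
    and r_nonneg: "\<And>t. 0 \<le> r t"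
    and r_pos: "\<exists>d>0. \<forall>t. 0 < t \<and> t < d \<longrightarrow> 0 < r t"
    and r_integrable: "\<And>x. 0 < x \<Longrightarrow> integrable lborel (\<lambda>t. indicator {0<..} t * (t powr (x - 1) * r t))"
    and u_cont: "continuous_on {0<..} (\<lambda>t. (1 - \<kappa> * t) * r t)"
    and u_deriv: "\<exists>E. finite E \<and> (\<forall>t>0. t \<notin> E \<longrightarrow>
       ((\<lambda>t. (1 - \<kappa> * t) * r t) has_real_derivative - b * r t) (at t))"
    and u_bounded: "\<And>x. 0 \<le> x \<Longrightarrow> \<exists>C. \<forall>t>0. t powr x * \<bar>(1 - \<kappa> * t) * r t\<bar> \<le> C"
begin

lemma power_weight_measurable [measurable]: "power_weight r s \<in> borel_measurable borel"
proof -
  have "power_weight r s = (\<lambda>t. if 0 < t then exp ((s - 1) * of_real (ln t)) * of_real (r t) else 0)"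
    by (auto simp: power_weight_def powr_def Ln_of_real)
  also have "\<dots> \<in> borel_measurable borel" by measurable
  finally show ?thesis .
qed

lemma norm_power_weight: "norm (power_weight r s t) = indicator {0<..} t * (t powr (Re s - 1) * r t)"
  using r_nonneg[of t] by (simp add: power_weight_def norm_mult norm_of_real_powr)

abbreviation (input) "u t \<equiv> (1 - \<kappa> * t) * r t"

lemma Q_eq:
  assumes "0 < t"
  shows "of_real (t - \<kappa> * t\<^sup>2) * power_weight r s t = of_real t powr s * of_real (u t)"
proof -
  have "of_real t powr s = of_real t powr (s - 1) * (of_real t :: complex)"
    using assms powr_add[of "complex_of_real t" "s - 1" 1] by simp
  moreover have "complex_of_real (t - \<kappa> * t\<^sup>2) = of_real t * of_real (1 - \<kappa> * t)"
    by (simp add: power2_eq_square algebra_simps)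
  ultimately show ?thesis using assms unfolding power_weight_def by (simp del: of_real_diff of_real_mult add: of_real_mult[of "1 - \<kappa> * t" "r t"])
qed

lemma norm_Q_eq:
  assumes "0 < t"
  shows "norm (of_real (t - \<kappa> * t\<^sup>2) * power_weight r s t) = t powr Re s * \<bar>u t\<bar>"
  unfolding Q_eq[OF assms] norm_mult norm_of_real norm_of_real_powr[OF assms] by simp

lemma Q_eq_0: "t \<le> 0 \<Longrightarrow> of_real (t - \<kappa> * t\<^sup>2) * power_weight r s t = 0"
  by (simp add: power_weight_def)

lemma Q_has_derivative:
  assumes "0 < t" and u: "((\<lambda>t. u t) has_real_derivative - b * r t) (at t)"
  shows "((\<lambda>t. of_real (t - \<kappa> * t\<^sup>2) * power_weight r s t) has_vector_derivative
     (s - (of_real \<kappa> * s + of_real b) * of_real t) * power_weight r s t) (at t)"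
proof -
  have "((\<lambda>z. z powr s) has_field_derivative s * of_real t powr (s - 1)) (at (complex_of_real t))"
    using assms by (intro has_field_derivative_powr) auto
  then have "((\<lambda>t. complex_of_real t powr s) has_vector_derivative s * of_real t powr (s - 1)) (at t)"
    using field_vector_diff_chain_at[of complex_of_real 1 t "\<lambda>z. z powr s" "s * of_real t powr (s - 1)"]
    by (simp add: o_def has_vector_derivative_of_real[OF DERIV_ident, simplified])
  from has_vector_derivative_mult[OF this has_vector_derivative_of_real[OF u]]
  have d: "((\<lambda>t. of_real t powr s * of_real (u t)) has_vector_derivative
     (of_real t powr s * of_real (- b * r t) + s * of_real t powr (s - 1) * of_real (u t))) (at t)" .
  have e: "of_real t powr s * of_real (- b * r t) + s * of_real t powr (s - 1) * of_real (u t) =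
      (s - (of_real \<kappa> * s + of_real b) * of_real t) * power_weight r s t"
  proof -
    have p: "of_real t powr s = of_real t powr (s - 1) * (of_real t :: complex)"
      using assms powr_add[of "complex_of_real t" "s - 1" 1] by simp
    show ?thesis unfolding p using assms by (simp add: power_weight_def algebra_simps)
  qed
  show ?thesis
    by (rule has_vector_derivative_transform_within_open[OF d[unfolded e], of "{0<..}"])
      (use assms Q_eq in auto)
qed

lemma pearson_weight:
  assumes "0 < Re s"
  shows "pearson_weight (power_weight r s) s (of_real \<kappa> * s + of_real b) \<kappa>"
proof
  show "power_weight r s \<in> borel_measurable borel" by measurable
next
  fix k
  let ?x = "Re s"
  show "integrable lborel (\<lambda>t. norm (power_weight r s t) * (1 + \<bar>t\<bar>) ^ k)"
  proof (rule Bochner_Integration.integrable_bound)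
    show "integrable lborel (\<lambda>t. 2 ^ k * (indicator {0<..} t * (t powr (?x - 1) * r t) +
        indicator {0<..} t * (t powr (?x + real k - 1) * r t)))"
      using assms by (intro integrable_mult_right Bochner_Integration.integrable_add r_integrable) auto
    have "norm (power_weight r s t) * (1 + \<bar>t\<bar>) ^ k \<le> 2 ^ k * (indicator {0<..} t * (t powr (?x - 1) * r t) +
        indicator {0<..} t * (t powr (?x + real k - 1) * r t))" for t
    proof (cases "0 < t")
      case True
      have "t powr (?x + real k - 1) = t powr (?x - 1) * t ^ k"
        using True powr_add[of t "?x - 1" "real k"] by (simp add: powr_realpow algebra_simps)
      moreover have "(t powr (?x - 1) * r t) * (1 + \<bar>t\<bar>) ^ k \<le> (t powr (?x - 1) * r t) * (2 ^ k * (1 + t ^ k))"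
        using True one_plus_power_le[of t k] r_nonneg by (intro mult_left_mono) auto
      ultimately show ?thesis using True unfolding norm_power_weight by (simp add: algebra_simps)
    qed (simp add: norm_power_weight)
    then show "AE t in lborel. norm (norm (power_weight r s t) * (1 + \<bar>t\<bar>) ^ k) \<le>
      norm (2 ^ k * (indicator {0<..} t * (t powr (?x - 1) * r t) + indicator {0<..} t * (t powr (?x + real k - 1) * r t)))"
      using r_nonneg by (intro AE_I2) (auto simp: abs_mult)
  qed measurable
  obtain C1 where C1: "\<forall>t>0. t powr ?x * \<bar>u t\<bar> \<le> C1" using u_bounded[of ?x] assms by auto
  obtain C2 where C2: "\<forall>t>0. t powr (?x + real k) * \<bar>u t\<bar> \<le> C2" using u_bounded[of "?x + real k"] assms by auto
  have C: "0 \<le> C1" "0 \<le> C2" using C1[rule_format, of 1] C2[rule_format, of 1] by auto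
  have "norm (of_real (t - \<kappa> * t\<^sup>2) * power_weight r s t) * (1 + \<bar>t\<bar>) ^ k \<le> 2 ^ k * (C1 + C2)" for t
  proof (cases "0 < t")
    case True
    have "t powr (?x + real k) = t powr ?x * t ^ k"
      using True by (simp add: powr_add powr_realpow)
    then have "t powr ?x * \<bar>u t\<bar> * (1 + t ^ k) \<le> C1 + C2"
      using C1[rule_format, OF True] C2[rule_format, OF True] by (simp add: algebra_simps)
    moreover have "t powr ?x * \<bar>u t\<bar> * (1 + \<bar>t\<bar>) ^ k \<le> t powr ?x * \<bar>u t\<bar> * (2 ^ k * (1 + t ^ k))"
      using True one_plus_power_le[of t k] by (intro mult_left_mono) auto
    ultimately have "t powr ?x * \<bar>u t\<bar> * (1 + \<bar>t\<bar>) ^ k \<le> 2 ^ k * (C1 + C2)"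
    proof -
      assume le: "t powr ?x * \<bar>u t\<bar> * (1 + t ^ k) \<le> C1 + C2"
        and le': "t powr ?x * \<bar>u t\<bar> * (1 + \<bar>t\<bar>) ^ k \<le> t powr ?x * \<bar>u t\<bar> * (2 ^ k * (1 + t ^ k))"
      note le'
      also have "t powr ?x * \<bar>u t\<bar> * (2 ^ k * (1 + t ^ k)) = 2 ^ k * (t powr ?x * \<bar>u t\<bar> * (1 + t ^ k))"
        by (simp only: mult_ac)
      also have "\<dots> \<le> 2 ^ k * (C1 + C2)" by (rule mult_left_mono[OF le]) simp
      finally show ?thesis .
    qed
    then show ?thesis unfolding norm_Q_eq[OF True] .
  next
    case False
    then have "t \<le> 0" by simp
    from Q_eq_0[OF this] have "norm (of_real (t - \<kappa> * t\<^sup>2) * power_weight r s t) = 0" by (simp only: norm_zero)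
    then show ?thesis using C by (simp only: mult_zero_left) simp
  qed
  then show "\<exists>C. \<forall>t. norm (of_real (t - \<kappa> * t\<^sup>2) * power_weight r s t) * (1 + \<bar>t\<bar>) ^ k \<le> C"
    by (intro exI allI)
next
  obtain E where E: "finite E" "\<forall>t>0. t \<notin> E \<longrightarrow> ((\<lambda>t. u t) has_real_derivative - b * r t) (at t)"
    using u_deriv by auto
  show "\<exists>E. finite E \<and> (\<forall>t. t \<notin> E \<longrightarrow> ((\<lambda>t. of_real (t - \<kappa> * t\<^sup>2) * power_weight r s t) has_vector_derivative
     (s - (of_real \<kappa> * s + of_real b) * of_real t) * power_weight r s t) (at t))"
  proof (intro exI[of _ "insert 0 E"] conjI allI impI)
    fix t assume t: "t \<notin> insert 0 E"
    show "((\<lambda>t. of_real (t - \<kappa> * t\<^sup>2) * power_weight r s t) has_vector_derivative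
     (s - (of_real \<kappa> * s + of_real b) * of_real t) * power_weight r s t) (at t)"
    proof (cases "0 < t")
      case True
      then show ?thesis using E t by (intro Q_has_derivative) auto
    next
      case False
      then have "t < 0" using t by auto
      have "((\<lambda>_. 0) has_vector_derivative 0) (at t)" by simp
      then have "((\<lambda>t. of_real (t - \<kappa> * t\<^sup>2) * power_weight r s t) has_vector_derivative 0) (at t)"
        by (rule has_vector_derivative_transform_within_open[of _ _ _ "{..<0}"]) (use \<open>t < 0\<close> Q_eq_0 in auto)
      then show ?thesis using \<open>t < 0\<close> by (simp add: power_weight_def)
    qed
  qed (use E in auto)
next
  let ?Q = "\<lambda>t. of_real (t - \<kappa> * t\<^sup>2) * power_weight r s t"
  obtain C where C: "\<forall>t>0. t powr 0 * \<bar>u t\<bar> \<le> C" using u_bounded[of 0] by auto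
  have "isCont ?Q t" for t
  proof (cases t "0::real" rule: linorder_cases)
    case less
    have "isCont (\<lambda>_. 0 :: complex) t" by simp
    moreover have "eventually (\<lambda>t. ?Q t = 0) (nhds t)"
    proof (rule eventually_mono)
      show "eventually (\<lambda>t. t \<in> {..<0}) (nhds t)" using less by (intro eventually_nhds_in_open) auto
      show "?Q t = 0" if "t \<in> {..<0}" for t by (rule Q_eq_0) (use that in simp)
    qed
    ultimately show ?thesis using isCont_cong by fastforce
  next
    case greater
    have "continuous_on {0<..} (\<lambda>t. of_real t powr s * of_real (u t) :: complex)"
      by (intro continuous_intros u_cont) auto
    then have "isCont (\<lambda>t. of_real t powr s * of_real (u t) :: complex) t"
      using greater by (auto simp: continuous_on_eq_continuous_at)
    moreover have "eventually (\<lambda>t. ?Q t = of_real t powr s * of_real (u t)) (nhds t)"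
    proof (rule eventually_mono)
      show "eventually (\<lambda>t. t \<in> {0<..}) (nhds t)" using greater by (intro eventually_nhds_in_open) auto
      show "?Q t = of_real t powr s * of_real (u t)" if "t \<in> {0<..}" for t by (rule Q_eq) (use that in simp)
    qed
    ultimately show ?thesis using isCont_cong by fastforce
  next
    case equal
    have "norm (?Q t) \<le> \<bar>t\<bar> powr Re s * C" for t
    proof (cases "0 < t")
      case True
      then show ?thesis unfolding norm_Q_eq[OF True] using C by (auto intro!: mult_left_mono)
    next
      case False
      then have "t \<le> 0" by simp
      from Q_eq_0[OF this] have "norm (?Q t) = 0" by (simp only: norm_zero)
      moreover have "0 \<le> C" using C[rule_format, of 1] by auto
      ultimately show ?thesis by (simp only:) simp
    qed
    moreover have "((\<lambda>t. \<bar>t\<bar> powr Re s * C) \<longlongrightarrow> 0 powr Re s * C) (at (0::real))"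
      using assms by (intro tendsto_mult tendsto_const tendsto_powr2) (auto intro!: tendsto_eq_intros)
    ultimately have "(?Q \<longlongrightarrow> 0) (at 0)"
      by (intro Lim_null_comparison[of ?Q "\<lambda>t. \<bar>t\<bar> powr Re s * C"] always_eventually) auto
    then show ?thesis using equal by (simp add: isCont_def)
  qed
  then show "continuous_on UNIV ?Q" by (simp add: continuous_at_imp_continuous_on)
qed

end

definition jacobi_cofactor :: "real \<Rightarrow> real \<Rightarrow> real" where
  "jacobi_cofactor b t = (if t < 1 then (1 - t) powr (b - 1) else 0)"

lemma jacobi_pearson_family:
  assumes "0 < b"
  shows "pearson_family (jacobi_cofactor b) 1 b"
proof
  have u: "(1 - 1 * t) * jacobi_cofactor b t = max 0 (1 - t) powr b" for t
    by (auto simp: jacobi_cofactor_def powr_diff)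
  show "jacobi_cofactor b \<in> borel_measurable borel" unfolding jacobi_cofactor_def by measurable
  show "0 \<le> jacobi_cofactor b t" for t by (simp add: jacobi_cofactor_def)
  show "\<exists>d>0. \<forall>t. 0 < t \<and> t < d \<longrightarrow> 0 < jacobi_cofactor b t"
    by (rule exI[of _ 1]) (auto simp: jacobi_cofactor_def)
  show "integrable lborel (\<lambda>t. indicator {0<..} t * (t powr (x - 1) * jacobi_cofactor b t))" if "0 < x" for x
  proof -
    have "set_integrable lborel {0..1} (\<lambda>t. t powr (x - 1) * (1 - t) powr (b - 1))"
      using integrable_Beta[OF that assms] .
    then show ?thesis unfolding set_integrable_def
      by (rule Bochner_Integration.integrable_bound) (auto simp: jacobi_cofactor_def indicator_def)
  qed
  show "continuous_on {0<..} (\<lambda>t. (1 - 1 * t) * jacobi_cofactor b t)"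
    unfolding u using assms by (intro continuous_on_powr' continuous_intros) auto
  show "\<exists>E. finite E \<and> (\<forall>t>0. t \<notin> E \<longrightarrow>
       ((\<lambda>t. (1 - 1 * t) * jacobi_cofactor b t) has_real_derivative - b * jacobi_cofactor b t) (at t))"
  proof (intro exI[of _ "{1}"] conjI allI impI)
    fix t :: real assume t: "0 < t" "t \<notin> {1}"
    show "((\<lambda>t. (1 - 1 * t) * jacobi_cofactor b t) has_real_derivative - b * jacobi_cofactor b t) (at t)"
    proof (cases "t < 1")
      case True
      have "((\<lambda>t. (1 - t) powr b) has_real_derivative - b * jacobi_cofactor b t) (at t)"
        using True by (auto intro!: derivative_eq_intros simp: jacobi_cofactor_def)
      then show ?thesis unfolding u
        by (rule has_field_derivative_transform_within_open[of _ _ _ "{..<1}"]) (use True in auto)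
    next
      case False
      have "((\<lambda>t. 0) has_real_derivative 0) (at t)" by simp
      then have "((\<lambda>t. max 0 (1 - t) powr b) has_real_derivative 0) (at t)"
        by (rule has_field_derivative_transform_within_open[of _ _ _ "{1<..}"]) (use False t in auto)
      then show ?thesis unfolding u using False by (simp add: jacobi_cofactor_def)
    qed
  qed auto
  show "\<exists>C. \<forall>t>0. t powr x * \<bar>(1 - 1 * t) * jacobi_cofactor b t\<bar> \<le> C" if "0 \<le> x" for x
  proof (intro exI[of _ 1] allI impI)
    fix t :: real assume t: "0 < t"
    show "t powr x * \<bar>(1 - 1 * t) * jacobi_cofactor b t\<bar> \<le> 1"
    proof (cases "t < 1")
      case True
      have "t powr x * (1 - t) powr b \<le> 1 * 1"
        using that True t assms by (intro mult_mono powr_le1) auto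
      then show ?thesis unfolding u using True by simp
    next
      case False
      then show ?thesis unfolding u using assms by simp
    qed
  qed
qed (use assms in simp_all)

text \<open>The constant comes from \<open>1 + t \<le> (4 k + 4) exp (t / (4 k + 4))\<close>, raised to the power \<open>k\<close>.\<close>

lemma power_le_exp:
  fixes t :: real
  assumes "0 \<le> t"
  shows "(1 + t) ^ k \<le> (4 * real k + 4) ^ k * exp (t / 4)"
proof -
  let ?m = "4 * real k + 4"
  have "1 + t \<le> ?m * (1 + t / ?m)" using assms by (simp add: field_simps)
  also have "\<dots> \<le> ?m * exp (t / ?m)" by (intro mult_left_mono exp_ge_add_one_self) auto
  finally have "(1 + t) ^ k \<le> (?m * exp (t / ?m)) ^ k" using assms by (intro power_mono) auto
  also have "\<dots> = ?m ^ k * exp (real k * (t / ?m))" by (simp only: power_mult_distrib exp_of_nat_mult)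
  also have "\<dots> \<le> ?m ^ k * exp (t / 4)"
    using assms by (intro mult_left_mono) (auto simp: field_simps)
  finally show ?thesis .
qed

lemma laguerre_pearson_family: "pearson_family (\<lambda>t. exp (- t / 2)) 0 (1 / 2)"
proof
  show "(\<lambda>t::real. exp (- t / 2)) \<in> borel_measurable borel" by measurable
  show "\<exists>d>0. \<forall>t::real. 0 < t \<and> t < d \<longrightarrow> 0 < exp (- t / 2)" by (rule exI[of _ 1]) auto
  show "integrable lborel (\<lambda>t. indicator {0<..} t * (t powr (x - 1) * exp (- t / 2)))" if "0 < x" for x :: real
  proof -
    have "(\<lambda>t. complex_of_real t powr (of_real x - 1) / of_real (exp (1 / 2 * t))) absolutely_integrable_on {0<..}"
      using that by (intro absolutely_integrable_Gamma_integral) auto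
    then have "integrable lebesgue (\<lambda>t. norm (indicator {0<..} t *\<^sub>R (complex_of_real t powr (of_real x - 1) / of_real (exp (1 / 2 * t)))))"
      unfolding set_integrable_def by (rule integrable_norm)
    also have "(\<lambda>t. norm (indicator {0<..} t *\<^sub>R (complex_of_real t powr (of_real x - 1) / of_real (exp (1 / 2 * t))))) =
       (\<lambda>t. indicator {0<..} t * (t powr (x - 1) * exp (- t / 2)))"
      by (auto simp: fun_eq_iff indicator_def norm_mult norm_divide norm_of_real_powr exp_minus field_simps)
    finally show ?thesis by (subst (asm) integrable_completion) auto
  qed
  show "continuous_on {0<..} (\<lambda>t::real. (1 - 0 * t) * exp (- t / 2))" by (intro continuous_intros) auto
  show "\<exists>E. finite E \<and> (\<forall>t>0. t \<notin> E \<longrightarrow>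
       ((\<lambda>t::real. (1 - 0 * t) * exp (- t / 2)) has_real_derivative - (1 / 2) * exp (- t / 2)) (at t))"
    by (intro exI[of _ "{}"]) (auto intro!: derivative_eq_intros)
  show "\<exists>C. \<forall>t>0. t powr x * \<bar>(1 - 0 * t) * exp (- t / 2)\<bar> \<le> C" if "0 \<le> x" for x :: real
  proof -
    define k where "k = nat \<lceil>x\<rceil>"
    have k: "x \<le> real k" unfolding k_def by linarith
    have "t powr x * exp (- t / 2) \<le> (4 * real k + 4) ^ k" if t: "0 < t" for t :: real
    proof -
      have "t powr x \<le> (1 + t) powr x" using t \<open>0 \<le> x\<close> by (intro powr_mono2) auto
      also have "\<dots> \<le> (1 + t) ^ k" using t k by (intro powr_le_power_ceiling) auto
      also have "\<dots> \<le> (4 * real k + 4) ^ k * exp (t / 4)" using t by (intro power_le_exp) auto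
      also have "\<dots> \<le> (4 * real k + 4) ^ k * exp (t / 2)" using t by (intro mult_left_mono) auto
      finally show ?thesis by (simp add: exp_minus field_simps)
    qed
    then show ?thesis by (intro exI[of _ "(4 * real k + 4) ^ k"]) auto
  qed
qed simp_all

section \<open>Selberg integrals as products of Gamma functions\<close>

lemma right_half_plane_not_nonpos_Int:
  fixes z :: complex
  assumes "0 < Re z"
  shows "z \<notin> \<int>\<^sub>\<le>\<^sub>0"
proof
  assume "z \<in> \<int>\<^sub>\<le>\<^sub>0"
  then obtain n where "z = of_int n" "n \<le> 0" by (rule nonpos_Ints_cases)
  then show False using assms by simp
qed

lemma Gamma_nonzero_right_half_plane: "0 < Re z \<Longrightarrow> Gamma z \<noteq> (0 :: complex)"
  using right_half_plane_not_nonpos_Int[of z] by (simp add: Gamma_eq_zero_iff)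

lemma Gamma_plus_one_right_half_plane: "0 < Re z \<Longrightarrow> Gamma (z + 1) = z * Gamma (z :: complex)"
  by (rule Gamma_plus1) (drule right_half_plane_not_nonpos_Int, simp)

text \<open>For \<open>y \<ge> 1/2\<close> this is the mean value inequality, with the derivative of \<open>z powr w\<close> bounded by \<open>2 \<bar>w\<bar>\<close>. For \<open>y < 1/2\<close>
the left side is at most \<open>2\<close> and \<open>\<bar>y - 1\<bar> > 1/2\<close>, which accounts for the summand \<open>4\<close>.\<close>

lemma norm_powr_minus_one_le:
  fixes y :: real and w :: complex
  assumes "0 \<le> y" "0 \<le> Re w" "Re w \<le> 1"
  shows "norm (of_real y powr w - 1) \<le> (2 * norm w + 4) * \<bar>y - 1\<bar>"
proof (cases "1 / 2 \<le> y")
  case True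
  define S where "S = complex_of_real ` {1/2..}"
  have "convex S" unfolding S_def by (intro convex_linear_image linear_of_real) auto
  have "norm (of_real y powr w - of_real 1 powr w) \<le> (2 * norm w) * norm (complex_of_real y - of_real 1)"
  proof (rule field_differentiable_bound[OF \<open>convex S\<close>])
    fix z assume "z \<in> S"
    then obtain t where "z = of_real t" "t \<in> {1 / 2..}" unfolding S_def by (rule imageE)
    then have t: "z = of_real t" "1 / 2 \<le> t" by auto
    show "((\<lambda>z. z powr w) has_field_derivative w * z powr (w - 1)) (at z within S)"
      by (rule has_field_derivative_at_within, rule has_field_derivative_powr) (use t in auto)
    have "t powr (Re w - 1) \<le> (1 / 2) powr (Re w - 1)"
      using t assms by (intro powr_mono2') auto
    also have "\<dots> \<le> (1 / 2) powr (- 1)" using assms by (intro powr_mono') auto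
    finally have "t powr (Re w - 1) \<le> 2" by (simp add: powr_minus)
    then have "norm w * t powr (Re w - 1) \<le> norm w * 2" by (intro mult_left_mono) auto
    then show "norm (w * z powr (w - 1)) \<le> 2 * norm w"
      using t by (simp add: norm_mult norm_of_real_powr)
  next
    show "complex_of_real y \<in> S" "complex_of_real 1 \<in> S" unfolding S_def using True by (intro imageI; simp)+
  qed
  also have "\<dots> = (2 * norm w) * \<bar>y - 1\<bar>" by (simp flip: of_real_diff add: norm_of_real del: of_real_1)
  also have "\<dots> \<le> (2 * norm w + 4) * \<bar>y - 1\<bar>" by (intro mult_right_mono) auto
  finally show ?thesis by simp
next
  case False
  have "norm (of_real y powr w) \<le> 1"
  proof (cases "y = 0")
    case False
    then show ?thesis using \<open>\<not> 1 / 2 \<le> y\<close> assms by (simp add: norm_of_real_powr powr_le1)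
  qed simp
  then have "norm (of_real y powr w - 1) \<le> 1 + 1"
    by (intro order_trans[OF norm_triangle_ineq4]) auto
  also have "\<dots> \<le> (2 * norm w + 4) * (1 / 2)" by simp
  also have "\<dots> \<le> (2 * norm w + 4) * \<bar>y - 1\<bar>" using False by (intro mult_left_mono) auto
  finally show ?thesis .
qed

text \<open>Euler's limit for the Gamma function at \<open>z\<close> and at \<open>z + w\<close>; the factorials cancel in the quotient.\<close>

lemma Gamma_shift_ratio_LIMSEQ:
  fixes z w :: complex
  assumes "0 < Re z" "0 < Re (z + w)"
  shows "(\<lambda>N. Gamma (z + w + of_nat (Suc N)) / (Gamma (z + of_nat (Suc N)) * exp (w * of_real (ln (real N))))) \<longlonglongrightarrow> 1"
proof -
  note nz = right_half_plane_not_nonpos_Int and G0 = Gamma_nonzero_right_half_plane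
  have *: "(\<lambda>N. fact N * exp (z * of_real (ln (real N))) / Gamma (z + of_nat (Suc N))) \<longlonglongrightarrow> 1" if "0 < Re z" for z :: complex
  proof -
    have "(\<lambda>N. Gamma_series z N / Gamma z) \<longlonglongrightarrow> Gamma z / Gamma z"
      using G0[OF that] by (intro tendsto_intros) auto
    also have "(\<lambda>N. Gamma_series z N / Gamma z) = (\<lambda>N. fact N * exp (z * of_real (ln (real N))) / Gamma (z + of_nat (Suc N)))"
      using G0[OF that] G0[of "z + of_nat (Suc _)"] that nz[OF that] pochhammer_Gamma[of z "Suc _"]
      by (intro ext) (simp add: Gamma_series_def)
    finally show ?thesis using G0[OF that] by simp
  qed
  have "(\<lambda>N. (fact N * exp (z * of_real (ln (real N))) / Gamma (z + of_nat (Suc N))) /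
     (fact N * exp ((z + w) * of_real (ln (real N))) / Gamma (z + w + of_nat (Suc N)))) \<longlonglongrightarrow> 1 / 1"
    using assms by (intro tendsto_divide *) auto
  also have "(\<lambda>N. (fact N * exp (z * of_real (ln (real N))) / Gamma (z + of_nat (Suc N))) /
     (fact N * exp ((z + w) * of_real (ln (real N))) / Gamma (z + w + of_nat (Suc N)))) =
     (\<lambda>N. Gamma (z + w + of_nat (Suc N)) / (Gamma (z + of_nat (Suc N)) * exp (w * of_real (ln (real N)))))"
    by (rule ext) (simp add: distrib_right exp_add)
  finally show ?thesis by simp
qed

context pearson_family
begin

definition ens_weight :: "real \<Rightarrow> 'i set \<Rightarrow> complex \<Rightarrow> ('i \<Rightarrow> real) \<Rightarrow> complex" where
  "ens_weight \<gamma> I s l = (\<Prod>i\<in>I. power_weight r s (l i)) * of_real (disc_pow \<gamma> I l)"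

definition selberg :: "real \<Rightarrow> 'i set \<Rightarrow> complex \<Rightarrow> complex" where
  "selberg \<gamma> I s = (LINT l|Pi\<^sub>M I (\<lambda>_. lborel). ens_weight \<gamma> I s l)"

lemma power_weight_add:
  "0 \<le> t \<Longrightarrow> power_weight r (s + w) t = of_real t powr w * power_weight r s t"
  using powr_add[of "complex_of_real t" "s - 1" w] by (simp add: power_weight_def algebra_simps)

lemma power_weight_nonpos: "t \<le> 0 \<Longrightarrow> power_weight r s t = 0"
  by (simp add: power_weight_def)

lemma power_weight_plus_one: "power_weight r (s + 1) t = of_real t * power_weight r s t"
  using power_weight_add[of t s 1] by (cases "0 < t") (auto simp: power_weight_def)

lemma ens_weight_eq_0: "finite I \<Longrightarrow> i \<in> I \<Longrightarrow> l i \<le> 0 \<Longrightarrow> ens_weight \<gamma> I s l = 0"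
  unfolding ens_weight_def by (subst prod_zero[of I]) (auto intro: power_weight_nonpos)

lemma ens_weight_add:
  assumes "finite I" "\<And>i. i \<in> I \<Longrightarrow> 0 < l i"
  shows "ens_weight \<gamma> I (s + w) l = of_real (\<Prod>i\<in>I. l i) powr w * ens_weight \<gamma> I s l"
proof -
  have "(\<Prod>i\<in>I. complex_of_real (l i) powr w) = of_real (\<Prod>i\<in>I. l i) powr w"
    using assms
  proof (induction I rule: finite_induct)
    case (insert i I)
    have "0 < (\<Prod>i\<in>I. l i)" using insert by (intro prod_pos) auto
    then show ?case using insert
      by (simp add: powr_times_real less_imp_le del: of_real_prod)
  qed simp
  moreover have "(\<Prod>i\<in>I. power_weight r (s + w) (l i)) = (\<Prod>i\<in>I. of_real (l i) powr w * power_weight r s (l i))"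
    using assms by (intro prod.cong refl power_weight_add) (auto intro: less_imp_le)
  ultimately show ?thesis unfolding ens_weight_def by (simp add: prod.distrib)
qed

lemma integrable_ens_weight:
  assumes "finite I" "0 < \<gamma>" "0 < Re s"
  shows "integrable (Pi\<^sub>M I (\<lambda>_. lborel)) (ens_weight \<gamma> I s)"
proof -
  interpret pearson_weight "power_weight r s" s "of_real \<kappa> * s + of_real b" \<kappa>
    by (rule pearson_weight) fact
  show ?thesis
    using integrable_moment[OF assms(1,2), of "{}"] by (simp add: weight_def[abs_def] ens_weight_def[abs_def])
qed

text \<open>The ratio of the Selberg integrals at \<open>s + 1\<close> and \<open>s\<close> that results from iterating the recursion over all particles.\<close>

definition shift_ratio :: "real \<Rightarrow> nat \<Rightarrow> complex \<Rightarrow> complex" where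
  "shift_ratio \<gamma> n s = (\<Prod>k<n. (s + of_real (\<gamma> * real k)) /
      (of_real \<kappa> * s + of_real b + of_real (\<kappa> * \<gamma> * (real n + real k - 1))))"

lemma shift_denominator_nonzero:
  assumes "0 < \<gamma>" "0 < Re s" "k < n"
  shows "of_real \<kappa> * s + of_real b + of_real (\<kappa> * \<gamma> * (real n + real k - 1)) \<noteq> 0"
proof -
  have "0 \<le> real n + real k - 1" using assms by auto
  then have "0 \<le> \<kappa> * \<gamma> * (real n + real k - 1)" "0 \<le> \<kappa> * Re s" using assms \<kappa>_nonneg by auto
  then have "0 < Re (of_real \<kappa> * s + of_real b + of_real (\<kappa> * \<gamma> * (real n + real k - 1)))"
    using b_pos by simp
  then have "Re (of_real \<kappa> * s + of_real b + of_real (\<kappa> * \<gamma> * (real n + real k - 1))) \<noteq> Re 0" by (simp only: zero_complex.sel)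
  then show ?thesis by (rule contrapos_nn) (rule arg_cong)
qed

lemma selberg_plus_one:
  assumes "finite I" "0 < \<gamma>" "0 < Re s"
  shows "selberg \<gamma> I (s + 1) = shift_ratio \<gamma> (card I) s * selberg \<gamma> I s"
proof -
  interpret pearson_weight "power_weight r s" s "of_real \<kappa> * s + of_real b" \<kappa>
    by (rule pearson_weight) fact
  have eq: "ens_weight \<gamma> I (s + 1) l = (\<Prod>i\<in>I. of_real (l i)) * weight \<gamma> I l" for l
    unfolding ens_weight_def weight_def by (simp add: power_weight_plus_one prod.distrib)
  have 1: "selberg \<gamma> I (s + 1) = moment \<gamma> I I" unfolding selberg_def moment_def eq ..
  have 2: "selberg \<gamma> I s = moment \<gamma> I {}"
    unfolding selberg_def moment_def ens_weight_def weight_def by simp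
  have "(\<Prod>k<card I. of_real \<kappa> * s + of_real b + of_real (\<kappa> * \<gamma> * (real (card I) + real k - 1))) \<noteq> 0"
    by (subst prod_zero_iff) (use shift_denominator_nonzero assms in auto)
  then show ?thesis
    using full_moment[OF assms(1,2)] unfolding 1 2 shift_ratio_def prod_dividef
    by (simp add: field_simps)
qed

text \<open>At a real exponent the ensemble weight is nonnegative, so that the norm recovers it as a real function.\<close>

definition real_weight :: "real \<Rightarrow> 'i set \<Rightarrow> real \<Rightarrow> ('i \<Rightarrow> real) \<Rightarrow> real" where
  "real_weight \<gamma> I x l = norm (ens_weight \<gamma> I (of_real x) l)"

lemma ens_weight_of_real: "ens_weight \<gamma> I (of_real x) l = of_real (real_weight \<gamma> I x l)"
proof -
  have "power_weight r (of_real x) t = of_real (norm (power_weight r (of_real x) t))" for t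
  proof -
    have "of_real t powr (of_real x - 1) = (of_real (t powr (x - 1)) :: complex)" if "0 < t"
      using that powr_of_real[of t "x - 1"] by simp
    then show ?thesis using r_nonneg[of t] by (auto simp: power_weight_def norm_mult norm_of_real_powr)
  qed
  then have "(\<Prod>i\<in>I. power_weight r (of_real x) (l i)) = (\<Prod>i\<in>I. of_real (norm (power_weight r (of_real x) (l i))))"
    by (intro prod.cong refl)
  also have "\<dots> = of_real (norm (\<Prod>i\<in>I. power_weight r (of_real x) (l i)))"
    by (simp only: of_real_prod prod_norm[symmetric])
  finally show ?thesis
    unfolding real_weight_def ens_weight_def norm_mult by (simp add: disc_pow_nonneg)
qed

lemma integrable_real_weight:
  "finite I \<Longrightarrow> 0 < \<gamma> \<Longrightarrow> 0 < x \<Longrightarrow> integrable (Pi\<^sub>M I (\<lambda>_. lborel)) (real_weight \<gamma> I x)"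
  unfolding real_weight_def[abs_def] by (intro integrable_norm integrable_ens_weight) auto

lemma selberg_of_real: "selberg \<gamma> I (of_real x) = of_real (LINT l|Pi\<^sub>M I (\<lambda>_. lborel). real_weight \<gamma> I x l)"
  unfolding selberg_def ens_weight_of_real by (rule integral_complex_of_real)

lemma real_weight_nonneg: "0 \<le> real_weight \<gamma> I x l"
  by (simp add: real_weight_def)

lemma real_weight_pos:
  assumes "finite I" "inj_on l I" "\<And>i. i \<in> I \<Longrightarrow> 0 < l i \<and> 0 < r (l i)"
  shows "0 < real_weight \<gamma> I x l"
proof -
  have "power_weight r (of_real x) (l i) \<noteq> 0" if "i \<in> I" for i
    using assms(3)[OF that] by (auto simp: power_weight_def)
  moreover have "\<bar>l i - l j\<bar> powr \<gamma> \<noteq> 0" if "i \<in> I" "j \<in> I - {i}" for i j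
    using assms(2) that by (auto simp: inj_on_def)
  ultimately have "ens_weight \<gamma> I (of_real x) l \<noteq> 0"
    using assms(1) unfolding ens_weight_def disc_pow_def
    by (simp add: prod_zero_iff)
  then show ?thesis by (simp add: real_weight_def)
qed

text \<open>The weight is positive on a box whose sides are disjoint short intervals near \<open>0\<close>, one for every particle.\<close>

lemma integral_real_weight_pos:
  assumes "finite I" "0 < \<gamma>" "0 < x"
  shows "0 < (LINT l|Pi\<^sub>M I (\<lambda>_. lborel). real_weight \<gamma> I x l)"
proof (rule ccontr)
  let ?M = "Pi\<^sub>M I (\<lambda>_. lborel :: real measure)"
  assume "\<not> 0 < (LINT l|?M. real_weight \<gamma> I x l)"
  moreover have "0 \<le> (LINT l|?M. real_weight \<gamma> I x l)"
    by (intro Bochner_Integration.integral_nonneg real_weight_nonneg)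
  ultimately have "(LINT l|?M. real_weight \<gamma> I x l) = 0" by simp
  then have AE: "AE l in ?M. real_weight \<gamma> I x l = 0"
    by (rule integral_nonneg_eq_0_iff_AE[OF integrable_real_weight[OF assms] AE_I2[OF real_weight_nonneg], THEN iffD1])
  obtain d where d: "0 < d" "\<And>t. 0 < t \<Longrightarrow> t < d \<Longrightarrow> 0 < r t" using r_pos by auto
  define n where "n = card I"
  obtain e where e: "bij_betw e I {0..<n}" using ex_bij_betw_finite_nat[OF assms(1)] n_def by auto
  define c where "c = d / real (n + 1)"
  have c: "0 < c" unfolding c_def using d by simp
  \<comment> \<open>The upper half of every cell is left out, which keeps the intervals apart.\<close>
  define A where "A = (\<lambda>i. {real (e i) * c<..<(real (e i) + 1/2) * c})"
  have "real_weight \<gamma> I x l \<noteq> 0" if l: "l \<in> Pi\<^sub>E I A" for l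
  proof -
    have lA: "real (e i) * c < l i" "l i < (real (e i) + 1/2) * c" if "i \<in> I" for i
      using l that by (auto simp: A_def PiE_def Pi_def)
    have "inj_on l I"
    proof (rule inj_onI)
      fix i j assume ij: "i \<in> I" "j \<in> I" "l i = l j"
      have "real (e i) * c < (real (e j) + 1/2) * c" "real (e j) * c < (real (e i) + 1/2) * c"
        using lA[of i] lA[of j] ij by auto
      then have "real (e i) < real (e j) + 1/2" "real (e j) < real (e i) + 1/2" using c by auto
      then have "e i = e j" by linarith
      then show "i = j" using e ij by (auto simp: bij_betw_def inj_on_def)
    qed
    moreover have "0 < l i \<and> 0 < r (l i)" if "i \<in> I" for i
    proof -
      have "e i < n" using e that by (auto simp: bij_betw_def)
      then have "(real (e i) + 1/2) * c < real (n + 1) * c" using c by (intro mult_strict_right_mono) auto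
      also have "\<dots> = d" unfolding c_def by simp
      finally have "l i < d" using lA[OF that] by simp
      moreover have "0 < l i" using lA(1)[OF that] c by (intro le_less_trans[OF _ lA(1)[OF that]]) auto
      ultimately show ?thesis using d by auto
    qed
    ultimately have "0 < real_weight \<gamma> I x l" by (intro real_weight_pos assms) auto
    then show ?thesis by simp
  qed
  then have "AE l in ?M. l \<notin> Pi\<^sub>E I A" using AE by (auto elim!: eventually_mono)
  moreover have "Pi\<^sub>E I A \<in> sets ?M" using assms by (intro sets_PiM_I_finite) (auto simp: A_def)
  moreover have "{l \<in> space ?M. \<not> l \<notin> Pi\<^sub>E I A} = Pi\<^sub>E I A" by (auto simp: space_PiM PiE_def)
  ultimately have "emeasure ?M (Pi\<^sub>E I A) = 0"
    using AE_iff_measurable[of "Pi\<^sub>E I A" ?M "\<lambda>l. l \<notin> Pi\<^sub>E I A"] by blast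
  moreover have "emeasure ?M (Pi\<^sub>E I A) = (\<Prod>i\<in>I. emeasure lborel (A i))"
    using assms by (intro lborel_emeasure_PiM) (auto simp: A_def)
  moreover have "emeasure lborel (A i) \<noteq> 0" for i
    unfolding A_def using c by (auto simp: algebra_simps ennreal_eq_0_iff)
  ultimately show False using assms by (simp add: prod_zero_iff)
qed

lemma selberg_nonzero: "finite I \<Longrightarrow> 0 < \<gamma> \<Longrightarrow> 0 < x \<Longrightarrow> selberg \<gamma> I (of_real x) \<noteq> 0"
  using integral_real_weight_pos[of I \<gamma> x] by (simp add: selberg_of_real)

text \<open>Write \<open>y\<close> for the product of the particles divided by \<open>\<rho>\<close>. The two integrals differ by that of \<open>y powr w - 1\<close>, which is
controlled by \<open>\<bar>y - 1\<bar>\<close>, and the bound on the right combines the first two moments of \<open>y\<close>, expressed by shifting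
the exponent: it is small if both are close to \<open>1\<close>. The parameter \<open>\<epsilon>\<close> comes from
\<open>2 \<bar>y - 1\<bar> \<le> \<epsilon> + (y - 1)\<^sup>2 / \<epsilon>\<close> and replaces the Cauchy-Schwarz inequality.\<close>

lemma selberg_concentration:
  assumes "finite I" "0 < \<gamma>" "0 < x" "0 \<le> Re w" "Re w \<le> 1" "0 < \<rho>" "0 < \<epsilon>"
  defines "S \<equiv> \<lambda>x. LINT l|Pi\<^sub>M I (\<lambda>_. lborel). real_weight \<gamma> I x l"
  shows "norm (selberg \<gamma> I (of_real x + w) / of_real \<rho> powr w - of_real (S x)) \<le>
    (2 * norm w + 4) * ((\<epsilon> * S x + (S (x + 2) / \<rho>\<^sup>2 - 2 * (S (x + 1) / \<rho>) + S x) / \<epsilon>) / 2)"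
proof -
  let ?M = "Pi\<^sub>M I (\<lambda>_. lborel :: real measure)"
  let ?K = "2 * norm w + 4"
  let ?v = "real_weight \<gamma> I"
  have int: "integrable ?M (ens_weight \<gamma> I (of_real x + w))" "integrable ?M (\<lambda>l. complex_of_real (?v x l))"
    using assms by (auto intro!: integrable_ens_weight integrable_of_real integrable_real_weight)
  have intv: "integrable ?M (?v x)" "integrable ?M (?v (x + 1))" "integrable ?M (?v (x + 2))"
    using assms by (auto intro!: integrable_real_weight)
  define B where "B = (\<lambda>l. ?K * ((\<epsilon> * ?v x l + (?v (x + 2) l / \<rho>\<^sup>2 - 2 * (?v (x + 1) l / \<rho>) + ?v x l) / \<epsilon>) / 2))"
  have intB: "integrable ?M B" unfolding B_def using intv
    by (intro integrable_mult_right integrable_divide Bochner_Integration.integrable_add Bochner_Integration.integrable_diff) auto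
  have bound: "norm (ens_weight \<gamma> I (of_real x + w) l / of_real \<rho> powr w - of_real (?v x l)) \<le> B l" for l
  proof (cases "\<forall>i\<in>I. 0 < l i")
    case True
    define p where "p = (\<Prod>i\<in>I. l i)"
    define y where "y = p / \<rho>"
    have p: "0 < p" unfolding p_def using True by (intro prod_pos) auto
    have y: "0 \<le> y" unfolding y_def using p assms by simp
    have w: "ens_weight \<gamma> I (of_real x + w) l = of_real p powr w * of_real (?v x l)"
      unfolding ens_weight_of_real[symmetric] p_def using True by (intro ens_weight_add assms) auto
    have v1: "?v (x + 1) l = p * ?v x l"
      using ens_weight_add[OF assms(1), of l \<gamma> "of_real x" 1] True p
      by (simp add: real_weight_def norm_mult p_def flip: of_real_prod)
    have v2: "?v (x + 2) l = p * (p * ?v x l)"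
    proof -
      have e: "complex_of_real (x + 2) = of_real (x + 1) + 1" by simp
      have "ens_weight \<gamma> I (of_real (x + 2)) l = of_real p powr 1 * ens_weight \<gamma> I (of_real (x + 1)) l"
        unfolding e p_def using True by (intro ens_weight_add assms) auto
      then show ?thesis using v1 p by (simp only: real_weight_def norm_mult) simp
    qed
    have "of_real p powr w = (of_real y powr w * of_real \<rho> powr w :: complex)"
      using powr_times_real[of y \<rho> w] y assms(6) by (simp add: y_def)
    then have "ens_weight \<gamma> I (of_real x + w) l / of_real \<rho> powr w - of_real (?v x l) =
        (of_real y powr w - 1) * of_real (?v x l)"
      unfolding w using assms(6) by (simp add: algebra_simps)
    then have "norm (ens_weight \<gamma> I (of_real x + w) l / of_real \<rho> powr w - of_real (?v x l)) =
        norm (of_real y powr w - 1) * ?v x l"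
      by (simp only: norm_mult norm_of_real abs_of_nonneg[OF real_weight_nonneg])
    also have "\<dots> \<le> (?K * \<bar>y - 1\<bar>) * ?v x l"
      by (intro mult_right_mono norm_powr_minus_one_le y assms real_weight_nonneg)
    also have "\<dots> \<le> (?K * ((\<epsilon> + (y - 1)\<^sup>2 / \<epsilon>) / 2)) * ?v x l"
    proof (intro mult_right_mono mult_left_mono real_weight_nonneg)
      have "0 \<le> (\<bar>y - 1\<bar> - \<epsilon>)\<^sup>2" by simp
      then have "2 * \<bar>y - 1\<bar> * \<epsilon> \<le> \<epsilon> * \<epsilon> + (y - 1)\<^sup>2" by (simp add: power2_eq_square algebra_simps abs_mult_self_eq)
      then show "\<bar>y - 1\<bar> \<le> (\<epsilon> + (y - 1)\<^sup>2 / \<epsilon>) / 2"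
        using assms(7) by (simp add: field_simps power2_eq_square)
    qed simp
    also have "\<dots> = B l"
      unfolding B_def v1 v2 y_def using assms(6,7)
      by (simp add: power2_eq_square field_simps)
    finally show ?thesis .
  next
    case False
    then obtain i where i: "i \<in> I" "l i \<le> 0" by (auto simp: not_less)
    have "ens_weight \<gamma> I s l = 0" for s by (rule ens_weight_eq_0[where i = i]) (use assms(1) i in auto)
    then show ?thesis by (simp add: B_def real_weight_def)
  qed
  have "selberg \<gamma> I (of_real x + w) / of_real \<rho> powr w - of_real (S x) =
      (LINT l|?M. ens_weight \<gamma> I (of_real x + w) l / of_real \<rho> powr w - of_real (?v x l))"
    unfolding selberg_def S_def using int
    by (subst Bochner_Integration.integral_diff) (auto simp: integral_complex_of_real)
  also have "norm \<dots> \<le> (LINT l|?M. B l)"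
  proof (rule order_trans[OF integral_norm_bound integral_mono])
    show "integrable ?M (\<lambda>l. norm (ens_weight \<gamma> I (of_real x + w) l / of_real \<rho> powr w - of_real (?v x l)))"
      using int by (intro integrable_norm Bochner_Integration.integrable_diff integrable_divide) auto
  qed (use intB bound in auto)
  also have "\<dots> = ?K * ((\<epsilon> * S x + (S (x + 2) / \<rho>\<^sup>2 - 2 * (S (x + 1) / \<rho>) + S x) / \<epsilon>) / 2)"
    unfolding B_def S_def using intv by (simp add: Bochner_Integration.integral_add Bochner_Integration.integral_diff)
  finally show ?thesis .
qed

text \<open>The determinant divided by \<open>\<rho> N\<close> has, under the ensemble with exponent \<open>x + N + 1\<close>, a mean and a second moment
tending to \<open>1\<close>, both being products of shift ratios. So it tends to \<open>1\<close> in mean square and its power \<open>w\<close> has a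
mean tending to \<open>1\<close>.\<close>

lemma selberg_shift_LIMSEQ:
  assumes I: "finite I" "0 < \<gamma>" and xw: "0 < x" "0 \<le> Re w" "Re w \<le> 1"
    and \<rho>: "\<And>N. 0 < \<rho> N"
    and lim: "\<And>x. 0 < x \<Longrightarrow> (\<lambda>N. shift_ratio \<gamma> (card I) (of_real x + of_nat (Suc N)) / of_real (\<rho> N)) \<longlonglongrightarrow> 1"
  shows "(\<lambda>N. selberg \<gamma> I (of_real x + w + of_nat (Suc N)) /
     (selberg \<gamma> I (of_real x + of_nat (Suc N)) * of_real (\<rho> N) powr w)) \<longlonglongrightarrow> 1"
proof -
  define S where "S = (\<lambda>x. LINT l|Pi\<^sub>M I (\<lambda>_. lborel). real_weight \<gamma> I x l)"
  define X where "X = (\<lambda>N. x + real (Suc N))"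
  have X: "0 < X N" for N using xw by (simp add: X_def)
  have Spos: "0 < S x" if "0 < x" for x unfolding S_def using I that by (rule integral_real_weight_pos)
  have sel: "selberg \<gamma> I (of_real x) = of_real (S x)" for x unfolding S_def by (rule selberg_of_real)
  define R where "R = (\<lambda>x. S (x + 1) / S x)"
  have shift: "shift_ratio \<gamma> (card I) (of_real x) = of_real (R x)" if "0 < x" for x
    using selberg_plus_one[OF I, of "of_real x"] that Spos[OF that] sel[of "x + 1"] sel[of x]
    by (simp add: R_def field_simps)
  have limR: "(\<lambda>N. R (x + real (Suc N)) / \<rho> N) \<longlonglongrightarrow> 1" if "0 < x" for x
  proof -
    have "shift_ratio \<gamma> (card I) (of_real x + of_nat (Suc N)) = of_real (R (x + real (Suc N)))" for N
      using shift[of "x + real (Suc N)"] that by simp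
    then have "(\<lambda>N. complex_of_real (R (x + real (Suc N)) / \<rho> N)) \<longlonglongrightarrow> of_real 1"
      using lim[OF that] by simp
    then show ?thesis by (simp only: tendsto_of_real_iff)
  qed
  define V where "V = (\<lambda>N. R (X N) / \<rho> N * (R (X N + 1) / \<rho> N) - 2 * (R (X N) / \<rho> N) + 1)"
  have "(\<lambda>N. R (X N) / \<rho> N) \<longlonglongrightarrow> 1" unfolding X_def by (rule limR) fact
  moreover have "(\<lambda>N. R (X N + 1) / \<rho> N) \<longlonglongrightarrow> 1"
    using limR[of "x + 1"] xw by (simp add: X_def add_ac)
  ultimately have "V \<longlonglongrightarrow> 1 * 1 - 2 * 1 + 1"
    unfolding V_def by (intro tendsto_add tendsto_diff tendsto_mult tendsto_const)
  then have V0: "V \<longlonglongrightarrow> 0" by simp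
  \<comment> \<open>\<open>V N\<close> is the mean square deviation of the rescaled determinant from \<open>1\<close>. The optimal \<open>\<epsilon>\<close> is its square root; the second summand keeps it positive.\<close>
  define e where "e = (\<lambda>N. sqrt \<bar>V N\<bar> + 1 / real (Suc N))"
  have e: "0 < e N" for N unfolding e_def by (intro add_nonneg_pos) auto
  have bound: "norm (selberg \<gamma> I (of_real x + w + of_nat (Suc N)) / (selberg \<gamma> I (of_real x + of_nat (Suc N)) * of_real (\<rho> N) powr w) - 1)
      \<le> (2 * norm w + 4) * ((e N + sqrt \<bar>V N\<bar>) / 2)" for N
  proof -
    have S0: "0 < S (X N)" "0 < S (X N + 1)" using X[of N] by (auto intro!: Spos)
    have eq1: "of_real x + w + of_nat (Suc N) = of_real (X N) + w" "of_real x + of_nat (Suc N) = complex_of_real (X N)"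
      by (auto simp: X_def)
    have "norm (selberg \<gamma> I (of_real (X N) + w) / (of_real (S (X N)) * of_real (\<rho> N) powr w) - 1) * S (X N) =
      norm ((selberg \<gamma> I (of_real (X N) + w) / (of_real (S (X N)) * of_real (\<rho> N) powr w) - 1) * of_real (S (X N)))"
      using S0 by (simp add: norm_mult)
    also have "(selberg \<gamma> I (of_real (X N) + w) / (of_real (S (X N)) * of_real (\<rho> N) powr w) - 1) * of_real (S (X N)) =
        selberg \<gamma> I (of_real (X N) + w) / of_real (\<rho> N) powr w - of_real (S (X N))"
      using S0 by (simp add: algebra_simps)
    also have "norm \<dots> \<le> (2 * norm w + 4) * ((e N * S (X N) +
        (S (X N + 2) / (\<rho> N)\<^sup>2 - 2 * (S (X N + 1) / \<rho> N) + S (X N)) / e N) / 2)"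
      unfolding S_def by (rule selberg_concentration[OF I X xw(2,3) \<rho> e])
    also have "S (X N + 2) / (\<rho> N)\<^sup>2 - 2 * (S (X N + 1) / \<rho> N) + S (X N) = S (X N) * V N"
      unfolding V_def R_def using S0 by (simp add: power2_eq_square add.assoc algebra_simps)
    also have "(2 * norm w + 4) * ((e N * S (X N) + S (X N) * V N / e N) / 2) =
        ((2 * norm w + 4) * ((e N + V N / e N) / 2)) * S (X N)"
      by (simp add: algebra_simps)
    also have "\<dots> \<le> ((2 * norm w + 4) * ((e N + sqrt \<bar>V N\<bar>) / 2)) * S (X N)"
    proof (intro mult_right_mono mult_left_mono divide_right_mono add_left_mono)
      have "V N \<le> sqrt \<bar>V N\<bar> * sqrt \<bar>V N\<bar>" by simp
      also have "\<dots> \<le> sqrt \<bar>V N\<bar> * e N" unfolding e_def by (intro mult_left_mono) auto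
      finally show "V N / e N \<le> sqrt \<bar>V N\<bar>" using e[of N] by (simp add: divide_le_eq)
    qed (use S0 in auto)
    finally have "norm (selberg \<gamma> I (of_real (X N) + w) / (of_real (S (X N)) * of_real (\<rho> N) powr w) - 1) \<le>
       (2 * norm w + 4) * ((e N + sqrt \<bar>V N\<bar>) / 2)"
      using S0(1) by (rule mult_right_le_imp_le)
    then show ?thesis unfolding eq1 sel .
  qed
  have "(\<lambda>N. (2 * norm w + 4) * ((e N + sqrt \<bar>V N\<bar>) / 2)) \<longlonglongrightarrow> (2 * norm w + 4) * (((sqrt \<bar>0\<bar> + 0) + sqrt \<bar>0\<bar>) / 2)"
  proof -
    have "(\<lambda>N. 1 / real (Suc N)) \<longlonglongrightarrow> 0"
      using LIMSEQ_inverse_real_of_nat by (simp add: inverse_eq_divide)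
    then show ?thesis unfolding e_def by (intro tendsto_mult tendsto_divide tendsto_add tendsto_const tendsto_real_sqrt tendsto_rabs V0) simp_all
  qed
  then have lim0: "(\<lambda>N. (2 * norm w + 4) * ((e N + sqrt \<bar>V N\<bar>) / 2)) \<longlonglongrightarrow> 0" by simp
  have "(\<lambda>N. selberg \<gamma> I (of_real x + w + of_nat (Suc N)) / (selberg \<gamma> I (of_real x + of_nat (Suc N)) * of_real (\<rho> N) powr w) - 1) \<longlonglongrightarrow> 0"
    by (rule Lim_null_comparison[OF _ lim0]) (rule always_eventually, rule allI, rule bound)
  then show ?thesis by (simp add: LIM_zero_iff)
qed

text \<open>A substitute for Carlson's theorem. The quotient \<open>H\<close> of the Selberg integral by \<open>G\<close> has period \<open>1\<close>. As both
functions grow by the same factor \<open>\<rho> N powr w\<close> between \<open>x + N + 1\<close> and \<open>x + w + N + 1\<close>, periodicity carries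
\<open>H (x + w) = H x\<close> back from infinity, for all \<open>w\<close> in the closed strip of width \<open>1\<close>.\<close>

theorem selberg_eq:
  fixes G :: "complex \<Rightarrow> complex"
  assumes I: "finite I" "0 < \<gamma>"
    and G: "\<And>s. 0 < Re s \<Longrightarrow> G (s + 1) = shift_ratio \<gamma> (card I) s * G s" "\<And>s. 0 < Re s \<Longrightarrow> G s \<noteq> 0"
    and \<rho>: "\<And>N. 0 < \<rho> N"
    and limG: "\<And>x w. 0 < x \<Longrightarrow> 0 \<le> Re w \<Longrightarrow> Re w \<le> 1 \<Longrightarrow>
      (\<lambda>N. G (of_real x + w + of_nat (Suc N)) / (G (of_real x + of_nat (Suc N)) * of_real (\<rho> N) powr w)) \<longlonglongrightarrow> 1"
    and s: "0 < Re s"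
  shows "selberg \<gamma> I s / G s = selberg \<gamma> I 1 / G 1"
proof -
  define H where "H = (\<lambda>s. selberg \<gamma> I s / G s)"
  have H1: "H (s + 1) = H s" if "0 < Re s" for s
  proof -
    have "G (s + 1) \<noteq> 0" using that by (intro G) auto
    then have "shift_ratio \<gamma> (card I) s \<noteq> 0" using G(1)[OF that] by auto
    then show ?thesis unfolding H_def G(1)[OF that] selberg_plus_one[OF I that] by simp
  qed
  have HN: "H (s + of_nat N) = H s" if "0 < Re s" for s N
  proof (induction N)
    case (Suc N)
    have "H (s + of_nat N + 1) = H (s + of_nat N)" using that by (intro H1) auto
    then show ?case using Suc by (simp add: add_ac)
  qed simp
  have lim: "(\<lambda>N. shift_ratio \<gamma> (card I) (of_real x + of_nat (Suc N)) / of_real (\<rho> N)) \<longlonglongrightarrow> 1" if "0 < x" for x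
  proof -
    have "G (of_real x + 1 + of_nat (Suc N)) / (G (of_real x + of_nat (Suc N)) * of_real (\<rho> N) powr 1) =
        shift_ratio \<gamma> (card I) (of_real x + of_nat (Suc N)) / of_real (\<rho> N)" for N
    proof -
      have pos: "0 < Re (of_real x + of_nat (Suc N))" using that by simp
      have "G (of_real x + 1 + of_nat (Suc N)) = G (of_real x + of_nat (Suc N) + 1)" by (simp add: add_ac)
      then show ?thesis using G(1)[OF pos] G(2)[OF pos] \<rho>[of N] by simp
    qed
    then show ?thesis using limG[OF that, of 1] by (simp only:) simp
  qed
  have Hw: "H (of_real x + w) = H (of_real x)" if xw: "0 < x" "0 \<le> Re w" "Re w \<le> 1" for x w
  proof -
    let ?A = "\<lambda>f N. f (of_real x + w + of_nat (Suc N)) / (f (of_real x + of_nat (Suc N)) * of_real (\<rho> N) powr w)"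
    have "(\<lambda>N. ?A (selberg \<gamma> I) N / ?A G N) \<longlonglongrightarrow> 1 / 1"
      by (intro tendsto_divide selberg_shift_LIMSEQ[OF I xw \<rho> lim] limG[OF xw]) auto
    moreover have "?A (selberg \<gamma> I) N / ?A G N = H (of_real x + w) / H (of_real x)" for N
    proof -
      have "?A (selberg \<gamma> I) N / ?A G N = H (of_real x + w + of_nat (Suc N)) / H (of_real x + of_nat (Suc N))"
        unfolding H_def using \<rho>[of N] by simp
      then show ?thesis using HN[of "of_real x + w" "Suc N"] HN[of "of_real x" "Suc N"] xw by (simp only:) simp
    qed
    ultimately have "(\<lambda>N. H (of_real x + w) / H (of_real x)) \<longlonglongrightarrow> 1" by simp
    then have "H (of_real x + w) / H (of_real x) = 1" by (simp add: LIMSEQ_const_iff)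
    then show ?thesis by (simp split: if_splits)
  qed
  have big: "H s = H 1" if "1 \<le> Re s" for s
  proof -
    \<comment> \<open>The strip of width \<open>1\<close> to the right of the integer \<open>k\<close> contains \<open>s\<close>, and periodicity moves \<open>k\<close> to \<open>1\<close>.\<close>
    define k where "k = nat \<lfloor>Re s\<rfloor>"
    have k: "1 \<le> k" "real k \<le> Re s" "Re s \<le> real k + 1" unfolding k_def using that by linarith+
    have "H s = H (of_real (real k) + (s - of_nat k))" by simp
    also have "\<dots> = H (of_real (real k))" using k by (intro Hw) auto
    also have "of_real (real k) = 1 + of_nat (k - 1)" using k by (simp add: of_nat_diff)
    also have "H (1 + of_nat (k - 1)) = H 1" by (rule HN) simp
    finally show ?thesis .
  qed
  have "H s = H (s + 1)" using H1[OF s] by simp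
  also have "\<dots> = H 1" using s by (intro big) simp
  finally show ?thesis unfolding H_def .
qed

end

definition jacobi_Gamma :: "real \<Rightarrow> real \<Rightarrow> nat \<Rightarrow> complex \<Rightarrow> complex" where
  "jacobi_Gamma \<gamma> b n s =
     (\<Prod>k<n. Gamma (s + of_real (\<gamma> * real k)) / Gamma (s + of_real b + of_real (\<gamma> * (real n + real k - 1))))"

text \<open>Here the determinant itself concentrates at \<open>1\<close>, hence \<open>\<rho> = 1\<close>.\<close>

lemma jacobi_selberg:
  fixes I :: "'i set"
  assumes I: "finite I" "0 < \<gamma>" and b: "0 < b" and s: "0 < Re s"
  shows "pearson_family.selberg (jacobi_cofactor b) \<gamma> I s / jacobi_Gamma \<gamma> b (card I) s =
    pearson_family.selberg (jacobi_cofactor b) \<gamma> I 1 / jacobi_Gamma \<gamma> b (card I) 1"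
proof -
  interpret pearson_family "jacobi_cofactor b" 1 b by (rule jacobi_pearson_family) fact
  define n where "n = card I"
  have pos: "0 < Re (s + of_real (\<gamma> * real k))" "0 < Re (s + of_real b + of_real (\<gamma> * (real n + real k - 1)))"
    if "0 < Re s" "k < n" for s k
  proof -
    have "0 \<le> \<gamma> * (real n + real k - 1)" "0 \<le> \<gamma> * real k" using that I by auto
    then show "0 < Re (s + of_real (\<gamma> * real k))" "0 < Re (s + of_real b + of_real (\<gamma> * (real n + real k - 1)))"
      using that b by (auto simp del: of_real_mult)
  qed
  show ?thesis
  proof (rule selberg_eq[OF I _ _ _ _ s, where \<rho> = "\<lambda>_. 1"], unfold n_def[symmetric])
    fix s :: complex assume s: "0 < Re s"
    show "jacobi_Gamma \<gamma> b n s \<noteq> 0"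
      unfolding jacobi_Gamma_def prod_zero_iff[OF finite_lessThan]
      using Gamma_nonzero_right_half_plane[OF pos(1)[OF s]] Gamma_nonzero_right_half_plane[OF pos(2)[OF s]]
      by (auto simp only: divide_eq_0_iff lessThan_iff)
    show "jacobi_Gamma \<gamma> b n (s + 1) = shift_ratio \<gamma> n s * jacobi_Gamma \<gamma> b n s"
      unfolding jacobi_Gamma_def shift_ratio_def prod.distrib[symmetric]
    proof (rule prod.cong[OF refl])
      fix k assume k: "k \<in> {..<n}"
      have e: "s + 1 + of_real (\<gamma> * real k) = (s + of_real (\<gamma> * real k)) + 1"
        "s + 1 + of_real b + of_real (\<gamma> * (real n + real k - 1)) = (s + of_real b + of_real (\<gamma> * (real n + real k - 1))) + 1"
        by (auto simp: add_ac)
      have p: "0 < Re (s + of_real (\<gamma> * real k))" "0 < Re (s + of_real b + of_real (\<gamma> * (real n + real k - 1)))"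
        using pos[OF s] k by auto
      show "Gamma (s + 1 + of_real (\<gamma> * real k)) / Gamma (s + 1 + of_real b + of_real (\<gamma> * (real n + real k - 1))) =
        (s + of_real (\<gamma> * real k)) / (of_real 1 * s + of_real b + of_real (1 * \<gamma> * (real n + real k - 1))) *
        (Gamma (s + of_real (\<gamma> * real k)) / Gamma (s + of_real b + of_real (\<gamma> * (real n + real k - 1))))"
        unfolding e Gamma_plus_one_right_half_plane[OF p(1)] Gamma_plus_one_right_half_plane[OF p(2)]
        by (simp only: of_real_1 mult_1 times_divide_times_eq)
    qed
  next
    fix x :: real and w :: complex
    assume x: "0 < x" "0 \<le> Re w"
    let ?R = "\<lambda>z N. Gamma (z + w + of_nat (Suc N)) / (Gamma (z + of_nat (Suc N)) * exp (w * of_real (ln (real N))))"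
    let ?z = "\<lambda>k. of_real x + of_real (\<gamma> * real k) :: complex"
    let ?z' = "\<lambda>k. of_real x + of_real b + of_real (\<gamma> * (real n + real k - 1)) :: complex"
    have p: "0 < Re (?z k)" "0 < Re (?z' k)" if "k < n" for k using pos[of "of_real x" k] x that by auto
    have "(\<lambda>N. \<Prod>k<n. ?R (?z k) N / ?R (?z' k) N) \<longlonglongrightarrow> (\<Prod>k<n. 1 / 1)"
    proof (intro tendsto_prod tendsto_divide)
      fix k assume "k \<in> {..<n}"
      then have "0 < Re (?z k)" "0 < Re (?z' k)" using p by auto
      then show "(\<lambda>N. ?R (?z k) N) \<longlonglongrightarrow> 1" "(\<lambda>N. ?R (?z' k) N) \<longlonglongrightarrow> 1"
        using x by (intro Gamma_shift_ratio_LIMSEQ; simp del: of_real_mult)+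
    qed simp
    also have "(\<lambda>N. \<Prod>k<n. ?R (?z k) N / ?R (?z' k) N) =
      (\<lambda>N. jacobi_Gamma \<gamma> b n (of_real x + w + of_nat (Suc N)) / (jacobi_Gamma \<gamma> b n (of_real x + of_nat (Suc N)) * of_real 1 powr w))"
    proof
      fix N
      have "?R (?z k) N / ?R (?z' k) N =
        Gamma (of_real x + w + of_nat (Suc N) + of_real (\<gamma> * real k)) / Gamma (of_real x + w + of_nat (Suc N) + of_real b + of_real (\<gamma> * (real n + real k - 1))) /
         (Gamma (of_real x + of_nat (Suc N) + of_real (\<gamma> * real k)) / Gamma (of_real x + of_nat (Suc N) + of_real b + of_real (\<gamma> * (real n + real k - 1))))" for k
      proof -
        have c: "?z k + w + of_nat (Suc N) = of_real x + w + of_nat (Suc N) + of_real (\<gamma> * real k)"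
          "?z k + of_nat (Suc N) = of_real x + of_nat (Suc N) + of_real (\<gamma> * real k)"
          "?z' k + w + of_nat (Suc N) = of_real x + w + of_nat (Suc N) + of_real b + of_real (\<gamma> * (real n + real k - 1))"
          "?z' k + of_nat (Suc N) = of_real x + of_nat (Suc N) + of_real b + of_real (\<gamma> * (real n + real k - 1))"
          by (simp_all only: add_ac)
        show ?thesis unfolding c by (simp add: divide_simps del: of_nat_Suc)
      qed
      then show "(\<Prod>k<n. ?R (?z k) N / ?R (?z' k) N) =
       jacobi_Gamma \<gamma> b n (of_real x + w + of_nat (Suc N)) / (jacobi_Gamma \<gamma> b n (of_real x + of_nat (Suc N)) * of_real 1 powr w)"
        unfolding jacobi_Gamma_def by (simp only: prod_dividef of_real_1 powr_one_eq_one mult_1_right)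
    qed
    finally show "(\<lambda>N. jacobi_Gamma \<gamma> b n (of_real x + w + of_nat (Suc N)) / (jacobi_Gamma \<gamma> b n (of_real x + of_nat (Suc N)) * of_real 1 powr w)) \<longlonglongrightarrow> 1"
      by simp
  qed simp
qed

definition laguerre_Gamma :: "real \<Rightarrow> nat \<Rightarrow> complex \<Rightarrow> complex" where
  "laguerre_Gamma \<gamma> n s = (\<Prod>k<n. exp (s * of_real (ln 2)) * Gamma (s + of_real (\<gamma> * real k)))"

text \<open>The weight \<open>exp (- t / 2)\<close> makes every particle of size \<open>2 N\<close> at the exponent \<open>N\<close>, hence \<open>\<rho> N = (2 N)\<^sup>n\<close> for \<open>N \<ge> 1\<close>.\<close>

lemma laguerre_selberg:
  fixes I :: "'i set"
  assumes I: "finite I" "0 < \<gamma>" and s: "0 < Re s"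
  shows "pearson_family.selberg (\<lambda>t. exp (- t / 2)) \<gamma> I s / laguerre_Gamma \<gamma> (card I) s =
    pearson_family.selberg (\<lambda>t. exp (- t / 2)) \<gamma> I 1 / laguerre_Gamma \<gamma> (card I) 1"
proof -
  interpret pearson_family "\<lambda>t. exp (- t / 2)" 0 "1 / 2" by (rule laguerre_pearson_family)
  define n where "n = card I"
  have pos: "0 < Re (s + of_real (\<gamma> * real k))" if "0 < Re s" for s k
    using that I by (auto intro!: add_pos_nonneg)
  define \<rho> where "\<rho> = (\<lambda>N. exp (real n * (ln 2 + ln (real N))))"
  show ?thesis
  proof (rule selberg_eq[OF I _ _ _ _ s, where \<rho> = \<rho>], unfold n_def[symmetric])
    fix s :: complex assume s: "0 < Re s"
    show "laguerre_Gamma \<gamma> n s \<noteq> 0"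
      unfolding laguerre_Gamma_def prod_zero_iff[OF finite_lessThan]
      using Gamma_nonzero_right_half_plane[OF pos[OF s]] by (auto simp only: mult_eq_0_iff exp_not_eq_zero)
    show "laguerre_Gamma \<gamma> n (s + 1) = shift_ratio \<gamma> n s * laguerre_Gamma \<gamma> n s"
      unfolding laguerre_Gamma_def shift_ratio_def prod.distrib[symmetric]
    proof (rule prod.cong[OF refl])
      fix k assume k: "k \<in> {..<n}"
      have e: "s + 1 + of_real (\<gamma> * real k) = (s + of_real (\<gamma> * real k)) + 1" by (auto simp: add_ac)
      have "exp (of_real (ln 2)) = (2 :: complex)" by (simp add: exp_of_real)
      then have x: "exp ((s + 1) * of_real (ln 2)) = 2 * exp (s * of_real (ln 2) :: complex)"
        by (simp add: distrib_right exp_add)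
      show "exp ((s + 1) * of_real (ln 2)) * Gamma (s + 1 + of_real (\<gamma> * real k)) =
        (s + of_real (\<gamma> * real k)) / (of_real 0 * s + of_real (1 / 2) + of_real (0 * \<gamma> * (real n + real k - 1))) *
        (exp (s * of_real (ln 2)) * Gamma (s + of_real (\<gamma> * real k)))"
        unfolding e Gamma_plus_one_right_half_plane[OF pos[OF s]] x by simp
    qed
  next
    fix x :: real and w :: complex
    assume x: "0 < x" "0 \<le> Re w"
    let ?R = "\<lambda>z N. Gamma (z + w + of_nat (Suc N)) / (Gamma (z + of_nat (Suc N)) * exp (w * of_real (ln (real N))))"
    let ?z = "\<lambda>k. of_real x + of_real (\<gamma> * real k) :: complex"
    have "(\<lambda>N. \<Prod>k<n. ?R (?z k) N) \<longlonglongrightarrow> (\<Prod>k<n. 1)"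
    proof (intro tendsto_prod)
      fix k assume "k \<in> {..<n}"
      have "0 < Re (?z k)" using pos[of "of_real x" k] x by auto
      then show "(\<lambda>N. ?R (?z k) N) \<longlonglongrightarrow> 1"
        using x by (intro Gamma_shift_ratio_LIMSEQ; simp del: of_real_mult)
    qed
    also have "(\<lambda>N. \<Prod>k<n. ?R (?z k) N) =
      (\<lambda>N. laguerre_Gamma \<gamma> n (of_real x + w + of_nat (Suc N)) / (laguerre_Gamma \<gamma> n (of_real x + of_nat (Suc N)) * of_real (\<rho> N) powr w))"
    proof
      fix N
      have rho: "of_real (\<rho> N) powr w = (\<Prod>k<n. exp (w * of_real (ln 2)) * exp (w * of_real (ln (real N))))"
      proof -
        have "of_real (\<rho> N) powr w = exp (w * of_real (ln (\<rho> N)))"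
          using Ln_of_real[of "\<rho> N"] by (simp add: powr_def \<rho>_def)
        also have "\<dots> = exp (w * of_real (ln 2) + w * of_real (ln (real N))) ^ n"
          by (simp add: \<rho>_def algebra_simps flip: exp_of_nat_mult)
        finally show ?thesis by (simp add: exp_add)
      qed
      have "?R (?z k) N =
        exp ((of_real x + w + of_nat (Suc N)) * of_real (ln 2)) * Gamma (of_real x + w + of_nat (Suc N) + of_real (\<gamma> * real k)) /
         (exp ((of_real x + of_nat (Suc N)) * of_real (ln 2)) * Gamma (of_real x + of_nat (Suc N) + of_real (\<gamma> * real k)) *
         (exp (w * of_real (ln 2)) * exp (w * of_real (ln (real N)))))" for k
      proof -
        have c: "?z k + w + of_nat (Suc N) = of_real x + w + of_nat (Suc N) + of_real (\<gamma> * real k)"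
          "?z k + of_nat (Suc N) = of_real x + of_nat (Suc N) + of_real (\<gamma> * real k)"
          by (simp_all only: add_ac)
        have d: "exp ((of_real x + w + of_nat (Suc N)) * of_real (ln 2)) =
            exp ((of_real x + of_nat (Suc N)) * of_real (ln 2)) * exp (w * of_real (ln 2) :: complex)"
          by (simp only: exp_add[symmetric] distrib_right[symmetric] add_ac)
        show ?thesis unfolding c d by (simp del: of_nat_Suc)
      qed
      then show "(\<Prod>k<n. ?R (?z k) N) =
       laguerre_Gamma \<gamma> n (of_real x + w + of_nat (Suc N)) / (laguerre_Gamma \<gamma> n (of_real x + of_nat (Suc N)) * of_real (\<rho> N) powr w)"
        unfolding laguerre_Gamma_def rho prod.distrib[symmetric] prod_dividef[symmetric] by (simp only:)
    qed
    finally show "(\<lambda>N. laguerre_Gamma \<gamma> n (of_real x + w + of_nat (Suc N)) / (laguerre_Gamma \<gamma> n (of_real x + of_nat (Suc N)) * of_real (\<rho> N) powr w)) \<longlonglongrightarrow> 1"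
      by simp
  qed (simp add: \<rho>_def)
qed

section \<open>Mellin transforms of the determinants\<close>

lemma exp_ln_eq_powr: "0 < y \<Longrightarrow> exp (z * complex_of_real (ln y)) = of_real y powr z"
  by (simp add: powr_def Ln_of_real)

context pearson_family
begin

text \<open>Multiplying the weight with exponent \<open>a\<close> by the power \<open>z\<close> of the determinant gives the weight with exponent \<open>a + z\<close>.\<close>

lemma normalized_density_mellin:
  fixes I :: "'i set"
  assumes I: "finite I" "0 < \<gamma>" and a: "0 < a"
    and w: "\<And>l. w l = real_weight \<gamma> I a l"
  defines "N \<equiv> normalized_density (Pi\<^sub>M I (\<lambda>_. lborel)) w"
  shows "prob_space N" "sets N = sets (Pi\<^sub>M I (\<lambda>_. lborel))" "AE l in N. 0 < (\<Prod>i\<in>I. l i)"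
    "0 < a + Re z \<Longrightarrow> integrable N (\<lambda>l. exp (z * of_real (ln (\<Prod>i\<in>I. l i))))"
    "0 < a + Re z \<Longrightarrow> (LINT l|N. exp (z * of_real (ln (\<Prod>i\<in>I. l i)))) = selberg \<gamma> I (of_real a + z) / selberg \<gamma> I (of_real a)"
proof -
  let ?M = "Pi\<^sub>M I (\<lambda>_. lborel :: real measure)"
  define S where "S = (LINT l|?M. real_weight \<gamma> I a l)"
  have S: "0 < S" unfolding S_def by (rule integral_real_weight_pos[OF I a])
  have w_eq: "w = real_weight \<gamma> I a" using w by auto
  have [measurable]: "real_weight \<gamma> I a \<in> borel_measurable ?M"
    using integrable_real_weight[OF I a] by auto
  have [measurable]: "w \<in> borel_measurable ?M"
    unfolding w_eq using integrable_real_weight[OF I a] by auto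
  have nn: "(\<integral>\<^sup>+l. ennreal (w l) \<partial>?M) = ennreal S"
    unfolding S_def w_eq by (rule nn_integral_eq_integral[OF integrable_real_weight[OF I a]]) (simp add: real_weight_nonneg)
  have N: "N = density ?M (\<lambda>l. ennreal (w l / S))"
    unfolding N_def normalized_density_def nn
    by (simp add: divide_ennreal S w real_weight_nonneg)
  have [measurable]: "(\<lambda>l. \<Prod>i\<in>I. l i) \<in> borel_measurable ?M"
    by (rule borel_measurable_prod) (rule component_borel_measurable)
  show "sets N = sets ?M" unfolding N by simp
  show "prob_space N"
  proof
    have "emeasure N (space N) = (\<integral>\<^sup>+l. ennreal (w l / S) \<partial>?M)"
      unfolding N by (simp add: emeasure_density nn_integral_set_ennreal[symmetric] cong: nn_integral_cong)
    also have "\<dots> = (\<integral>\<^sup>+l. ennreal (w l) \<partial>?M) / ennreal S"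
      using S by (simp add: divide_ennreal[symmetric] w real_weight_nonneg nn_integral_divide)
    also have "\<dots> = 1" unfolding nn using S by (simp add: divide_ennreal)
    finally show "emeasure N (space N) = 1" .
  qed
  have w0: "w l = 0" if "i \<in> I" "l i \<le> 0" for l i
    using ens_weight_eq_0[where i = i and l = l] that I unfolding w real_weight_def by simp
  have pos: "0 < (\<Prod>i\<in>I. l i) \<and> (\<forall>i\<in>I. 0 < l i)" if "w l \<noteq> 0" for l
    using w0 that by (meson not_less prod_pos)
  show "AE l in N. 0 < (\<Prod>i\<in>I. l i)"
    unfolding N
  proof (subst AE_density)
    show "AE l in ?M. 0 < ennreal (w l / S) \<longrightarrow> 0 < (\<Prod>i\<in>I. l i)"
      using pos S by (intro AE_I2) (auto simp: zero_less_divide_iff)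
  qed measurable
  have eq: "(w l / S) *\<^sub>R exp (z * of_real (ln (\<Prod>i\<in>I. l i))) = ens_weight \<gamma> I (of_real a + z) l / of_real S" for l z
  proof (cases "\<forall>i\<in>I. 0 < l i")
    case True
    then have "0 < (\<Prod>i\<in>I. l i)" by (intro prod_pos) auto
    then have "exp (z * of_real (ln (\<Prod>i\<in>I. l i))) = of_real (\<Prod>i\<in>I. l i) powr z" by (rule exp_ln_eq_powr)
    then show ?thesis
      using ens_weight_add[OF I(1), of l \<gamma> "of_real a" z] True S
      by (simp add: w ens_weight_of_real scaleR_conv_of_real)
  next
    case False
    then obtain i where i: "i \<in> I" "l i \<le> 0" by (auto simp: not_less)
    have "ens_weight \<gamma> I (of_real a + z) l = 0"
      by (rule ens_weight_eq_0[where i = i]) (use i I in auto)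
    then show ?thesis using w0[of i l] i by simp
  qed
  have nonneg: "AE l in ?M. 0 \<le> w l / S" using S by (intro AE_I2) (simp add: w real_weight_nonneg)
  show "integrable N (\<lambda>l. exp (z * of_real (ln (\<Prod>i\<in>I. l i))))" if "0 < a + Re z" for z
  proof -
    have "integrable ?M (\<lambda>l. ens_weight \<gamma> I (of_real a + z) l / of_real S)"
      using that I by (intro integrable_divide integrable_ens_weight) auto
    then show ?thesis unfolding N using nonneg
      by (subst integrable_density) (simp_all only: eq, measurable)
  qed
  show "(LINT l|N. exp (z * of_real (ln (\<Prod>i\<in>I. l i)))) = selberg \<gamma> I (of_real a + z) / selberg \<gamma> I (of_real a)"
    if "0 < a + Re z" for z
  proof -
    have "(LINT l|N. exp (z * of_real (ln (\<Prod>i\<in>I. l i)))) = (LINT l|?M. ens_weight \<gamma> I (of_real a + z) l / of_real S)"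
      unfolding N using nonneg by (subst integral_density) (simp_all only: eq, measurable)
    also have "\<dots> = selberg \<gamma> I (of_real a + z) / of_real S"
      unfolding selberg_def by (rule integral_divide_zero)
    finally show ?thesis unfolding selberg_of_real S_def .
  qed
qed

end

lemma vandermonde_powr: "vandermonde_abs n l powr \<beta> = disc_pow (\<beta> / 2) {1..n} l"
proof -
  have "vandermonde_abs n l powr \<beta> = (\<Prod>k\<in>{1..n}. \<Prod>j\<in>{1..<k}. \<bar>l k - l j\<bar> powr \<beta>)"
    unfolding vandermonde_abs_def by (subst prod_powr_distrib) (auto simp: prod_powr_distrib prod_nonneg)
  also have "\<dots> = disc_pow (\<beta> / 2) {1..n} l"
  proof (induction n)
    case (Suc n)
    have e: "{1..Suc n} = insert (Suc n) {1..n}" by auto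
    show ?case unfolding e using Suc disc_pow_insert[of "{1..n}" "Suc n" "\<beta> / 2" l]
      by (simp add: atLeastLessThanSuc_atLeastAtMost)
  qed (simp add: disc_pow_def)
  finally show ?thesis .
qed

lemma laguerre_weight_eq:
  "laguerre_weight \<beta> n l = pearson_family.real_weight (\<lambda>t. exp (- t / 2)) (\<beta> / 2) {1..n} (\<beta> / 2) l"
proof -
  interpret pearson_family "\<lambda>t. exp (- t / 2)" 0 "1 / 2" by (rule laguerre_pearson_family)
  show ?thesis
  proof (cases "\<forall>k\<in>{1..n}. 0 < l k")
    case True
    then have "(\<Prod>k\<in>{1..n}. norm (power_weight (\<lambda>t. exp (- t / 2)) (of_real (\<beta> / 2)) (l k))) =
        (\<Prod>k\<in>{1..n}. l k powr (\<beta> / 2 - 1) * exp (- l k / 2))"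
    proof (intro prod.cong refl)
      fix k assume "k \<in> {1..n}"
      then have "0 < l k" using True by blast
      then show "norm (power_weight (\<lambda>t. exp (- t / 2)) (of_real (\<beta> / 2)) (l k)) = l k powr (\<beta> / 2 - 1) * exp (- l k / 2)"
        unfolding norm_power_weight by simp
    qed
    then show ?thesis
      unfolding laguerre_weight_def real_weight_def ens_weight_def norm_mult prod_norm[symmetric] vandermonde_powr
      using True by (simp add: disc_pow_nonneg mult.commute)
  next
    case False
    then obtain k where k: "k \<in> {1..n}" "l k \<le> 0" by (auto simp: not_less)
    have "ens_weight (\<beta> / 2) {1..n} (of_real (\<beta> / 2)) l = 0"
      by (rule ens_weight_eq_0[where i = k]) (use k in auto)
    then show ?thesis unfolding laguerre_weight_def real_weight_def using False by (simp only: if_False norm_zero)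
  qed
qed

lemma jacobi_weight_eq:
  assumes "0 < \<beta>" "m \<le> M"
  shows "jacobi_weight \<beta> m M l =
    pearson_family.real_weight (jacobi_cofactor (\<beta> / 2 * (real M - real m + 1))) (\<beta> / 2) {1..m} (\<beta> / 2) l"
proof -
  define b where "b = \<beta> / 2 * (real M - real m + 1)"
  have b: "0 < b" unfolding b_def using assms by (intro mult_pos_pos) auto
  interpret pearson_family "jacobi_cofactor b" 1 b by (rule jacobi_pearson_family) fact
  have "jacobi_weight \<beta> m M l = real_weight (\<beta> / 2) {1..m} (\<beta> / 2) l"
  proof (cases "\<forall>k\<in>{1..m}. 0 < l k \<and> l k < 1")
    case True
    then have "(\<Prod>k\<in>{1..m}. norm (power_weight (jacobi_cofactor b) (of_real (\<beta> / 2)) (l k))) =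
        (\<Prod>k\<in>{1..m}. l k powr (\<beta> / 2 - 1) * (1 - l k) powr (b - 1))"
      by (intro prod.cong refl) (auto simp: norm_power_weight jacobi_cofactor_def)
    then show ?thesis
      unfolding jacobi_weight_def real_weight_def ens_weight_def norm_mult prod_norm[symmetric] vandermonde_powr b_def[symmetric]
      using True by (simp add: disc_pow_nonneg mult.commute)
  next
    case False
    then obtain k where k: "k \<in> {1..m}" "l k \<le> 0 \<or> 1 \<le> l k" by (auto simp: not_less)
    then have "power_weight (jacobi_cofactor b) (of_real (\<beta> / 2)) (l k) = 0"
      by (auto simp: power_weight_def jacobi_cofactor_def)
    then have "(\<Prod>i\<in>{1..m}. power_weight (jacobi_cofactor b) (of_real (\<beta> / 2)) (l i)) = 0"
      using k by (intro prod_zero) auto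
    then have "ens_weight (\<beta> / 2) {1..m} (of_real (\<beta> / 2)) l = 0"
      unfolding ens_weight_def by (simp only: mult_zero_left)
    then show ?thesis unfolding jacobi_weight_def real_weight_def using False by (simp only: if_False norm_zero)
  qed
  then show ?thesis unfolding b_def .
qed

text \<open>The power \<open>y\<^sup>z\<close> is written \<open>exp (z ln y)\<close>, which agrees with it because the law is concentrated on the positive
reals, and which is the form in which it meets the variable \<open>X\<close> of the theorem.\<close>

definition has_mellin :: "real measure \<Rightarrow> real \<Rightarrow> (complex \<Rightarrow> complex) \<Rightarrow> bool" where
  "has_mellin D a F \<longleftrightarrow> prob_space D \<and> sets D = sets borel \<and> (AE y in D. 0 < y) \<and>
     (\<forall>z. - a < Re z \<longrightarrow> integrable D (\<lambda>y. exp (z * of_real (ln y))) \<and> (LINT y|D. exp (z * of_real (ln y))) = F z)"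

lemma has_mellin_distr:
  assumes "prob_space N" and [measurable]: "X \<in> borel_measurable N" and "AE l in N. 0 < X l"
    and "\<And>z. - a < Re z \<Longrightarrow> integrable N (\<lambda>l. exp (z * of_real (ln (X l))))"
    and "\<And>z. - a < Re z \<Longrightarrow> (LINT l|N. exp (z * of_real (ln (X l)))) = F z"
  shows "has_mellin (distr N borel X) a F"
  unfolding has_mellin_def using assms
  by (auto simp: prob_space.prob_space_distr AE_distr_iff integrable_distr_eq integral_distr)

lemma product_measurable:
  assumes "sets N = sets (Pi\<^sub>M I (\<lambda>_. lborel :: real measure))"
  shows "(\<lambda>l. \<Prod>i\<in>I. l i) \<in> borel_measurable N"
  unfolding measurable_cong_sets[OF assms refl]
  by (rule borel_measurable_prod) (rule component_borel_measurable)

lemma laguerre_has_mellin: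
  assumes \<beta>: "0 < \<beta>"
  shows "has_mellin (distr (laguerre_ensemble \<beta> n) borel (\<lambda>l. \<Prod>k\<in>{1..n}. l k)) (\<beta> / 2)
    (\<lambda>z. laguerre_Gamma (\<beta> / 2) n (of_real (\<beta> / 2) + z) / laguerre_Gamma (\<beta> / 2) n (of_real (\<beta> / 2)))"
proof -
  interpret pearson_family "\<lambda>t. exp (- t / 2)" 0 "1 / 2" by (rule laguerre_pearson_family)
  have \<gamma>: "0 < \<beta> / 2" using \<beta> by simp
  note nd = normalized_density_mellin[OF finite_atLeastAtMost \<gamma> \<gamma> laguerre_weight_eq, folded laguerre_ensemble_def]
  show ?thesis
  proof (rule has_mellin_distr)
    fix z :: complex assume z: "- (\<beta> / 2) < Re z"
    then have pos: "0 < Re (of_real (\<beta> / 2) + z)" "0 < Re (of_real (\<beta> / 2) :: complex)" using \<beta> by auto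
    have nz: "selberg (\<beta> / 2) {1..n} (of_real (\<beta> / 2)) \<noteq> 0" using \<gamma> by (intro selberg_nonzero) auto
    have ex: "s1 / s2 = g1 / g2" if "s1 / g1 = c" "s2 / g2 = c" "s2 \<noteq> 0" "g1 \<noteq> 0" "g2 \<noteq> 0" for s1 s2 g1 g2 c :: complex
      using that by (auto simp: field_simps)
    have g: "laguerre_Gamma (\<beta> / 2) n s \<noteq> 0" if "0 < Re s" for s
      unfolding laguerre_Gamma_def using that \<gamma>
      by (auto simp: prod_zero_iff intro!: Gamma_nonzero_right_half_plane add_pos_nonneg)
    show "(LINT l|laguerre_ensemble \<beta> n. exp (z * of_real (ln (\<Prod>k\<in>{1..n}. l k)))) =
       laguerre_Gamma (\<beta> / 2) n (of_real (\<beta> / 2) + z) / laguerre_Gamma (\<beta> / 2) n (of_real (\<beta> / 2))"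
    proof -
      have "(LINT l|laguerre_ensemble \<beta> n. exp (z * of_real (ln (\<Prod>k\<in>{1..n}. l k)))) =
          selberg (\<beta> / 2) {1..n} (of_real (\<beta> / 2) + z) / selberg (\<beta> / 2) {1..n} (of_real (\<beta> / 2))"
        by (rule nd(5)) (use z in simp)
      also have "\<dots> = laguerre_Gamma (\<beta> / 2) n (of_real (\<beta> / 2) + z) / laguerre_Gamma (\<beta> / 2) n (of_real (\<beta> / 2))"
        using laguerre_selberg[of "{1..n}" "\<beta> / 2", OF finite_atLeastAtMost \<gamma> pos(1)]
          laguerre_selberg[of "{1..n}" "\<beta> / 2", OF finite_atLeastAtMost \<gamma> pos(2)] nz g[OF pos(1)] g[OF pos(2)]
        by (intro ex) simp_all
      finally show ?thesis .
    qed
    show "integrable (laguerre_ensemble \<beta> n) (\<lambda>l. exp (z * of_real (ln (\<Prod>k\<in>{1..n}. l k))))"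
      by (rule nd(4)) (use z in simp)
  qed (use nd(1-3) product_measurable[OF nd(2)] in auto)
qed

lemma jacobi_Gamma_nonzero:
  assumes "0 < \<gamma>" "0 < b" "0 < Re s"
  shows "jacobi_Gamma \<gamma> b n s \<noteq> 0"
  unfolding jacobi_Gamma_def prod_zero_iff[OF finite_lessThan] divide_eq_0_iff
proof (rule notI, elim bexE)
  fix k assume k: "k \<in> {..<n}"
    and "Gamma (s + of_real (\<gamma> * real k)) = 0 \<or> Gamma (s + of_real b + of_real (\<gamma> * (real n + real k - 1))) = 0"
  have p: "0 \<le> \<gamma> * (real n + real k - 1)" "0 \<le> \<gamma> * real k" using k assms by auto
  have "Gamma (s + of_real (\<gamma> * real k)) \<noteq> 0"
  proof (rule Gamma_nonzero_right_half_plane)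
    have "0 < Re s + \<gamma> * real k" using p(2) assms(3) by linarith
    then show "0 < Re (s + of_real (\<gamma> * real k))" by simp
  qed
  moreover have "Gamma (s + of_real b + of_real (\<gamma> * (real n + real k - 1))) \<noteq> 0"
  proof (rule Gamma_nonzero_right_half_plane)
    have "0 < Re s + b + \<gamma> * (real n + real k - 1)" using p(1) assms by linarith
    then show "0 < Re (s + of_real b + of_real (\<gamma> * (real n + real k - 1)))" by simp
  qed
  moreover note \<open>Gamma (s + of_real (\<gamma> * real k)) = 0 \<or> _\<close>
  ultimately show False by blast
qed

lemma jacobi_selberg_quotient:
  assumes I: "finite I" "0 < \<gamma>" and b: "0 < b" and a: "0 < a" "0 < a + Re z"
  shows "pearson_family.selberg (jacobi_cofactor b) \<gamma> I (of_real a + z) / pearson_family.selberg (jacobi_cofactor b) \<gamma> I (of_real a) =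
    jacobi_Gamma \<gamma> b (card I) (of_real a + z) / jacobi_Gamma \<gamma> b (card I) (of_real a)"
proof -
  interpret pearson_family "jacobi_cofactor b" 1 b by (rule jacobi_pearson_family) fact
  have pos: "0 < Re (of_real a + z)" "0 < Re (of_real a :: complex)" using a by auto
  have nz: "selberg \<gamma> I (of_real a) \<noteq> 0" using I a by (intro selberg_nonzero) auto
  have ex: "s1 / s2 = g1 / g2" if "s1 / g1 = c" "s2 / g2 = c" "s2 \<noteq> 0" "g1 \<noteq> 0" "g2 \<noteq> 0" for s1 s2 g1 g2 c :: complex
    using that by (auto simp: field_simps)
  show ?thesis
    by (rule ex[OF jacobi_selberg[OF I b pos(1)] jacobi_selberg[OF I b pos(2)] nz
      jacobi_Gamma_nonzero[OF I(2) b pos(1)] jacobi_Gamma_nonzero[OF I(2) b pos(2)]])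
qed

lemma jacobi_has_mellin:
  assumes \<beta>: "0 < \<beta>" and mM: "m \<le> M"
  defines "b \<equiv> \<beta> / 2 * (real M - real m + 1)"
  shows "has_mellin (distr (jacobi_ensemble \<beta> m M) borel (\<lambda>l. \<Prod>k\<in>{1..m}. l k)) (\<beta> / 2)
    (\<lambda>z. jacobi_Gamma (\<beta> / 2) b m (of_real (\<beta> / 2) + z) / jacobi_Gamma (\<beta> / 2) b m (of_real (\<beta> / 2)))"
proof -
  have b: "0 < b" unfolding b_def using assms by (intro mult_pos_pos) auto
  interpret pearson_family "jacobi_cofactor b" 1 b by (rule jacobi_pearson_family) fact
  have \<gamma>: "0 < \<beta> / 2" using \<beta> by simp
  note nd = normalized_density_mellin[OF finite_atLeastAtMost \<gamma> \<gamma> jacobi_weight_eq[OF \<beta> mM, folded b_def], folded jacobi_ensemble_def]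
  show ?thesis
  proof (rule has_mellin_distr)
    fix z :: complex assume z: "- (\<beta> / 2) < Re z"
    have "(LINT l|jacobi_ensemble \<beta> m M. exp (z * of_real (ln (\<Prod>k\<in>{1..m}. l k)))) =
        selberg (\<beta> / 2) {1..m} (of_real (\<beta> / 2) + z) / selberg (\<beta> / 2) {1..m} (of_real (\<beta> / 2))"
      by (rule nd(5)) (use z in simp)
    then show "(LINT l|jacobi_ensemble \<beta> m M. exp (z * of_real (ln (\<Prod>k\<in>{1..m}. l k)))) =
       jacobi_Gamma (\<beta> / 2) b m (of_real (\<beta> / 2) + z) / jacobi_Gamma (\<beta> / 2) b m (of_real (\<beta> / 2))"
      using jacobi_selberg_quotient[OF finite_atLeastAtMost[of 1 m] \<gamma> b \<gamma>, of z] z by simp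
    show "integrable (jacobi_ensemble \<beta> m M) (\<lambda>l. exp (z * of_real (ln (\<Prod>k\<in>{1..m}. l k))))"
      by (rule nd(4)) (use z in simp)
  qed (use nd(1-3) product_measurable[OF nd(2)] in auto)
qed

text \<open>The ratio of moments \<open>\<Gamma>(a + z) \<Gamma>(c) / (\<Gamma>(a) \<Gamma>(c + z))\<close> of the Beta law with parameters \<open>a\<close> and \<open>c - a\<close>; \<open>None\<close> stands for
\<open>c = \<infinity>\<close> and leaves the moments of the Gamma law with parameter \<open>a\<close>.\<close>

definition gamma_factor :: "real \<Rightarrow> real option \<Rightarrow> complex \<Rightarrow> complex" where
  "gamma_factor a c z = Gamma (of_real a + z) / Gamma (of_real a) /
     (case c of None \<Rightarrow> 1 | Some c \<Rightarrow> Gamma (of_real c + z) / Gamma (of_real c))"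

fun det_size :: "ensemble \<Rightarrow> real \<Rightarrow> real \<Rightarrow> nat \<Rightarrow> nat" where
  "det_size Laguerre \<tau>1 \<tau>2 n = n"
| "det_size Gram \<tau>1 \<tau>2 n = n - 1"
| "det_size Jacobi \<tau>1 \<tau>2 n = min (floor_dim \<tau>1 n) (floor_dim \<tau>2 n)"

text \<open>The point \<open>c\<close> of the \<open>k\<close>-th factor, which has \<open>a = \<beta> k / 2\<close> in all three ensembles.\<close>

fun det_den :: "ensemble \<Rightarrow> real \<Rightarrow> real \<Rightarrow> real \<Rightarrow> nat \<Rightarrow> nat \<Rightarrow> real option" where
  "det_den Laguerre \<beta> \<tau>1 \<tau>2 n k = None"
| "det_den Gram \<beta> \<tau>1 \<tau>2 n k = Some (\<beta> / 2 * real n)"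
| "det_den Jacobi \<beta> \<tau>1 \<tau>2 n k = Some (\<beta> / 2 * (real (max (floor_dim \<tau>1 n) (floor_dim \<tau>2 n)) + real k))"

fun det_scale :: "ensemble \<Rightarrow> nat \<Rightarrow> real" where
  "det_scale Laguerre n = real n * ln 2"
| "det_scale _ n = 0"

definition det_mellin :: "ensemble \<Rightarrow> real \<Rightarrow> real \<Rightarrow> real \<Rightarrow> nat \<Rightarrow> complex \<Rightarrow> complex" where
  "det_mellin i \<beta> \<tau>1 \<tau>2 n z = exp (z * of_real (det_scale i n)) *
     (\<Prod>k=1..det_size i \<tau>1 \<tau>2 n. gamma_factor (\<beta> / 2 * real k) (det_den i \<beta> \<tau>1 \<tau>2 n k) z)"

lemma has_mellin_cong:
  assumes "has_mellin D a F" "a' \<le> a" "\<And>z. - a' < Re z \<Longrightarrow> F z = G z"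
  shows "has_mellin D a' G"
  using assms unfolding has_mellin_def by auto

text \<open>This is the Selberg integral of the Jacobi weight for a single particle.\<close>

lemma has_mellin_beta:
  assumes a: "0 < a" and b: "0 < b"
  shows "has_mellin (beta_distribution a b) a (gamma_factor a (Some (a + b)))"
proof -
  interpret pearson_family "jacobi_cofactor b" 1 b by (rule jacobi_pearson_family) fact
  let ?pw = "power_weight (jacobi_cofactor b)"
  have Bpos: "0 < Beta a b" unfolding Beta_def using a b by (simp add: Gamma_real_pos)
  have dens: "beta_density a b t = norm (?pw (of_real a) t) / Beta a b" for t
    unfolding norm_power_weight beta_density_def jacobi_cofactor_def by auto
  have dens': "beta_density a b t = indicator {0..1} t * (t powr (a - 1) * (1 - t) powr (b - 1)) / Beta a b" for t
    by (auto simp: beta_density_def indicator_def less_le)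
  have [measurable]: "beta_density a b \<in> borel_measurable borel"
    unfolding dens'[abs_def] by measurable
  have nonneg: "0 \<le> beta_density a b t" for t unfolding dens using Bpos by simp
  have sel: "selberg 1 {0 :: nat} s = (LINT t|lborel. ?pw s t)" "integrable lborel (?pw s)" if "0 < Re s" for s
  proof -
    interpret pearson_weight "?pw s" s "of_real 1 * s + of_real b" 1 by (rule pearson_weight) fact
    have "integrable lborel (\<lambda>t. norm (?pw s t))" using q_integrable[of 0] by simp
    then show "integrable lborel (?pw s)" by (subst (asm) integrable_norm_iff) auto
    then have "(LINT l|Pi\<^sub>M {0 :: nat} (\<lambda>_. lborel). ?pw s (l 0)) = (LINT t|lborel. ?pw s t)"
      by (intro product_sigma_finite.product_integral_singleton[OF product_sigma_finite_lborel]) auto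
    then show "selberg 1 {0 :: nat} s = (LINT t|lborel. ?pw s t)"
      unfolding selberg_def ens_weight_def disc_pow_def by simp
  qed
  have int1: "(\<integral>\<^sup>+t. ennreal (beta_density a b t) \<partial>lborel) = 1"
  proof -
    have "(\<integral>\<^sup>+t. ennreal (indicator {0..1} t * (t powr (a - 1) * (1 - t) powr (b - 1))) \<partial>lborel) = ennreal (Beta a b)"
      by (rule nn_integral_has_integral_lebesgue[OF _ has_integral_Beta_real[OF a b]]) simp
    then have "(\<integral>\<^sup>+t. ennreal (indicator {0..1} t * (t powr (a - 1) * (1 - t) powr (b - 1))) / ennreal (Beta a b) \<partial>lborel) = 1"
      using Bpos by (subst nn_integral_divide) (auto simp: divide_ennreal)
    then show ?thesis unfolding dens' using Bpos by (simp add: divide_ennreal)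
  qed
  have selreal: "selberg 1 {0 :: nat} (of_real a) = of_real (Beta a b)"
  proof -
    have "ennreal (LINT t|lborel. norm (?pw (of_real a) t)) = (\<integral>\<^sup>+t. ennreal (norm (?pw (of_real a) t)) \<partial>lborel)"
      using sel(2)[of "of_real a"] a by (intro nn_integral_eq_integral[symmetric] integrable_norm) auto
    also have "\<dots> = (\<integral>\<^sup>+t. ennreal (Beta a b) * ennreal (beta_density a b t) \<partial>lborel)"
      unfolding dens using Bpos by (simp add: ennreal_mult'[symmetric])
    also have "\<dots> = ennreal (Beta a b)" using int1 by (subst nn_integral_cmult) auto
    finally have r: "(LINT t|lborel. norm (?pw (of_real a) t)) = Beta a b"
      using Bpos by (subst (asm) ennreal_inj) auto
    have "?pw (of_real a) t = of_real (norm (?pw (of_real a) t))" for t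
      using ens_weight_of_real[of 1 "{0 :: nat}" a "\<lambda>_. t"] by (simp add: real_weight_def ens_weight_def disc_pow_def)
    then have "(LINT t|lborel. ?pw (of_real a) t) = of_real (LINT t|lborel. norm (?pw (of_real a) t))"
      using integral_complex_of_real[of lborel "\<lambda>t. norm (?pw (of_real a) t)"] by simp
    then show ?thesis using sel(1)[of "of_real a"] a r by simp
  qed
  have "prob_space (beta_distribution a b)"
    unfolding beta_distribution_def
    by (rule prob_spaceI) (use int1 in \<open>simp add: emeasure_density\<close>)
  moreover have "AE t in beta_distribution a b. 0 < t"
    unfolding beta_distribution_def by (subst AE_density) (auto simp: beta_density_def intro!: AE_I2)
  moreover have "integrable (beta_distribution a b) (\<lambda>y. exp (z * of_real (ln y))) \<and>
      (LINT y|beta_distribution a b. exp (z * of_real (ln y))) = gamma_factor a (Some (a + b)) z" if z: "- a < Re z" for z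
  proof -
    have eq: "beta_density a b t *\<^sub>R exp (z * of_real (ln t)) = ?pw (of_real a + z) t / of_real (Beta a b)" for t
    proof (cases "0 < t")
      case True
      have "?pw (of_real a) t = of_real (norm (?pw (of_real a) t))"
        using ens_weight_of_real[of 1 "{0 :: nat}" a "\<lambda>_. t"] by (simp add: real_weight_def ens_weight_def disc_pow_def)
      then show ?thesis
        using power_weight_add[of t "of_real a" z] True unfolding exp_ln_eq_powr[OF True] dens
        by (simp add: scaleR_conv_of_real)
    qed (auto simp: beta_density_def power_weight_def)
    have pos: "0 < Re (of_real a + z)" "0 < a + Re z" using z by auto
    have i: "integrable lborel (\<lambda>t. beta_density a b t *\<^sub>R exp (z * of_real (ln t)))"
      unfolding eq by (intro integrable_divide sel(2) pos)
    have "(LINT y|beta_distribution a b. exp (z * of_real (ln y))) = (LINT t|lborel. ?pw (of_real a + z) t / of_real (Beta a b))"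
      unfolding beta_distribution_def using nonneg by (subst integral_density) (auto simp: eq)
    also have "\<dots> = selberg 1 {0 :: nat} (of_real a + z) / selberg 1 {0 :: nat} (of_real a)"
      unfolding selreal sel(1)[OF pos(1)] by (rule integral_divide_zero)
    also have "\<dots> = gamma_factor a (Some (a + b)) z"
      unfolding jacobi_selberg_quotient[of "{0 :: nat}" 1 b a z, OF _ _ b a pos(2), simplified]
      unfolding jacobi_Gamma_def gamma_factor_def by (simp add: add_ac)
    finally show ?thesis
      using i nonneg unfolding beta_distribution_def by (subst integrable_density) auto
  qed
  ultimately show ?thesis unfolding has_mellin_def by (simp add: beta_distribution_def)
qed

text \<open>Independence. The marginals outside \<open>K\<close> are replaced by a point mass in the proof because a product space asks
for a probability measure at every index.\<close>

lemma has_mellin_prod: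
  assumes K: "finite K" and D: "\<And>k. k \<in> K \<Longrightarrow> has_mellin (D k) a (F k)"
  shows "has_mellin (distr (Pi\<^sub>M K D) borel (\<lambda>\<rho>. \<Prod>k\<in>K. \<rho> k)) a (\<lambda>z. \<Prod>k\<in>K. F k z)"
proof -
  define E where "E = (\<lambda>k. if k \<in> K then D k else return borel (1 :: real))"
  have EK: "E k = D k" if "k \<in> K" for k using that by (simp add: E_def)
  have PE: "prob_space (E k)" for k
    using D[of k] unfolding E_def has_mellin_def by (auto intro: prob_space_return)
  interpret product_prob_space E by (intro product_prob_spaceI PE)
  have setsE: "sets (E k) = sets borel" for k using D[of k] unfolding E_def has_mellin_def by auto
  have PiM: "Pi\<^sub>M K D = Pi\<^sub>M K E" by (intro PiM_cong) (auto simp: E_def)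
  have comp: "(\<lambda>\<rho>. \<rho> k) \<in> borel_measurable (Pi\<^sub>M K E)" if "k \<in> K" for k
    using measurable_component_singleton[OF that, of E] unfolding measurable_cong_sets[OF refl setsE] .
  have [measurable]: "(\<lambda>\<rho>. \<Prod>k\<in>K. \<rho> k) \<in> borel_measurable (Pi\<^sub>M K E)"
    by (rule borel_measurable_prod) (rule comp)
  have "AE \<rho> in Pi\<^sub>M K E. 0 < \<rho> k" if "k \<in> K" for k
  proof (rule AE_PiM_component[OF PE that])
    show "AE y in E k. 0 < y" unfolding EK[OF that] using D[OF that] by (simp add: has_mellin_def)
  qed
  then have AE: "AE \<rho> in Pi\<^sub>M K E. \<forall>k\<in>K. 0 < \<rho> k" using K by (intro AE_finite_allI) auto
  show ?thesis unfolding PiM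
  proof (rule has_mellin_distr)
    show "prob_space (Pi\<^sub>M K E)" by (intro prob_space_PiM PE)
    show "AE \<rho> in Pi\<^sub>M K E. 0 < (\<Prod>k\<in>K. \<rho> k)" using AE by eventually_elim (auto intro: prod_pos)
    fix z :: complex assume z: "- a < Re z"
    let ?f = "\<lambda>y. exp (z * complex_of_real (ln y))"
    have Ek: "integrable (E k) ?f" "(LINT y|E k. ?f y) = F k z" if "k \<in> K" for k
      using D[OF that] z that by (auto simp: E_def has_mellin_def)
    have AEeq: "AE \<rho> in Pi\<^sub>M K E. (\<Prod>k\<in>K. ?f (\<rho> k)) = ?f (\<Prod>k\<in>K. \<rho> k)"
      using AE
    proof eventually_elim
      case (elim \<rho>)
      then have "ln (\<Prod>k\<in>K. \<rho> k) = (\<Sum>k\<in>K. ln (\<rho> k))" using K by (intro ln_prod) auto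
      then show ?case using K by (simp add: exp_sum sum_distrib_left)
    qed
    have [measurable]: "(\<lambda>\<rho>. \<Prod>k\<in>K. ?f (\<rho> k)) \<in> borel_measurable (Pi\<^sub>M K E)"
    proof (rule borel_measurable_prod)
      fix k assume "k \<in> K"
      note [measurable] = comp[OF this]
      show "(\<lambda>\<rho>. ?f (\<rho> k)) \<in> borel_measurable (Pi\<^sub>M K E)" by measurable
    qed
    have "integrable (Pi\<^sub>M K E) (\<lambda>\<rho>. \<Prod>k\<in>K. ?f (\<rho> k))"
      using K Ek(1) by (intro product_integrable_prod) auto
    then show "integrable (Pi\<^sub>M K E) (\<lambda>\<rho>. ?f (\<Prod>k\<in>K. \<rho> k))"
      using AEeq by (subst (asm) integrable_cong_AE[of _ _ "\<lambda>\<rho>. ?f (\<Prod>k\<in>K. \<rho> k)"]) auto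
    have "(LINT \<rho>|Pi\<^sub>M K E. ?f (\<Prod>k\<in>K. \<rho> k)) = (LINT \<rho>|Pi\<^sub>M K E. (\<Prod>k\<in>K. ?f (\<rho> k)))"
      using AEeq by (intro integral_cong_AE) auto
    also have "\<dots> = (\<Prod>k\<in>K. LINT y|E k. ?f y)"
      using K Ek(1) by (intro product_integral_prod) auto
    also have "\<dots> = (\<Prod>k\<in>K. F k z)" using Ek(2) by (intro prod.cong) auto
    finally show "(LINT \<rho>|Pi\<^sub>M K E. ?f (\<Prod>k\<in>K. \<rho> k)) = (\<Prod>k\<in>K. F k z)" .
  qed measurable
qed

text \<open>For the Gram ensemble the factors appear in the reverse order, \<open>k\<close> being replaced by \<open>n + 1 - k\<close>.\<close>

theorem det_law_has_mellin:
  assumes \<beta>: "0 < \<beta>" and n: "1 \<le> n"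
  shows "has_mellin (det_law i \<beta> \<tau>1 \<tau>2 n) (\<beta> / 2) (det_mellin i \<beta> \<tau>1 \<tau>2 n)"
proof (cases i)
  case Laguerre
  have "laguerre_Gamma (\<beta> / 2) n (of_real (\<beta> / 2) + z) / laguerre_Gamma (\<beta> / 2) n (of_real (\<beta> / 2)) =
     det_mellin Laguerre \<beta> \<tau>1 \<tau>2 n z" for z
  proof -
    have "exp (z * of_real (real n * ln 2)) = (\<Prod>k<n. exp (z * of_real (ln 2)))"
      by (simp flip: exp_of_nat_mult add: mult_ac)
    then have e: "det_mellin Laguerre \<beta> \<tau>1 \<tau>2 n z =
        (\<Prod>k<n. exp (z * of_real (ln 2)) * gamma_factor (\<beta> / 2 * real (Suc k)) None z)"
      unfolding det_mellin_def det_size.simps det_scale.simps det_den.simps One_nat_def prod.atLeast1_atMost_eq prod.distrib by (simp only:)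
    show ?thesis unfolding e laguerre_Gamma_def prod_dividef[symmetric]
    proof (rule prod.cong[OF refl])
      fix k
      have e1: "of_real (\<beta> / 2) + z + of_real (\<beta> / 2 * real k) = of_real (\<beta> / 2 * real (Suc k)) + z"
        "of_real (\<beta> / 2) + of_real (\<beta> / 2 * real k) = complex_of_real (\<beta> / 2 * real (Suc k))"
        by (simp_all add: algebra_simps add_divide_distrib)
      have e2: "exp ((of_real (\<beta> / 2) + z) * of_real (ln 2)) = exp (of_real (\<beta> / 2) * of_real (ln 2)) * exp (z * of_real (ln 2) :: complex)"
        by (simp only: distrib_right exp_add)
      show "exp ((of_real (\<beta> / 2) + z) * of_real (ln 2)) * Gamma (of_real (\<beta> / 2) + z + of_real (\<beta> / 2 * real k)) /
         (exp (of_real (\<beta> / 2) * of_real (ln 2)) * Gamma (of_real (\<beta> / 2) + of_real (\<beta> / 2 * real k))) =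
         exp (z * of_real (ln 2)) * gamma_factor (\<beta> / 2 * real (Suc k)) None z"
        unfolding e1 e2 gamma_factor_def option.case by (simp del: of_real_mult of_real_divide of_nat_Suc)
    qed
  qed
  then show ?thesis using Laguerre
    has_mellin_cong[OF laguerre_has_mellin[OF \<beta>, of n] order_refl, of "det_mellin Laguerre \<beta> \<tau>1 \<tau>2 n"] by simp
next
  case Gram
  have "has_mellin (det_law Gram \<beta> \<tau>1 \<tau>2 n) (\<beta> / 2)
     (\<lambda>z. \<Prod>k\<in>{2..n}. gamma_factor (\<beta> / 2 * (real n - real k + 1)) (Some (\<beta> / 2 * real n)) z)"
    unfolding det_law.simps
  proof (rule has_mellin_prod)
    fix k assume k: "k \<in> {2..n}"
    have s: "\<beta> / 2 * (real n - real k + 1) + \<beta> / 2 * (real k - 1) = \<beta> / 2 * real n" unfolding distrib_left[symmetric] by simp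
    have pos: "0 < \<beta> / 2 * (real n - real k + 1)" "0 < \<beta> / 2 * (real k - 1)"
      using k \<beta> by (auto intro!: mult_pos_pos)
    have "\<beta> / 2 * 1 \<le> \<beta> / 2 * (real n - real k + 1)" using k \<beta> by (intro mult_left_mono) auto
    then show "has_mellin (beta_distribution (\<beta> / 2 * (real n - real k + 1)) (\<beta> / 2 * (real k - 1))) (\<beta> / 2)
        (gamma_factor (\<beta> / 2 * (real n - real k + 1)) (Some (\<beta> / 2 * real n)))"
      using has_mellin_beta[OF pos, unfolded s] by (rule_tac has_mellin_cong) auto
  qed simp
  moreover have "(\<Prod>k\<in>{2..n}. gamma_factor (\<beta> / 2 * (real n - real k + 1)) (Some (\<beta> / 2 * real n)) z) = det_mellin Gram \<beta> \<tau>1 \<tau>2 n z" for z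
  proof -
    have "(\<Prod>k\<in>{2..n}. gamma_factor (\<beta> / 2 * (real n - real k + 1)) (Some (\<beta> / 2 * real n)) z) =
      (\<Prod>k\<in>{1..n - 1}. gamma_factor (\<beta> / 2 * real k) (Some (\<beta> / 2 * real n)) z)"
    proof (rule prod.reindex_bij_witness[of _ "\<lambda>k. n + 1 - k" "\<lambda>k. n + 1 - k"])
      fix k assume "k \<in> {2..n}"
      then have "real (n + 1 - k) = real n - real k + 1" by (simp add: of_nat_diff)
      then show "gamma_factor (\<beta> / 2 * real (n + 1 - k)) (Some (\<beta> / 2 * real n)) z =
        gamma_factor (\<beta> / 2 * (real n - real k + 1)) (Some (\<beta> / 2 * real n)) z" by (simp only:)
    qed auto
    then show ?thesis unfolding det_mellin_def by simp
  qed
  ultimately show ?thesis using Gram by simp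
next
  case Jacobi
  define m where "m = min (floor_dim \<tau>1 n) (floor_dim \<tau>2 n)"
  define M where "M = max (floor_dim \<tau>1 n) (floor_dim \<tau>2 n)"
  have mM: "m \<le> M" by (simp add: m_def M_def)
  define b where "b = \<beta> / 2 * (real M - real m + 1)"
  have eq: "jacobi_Gamma (\<beta> / 2) b m (of_real (\<beta> / 2) + z) / jacobi_Gamma (\<beta> / 2) b m (of_real (\<beta> / 2)) =
     det_mellin Jacobi \<beta> \<tau>1 \<tau>2 n z" for z
  proof -
    have e1: "of_real (\<beta> / 2) + z + of_real (\<beta> / 2 * real k) = of_real (\<beta> / 2 * real (Suc k)) + z"
      "of_real (\<beta> / 2) + of_real (\<beta> / 2 * real k) = complex_of_real (\<beta> / 2 * real (Suc k))"
      "of_real (\<beta> / 2) + z + of_real b + of_real (\<beta> / 2 * (real m + real k - 1)) = of_real (\<beta> / 2 * (real M + real (Suc k))) + z"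
      "of_real (\<beta> / 2) + of_real b + of_real (\<beta> / 2 * (real m + real k - 1)) = complex_of_real (\<beta> / 2 * (real M + real (Suc k)))" for k
      by (simp_all add: b_def field_simps)
    have e: "det_mellin Jacobi \<beta> \<tau>1 \<tau>2 n z =
        (\<Prod>k<m. gamma_factor (\<beta> / 2 * real (Suc k)) (Some (\<beta> / 2 * (real M + real (Suc k)))) z)"
      unfolding det_mellin_def det_size.simps det_scale.simps det_den.simps m_def[symmetric] M_def[symmetric]
        One_nat_def prod.atLeast1_atMost_eq by (simp only: of_real_0 mult_zero_right exp_zero mult_1)
    show ?thesis unfolding e jacobi_Gamma_def prod_dividef[symmetric] e1
      by (rule prod.cong[OF refl]) (simp add: gamma_factor_def divide_divide_eq_left divide_divide_eq_right mult.commute)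
  qed
  show ?thesis unfolding Jacobi det_law.simps Let_def m_def[symmetric] M_def[symmetric]
    by (rule has_mellin_cong[OF jacobi_has_mellin[OF \<beta> mM] order_refl]) (rule eq[unfolded b_def])
qed

section \<open>Binet's formula\<close>

text \<open>Over a common denominator the poles at \<open>0\<close> are gone from the numerator: its sign follows from its derivative,
and the quadratic Taylor bound for \<open>exp\<close> gives \<open>phi \<le> 1/2\<close>.\<close>

lemma phi_alt: "0 < s \<Longrightarrow> phi s = (exp s * (s - 2) + s + 2) / (2 * s\<^sup>2 * (exp s - 1))"
  unfolding phi_def by (simp add: field_simps power2_eq_square)

lemma phi_nonneg:
  assumes "0 < s"
  shows "0 \<le> phi s"
proof -
  define f :: "real \<Rightarrow> real" where "f = (\<lambda>s. exp s * (s - 2) + s + 2)"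
  have "f 0 \<le> f s"
  proof (rule deriv_nonneg_imp_mono[where g = f and a = 0 and b = s])
    fix x :: real
    have "(1 - x) * exp x \<le> exp (- x) * exp x"
      using exp_ge_add_one_self[of "- x"] by (intro mult_right_mono) auto
    then show "0 \<le> exp x * (x - 1) + 1" by (simp add: exp_minus field_simps)
    show "(f has_real_derivative exp x * (x - 1) + 1) (at x)"
      unfolding f_def by (auto intro!: derivative_eq_intros simp: algebra_simps)
  qed (use assms in simp)
  then show ?thesis unfolding phi_alt[OF assms] using assms by (simp add: f_def)
qed

lemma phi_le:
  assumes "0 < s"
  shows "phi s \<le> 1 / 2"
proof -
  have "0 \<le> s * s * s / 2 + s * s * s * s / 2" using assms by simp
  moreover have "(1 + s + s\<^sup>2 / 2) * (s\<^sup>2 - s + 2) = s\<^sup>2 + s + 2 + (s * s * s / 2 + s * s * s * s / 2)"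
    by (simp add: field_simps power2_eq_square)
  ultimately have "s\<^sup>2 + s + 2 \<le> (1 + s + s\<^sup>2 / 2) * (s\<^sup>2 - s + 2)" by linarith
  also have "\<dots> \<le> exp s * (s\<^sup>2 - s + 2)"
  proof (rule mult_right_mono)
    show "1 + s + s\<^sup>2 / 2 \<le> exp s" using exp_lower_Taylor_quadratic[of s] assms by simp
    have "0 \<le> (s - 1)\<^sup>2 + s + 1" using assms by simp
    then show "0 \<le> s\<^sup>2 - s + 2" by (simp add: power2_eq_square algebra_simps)
  qed
  finally have "exp s * (s - 2) + s + 2 \<le> s\<^sup>2 * (exp s - 1)" by (simp add: algebra_simps)
  then show ?thesis unfolding phi_alt[OF assms] using assms by (simp add: field_simps)
qed

lemma phi_measurable [measurable]: "phi \<in> borel_measurable borel"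
  unfolding phi_def by measurable

lemma exp_neg_integral:
  fixes a :: real
  assumes "0 < a"
  shows "set_integrable lborel {0<..} (\<lambda>s. exp (- (s * a)))" "(LINT s:{0<..}|lborel. exp (- (s * a))) = 1 / a"
proof -
  have "((\<lambda>s. exp (- a * s)) has_integral exp (- a * 0) / a) {0..}"
    by (rule has_integral_exp_minus_to_infinity) fact
  then have hi: "((\<lambda>s. exp (- (s * a))) has_integral 1 / a) {0..}" by (simp add: mult.commute)
  have ni: "(\<integral>\<^sup>+s. ennreal (indicator {0..} s * exp (- (s * a))) \<partial>lborel) = ennreal (1 / a)"
    by (rule nn_integral_has_integral_lebesgue[OF _ hi]) simp
  have AE: "AE s in lborel. indicator {0..} s * exp (- (s * a)) = indicator {0<..} s *\<^sub>R exp (- (s * a))"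
    using AE_lborel_singleton[of "0::real"] by eventually_elim (auto simp: indicator_def)
  have "(\<integral>\<^sup>+s. ennreal (indicator {0<..} s *\<^sub>R exp (- (s * a))) \<partial>lborel) = ennreal (1 / a)"
    unfolding ni[symmetric] using AE by (intro nn_integral_cong_AE) auto
  then have "has_bochner_integral lborel (\<lambda>s. indicator {0<..} s *\<^sub>R exp (- (s * a))) (1 / a)"
    using assms by (intro has_bochner_integral_nn_integral) auto
  then show "set_integrable lborel {0<..} (\<lambda>s. exp (- (s * a)))" "(LINT s:{0<..}|lborel. exp (- (s * a))) = 1 / a"
    unfolding set_integrable_def set_lebesgue_integral_def by (auto simp: has_bochner_integral_iff)
qed

text \<open>The remainder of Stirling's formula for \<open>ln \<Gamma>(w)\<close>.\<close>

definition binet :: "real \<Rightarrow> real" where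
  "binet w = (LINT s:{0<..}|lborel. phi s * exp (- (s * w)))"

lemma set_integrable_phi_mult:
  assumes "set_integrable lborel {0<..} g"
  shows "set_integrable lborel {0<..} (\<lambda>s. phi s * g s)"
proof -
  have m: "(\<lambda>s. indicator {0<..} s *\<^sub>R (phi s * g s)) = (\<lambda>s. phi s * (indicator {0<..} s *\<^sub>R g s))"
    by (auto simp: fun_eq_iff)
  show ?thesis
    unfolding set_integrable_def
  proof (rule Bochner_Integration.integrable_bound[OF assms[unfolded set_integrable_def]])
    show "(\<lambda>s. indicator {0<..} s *\<^sub>R (phi s * g s)) \<in> borel_measurable lborel"
      unfolding m using assms unfolding set_integrable_def by (intro borel_measurable_times) auto
    have "\<bar>phi s\<bar> * \<bar>g s\<bar> \<le> 1 * \<bar>g s\<bar>" if "0 < s" for s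
      using phi_nonneg[OF that] phi_le[OF that] by (intro mult_right_mono) auto
    then show "AE s in lborel. norm (indicator {0<..} s *\<^sub>R (phi s * g s)) \<le> norm (indicator {0<..} s *\<^sub>R g s)"
      by (intro AE_I2) (auto simp: indicator_def abs_mult)
  qed
qed

lemma set_integrable_phi_exp: "0 < w \<Longrightarrow> set_integrable lborel {0<..} (\<lambda>s. phi s * exp (- (s * w)))"
  by (intro set_integrable_phi_mult exp_neg_integral)

text \<open>As \<open>0 \<le> phi \<le> 1\<close>, the integrals are dominated by those without \<open>phi\<close>, which are elementary.\<close>

lemma phi_exp_diff:
  assumes "0 < w" "0 < w'"
  shows "set_integrable lborel {0<..} (\<lambda>s. phi s * (exp (- (s * w)) - exp (- (s * w'))))"
    and "(LINT s:{0<..}|lborel. \<bar>phi s * (exp (- (s * w)) - exp (- (s * w')))\<bar>) \<le> \<bar>1 / w - 1 / w'\<bar>"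
    and "(LINT s:{0<..}|lborel. phi s * (exp (- (s * w)) - exp (- (s * w')))) = binet w - binet w'"
proof -
  have i: "set_integrable lborel {0<..} (\<lambda>s. phi s * (exp (- (s * w)) - exp (- (s * w'))))" if "0 < w" "0 < w'" for w w'
    using that by (intro set_integrable_phi_mult set_integral_diff exp_neg_integral) auto
  show "set_integrable lborel {0<..} (\<lambda>s. phi s * (exp (- (s * w)) - exp (- (s * w'))))"
    using assms by (rule i)
  show "(LINT s:{0<..}|lborel. phi s * (exp (- (s * w)) - exp (- (s * w')))) = binet w - binet w'"
    unfolding binet_def right_diff_distrib using assms
    by (intro set_integral_diff(2) set_integrable_phi_exp) auto
  have le: "(LINT s:{0<..}|lborel. \<bar>phi s * (exp (- (s * w)) - exp (- (s * w')))\<bar>) \<le> \<bar>1 / w - 1 / w'\<bar>"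
    if w: "0 < w" "w \<le> w'" for w w'
  proof -
    have "(LINT s:{0<..}|lborel. \<bar>phi s * (exp (- (s * w)) - exp (- (s * w')))\<bar>) \<le> (LINT s:{0<..}|lborel. exp (- (s * w)) - exp (- (s * w')))"
    proof (rule set_integral_mono)
      show "set_integrable lborel {0<..} (\<lambda>s. \<bar>phi s * (exp (- (s * w)) - exp (- (s * w')))\<bar>)"
        using w by (intro set_integrable_abs i) auto
      show "set_integrable lborel {0<..} (\<lambda>s. exp (- (s * w)) - exp (- (s * w')))"
        using w by (intro set_integral_diff exp_neg_integral) auto
      fix s :: real assume "s \<in> {0<..}"
      then have s: "0 < s" by simp
      have "s * w \<le> s * w'" using w s by (intro mult_left_mono) auto
      then have d: "0 \<le> exp (- (s * w)) - exp (- (s * w'))" by simp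
      then have "phi s * (exp (- (s * w)) - exp (- (s * w'))) \<le> 1 * (exp (- (s * w)) - exp (- (s * w')))"
        using phi_le[OF s] by (intro mult_right_mono) auto
      then show "\<bar>phi s * (exp (- (s * w)) - exp (- (s * w')))\<bar> \<le> exp (- (s * w)) - exp (- (s * w'))"
        using phi_nonneg[OF s] d by (simp add: abs_mult)
    qed
    also have "\<dots> = 1 / w - 1 / w'"
      using w by (subst set_integral_diff) (auto simp: exp_neg_integral)
    finally show ?thesis by simp
  qed
  show "(LINT s:{0<..}|lborel. \<bar>phi s * (exp (- (s * w)) - exp (- (s * w')))\<bar>) \<le> \<bar>1 / w - 1 / w'\<bar>"
  proof (cases "w \<le> w'")
    case True
    then show ?thesis using assms by (intro le) auto
  next
    case False
    have "\<bar>phi s * (exp (- (s * w)) - exp (- (s * w')))\<bar> = \<bar>phi s * (exp (- (s * w')) - exp (- (s * w)))\<bar>" for s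
      by (simp add: abs_mult abs_minus_commute)
    then show ?thesis using le[of w' w] False assms by (simp add: abs_minus_commute)
  qed
qed

lemma binet_diff_bound:
  assumes "0 < w" "0 < w'"
  shows "\<bar>binet w - binet w'\<bar> \<le> \<bar>1 / w - 1 / w'\<bar>"
  using set_integral_norm_bound[OF phi_exp_diff(1)[OF assms]] phi_exp_diff(2,3)[OF assms] by simp

lemma binet_bound:
  assumes "0 < w"
  shows "\<bar>binet w\<bar> \<le> 1 / w"
proof -
  have "\<bar>binet w\<bar> \<le> (LINT s:{0<..}|lborel. \<bar>phi s * exp (- (s * w))\<bar>)"
    unfolding binet_def using set_integral_norm_bound[OF set_integrable_phi_exp[OF assms]] by simp
  also have "\<dots> \<le> (LINT s:{0<..}|lborel. exp (- (s * w)))"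
  proof (rule set_integral_mono)
    show "set_integrable lborel {0<..} (\<lambda>s. \<bar>phi s * exp (- (s * w))\<bar>)"
      by (rule set_integrable_abs[OF set_integrable_phi_exp[OF assms]])
    show "set_integrable lborel {0<..} (\<lambda>s. exp (- (s * w)))" using assms by (rule exp_neg_integral)
    fix s :: real assume "s \<in> {0<..}"
    then have s: "0 < s" by simp
    have "phi s * exp (- (s * w)) \<le> 1 * exp (- (s * w))"
      using phi_le[OF s] by (intro mult_right_mono) auto
    then show "\<bar>phi s * exp (- (s * w))\<bar> \<le> exp (- (s * w))" using phi_nonneg[OF s] by (simp add: abs_mult)
  qed
  also have "\<dots> = 1 / w" using assms by (rule exp_neg_integral)
  finally show ?thesis .
qed

text \<open>Integrate \<open>(1/2 - \<theta>) exp (- s (w + \<theta>))\<close> over \<open>s > 0\<close> and \<open>0 \<le> \<theta> \<le> 1\<close>. Integrating over \<open>s\<close> first leaves an elementary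
integral in \<open>\<theta>\<close>; integrating over \<open>\<theta>\<close> first produces \<open>phi s (1 - exp (- s)) exp (- s w)\<close>.\<close>

lemma binet_diff_one:
  assumes w: "0 < w"
  shows "binet w - binet (w + 1) = (w + 1 / 2) * ln ((w + 1) / w) - 1"
proof -
  define f :: "real \<Rightarrow> real \<Rightarrow> real" where
    "f = (\<lambda>s \<theta>. indicator {0<..} s * (indicator {0..1} \<theta> * ((1 / 2 - \<theta>) * exp (- (s * (w + \<theta>))))))"
  have [measurable]: "case_prod f \<in> borel_measurable (lborel \<Otimes>\<^sub>M lborel)"
    unfolding f_def by measurable
  have bound: "\<bar>f s \<theta>\<bar> \<le> (indicator {0<..} s * exp (- (s * w))) * indicator {0..1} \<theta>" for s \<theta>
  proof (cases "0 < s \<and> \<theta> \<in> {0..1}")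
    case True
    then have "\<bar>1 / 2 - \<theta>\<bar> * exp (- (s * (w + \<theta>))) \<le> 1 * exp (- (s * w))"
      by (intro mult_mono) (auto simp: mult_left_mono)
    then show ?thesis using True by (simp add: f_def abs_mult)
  qed (auto simp: f_def)
  have if1: "integrable lborel (f s)" for s
  proof (rule Bochner_Integration.integrable_bound)
    show "integrable lborel (\<lambda>\<theta>. (indicator {0<..} s * exp (- (s * w))) * indicator {0..1::real} \<theta> :: real)"
      by (intro integrable_mult_right) simp
    show "f s \<in> borel_measurable lborel" unfolding f_def by measurable
    show "AE \<theta> in lborel. norm (f s \<theta>) \<le> norm (indicator {0<..} s * exp (- (s * w)) * indicator {0..1} \<theta>)"
      using bound[of s] by (intro AE_I2) (auto simp: abs_mult)
  qed
  have if2: "integrable lborel (\<lambda>s. indicator {0<..} s * exp (- (s * w)))"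
    using exp_neg_integral(1)[OF w] by (simp add: set_integrable_def)
  have int: "integrable (lborel \<Otimes>\<^sub>M lborel) (case_prod f)"
  proof (rule lborel_pair.Fubini_integrable)
    show "integrable lborel (\<lambda>s. LINT \<theta>|lborel. norm (case_prod f (s, \<theta>)))"
    proof (rule Bochner_Integration.integrable_bound[OF if2])
      show "(\<lambda>s. LINT \<theta>|lborel. norm (case_prod f (s, \<theta>))) \<in> borel_measurable lborel" by measurable
      have "(LINT \<theta>|lborel. norm (f s \<theta>)) \<le> (LINT \<theta>|lborel. (indicator {0<..} s * exp (- (s * w))) * indicator {0..1::real} \<theta>)" for s
      proof (rule Bochner_Integration.integral_mono)
        show "integrable lborel (\<lambda>\<theta>. norm (f s \<theta>))" by (rule integrable_norm[OF if1])
        show "integrable lborel (\<lambda>\<theta>. (indicator {0<..} s * exp (- (s * w))) * indicator {0..1::real} \<theta> :: real)"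
          by (intro integrable_mult_right) simp
        show "norm (f s \<theta>) \<le> (indicator {0<..} s * exp (- (s * w))) * indicator {0..1} \<theta>" for \<theta>
          unfolding real_norm_def by (rule bound)
      qed
      also have "(LINT \<theta>|lborel. (indicator {0<..} s * exp (- (s * w))) * indicator {0..1::real} \<theta>) = indicator {0<..} s * exp (- (s * w))" for s
        by simp
      finally show "AE s in lborel. norm (LINT \<theta>|lborel. norm (case_prod f (s, \<theta>))) \<le> norm (indicator {0<..} s * exp (- (s * w)))"
        by (intro AE_I2) auto
    qed
    show "AE s in lborel. integrable lborel (\<lambda>\<theta>. case_prod f (s, \<theta>))" using if1 by simp
  qed measurable
  have inner1: "(LINT s|lborel. f s \<theta>) = indicator {0..1} \<theta> * ((1 / 2 - \<theta>) / (w + \<theta>))" for \<theta>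
  proof (cases "\<theta> \<in> {0..1}")
    case True
    then have "(LINT s|lborel. f s \<theta>) = (LINT s|lborel. (1 / 2 - \<theta>) * (indicator {0<..} s *\<^sub>R exp (- (s * (w + \<theta>)))))"
      by (intro Bochner_Integration.integral_cong) (auto simp: f_def)
    also have "\<dots> = (1 / 2 - \<theta>) * (LINT s:{0<..}|lborel. exp (- (s * (w + \<theta>))))"
      unfolding set_lebesgue_integral_def by (rule Bochner_Integration.integral_mult_right_zero)
    also have "(LINT s:{0<..}|lborel. exp (- (s * (w + \<theta>)))) = 1 / (w + \<theta>)"
      using True w by (intro exp_neg_integral) auto
    finally show ?thesis using True by simp
  qed (auto simp: f_def)
  have outer1: "(LINT \<theta>|lborel. indicator {0..1} \<theta> * ((1 / 2 - \<theta>) / (w + \<theta>))) = (w + 1 / 2) * ln ((w + 1) / w) - 1"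
  proof -
    have "(LINT \<theta>|lborel. ((1 / 2 - \<theta>) / (w + \<theta>)) * indicator {0..1} \<theta>) =
      ((w + 1 / 2) * ln (w + 1) - 1) - ((w + 1 / 2) * ln (w + 0) - 0)"
    proof (rule integral_FTC_Icc_real)
      fix x :: real assume x: "0 \<le> x" "x \<le> 1"
      show "DERIV (\<lambda>\<theta>. (w + 1 / 2) * ln (w + \<theta>) - \<theta>) x :> (1 / 2 - x) / (w + x)"
        using x w by (auto intro!: derivative_eq_intros simp: field_simps)
      show "isCont (\<lambda>\<theta>. (1 / 2 - \<theta>) / (w + \<theta>)) x" using x w by (intro continuous_intros) auto
    qed simp
    then show ?thesis using w by (simp add: ln_div algebra_simps)
  qed
  have inner2: "(LINT \<theta>|lborel. f s \<theta>) = indicator {0<..} s *\<^sub>R (phi s * exp (- (s * w)) - phi s * exp (- (s * (w + 1))))" for s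
  proof (cases "0 < s")
    case True
    have "(LINT \<theta>|lborel. ((1 / 2 - \<theta>) * exp (- (s * (w + \<theta>)))) * indicator {0..1} \<theta>) =
      ((1 - 1 / 2) / s + 1 / s\<^sup>2) * exp (- (s * (w + 1))) - ((0 - 1 / 2) / s + 1 / s\<^sup>2) * exp (- (s * (w + 0)))"
    proof (rule integral_FTC_Icc_real)
      fix x :: real assume x: "0 \<le> x" "x \<le> 1"
      show "DERIV (\<lambda>\<theta>. ((\<theta> - 1 / 2) / s + 1 / s\<^sup>2) * exp (- (s * (w + \<theta>)))) x :> (1 / 2 - x) * exp (- (s * (w + x)))"
      proof -
        define E where "E = exp (- (s * (w + x)))"
        have "((\<lambda>\<theta>. exp (- (s * (w + \<theta>)))) has_real_derivative - s * E) (at x)"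
          unfolding E_def by (auto intro!: derivative_eq_intros)
        moreover have "((\<lambda>\<theta>. (\<theta> - 1 / 2) / s + 1 / s\<^sup>2) has_real_derivative 1 / s) (at x)"
          using True by (auto intro!: derivative_eq_intros)
        ultimately have "DERIV (\<lambda>\<theta>. ((\<theta> - 1 / 2) / s + 1 / s\<^sup>2) * exp (- (s * (w + \<theta>)))) x :>
            1 / s * E + (- s * E) * ((x - 1 / 2) / s + 1 / s\<^sup>2)"
          unfolding E_def by (rule DERIV_mult[rotated])
        also have "1 / s * E + (- s * E) * ((x - 1 / 2) / s + 1 / s\<^sup>2) = (1 / 2 - x) * E"
          using True by (simp add: field_simps power2_eq_square)
        finally show ?thesis unfolding E_def .
      qed
      show "isCont (\<lambda>\<theta>. (1 / 2 - \<theta>) * exp (- (s * (w + \<theta>)))) x" by (intro continuous_intros)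
    qed simp
    also have "\<dots> = phi s * exp (- (s * w)) - phi s * exp (- (s * (w + 1)))"
    proof -
      have e: "exp (- (s * (w + 1))) = exp (- (s * w)) / exp s"
        by (simp add: algebra_simps exp_diff[symmetric])
      have key: "((1 - 1 / 2) / s + 1 / s\<^sup>2) * (y / X) - ((0 - 1 / 2) / s + 1 / s\<^sup>2) * y =
          (1 / 2 - 1 / s + 1 / (X - 1)) * (1 / s) * y - (1 / 2 - 1 / s + 1 / (X - 1)) * (1 / s) * (y / X)"
        if "X \<noteq> 0" "X - 1 \<noteq> 0" for X y :: real
      proof -
        have "1 / (X - 1) - 1 / (X - 1) / X = 1 / X" using that by (simp add: divide_simps)
        then have "y / s * (1 / (X - 1) - 1 / (X - 1) / X) = y / s * (1 / X)" by simp
        then show ?thesis by (simp add: algebra_simps power2_eq_square)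
      qed
      show ?thesis unfolding e phi_def add_0_right by (rule key) (use True in simp_all)
    qed
    finally show ?thesis using True by (simp add: f_def mult_ac)
  qed (simp add: f_def)
  have "(LINT \<theta>|lborel. LINT s|lborel. f s \<theta>) = (LINT s|lborel. LINT \<theta>|lborel. f s \<theta>)"
    by (rule lborel_pair.Fubini_integral[OF int])
  then have "(w + 1 / 2) * ln ((w + 1) / w) - 1 =
     (LINT s:{0<..}|lborel. phi s * exp (- (s * w)) - phi s * exp (- (s * (w + 1))))"
    unfolding inner1 inner2 outer1 set_lebesgue_integral_def .
  also have "\<dots> = binet w - binet (w + 1)"
    unfolding binet_def using w by (intro set_integral_diff set_integrable_phi_exp) auto
  finally show ?thesis ..
qed

text \<open>The defect in Binet's formula. It has period \<open>1\<close> by the functional equation of \<open>\<Gamma>\<close>, it is constant by the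
asymptotics of \<open>\<Gamma>(w + n)\<close>, and the duplication formula forces the constant to be \<open>0\<close>.\<close>

definition stirling_rem :: "real \<Rightarrow> real" where
  "stirling_rem w = ln_Gamma w - ((w - 1 / 2) * ln w - w + ln (2 * pi) / 2) - binet w"

lemma stirling_rem_plus_one: "0 < w \<Longrightarrow> stirling_rem (w + 1) = stirling_rem w"
proof -
  assume w: "0 < w"
  have "w \<notin> \<int>\<^sub>\<le>\<^sub>0" using w by (auto elim!: nonpos_Ints_cases)
  then have "ln_Gamma (w + 1) = ln w + ln_Gamma w"
    using w Gamma_plus1[of w] Gamma_real_pos[OF w] ln_mult_pos[of w "Gamma w"] by (simp add: ln_Gamma_real_pos)
  moreover have "binet w - binet (w + 1) = (w + 1 / 2) * (ln (w + 1) - ln w) - 1"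
    using binet_diff_one[OF w] w by (simp add: ln_div)
  ultimately show ?thesis unfolding stirling_rem_def by (simp add: algebra_simps)
qed

lemma stirling_rem_plus_nat: "0 < w \<Longrightarrow> stirling_rem (w + real n) = stirling_rem w"
proof (induction n)
  case (Suc n)
  then show ?case using stirling_rem_plus_one[of "w + real n"] by (simp add: add_ac)
qed simp

lemma binet_tendsto_0:
  assumes "filterlim f at_top F"
  shows "((\<lambda>n. binet (f n)) \<longlongrightarrow> 0) F"
proof (rule Lim_null_comparison)
  show "\<forall>\<^sub>F n in F. norm (binet (f n)) \<le> 1 / f n"
    using filterlim_at_top_dense[THEN iffD1, OF assms, rule_format, of 0]
    by eventually_elim (auto intro: binet_bound)
  show "((\<lambda>n. 1 / f n) \<longlongrightarrow> 0) F"
    using assms by (intro tendsto_divide_0[OF tendsto_const] filterlim_at_top_imp_at_infinity)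
qed

lemma ln_Gamma_plus_nat_LIMSEQ:
  fixes w :: real
  assumes w: "0 < w"
  shows "(\<lambda>n. ln_Gamma (real n) + w * ln (real n) - ln_Gamma (w + real n)) \<longlonglongrightarrow> 0"
proof -
  have nn: "w \<notin> \<int>\<^sub>\<le>\<^sub>0" using w by (auto elim!: nonpos_Ints_cases)
  have G: "0 < Gamma w" by (rule Gamma_real_pos) fact
  have "(\<lambda>n. Gamma_series' w n / Gamma w) \<longlonglongrightarrow> Gamma w / Gamma w"
    using G by (intro tendsto_divide Gamma_series'_LIMSEQ) auto
  then have "(\<lambda>n. ln (Gamma_series' w n / Gamma w)) \<longlonglongrightarrow> ln 1"
    using G by (intro tendsto_ln) auto
  moreover have "eventually (\<lambda>n. ln (Gamma_series' w n / Gamma w) = ln_Gamma (real n) + w * ln (real n) - ln_Gamma (w + real n)) sequentially"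
    using eventually_gt_at_top[of 0]
  proof eventually_elim
    case (elim n)
    have p: "0 < Gamma (real n)" "0 < Gamma (w + real n)" using elim w by (auto intro!: Gamma_real_pos)
    have "Gamma_series' w n / Gamma w = Gamma (real n) * exp (w * ln (real n)) / Gamma (w + real n)"
      using Gamma_fact[of "n - 1", where 'a = real] elim G pochhammer_Gamma[OF nn, of n] by (simp add: Gamma_series'_def of_nat_diff)
    moreover have "Gamma (real n) \<noteq> 0" "Gamma (w + real n) \<noteq> 0" using p by linarith+
    ultimately show ?case using elim w by (simp add: ln_div ln_mult ln_Gamma_real_pos)
  qed
  ultimately show ?thesis by (simp add: tendsto_cong)
qed

text \<open>By periodicity the difference can be evaluated at \<open>w + n\<close> and \<open>1 + n\<close>, where Euler's limit and elementary
asymptotics show that it tends to \<open>0\<close>.\<close>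

lemma stirling_rem_const:
  assumes w: "0 < w"
  shows "stirling_rem w = stirling_rem 1"
proof -
  let ?g = "\<lambda>w n. ln_Gamma (real n) + w * ln (real n) - ln_Gamma (w + real n)"
  let ?e = "\<lambda>n. ((w + real n - 1 / 2) * ln (w + real n) - (w + real n)) -
       ((1 + real n - 1 / 2) * ln (1 + real n) - (1 + real n)) - (w - 1) * ln (real n)"
  let ?b = "\<lambda>n. binet (w + real n) - binet (1 + real n)"
  have top: "filterlim (\<lambda>n. a + real n) at_top sequentially" for a
    by (intro filterlim_tendsto_add_at_top[OF tendsto_const] filterlim_real_sequentially)
  have e: "?e \<longlonglongrightarrow> 0" using w by real_asymp
  have b: "?b \<longlonglongrightarrow> 0 - 0" by (intro tendsto_diff binet_tendsto_0 top)
  have "(\<lambda>n. ?g 1 n - ?g w n - ?e n - ?b n) \<longlonglongrightarrow> 0 - 0 - 0 - (0 - 0)"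
    by (rule tendsto_diff[OF tendsto_diff[OF tendsto_diff[OF ln_Gamma_plus_nat_LIMSEQ[OF zero_less_one] ln_Gamma_plus_nat_LIMSEQ[OF w]] e] b])
  also have "(\<lambda>n. ?g 1 n - ?g w n - ?e n - ?b n) = (\<lambda>n. stirling_rem w - stirling_rem 1)"
  proof
    fix n
    have "?g 1 n - ?g w n - ?e n - ?b n = stirling_rem (w + real n) - stirling_rem (1 + real n)"
      unfolding stirling_rem_def by (simp add: algebra_simps)
    then show "?g 1 n - ?g w n - ?e n - ?b n = stirling_rem w - stirling_rem 1"
      using stirling_rem_plus_nat[OF w, of n] stirling_rem_plus_nat[of 1 n] by simp
  qed
  finally show ?thesis by (simp add: LIMSEQ_const_iff)
qed

lemma ln_Gamma_duplication:
  fixes w :: real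
  assumes w: "0 < w"
  shows "ln_Gamma w + ln_Gamma (w + 1 / 2) = (1 - 2 * w) * ln 2 + ln pi / 2 + ln_Gamma (2 * w)"
proof -
  have nn: "complex_of_real w \<notin> \<int>\<^sub>\<le>\<^sub>0" "complex_of_real w + 1 / 2 \<notin> \<int>\<^sub>\<le>\<^sub>0"
    using w by (auto intro!: right_half_plane_not_nonpos_Int)
  have e: "complex_of_real w + 1 / 2 = of_real (w + 1 / 2)" "2 * complex_of_real w = of_real (2 * w)"
    "exp ((1 - 2 * complex_of_real w) * of_real (ln 2)) = of_real (exp ((1 - 2 * w) * ln 2))"
    by (simp_all flip: exp_of_real)
  have "complex_of_real (Gamma w * Gamma (w + 1 / 2)) = of_real (exp ((1 - 2 * w) * ln 2) * sqrt pi * Gamma (2 * w))"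
    using Gamma_legendre_duplication[OF nn, unfolded e(3), unfolded e(1,2) Gamma_complex_of_real] by (simp only: of_real_mult)
  then have "Gamma w * Gamma (w + 1 / 2) = exp ((1 - 2 * w) * ln 2) * sqrt pi * Gamma (2 * w)"
    by (simp only: of_real_eq_iff)
  then have "ln (Gamma w * Gamma (w + 1 / 2)) = ln (exp ((1 - 2 * w) * ln 2) * sqrt pi * Gamma (2 * w))" by (rule arg_cong)
  moreover have "0 < Gamma w" "0 < Gamma (w + 1 / 2)" "0 < Gamma (2 * w)" using w by (auto intro!: Gamma_real_pos)
  ultimately show ?thesis using w by (simp add: ln_mult ln_Gamma_real_pos ln_sqrt)
qed

text \<open>With \<open>C\<close> the constant value, Legendre's duplication formula at a large argument reads \<open>C + C - C = o(1)\<close>.\<close>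

lemma stirling_rem_eq_0: "0 < w \<Longrightarrow> stirling_rem w = 0"
proof -
  assume w: "0 < w"
  let ?e = "\<lambda>n. (1 - 2 * real (Suc n)) * ln 2 + ln pi / 2 -
     (((real (Suc n) - 1 / 2) * ln (real (Suc n)) - real (Suc n)) +
      ((real (Suc n) + 1 / 2 - 1 / 2) * ln (real (Suc n) + 1 / 2) - (real (Suc n) + 1 / 2)) -
      ((2 * real (Suc n) - 1 / 2) * ln (2 * real (Suc n)) - 2 * real (Suc n)) + ln (2 * pi) / 2)"
  let ?b = "\<lambda>n. binet (real (Suc n)) + binet (real (Suc n) + 1 / 2) - binet (2 * real (Suc n))"
  have "?e \<longlonglongrightarrow> ln pi / 2 + ln 2 / 2 - ln (2 * pi) / 2" by real_asymp
  moreover have "ln pi / 2 + ln 2 / 2 - ln (2 * pi) / 2 = 0" by (simp add: ln_mult)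
  ultimately have "?e \<longlonglongrightarrow> 0" by (simp only:)
  moreover have "?b \<longlonglongrightarrow> 0 + 0 - 0"
    by (intro tendsto_diff tendsto_add binet_tendsto_0) real_asymp+
  ultimately have "(\<lambda>n. ?e n - ?b n) \<longlonglongrightarrow> 0 - (0 + 0 - 0)" by (rule tendsto_diff)
  also have "(\<lambda>n. ?e n - ?b n) = (\<lambda>n. stirling_rem 1)"
  proof
    fix n
    have "stirling_rem 1 = stirling_rem (real (Suc n)) + stirling_rem (real (Suc n) + 1 / 2) - stirling_rem (2 * real (Suc n))"
      using stirling_rem_const[of "real (Suc n)"] stirling_rem_const[of "real (Suc n) + 1 / 2"] stirling_rem_const[of "2 * real (Suc n)"]
      by simp
    also have "\<dots> = ?e n - ?b n"
      using ln_Gamma_duplication[of "real (Suc n)"] unfolding stirling_rem_def by (simp del: of_nat_Suc)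
    finally show "?e n - ?b n = stirling_rem 1" ..
  qed
  finally have "stirling_rem 1 = 0" by (simp add: LIMSEQ_const_iff)
  then show ?thesis using stirling_rem_const[OF w] by simp
qed

theorem ln_Gamma_binet:
  "0 < w \<Longrightarrow> ln_Gamma w = (w - 1 / 2) * ln w - w + ln (2 * pi) / 2 + binet w"
  using stirling_rem_eq_0[of w] by (simp add: stirling_rem_def)

text \<open>Summing the integrands over \<open>k\<close> gives a geometric series, whence the denominator \<open>exp (s \<beta> / 2) - 1\<close> in \<open>Upsilon\<close>. Sum
and integral may be exchanged because the \<open>k\<close>-th term has norm \<open>O(1/k\<^sup>2)\<close>.\<close>

lemma binet_sum_LIMSEQ:
  assumes \<beta>: "0 < \<beta>" and z: "- \<beta> / 2 < z"
  shows "(\<lambda>n. \<Sum>k=1..n. binet (\<beta> / 2 * real k + z) - binet (\<beta> / 2 * real k)) \<longlonglongrightarrow>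
    (LINT s:{0<..}|lborel. phi s * (exp (- (s * z)) - 1) / (exp (s * \<beta> / 2) - 1))"
proof -
  define f where "f = (\<lambda>k s. indicator {0<..} s *\<^sub>R (phi s * (exp (- (s * (\<beta> / 2 * real (Suc k) + z))) - exp (- (s * (\<beta> / 2 * real (Suc k)))))))"
  have pos: "0 < \<beta> / 2 * real (Suc k)" "0 < \<beta> / 2 * real (Suc k) + z" for k
  proof -
    have "\<beta> / 2 * 1 \<le> \<beta> / 2 * real (Suc k)" using \<beta> by (intro mult_left_mono) auto
    then show "0 < \<beta> / 2 * real (Suc k)" "0 < \<beta> / 2 * real (Suc k) + z"
      using \<beta> z unfolding mult_1_right by linarith+
  qed
  have int: "integrable lborel (f k)" for k
    using phi_exp_diff(1)[OF pos(2)[of k] pos(1)[of k]] unfolding f_def set_integrable_def .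
  have f_eq: "f k s = indicator {0<..} s * (phi s * (exp (- (s * z)) - 1)) * exp (- (s * \<beta> / 2)) * exp (- (s * \<beta> / 2)) ^ k" for k s
  proof -
    have "exp (- (s * (\<beta> / 2 * real (Suc k)))) = exp (- (s * \<beta> / 2)) ^ Suc k"
      by (subst exp_of_nat_mult[symmetric]) (simp add: algebra_simps)
    moreover have "exp (- (s * (\<beta> / 2 * real (Suc k) + z))) = exp (- (s * (\<beta> / 2 * real (Suc k)))) * exp (- (s * z))"
      by (simp add: exp_add[symmetric] algebra_simps)
    ultimately show ?thesis unfolding f_def by (simp add: algebra_simps)
  qed
  have sm: "(\<lambda>k. f k s) sums (indicator {0<..} s *\<^sub>R (phi s * (exp (- (s * z)) - 1) / (exp (s * \<beta> / 2) - 1)))" for s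
  proof (cases "0 < s")
    case True
    define x where "x = exp (- (s * \<beta> / 2))"
    have x: "0 < x" "x < 1" unfolding x_def using True \<beta> by auto
    have "(\<lambda>k. x ^ k) sums (1 / (1 - x))" using x by (intro geometric_sums) auto
    then have "(\<lambda>k. (phi s * (exp (- (s * z)) - 1)) * x * x ^ k) sums ((phi s * (exp (- (s * z)) - 1)) * x * (1 / (1 - x)))"
      by (rule sums_mult)
    moreover have "(phi s * (exp (- (s * z)) - 1)) * x * (1 / (1 - x)) = phi s * (exp (- (s * z)) - 1) / (exp (s * \<beta> / 2) - 1)"
    proof -
      have e: "exp (s * \<beta> / 2) = 1 / x" by (simp add: x_def exp_minus field_simps)
      have "x * (1 / (1 - x)) = 1 / (1 / x - 1)" using x by (simp add: divide_simps)
      then show ?thesis unfolding e mult.assoc by simp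
    qed
    ultimately have "(\<lambda>k. (phi s * (exp (- (s * z)) - 1)) * x * x ^ k) sums (phi s * (exp (- (s * z)) - 1) / (exp (s * \<beta> / 2) - 1))"
      by (simp only:)
    then show ?thesis unfolding f_eq x_def[symmetric] using True by simp
  qed (simp add: f_eq)
  have "(\<lambda>k. LINT s|lborel. f k s) sums (LINT s|lborel. (\<Sum>k. f k s))"
  proof (rule sums_integral[OF int])
    show "AE s in lborel. summable (\<lambda>k. norm (f k s))"
    proof (rule AE_I2)
      fix s
      show "summable (\<lambda>k. norm (f k s))"
      proof (cases "0 < s")
        case True
        then have "summable (\<lambda>k. exp (- (s * \<beta> / 2)) ^ k)" using \<beta> by (intro summable_geometric) auto
        then have "summable (\<lambda>k. \<bar>indicator {0<..} s * (phi s * (exp (- (s * z)) - 1)) * exp (- (s * \<beta> / 2))\<bar> * exp (- (s * \<beta> / 2)) ^ k)"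
          by (rule summable_mult)
        then show ?thesis unfolding f_eq by (simp add: abs_mult)
      qed (simp add: f_eq)
    qed
    show "summable (\<lambda>k. LINT s|lborel. norm (f k s))"
    proof (rule summable_comparison_test')
      have "(\<lambda>k. 1 / (\<beta> / 2 * real (Suc k) + z) - 1 / (\<beta> / 2 * real (Suc k))) \<in> O(\<lambda>k. 1 / real k ^ 2)"
        using \<beta> by real_asymp
      then have "(\<lambda>k. \<bar>1 / (\<beta> / 2 * real (Suc k) + z) - 1 / (\<beta> / 2 * real (Suc k))\<bar>) \<in> O(\<lambda>k. 1 / real k ^ 2)"
        by (simp only: landau_o.big.abs_in_iff)
      moreover have "summable (\<lambda>k. norm (1 / real k ^ 2))"
        using inverse_power_summable[of 2, where 'a = real] by (simp add: inverse_eq_divide)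
      ultimately show "summable (\<lambda>k. \<bar>1 / (\<beta> / 2 * real (Suc k) + z) - 1 / (\<beta> / 2 * real (Suc k))\<bar>)"
        by (rule summable_comparison_test_bigo[rotated])
      fix k
      have "norm (f k s) = indicator {0<..} s *\<^sub>R \<bar>phi s * (exp (- (s * (\<beta> / 2 * real (Suc k) + z))) - exp (- (s * (\<beta> / 2 * real (Suc k)))))\<bar>" for s
        unfolding f_def by (simp add: indicator_def)
      then have "(LINT s|lborel. norm (f k s)) \<le> \<bar>1 / (\<beta> / 2 * real (Suc k) + z) - 1 / (\<beta> / 2 * real (Suc k))\<bar>"
        using phi_exp_diff(2)[OF pos(2)[of k] pos(1)[of k]] unfolding set_lebesgue_integral_def by (simp only:)
      moreover have "0 \<le> (LINT s|lborel. norm (f k s))" by (intro Bochner_Integration.integral_nonneg) simp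
      ultimately show "norm (LINT s|lborel. norm (f k s)) \<le> \<bar>1 / (\<beta> / 2 * real (Suc k) + z) - 1 / (\<beta> / 2 * real (Suc k))\<bar>" by simp
    qed
  qed
  also have "(LINT s|lborel. (\<Sum>k. f k s)) = (LINT s:{0<..}|lborel. phi s * (exp (- (s * z)) - 1) / (exp (s * \<beta> / 2) - 1))"
    unfolding set_lebesgue_integral_def using sums_unique[OF sm] by simp
  also have "(\<lambda>k. LINT s|lborel. f k s) = (\<lambda>k. binet (\<beta> / 2 * real (Suc k) + z) - binet (\<beta> / 2 * real (Suc k)))"
    using phi_exp_diff(3)[OF pos(2) pos(1)] unfolding f_def set_lebesgue_integral_def by (simp only:)
  finally show ?thesis unfolding sums_def One_nat_def sum.atLeast1_atMost_eq .
qed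

section \<open>Asymptotics of products of Gamma functions\<close>

definition ln_Gamma_sum :: "real \<Rightarrow> nat \<Rightarrow> real \<Rightarrow> real" where
  "ln_Gamma_sum \<beta> n z = (\<Sum>k=1..n. ln_Gamma (\<beta> / 2 * real k + z) - ln_Gamma (\<beta> / 2 * real k))"

text \<open>The derivative of the left side without absolute values is \<open>t\<^sup>2 / (1 + t)\<close>, at most \<open>2 x\<^sup>2\<close> for \<open>\<bar>t\<bar> \<le> \<bar>x\<bar> \<le> 1/2\<close>.\<close>

lemma abs_ln_one_plus_second_order_le:
  fixes x :: real
  assumes x: "\<bar>x\<bar> \<le> 1 / 2"
  shows "\<bar>ln (1 + x) - x + x\<^sup>2 / 2\<bar> \<le> 2 * \<bar>x\<bar> ^ 3"
proof -
  define h where "h = (\<lambda>t::real. ln (1 + t) - t + t\<^sup>2 / 2)"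
  have "norm (h x - h 0) \<le> 2 * x\<^sup>2 * norm (x - 0)"
  proof (rule field_differentiable_bound[of "{- \<bar>x\<bar>..\<bar>x\<bar>}"])
    fix t assume "t \<in> {- \<bar>x\<bar>..\<bar>x\<bar>}"
    then have t: "\<bar>t\<bar> \<le> \<bar>x\<bar>" "1 / 2 \<le> 1 + t" using x by auto
    have "(h has_real_derivative 1 / (1 + t) - 1 + t) (at t within {- \<bar>x\<bar>..\<bar>x\<bar>})"
      unfolding h_def using t by (auto intro!: derivative_eq_intros)
    also have "1 / (1 + t) - 1 + t = t\<^sup>2 / (1 + t)" using t by (simp add: field_simps power2_eq_square)
    finally show "(h has_real_derivative t\<^sup>2 / (1 + t)) (at t within {- \<bar>x\<bar>..\<bar>x\<bar>})" .
    have "t\<^sup>2 / (1 + t) \<le> x\<^sup>2 / (1 / 2)"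
      using t by (intro frac_le) (auto simp: abs_le_square_iff)
    then show "norm (t\<^sup>2 / (1 + t)) \<le> 2 * x\<^sup>2" using t by simp
  qed auto
  then show ?thesis unfolding h_def by (simp add: power3_eq_cube power2_eq_square abs_mult)
qed

text \<open>The partial products of Barnes' function, with the factors \<open>1 + 1/j\<close> telescoped to \<open>n + 1\<close>. Their logarithms
\<open>g j\<close> are \<open>O(1/j\<^sup>2)\<close>, because the expansion of \<open>j ln (1 + w/j)\<close> up to order \<open>1/j\<close> cancels against the other two terms.\<close>

lemma barnes_G_LIMSEQ:
  assumes w: "-1 < w"
  shows "(\<lambda>n. (\<Sum>k=1..n. real k * ln (1 + w / real k)) + w\<^sup>2 / 2 * ln (real n) - real n * w) \<longlonglongrightarrow>
     ln (barnes_G (w + 1)) - w / 2 * ln (2 * pi) + (w + 1) * w / 2"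
proof -
  define g where "g = (\<lambda>i. real (Suc i) * ln (1 + w / real (Suc i)) + w\<^sup>2 / 2 * ln (1 + 1 / real (Suc i)) - w)"
  have pos: "0 < 1 + w / real (Suc i)" for i
  proof -
    have "0 < real (Suc i) + w" using w by simp
    then show ?thesis by (simp add: field_simps)
  qed
  have "(\<lambda>i. real (Suc i) * ln (1 + w / real (Suc i)) - w + w\<^sup>2 / 2 * (1 / real (Suc i))) \<in> O(\<lambda>i. 1 / real i ^ 2)"
  proof (rule bigoI)
    have "eventually (\<lambda>i. \<bar>w\<bar> / real (Suc i) \<le> 1 / 2) sequentially" by real_asymp
    then show "eventually (\<lambda>i. norm (real (Suc i) * ln (1 + w / real (Suc i)) - w + w\<^sup>2 / 2 * (1 / real (Suc i))) \<le>
        2 * \<bar>w\<bar> ^ 3 * norm (1 / real i ^ 2)) sequentially"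
      using eventually_gt_at_top[of 0]
    proof eventually_elim
      case (elim i)
      define j where "j = real (Suc i)"
      have j: "0 < j" "real i \<le> j" unfolding j_def by auto
      have "real (Suc i) * ln (1 + w / real (Suc i)) - w + w\<^sup>2 / 2 * (1 / real (Suc i)) =
          j * (ln (1 + w / j) - w / j + (w / j)\<^sup>2 / 2)"
        unfolding j_def[symmetric] using j by (simp add: field_simps power2_eq_square)
      also have "norm \<dots> \<le> j * (2 * \<bar>w / j\<bar> ^ 3)"
        unfolding real_norm_def abs_mult using j elim
        by (intro mult_mono abs_ln_one_plus_second_order_le) (auto simp: j_def abs_divide)
      also have "\<dots> = 2 * \<bar>w\<bar> ^ 3 * (1 / j ^ 2)"
        using j by (simp add: field_simps power2_eq_square power3_eq_cube)
      also have "\<dots> \<le> 2 * \<bar>w\<bar> ^ 3 * (1 / real i ^ 2)"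
        using j elim by (intro mult_left_mono divide_left_mono power_mono mult_pos_pos) auto
      finally show ?case by simp
    qed
  qed
  moreover have "(\<lambda>i. w\<^sup>2 / 2 * (ln (1 + 1 / real (Suc i)) - 1 / real (Suc i))) \<in> O(\<lambda>i. 1 / real i ^ 2)"
  proof -
    have "(\<lambda>i. ln (1 + 1 / real (Suc i)) - 1 / real (Suc i)) \<in> O(\<lambda>i. 1 / real i ^ 2)" by real_asymp
    then show ?thesis by simp
  qed
  ultimately have "(\<lambda>i. (real (Suc i) * ln (1 + w / real (Suc i)) - w + w\<^sup>2 / 2 * (1 / real (Suc i))) +
      w\<^sup>2 / 2 * (ln (1 + 1 / real (Suc i)) - 1 / real (Suc i))) \<in> O(\<lambda>i. 1 / real i ^ 2)"
    by (rule sum_in_bigo)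
  then have "g \<in> O(\<lambda>i. 1 / real i ^ 2)" unfolding g_def by (simp add: algebra_simps)
  moreover have "summable (\<lambda>k. norm (1 / real k ^ 2))"
    using inverse_power_summable[of 2, where 'a = real] by (simp add: inverse_eq_divide)
  ultimately have "summable g" by (rule summable_comparison_test_bigo[rotated])
  then obtain L where L: "g sums L" by (auto simp: summable_def)
  define f where "f = (\<lambda>i. (1 + w / real (Suc i)) ^ Suc i * (1 + 1 / real (Suc i)) powr (w\<^sup>2 / 2) * exp (- w))"
  have f: "f i = exp (g i)" for i
  proof -
    have "exp (g i) = exp (real (Suc i) * ln (1 + w / real (Suc i))) * exp (w\<^sup>2 / 2 * ln (1 + 1 / real (Suc i))) * exp (- w)"
      unfolding g_def by (simp only: exp_add diff_conv_add_uminus)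
    also have "exp (real (Suc i) * ln (1 + w / real (Suc i))) = (1 + w / real (Suc i)) ^ Suc i"
      using pos[of i] by (simp only: exp_of_nat_mult exp_ln)
    also have "exp (w\<^sup>2 / 2 * ln (1 + 1 / real (Suc i))) = (1 + 1 / real (Suc i)) powr (w\<^sup>2 / 2)"
    proof -
      have "0 < 1 + 1 / real (Suc i)" by (intro add_pos_nonneg) auto
      then show ?thesis unfolding powr_def by simp
    qed
    finally show ?thesis unfolding f_def ..
  qed
  have "(\<lambda>n. \<Sum>i\<le>n. g i) \<longlonglongrightarrow> L" using L by (simp add: sums_def_le)
  then have "(\<lambda>n. exp (\<Sum>i\<le>n. g i)) \<longlonglongrightarrow> exp L" by (rule tendsto_exp)
  then have "raw_has_prod f 0 (exp L)" unfolding raw_has_prod_def f by (simp add: exp_sum)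
  then have "f has_prod exp L" unfolding has_prod_def by blast
  then have P: "prodinf f = exp L" by (rule has_prod_unique[symmetric])
  have "barnes_G (w + 1) = (2 * pi) powr (w / 2) * exp (- ((w + 1) * w / 2)) * exp L"
    unfolding barnes_G_def Let_def add_diff_cancel_right' P[symmetric] f_def ..
  then have lnG: "ln (barnes_G (w + 1)) = w / 2 * ln (2 * pi) - (w + 1) * w / 2 + L"
    by (simp add: ln_mult ln_powr)
  have sum: "(\<Sum>i<n. g i) = (\<Sum>k=1..n. real k * ln (1 + w / real k)) + w\<^sup>2 / 2 * ln (real (Suc n)) - real n * w" for n
  proof (induction n)
    case (Suc n)
    have "1 + 1 / real (Suc n) = real (Suc (Suc n)) / real (Suc n)" by (simp add: field_simps)
    then have l: "ln (1 + 1 / real (Suc n)) = ln (real (Suc (Suc n))) - ln (real (Suc n))"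
      by (simp add: ln_div del: of_nat_Suc)
    have r: "real (Suc n) * w = real n * w + w" by (simp add: algebra_simps)
    show ?case unfolding sum.lessThan_Suc Suc r unfolding g_def l
      by (simp add: algebra_simps del: of_nat_Suc)
  qed simp
  have "(\<lambda>n. (\<Sum>i<n. g i) + w\<^sup>2 / 2 * (ln (real n) - ln (real (Suc n)))) \<longlonglongrightarrow> L + w\<^sup>2 / 2 * 0"
  proof (intro tendsto_add tendsto_mult tendsto_const)
    show "(\<lambda>n. \<Sum>i<n. g i) \<longlonglongrightarrow> L" using L by (simp add: sums_def)
    show "(\<lambda>n. ln (real n) - ln (real (Suc n))) \<longlonglongrightarrow> 0" by real_asymp
  qed
  also have "(\<lambda>n. (\<Sum>i<n. g i) + w\<^sup>2 / 2 * (ln (real n) - ln (real (Suc n)))) =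
     (\<lambda>n. (\<Sum>k=1..n. real k * ln (1 + w / real k)) + w\<^sup>2 / 2 * ln (real n) - real n * w)"
    unfolding sum by (rule ext) (simp add: field_simps del: of_nat_Suc)
  also have "L + w\<^sup>2 / 2 * 0 = ln (barnes_G (w + 1)) - w / 2 * ln (2 * pi) + (w + 1) * w / 2"
    unfolding lnG by simp
  finally show ?thesis .
qed

lemma Gamma_product_LIMSEQ:
  fixes w :: real
  assumes w: "-1 < w"
  shows "(\<lambda>n. (\<Sum>k=1..n. ln (1 + w / real k)) - w * ln (real n)) \<longlonglongrightarrow> - ln (Gamma (w + 1))"
proof -
  have w1: "0 < w + 1" using w by simp
  have G: "0 < Gamma (w + 1)" by (rule Gamma_real_pos[OF w1])
  have pos: "0 < 1 + w / real k" if "1 \<le> k" for k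
  proof -
    have "0 < real k + w" using w that by linarith
    then show ?thesis using that by (simp add: field_simps)
  qed
  have "(\<lambda>n. - ln (Gamma_series' (w + 1) n)) \<longlonglongrightarrow> - ln (Gamma (w + 1))"
    using G by (intro tendsto_minus tendsto_ln Gamma_series'_LIMSEQ) auto
  moreover have "eventually (\<lambda>n. - ln (Gamma_series' (w + 1) n) = (\<Sum>k=1..n. ln (1 + w / real k)) - w * ln (real n)) sequentially"
    using eventually_gt_at_top[of 0]
  proof eventually_elim
    case (elim n)
    have p: "pochhammer (w + 1) n = fact n * (\<Prod>k=1..n. 1 + w / real k)" for n
    proof (induction n)
      case (Suc n)
      have "pochhammer (w + 1) (Suc n) = pochhammer (w + 1) n * (w + 1 + real n)" by (rule pochhammer_Suc)
      also have "w + 1 + real n = real (Suc n) * (1 + w / real (Suc n))" by (simp add: field_simps)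
      finally show ?case using Suc by simp
    qed simp
    define P where "P = (\<Prod>k=1..n. 1 + w / real k)"
    have P: "0 < P" unfolding P_def using pos by (intro prod_pos) auto
    have lnP: "ln P = (\<Sum>k=1..n. ln (1 + w / real k))"
      unfolding P_def using pos by (intro ln_prod) (auto simp: less_imp_neq[symmetric])
    have fact: "fact n = real n * fact (n - 1)" using elim by (rule fact_reduce)
    have "exp ((w + 1) * ln (real n)) = real n * exp (w * ln (real n))"
      using elim by (simp add: distrib_right exp_add)
    then have "Gamma_series' (w + 1) n = exp (w * ln (real n)) / P"
      unfolding Gamma_series'_def p P_def[symmetric] fact using elim by simp
    then show ?case using P lnP by (simp add: ln_div)
  qed
  ultimately show ?thesis by (simp add: tendsto_cong)
qed

lemma ln_fact_LIMSEQ: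
  "(\<lambda>n. (\<Sum>k=1..n. ln (real k)) - (real n * ln (real n) - real n + ln (real n) / 2)) \<longlonglongrightarrow> ln (2 * pi) / 2"
proof -
  have "(\<lambda>n. ln (2 * pi) / 2 + binet (real n)) \<longlonglongrightarrow> ln (2 * pi) / 2 + 0"
    by (intro tendsto_add tendsto_const binet_tendsto_0 filterlim_real_sequentially)
  moreover have "eventually (\<lambda>n. ln (2 * pi) / 2 + binet (real n) =
      (\<Sum>k=1..n. ln (real k)) - (real n * ln (real n) - real n + ln (real n) / 2)) sequentially"
    using eventually_gt_at_top[of 0]
  proof eventually_elim
    case (elim n)
    have sum: "(\<Sum>k=1..n. ln (real k)) = ln (fact n)"
    proof -
      have "fact n = (\<Prod>k=1..n. real k)" by (simp add: fact_prod)
      then show ?thesis using ln_prod[of "{1..n}" real] by simp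
    qed
    have "ln (fact n) = ln (real n) + ln_Gamma (real n)"
      using elim by (simp add: ln_Gamma_real_conv_fact fact_reduce[of n] ln_mult)
    then show ?case using ln_Gamma_binet[of "real n"] elim unfolding sum by (simp add: algebra_simps)
  qed
  ultimately show ?thesis by (simp add: tendsto_cong)
qed

text \<open>Binet's formula splits every summand into an elementary part and a difference of \<open>binet\<close>. With \<open>w = 2 z / \<beta>\<close> the
elementary parts add up to \<open>\<beta>/2\<close> times the sum for Barnes' function, \<open>z - 1/2\<close> times the sum for \<open>\<Gamma>(w + 1)\<close>, and \<open>z\<close> times
\<open>ln n!\<close>; their constants are the terms of \<open>Upsilon\<close>.\<close>

theorem ln_Gamma_sum_LIMSEQ:
  assumes \<beta>: "0 < \<beta>" and z: "- \<beta> / 2 < z"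
  shows "(\<lambda>n. ln_Gamma_sum \<beta> n z - (real n * z * ln (\<beta> / 2) - real n * z + z * real n * ln (real n)
      + (z\<^sup>2 / \<beta> + (1 / 2 - 1 / \<beta>) * z) * ln (real n))) \<longlonglongrightarrow> Upsilon \<beta> z"
proof -
  define w where "w = 2 * z / \<beta>"
  have w: "-1 < w" unfolding w_def using \<beta> z by (simp add: field_simps)
  have zw: "z = \<beta> / 2 * w" unfolding w_def using \<beta> by simp
  define A where "A = (\<lambda>n. \<Sum>k=1..n. real k * ln (1 + w / real k))"
  define B where "B = (\<lambda>n. \<Sum>k=1..n. ln (1 + w / real k))"
  define C where "C = (\<lambda>n. \<Sum>k=1..n. ln (real k))"
  define I where "I = (\<lambda>n. \<Sum>k=1..n. binet (\<beta> / 2 * real k + z) - binet (\<beta> / 2 * real k))"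
  have trm: "ln_Gamma (\<beta> / 2 * real k + z) - ln_Gamma (\<beta> / 2 * real k) =
      (z * ln (\<beta> / 2) - z) + \<beta> / 2 * (real k * ln (1 + w / real k)) + (z - 1 / 2) * ln (1 + w / real k)
      + z * ln (real k) + (binet (\<beta> / 2 * real k + z) - binet (\<beta> / 2 * real k))" if k: "1 \<le> k" for k
  proof -
    have kw: "0 < real k + w" using k w by linarith
    have eq: "\<beta> / 2 * real k + z = \<beta> / 2 * (real k * (1 + w / real k))" using k by (simp add: zw field_simps)
    have p1: "0 < 1 + w / real k" using kw k by (simp add: field_simps)
    have p: "0 < \<beta> / 2 * real k" "0 < \<beta> / 2 * real k + z"
      unfolding eq using \<beta> k p1 by (auto intro!: mult_pos_pos divide_pos_pos)
    have l1: "ln (\<beta> / 2 * real k + z) = ln (\<beta> / 2) + (ln (real k) + ln (1 + w / real k))"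
      unfolding eq using \<beta> k p1 by (subst ln_mult_pos, simp, simp)+ simp
    have l2: "ln (\<beta> / 2 * real k) = ln (\<beta> / 2) + ln (real k)"
      using \<beta> k by (subst ln_mult_pos) auto
    show ?thesis unfolding ln_Gamma_binet[OF p(1)] ln_Gamma_binet[OF p(2)] l1 l2 by (simp add: algebra_simps)
  qed
  have S: "ln_Gamma_sum \<beta> n z = real n * (z * ln (\<beta> / 2) - z) + \<beta> / 2 * A n + (z - 1 / 2) * B n + z * C n + I n" for n
  proof -
    have "ln_Gamma_sum \<beta> n z = (\<Sum>k=1..n. (z * ln (\<beta> / 2) - z) + \<beta> / 2 * (real k * ln (1 + w / real k)) + (z - 1 / 2) * ln (1 + w / real k)
      + z * ln (real k) + (binet (\<beta> / 2 * real k + z) - binet (\<beta> / 2 * real k)))"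
      unfolding ln_Gamma_sum_def by (intro sum.cong refl trm) simp
    also have "\<dots> = real n * (z * ln (\<beta> / 2) - z) + \<beta> / 2 * A n + (z - 1 / 2) * B n + z * C n + I n"
      unfolding A_def B_def C_def I_def sum.distrib sum_distrib_left by simp
    finally show ?thesis .
  qed
  have eq: "ln_Gamma_sum \<beta> n z - (real n * z * ln (\<beta> / 2) - real n * z + z * real n * ln (real n)
      + (z\<^sup>2 / \<beta> + (1 / 2 - 1 / \<beta>) * z) * ln (real n)) =
     \<beta> / 2 * (A n + w\<^sup>2 / 2 * ln (real n) - real n * w) + (z - 1 / 2) * (B n - w * ln (real n))
     + z * (C n - (real n * ln (real n) - real n + ln (real n) / 2)) + I n" for n
    unfolding S using \<beta> by (simp add: zw field_simps power2_eq_square)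
  have lim: "(\<lambda>n. \<beta> / 2 * (A n + w\<^sup>2 / 2 * ln (real n) - real n * w) + (z - 1 / 2) * (B n - w * ln (real n))
     + z * (C n - (real n * ln (real n) - real n + ln (real n) / 2)) + I n) \<longlonglongrightarrow>
     \<beta> / 2 * (ln (barnes_G (w + 1)) - w / 2 * ln (2 * pi) + (w + 1) * w / 2) + (z - 1 / 2) * (- ln (Gamma (w + 1)))
     + z * (ln (2 * pi) / 2) + (LINT s:{0<..}|lborel. phi s * (exp (- (s * z)) - 1) / (exp (s * \<beta> / 2) - 1))"
    unfolding A_def B_def C_def I_def
    by (intro tendsto_add[OF tendsto_add[OF tendsto_add]] tendsto_mult[OF tendsto_const] barnes_G_LIMSEQ[OF w]
      Gamma_product_LIMSEQ[OF w] ln_fact_LIMSEQ binet_sum_LIMSEQ[OF \<beta> z])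
  have "\<beta> / 2 * (ln (barnes_G (w + 1)) - w / 2 * ln (2 * pi) + (w + 1) * w / 2) + (z - 1 / 2) * (- ln (Gamma (w + 1)))
     + z * (ln (2 * pi) / 2) + (LINT s:{0<..}|lborel. phi s * (exp (- (s * z)) - 1) / (exp (s * \<beta> / 2) - 1)) = Upsilon \<beta> z"
  proof -
    have "\<beta> / 2 * ((w + 1) * w / 2) = z\<^sup>2 / \<beta> + z / 2" "\<beta> / 2 * (w / 2 * ln (2 * pi)) = z * (ln (2 * pi) / 2)"
      unfolding zw using \<beta> by (auto simp: field_simps power2_eq_square)
    then show ?thesis unfolding Upsilon_def w_def[symmetric] distrib_left right_diff_distrib by linarith
  qed
  with lim show ?thesis unfolding eq by simp
qed

text \<open>The error of Stirling's formula must be \<open>o(1/n)\<close> here, so it does not suffice that \<open>binet\<close> tends to \<open>0\<close>: the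
difference of the two values is of order \<open>1/n\<^sup>2\<close>.\<close>

lemma Gram_denominator_LIMSEQ:
  assumes \<beta>: "0 < \<beta>" and z: "- \<beta> / 2 < z"
  shows "(\<lambda>n. real n * (ln_Gamma (\<beta> / 2 * real n + z) - ln_Gamma (\<beta> / 2 * real n)) - real n * z * ln (\<beta> / 2 * real n))
    \<longlonglongrightarrow> (z\<^sup>2 - z) / \<beta>"
proof -
  let ?W = "\<lambda>n. \<beta> / 2 * real n"
  let ?e = "\<lambda>n. real n * ((?W n + z - 1 / 2) * ln (?W n + z) - (?W n - 1 / 2) * ln (?W n) - z) - real n * z * ln (?W n)"
  let ?b = "\<lambda>n. real n * (binet (?W n + z) - binet (?W n))"
  have pos: "eventually (\<lambda>n. 0 < ?W n \<and> 0 < ?W n + z) sequentially"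
    using \<beta> by (intro eventually_conj) real_asymp+
  have "?b \<longlonglongrightarrow> 0"
  proof (rule Lim_null_comparison)
    show "eventually (\<lambda>n. norm (?b n) \<le> real n * \<bar>1 / (?W n + z) - 1 / ?W n\<bar>) sequentially"
      using pos
    proof eventually_elim
      case (elim n)
      then have "\<bar>binet (?W n + z) - binet (?W n)\<bar> \<le> \<bar>1 / (?W n + z) - 1 / ?W n\<bar>" by (intro binet_diff_bound) auto
      then show ?case unfolding real_norm_def abs_mult abs_of_nat by (rule mult_left_mono) simp
    qed
    have "(\<lambda>n. real n * (1 / (?W n + z) - 1 / ?W n)) \<longlonglongrightarrow> 0" using \<beta> by real_asymp
    from tendsto_rabs[OF this] show "(\<lambda>n. real n * \<bar>1 / (?W n + z) - 1 / ?W n\<bar>) \<longlonglongrightarrow> 0"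
      by (simp only: abs_mult abs_of_nat abs_0)
  qed
  moreover have "?e \<longlonglongrightarrow> (z\<^sup>2 - z) / \<beta>"
    using \<beta> by (real_asymp simp: field_simps power2_eq_square)
  ultimately have "(\<lambda>n. ?e n + ?b n) \<longlonglongrightarrow> (z\<^sup>2 - z) / \<beta> + 0" by (intro tendsto_add)
  then have l: "(\<lambda>n. ?e n + ?b n) \<longlonglongrightarrow> (z\<^sup>2 - z) / \<beta>" by (simp only: add_0_right)
  have "eventually (\<lambda>n. ?e n + ?b n = real n * (ln_Gamma (?W n + z) - ln_Gamma (?W n)) - real n * z * ln (?W n)) sequentially"
    using pos by eventually_elim (auto simp: ln_Gamma_binet algebra_simps)
  then show ?thesis by (rule Lim_transform_eventually[OF l])
qed

section \<open>From characteristic functions to one-sided exponential integrals\<close>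

text \<open>The kernel of Levy's inversion formula, i.e. the Fourier transform of the indicator of the interval from \<open>a\<close> to
\<open>b\<close>.\<close>

definition interval_kernel :: "real \<Rightarrow> real \<Rightarrow> real \<Rightarrow> complex" where
  "interval_kernel a b u = (iexp (- (u * a)) - iexp (- (u * b))) / (\<i> * of_real u)"

lemma interval_kernel_measurable [measurable]: "interval_kernel a b \<in> borel_measurable borel"
  unfolding interval_kernel_def by measurable

lemma norm_interval_kernel_le:
  assumes "a \<le> b"
  shows "norm (interval_kernel a b u) \<le> b - a"
proof (cases "u = 0")
  case False
  have "norm (interval_kernel a b u) = norm ((iexp (u * (- a)) - iexp (u * (- b))) / (\<i> * of_real u))"
    by (simp add: interval_kernel_def)
  also have "\<dots> \<le> (- a) - (- b)" using assms False by (intro Levy_Inversion_aux2) auto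
  finally show ?thesis by simp
qed (use assms in \<open>simp add: interval_kernel_def\<close>)

context real_distribution
begin

lemma char_inversion:
  assumes int: "integrable lborel (char M)" and ab: "a \<le> b" and atoms: "prob {a} = 0" "prob {b} = 0"
  shows "complex_of_real (prob {a<..b}) = (CLBINT u. interval_kernel a b u * char M u) / (2 * pi)"
proof -
  let ?f = "\<lambda>u. interval_kernel a b u * char M u"
  have [measurable]: "char M \<in> borel_measurable borel" using int by auto
  have intf: "integrable lborel ?f"
  proof (rule Bochner_Integration.integrable_bound)
    show "integrable lborel (\<lambda>u. of_real (b - a) * char M u)" using int by simp
    show "AE u in lborel. norm (?f u) \<le> norm (of_real (b - a) * char M u)"
      using norm_interval_kernel_le[OF ab] ab by (intro AE_I2) (auto simp: norm_mult intro!: mult_right_mono simp del: of_real_diff)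
  qed measurable
  have eq: "(CLBINT t=-real T..real T. (iexp (- (t * a)) - iexp (- (t * b))) / (\<i> * t) * char M t) =
      (LINT u|lborel. indicator {- real T..real T} u *\<^sub>R ?f u)" for T
    by (subst interval_integral_Icc) (auto simp: set_lebesgue_integral_def interval_kernel_def)
  have "(\<lambda>T. LINT u|lborel. indicator {- real T..real T} u *\<^sub>R ?f u) \<longlonglongrightarrow> (LINT u|lborel. ?f u)"
  proof (rule integral_dominated_convergence[where w = "\<lambda>u. norm (?f u)"])
    have "(\<lambda>n. indicator {- real n..real n} u *\<^sub>R ?f u) \<longlonglongrightarrow> ?f u" for u
    proof (rule tendsto_eventually)
      have "eventually (\<lambda>n. \<bar>u\<bar> \<le> real n) sequentially"
        using filterlim_at_top filterlim_real_sequentially by blast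
      then show "eventually (\<lambda>n. indicator {- real n..real n} u *\<^sub>R ?f u = ?f u) sequentially"
        by eventually_elim (auto simp: indicator_def abs_le_iff)
    qed
    then show "AE u in lborel. (\<lambda>n. indicator {- real n..real n} u *\<^sub>R ?f u) \<longlonglongrightarrow> ?f u" by simp
  qed (use intf in \<open>auto simp: indicator_def\<close>)
  then have "(\<lambda>T. 1 / (2 * pi) * (CLBINT t=-real T..real T. (iexp (- (t * a)) - iexp (- (t * b))) / (\<i> * t) * char M t)) \<longlonglongrightarrow>
     1 / (2 * pi) * (LINT u|lborel. ?f u)"
    unfolding eq by (intro tendsto_mult tendsto_const)
  moreover have "real_of_int (- int T) = - real T" for T by simp
  ultimately have "complex_of_real (prob {a<..b}) = complex_of_real (1 / (2 * pi)) * (LINT u|lborel. ?f u)"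
    using LIMSEQ_unique[OF Levy_Inversion[OF ab atoms]] by (simp only: of_int_minus of_int_of_nat_eq)
  then show ?thesis by simp
qed

text \<open>Inversion is available between points that are not atoms, and these are dense since there are only countably
many atoms. It bounds the mass of a short interval around \<open>x\<close> by a constant times its length.\<close>

lemma no_atoms_if_char_integrable:
  assumes int: "integrable lborel (char M)"
  shows "prob {x} = 0"
proof (rule ccontr)
  assume "prob {x} \<noteq> 0"
  then have px: "0 < prob {x}" using measure_nonneg[of M "{x}"] by linarith
  define C where "C = (LINT u|lborel. norm (char M u))"
  have C: "0 \<le> C" unfolding C_def by (intro Bochner_Integration.integral_nonneg) simp
  \<comment> \<open>Half-width of an interval around \<open>x\<close> whose mass is at most \<open>2 d C\<close>, strictly less than \<open>prob {x}\<close>.\<close>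
  define d where "d = prob {x} / (2 * (C + 1))"
  have d: "0 < d" unfolding d_def using px C by simp
  have ex: "\<exists>y\<in>{s<..<r}. prob {y} = 0" if "s < r" for s r :: real
  proof (rule ccontr)
    assume "\<not> ?thesis"
    then have "{s<..<r} \<subseteq> {x. prob {x} \<noteq> 0}" by auto
    then have "countable {s<..<r}" using countable_support countable_subset by blast
    then show False using uncountable_open_interval[of s r] that by simp
  qed
  obtain a where a: "x - d < a" "a < x" "prob {a} = 0" using ex[of "x - d" x] d by auto
  obtain b where b: "x < b" "b < x + d" "prob {b} = 0" using ex[of x "x + d"] d by auto
  have ab: "a \<le> b" using a b by simp
  have [measurable]: "char M \<in> borel_measurable borel" using int by auto
  have "prob {x} \<le> prob {a<..b}" using a b by (intro finite_measure_mono) auto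
  also have "\<dots> = norm (complex_of_real (prob {a<..b}))" by simp
  also have "\<dots> = norm (CLBINT u. interval_kernel a b u * char M u) / (2 * pi)"
    unfolding char_inversion[OF int ab a(3) b(3)] by (simp add: norm_divide)
  also have "\<dots> \<le> (LINT u|lborel. (b - a) * norm (char M u)) / (2 * pi)"
  proof (intro divide_right_mono order_trans[OF integral_norm_bound integral_mono])
    have le: "norm (interval_kernel a b u * char M u) \<le> (b - a) * norm (char M u)" for u
      unfolding norm_mult by (intro mult_right_mono norm_interval_kernel_le ab) auto
    then show "norm (interval_kernel a b u * char M u) \<le> (b - a) * norm (char M u)" for u .
    show i: "integrable lborel (\<lambda>u. (b - a) * norm (char M u))" using int by simp
    show "integrable lborel (\<lambda>u. norm (interval_kernel a b u * char M u))"
      by (rule Bochner_Integration.integrable_bound[OF i]) (use le ab in \<open>auto intro!: AE_I2 simp: abs_mult\<close>)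
  qed auto
  also have "\<dots> = (b - a) * C / (2 * pi)" unfolding C_def by simp
  also have "\<dots> \<le> (b - a) * C / 1" using ab C pi_gt3 by (intro divide_left_mono) auto
  also have "\<dots> \<le> (2 * d) * C" using a b C by (intro order_trans[OF _ mult_right_mono[of "b - a" "2 * d" C]]) auto
  also have "\<dots> < (2 * d) * (C + 1)" using d by simp
  also have "\<dots> = prob {x}" unfolding d_def using C by (simp add: field_simps)
  finally show False by simp
qed

text \<open>Fubini's theorem with \<open>exp (- x z)\<close> written as the integral of \<open>x exp (- x y)\<close> over \<open>y \<ge> z\<close>. This reduces the integral
to masses of intervals, to which the inversion formula applies.\<close>

lemma laplace_half_line:
  assumes x: "0 < x"
  shows "(LINT z|M. indicator {0..} z * exp (- (x * z))) = (LINT y|lborel. indicator {0..} y * (x * exp (- (x * y)) * prob {0..y}))"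
proof -
  interpret L: sigma_finite_measure "lborel :: real measure" by (rule sigma_finite_lborel)
  interpret P: pair_sigma_finite M "lborel :: real measure" ..
  have inner: "(\<integral>\<^sup>+y. ennreal (indicator {0..} z * (indicator {z..} y * (x * exp (- (x * y))))) \<partial>lborel) =
      ennreal (indicator {0..} z * exp (- (x * z)))" for z
  proof -
    have "((\<lambda>y. exp (- x * y)) has_integral exp (- x * z) / x) {z..}"
      by (rule has_integral_exp_minus_to_infinity) fact
    then have "((\<lambda>y. x * exp (- (x * y))) has_integral x * (exp (- (x * z)) / x)) {z..}"
      using has_integral_mult_right[of "\<lambda>y. exp (- x * y)" "exp (- x * z) / x" "{z..}" x] by simp
    then have "(\<integral>\<^sup>+y. ennreal (indicator {z..} y * (x * exp (- (x * y)))) \<partial>lborel) = ennreal (x * (exp (- (x * z)) / x))"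
      using x by (intro nn_integral_has_integral_lebesgue) auto
    then show ?thesis using x by (cases "0 \<le> z") auto
  qed
  have "(\<integral>\<^sup>+z. ennreal (indicator {0..} z * exp (- (x * z))) \<partial>M) =
     (\<integral>\<^sup>+z. \<integral>\<^sup>+y. ennreal (indicator {0..} z * (indicator {z..} y * (x * exp (- (x * y))))) \<partial>lborel \<partial>M)"
    unfolding inner ..
  also have "\<dots> = (\<integral>\<^sup>+y. \<integral>\<^sup>+z. ennreal (indicator {0..} z * (indicator {z..} y * (x * exp (- (x * y))))) \<partial>M \<partial>lborel)"
  proof (rule P.Fubini'[symmetric])
    have "(\<lambda>(z, y). ennreal (indicator {0..} z * (indicator {z..} y * (x * exp (- (x * y)))))) =
      (\<lambda>(z, y). ennreal ((if 0 \<le> z \<and> z \<le> y then x * exp (- (x * y)) else 0)))"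
      by (auto simp: fun_eq_iff indicator_def)
    also have "\<dots> \<in> borel_measurable (M \<Otimes>\<^sub>M lborel)" by measurable
    finally show "(\<lambda>(z, y). ennreal (indicator {0..} z * (indicator {z..} y * (x * exp (- (x * y)))))) \<in> borel_measurable (M \<Otimes>\<^sub>M lborel)" .
  qed
  also have "\<dots> = (\<integral>\<^sup>+y. ennreal (indicator {0..} y * (x * exp (- (x * y)) * prob {0..y})) \<partial>lborel)"
  proof (rule nn_integral_cong)
    fix y
    have "(\<integral>\<^sup>+z. ennreal (indicator {0..} z * (indicator {z..} y * (x * exp (- (x * y))))) \<partial>M) =
      (\<integral>\<^sup>+z. ennreal (x * exp (- (x * y))) * indicator {0..y} z \<partial>M)"
      using x by (intro nn_integral_cong) (auto simp: indicator_def)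
    also have "\<dots> = ennreal (x * exp (- (x * y))) * emeasure M {0..y}"
      by (intro nn_integral_cmult_indicator) auto
    also have "\<dots> = ennreal (indicator {0..} y * (x * exp (- (x * y)) * prob {0..y}))"
      using x by (cases "0 \<le> y") (auto simp: emeasure_eq_measure ennreal_mult'[symmetric])
    finally show "(\<integral>\<^sup>+z. ennreal (indicator {0..} z * (indicator {z..} y * (x * exp (- (x * y))))) \<partial>M) =
      ennreal (indicator {0..} y * (x * exp (- (x * y)) * prob {0..y}))" .
  qed
  finally have nn: "(\<integral>\<^sup>+z. ennreal (indicator {0..} z * exp (- (x * z))) \<partial>M) =
    (\<integral>\<^sup>+y. ennreal (indicator {0..} y * (x * exp (- (x * y)) * prob {0..y})) \<partial>lborel)" .
  have [measurable]: "(\<lambda>y. prob {0..y}) \<in> borel_measurable lborel"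
  proof -
    have "mono (\<lambda>y. prob {0..y})" by (intro monoI finite_measure_mono) auto
    then show ?thesis using borel_measurable_mono by simp
  qed
  show ?thesis
    using x by (subst (1 2) integral_eq_nn_integral) (auto simp: nn measure_nonneg)
qed

end

lemma gaussian_integral: "(LINT v|lborel. exp (- v\<^sup>2 / 2)) = sqrt (2 * pi)"
proof -
  have "(LINT v|lborel. exp (- v\<^sup>2 / 2)) = (LINT v|lborel. sqrt (2 * pi) * std_normal_density v)"
    by (intro Bochner_Integration.integral_cong) (auto simp: std_normal_density_def)
  then show ?thesis by simp
qed

lemma gaussian_integrable: "integrable lborel (\<lambda>v::real. exp (- v\<^sup>2 / 4))"
proof -
  have "integrable lborel (\<lambda>v. sqrt (4 * pi) * normal_density 0 (sqrt 2) v)" by simp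
  then show ?thesis by (simp add: normal_density_def)
qed

lemma cauchy_integrable: "integrable lborel (\<lambda>v::real. 1 / (1 + v\<^sup>2))"
  using integrable_inverse_1_plus_square by (simp add: set_integrable_def einterval_def inverse_eq_divide)

text \<open>Rescale the inversion formula by \<open>u = v / sqrt t\<close>. The characteristic function then tends to \<open>exp (- v\<^sup>2 / 2)\<close> and the
kernel of a fixed interval to its length \<open>y\<close>, so \<open>sqrt (2 \<pi> t)\<close> times the mass of the interval tends to \<open>y\<close>. Dominated
convergence is used twice, in \<open>v\<close> and in \<open>y\<close>, with a bound for the mass that is linear in \<open>y\<close>.\<close>

theorem tilted_tail_LIMSEQ:
  fixes M :: "nat \<Rightarrow> real measure" and t m \<sigma> :: "nat \<Rightarrow> real"
  assumes M: "\<And>n. real_distribution (M n)"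
    and t: "filterlim t at_top sequentially" "\<And>n. 1 \<le> t n" "\<And>n. 6 * B \<le> t n" and B: "0 \<le> B"
    and m: "\<And>n. \<bar>m n\<bar> \<le> B" and \<sigma>: "\<And>n. \<bar>\<sigma> n - t n\<bar> \<le> B"
    and near: "\<And>n u. \<bar>u\<bar> \<le> 1 \<Longrightarrow> \<exists>R. char (M n) u = exp (\<i> * of_real (u * m n) - of_real (\<sigma> n * u\<^sup>2 / 2) + R) \<and> norm R \<le> B * \<bar>u\<bar> ^ 3"
    and far: "\<And>n u. 1 \<le> \<bar>u\<bar> \<Longrightarrow> norm (char (M n) u) \<le> C * exp (- c * t n) / (1 + u\<^sup>2)"
    and c: "0 < c" and x: "0 < x"
  shows "(\<lambda>n. sqrt (2 * pi * t n) * (LINT z|M n. indicator {0..} z * exp (- (x * z)))) \<longlonglongrightarrow> 1 / x"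
proof -
  have tpos: "0 < t n" for n using t(2)[of n] by linarith
  have C: "0 \<le> C"
  proof -
    have "0 \<le> C * exp (- c * t 0) / (1 + 1\<^sup>2)" using far[of 1 0] norm_ge_zero[of "char (M 0) 1"] by linarith
    then show ?thesis by (simp add: zero_le_mult_iff)
  qed
  \<comment> \<open>From \<open>t exp (- c t) \<le> 1 / c\<close>, after the far bound is rescaled.\<close>
  define C' where "C' = C / c"
  define w where "w = (\<lambda>v::real. exp (- v\<^sup>2 / 4) + C' * (1 / (1 + v\<^sup>2)))"
  have C': "0 \<le> C'" unfolding C'_def using C c by simp
  have w_nonneg: "0 \<le> w v" for v unfolding w_def using C' by (intro add_nonneg_nonneg) auto
  have w_int: "integrable lborel w"
    unfolding w_def by (intro Bochner_Integration.integrable_add gaussian_integrable integrable_mult_right cauchy_integrable)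
  have meas: "char (M n) \<in> borel_measurable borel" for n
  proof -
    interpret real_distribution "M n" by (rule M)
    show ?thesis by (rule char_measurable)
  qed
  note [measurable] = meas
  have bound: "norm (char (M n) (v / sqrt (t n))) \<le> w v" for n v
  proof (cases "\<bar>v / sqrt (t n)\<bar> \<le> 1")
    case True
    define u where "u = v / sqrt (t n)"
    have u: "\<bar>u\<bar> \<le> 1" and u2: "u\<^sup>2 * t n = v\<^sup>2" using True tpos[of n] by (auto simp: u_def power_divide)
    obtain R where R: "char (M n) u = exp (\<i> * of_real (u * m n) - of_real (\<sigma> n * u\<^sup>2 / 2) + R)" "norm R \<le> B * \<bar>u\<bar> ^ 3"
      using near[OF u] by blast
    have "norm (char (M n) u) = exp (Re R - \<sigma> n * u\<^sup>2 / 2)" unfolding R(1) norm_exp_eq_Re by simp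
    also have "\<dots> \<le> exp (- v\<^sup>2 / 4)"
    proof -
      have "\<bar>u\<bar> ^ 3 \<le> \<bar>u\<bar> ^ 2" using u by (intro power_decreasing) auto
      then have "B * \<bar>u\<bar> ^ 3 \<le> B * u\<^sup>2" using B by (intro mult_left_mono) auto
      then have "Re R \<le> B * u\<^sup>2" using R(2) complex_Re_le_cmod[of R] by linarith
      moreover have "(t n - B) * u\<^sup>2 \<le> \<sigma> n * u\<^sup>2" using \<sigma>[of n] by (intro mult_right_mono) auto
      moreover have "6 * B * u\<^sup>2 \<le> t n * u\<^sup>2" using t(3)[of n] by (intro mult_right_mono) auto
      ultimately have "Re R - \<sigma> n * u\<^sup>2 / 2 \<le> - (u\<^sup>2 * t n) / 4" by (simp add: algebra_simps)
      then show ?thesis unfolding u2 by simp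
    qed
    also have "\<dots> \<le> w v" unfolding w_def using C' by simp
    finally show ?thesis unfolding u_def .
  next
    case False
    define u where "u = v / sqrt (t n)"
    have u: "1 \<le> \<bar>u\<bar>" and u2: "u\<^sup>2 = v\<^sup>2 / t n" using False tpos[of n] by (auto simp: u_def power_divide)
    have "(1 + v\<^sup>2) / t n \<le> 1 + u\<^sup>2" unfolding u2 using t(2)[of n] by (simp add: add_divide_distrib)
    moreover have p: "0 < (1 + v\<^sup>2) / t n" using tpos[of n] by (intro divide_pos_pos) (auto intro: add_pos_nonneg)
    ultimately have "C * exp (- c * t n) / (1 + u\<^sup>2) \<le> C * exp (- c * t n) / ((1 + v\<^sup>2) / t n)"
      using C by (intro divide_left_mono mult_pos_pos[OF add_pos_nonneg p]) auto
    also have "\<dots> = C * (t n * exp (- c * t n)) / (1 + v\<^sup>2)" by simp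
    also have "\<dots> \<le> C * (1 / c) / (1 + v\<^sup>2)"
    proof (intro divide_right_mono mult_left_mono C)
      have "c * t n \<le> exp (c * t n)" using exp_ge_add_one_self[of "c * t n"] by linarith
      then show "t n * exp (- c * t n) \<le> 1 / c" using c by (simp add: exp_minus field_simps)
    qed (auto intro: add_nonneg_nonneg)
    finally have "norm (char (M n) u) \<le> C' * (1 / (1 + v\<^sup>2))"
      using far[OF u, of n] unfolding C'_def by simp
    then show ?thesis unfolding w_def u_def[symmetric] by (simp add: add_increasing)
  qed
  have char_int: "integrable lborel (char (M n))" for n
  proof -
    have s: "sqrt (t n) \<noteq> 0" using tpos[of n] by simp
    have "integrable lborel (\<lambda>v. char (M n) (0 + (1 / sqrt (t n)) * v))"
      by (rule Bochner_Integration.integrable_bound[OF w_int]) (use bound w_nonneg in \<open>auto intro!: AE_I2\<close>)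
    then show ?thesis using s by (subst (asm) lborel_integrable_real_affine_iff) auto
  qed
  define G where "G = (\<lambda>n y. LINT v|lborel. interval_kernel 0 y (v / sqrt (t n)) * char (M n) (v / sqrt (t n)))"
  have prob: "complex_of_real (sqrt (2 * pi * t n) * measure (M n) {0..y}) = G n y / sqrt (2 * pi)" if y: "0 \<le> y" for n y
  proof -
    interpret real_distribution "M n" by (rule M)
    have s: "0 < sqrt (t n)" using tpos[of n] by simp
    have "{0..y} = {0} \<union> {0<..y}" using y by auto
    then have "prob {0..y} = prob {0} + prob {0<..y}"
      using finite_measure_Union[of "{0}" "{0<..y}"] by (simp only:) auto
    then have p: "prob {0..y} = prob {0<..y}" using no_atoms_if_char_integrable[OF char_int] by simp
    have "(CLBINT u. interval_kernel 0 y u * char (M n) u) =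
      \<bar>1 / sqrt (t n)\<bar> *\<^sub>R (CLBINT v. interval_kernel 0 y (0 + (1 / sqrt (t n)) * v) * char (M n) (0 + (1 / sqrt (t n)) * v))"
      using s by (intro lborel_integral_real_affine) auto
    also have "\<dots> = G n y / sqrt (t n)" unfolding G_def using s by (simp add: scaleR_conv_of_real)
    finally have "complex_of_real (prob {0..y}) = G n y / sqrt (t n) / (2 * pi)"
      unfolding p using char_inversion[OF char_int y no_atoms_if_char_integrable[OF char_int] no_atoms_if_char_integrable[OF char_int]] by simp
    moreover have "complex_of_real (2 * pi) = of_real (sqrt (2 * pi)) * of_real (sqrt (2 * pi))"
      by (simp only: of_real_mult[symmetric] real_sqrt_mult_self) simp
    ultimately show ?thesis
      using s by (simp only: of_real_mult real_sqrt_mult[of "2 * pi"]) (simp add: divide_simps)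
  qed
  have G_le: "norm (G n y) \<le> y * (LINT v|lborel. w v)" if y: "0 \<le> y" for n y
  proof -
    have "norm (G n y) \<le> (LINT v|lborel. y * w v)"
      unfolding G_def
    proof (rule order_trans[OF integral_norm_bound integral_mono])
      have le: "norm (interval_kernel 0 y (v / sqrt (t n)) * char (M n) (v / sqrt (t n))) \<le> y * w v" for v
        unfolding norm_mult using norm_interval_kernel_le[OF y, of "v / sqrt (t n)"] bound y
        by (intro mult_mono) auto
      then show "norm (interval_kernel 0 y (v / sqrt (t n)) * char (M n) (v / sqrt (t n))) \<le> y * w v" for v .
      show i: "integrable lborel (\<lambda>v. y * w v)" using w_int by simp
      show "integrable lborel (\<lambda>v. norm (interval_kernel 0 y (v / sqrt (t n)) * char (M n) (v / sqrt (t n))))"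
        by (rule Bochner_Integration.integrable_bound[OF i]) (use le y w_nonneg in \<open>auto intro!: AE_I2 simp: abs_mult\<close>)
    qed
    then show ?thesis by simp
  qed
  have sqrt_top: "filterlim (\<lambda>n. sqrt (t n)) at_top sequentially"
    by (rule filterlim_compose[OF sqrt_at_top t(1)])
  have to0: "(\<lambda>n. a / sqrt (t n)) \<longlonglongrightarrow> 0" for a :: real
    by (intro tendsto_divide_0[OF tendsto_const] filterlim_at_top_imp_at_infinity sqrt_top)
  have G_lim: "(\<lambda>n. G n y) \<longlonglongrightarrow> of_real (y * sqrt (2 * pi))" if y: "0 \<le> y" for y
  proof -
    have "(\<lambda>n. G n y) \<longlonglongrightarrow> (LINT v|lborel. of_real y * of_real (exp (- v\<^sup>2 / 2)) :: complex)"
      unfolding G_def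
    \<comment> \<open>The kernel is at most the length \<open>y\<close> of the interval, and \<open>w\<close> bounds the rescaled characteristic function.\<close>
    proof (rule integral_dominated_convergence[where w = "\<lambda>v. y * w v"])
      show "integrable lborel (\<lambda>v. y * w v)" using w_int by simp
      show "AE v in lborel. norm (interval_kernel 0 y (v / sqrt (t n)) * char (M n) (v / sqrt (t n))) \<le> y * w v" for n
        using norm_interval_kernel_le[OF y] bound y unfolding norm_mult by (intro AE_I2 mult_mono) auto
      have "(\<lambda>n. interval_kernel 0 y (v / sqrt (t n)) * char (M n) (v / sqrt (t n))) \<longlonglongrightarrow> of_real y * of_real (exp (- v\<^sup>2 / 2))"
        if v: "v \<noteq> 0" for v
      proof (rule tendsto_mult)
        have "filterlim (\<lambda>n. v / sqrt (t n)) (at 0) sequentially"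
          unfolding filterlim_at using to0[of v] v tpos by (auto simp: less_imp_neq[symmetric])
        from filterlim_compose[OF Levy_Inversion_aux1[OF y] this]
        show "(\<lambda>n. interval_kernel 0 y (v / sqrt (t n))) \<longlonglongrightarrow> of_real y"
          unfolding interval_kernel_def by simp
        have "\<exists>R. \<forall>n. \<bar>v / sqrt (t n)\<bar> \<le> 1 \<longrightarrow> char (M n) (v / sqrt (t n)) =
            exp (\<i> * of_real (v / sqrt (t n) * m n) - of_real (\<sigma> n * (v / sqrt (t n))\<^sup>2 / 2) + R n) \<and> norm (R n) \<le> B * \<bar>v / sqrt (t n)\<bar> ^ 3"
        proof (rule choice, rule allI)
          fix n
          show "\<exists>R. \<bar>v / sqrt (t n)\<bar> \<le> 1 \<longrightarrow> char (M n) (v / sqrt (t n)) =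
            exp (\<i> * of_real (v / sqrt (t n) * m n) - of_real (\<sigma> n * (v / sqrt (t n))\<^sup>2 / 2) + R) \<and> norm R \<le> B * \<bar>v / sqrt (t n)\<bar> ^ 3"
            using near[of "v / sqrt (t n)" n] by (cases "\<bar>v / sqrt (t n)\<bar> \<le> 1") auto
        qed
        then obtain R where R: "\<And>n. \<bar>v / sqrt (t n)\<bar> \<le> 1 \<Longrightarrow> char (M n) (v / sqrt (t n)) =
            exp (\<i> * of_real (v / sqrt (t n) * m n) - of_real (\<sigma> n * (v / sqrt (t n))\<^sup>2 / 2) + R n)"
          "\<And>n. \<bar>v / sqrt (t n)\<bar> \<le> 1 \<Longrightarrow> norm (R n) \<le> B * \<bar>v / sqrt (t n)\<bar> ^ 3" by blast
        have ev: "eventually (\<lambda>n. \<bar>v / sqrt (t n)\<bar> \<le> 1) sequentially"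
          using tendsto_rabs[OF to0[of v]] by (auto dest!: order_tendstoD(2)[of _ _ _ 1] elim!: eventually_mono)
        have R0: "R \<longlonglongrightarrow> 0"
        proof (rule Lim_null_comparison)
          show "eventually (\<lambda>n. norm (R n) \<le> B * \<bar>v / sqrt (t n)\<bar> ^ 3) sequentially"
            using ev by eventually_elim (rule R(2))
          have "(\<lambda>n. B * \<bar>v / sqrt (t n)\<bar> ^ 3) \<longlonglongrightarrow> B * \<bar>0\<bar> ^ 3"
            by (intro tendsto_mult tendsto_const tendsto_power tendsto_rabs to0)
          then show "(\<lambda>n. B * \<bar>v / sqrt (t n)\<bar> ^ 3) \<longlonglongrightarrow> 0" by simp
        qed
        have m0: "(\<lambda>n. v / sqrt (t n) * m n) \<longlonglongrightarrow> 0"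
        proof (rule Lim_null_comparison)
          show "eventually (\<lambda>n. norm (v / sqrt (t n) * m n) \<le> \<bar>v / sqrt (t n)\<bar> * B) sequentially"
            unfolding real_norm_def abs_mult by (intro always_eventually allI mult_left_mono m) auto
          show "(\<lambda>n. \<bar>v / sqrt (t n)\<bar> * B) \<longlonglongrightarrow> 0" using tendsto_mult[OF tendsto_rabs[OF to0[of v]] tendsto_const[of B]] by simp
        qed
        have s0: "(\<lambda>n. \<sigma> n * (v / sqrt (t n))\<^sup>2 / 2) \<longlonglongrightarrow> v\<^sup>2 / 2"
        proof -
          have "(\<lambda>n. (\<sigma> n - t n) / t n) \<longlonglongrightarrow> 0"
          proof (rule Lim_null_comparison)
            show "eventually (\<lambda>n. norm ((\<sigma> n - t n) / t n) \<le> B / t n) sequentially"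
              unfolding real_norm_def abs_divide abs_of_pos[OF tpos] using \<sigma> tpos by (intro always_eventually allI divide_right_mono less_imp_le[OF tpos])
            show "(\<lambda>n. B / t n) \<longlonglongrightarrow> 0"
              by (intro tendsto_divide_0[OF tendsto_const] filterlim_at_top_imp_at_infinity t)
          qed
          then have "(\<lambda>n. v\<^sup>2 / 2 * (1 + (\<sigma> n - t n) / t n)) \<longlonglongrightarrow> v\<^sup>2 / 2 * (1 + 0)"
            by (intro tendsto_mult tendsto_add tendsto_const)
          moreover have "v\<^sup>2 / 2 * (1 + (\<sigma> n - t n) / t n) = \<sigma> n * (v / sqrt (t n))\<^sup>2 / 2" for n
            using tpos[of n] by (simp add: power_divide field_simps)
          ultimately show ?thesis by simp
        qed
        have "(\<lambda>n. exp (\<i> * of_real (v / sqrt (t n) * m n) - of_real (\<sigma> n * (v / sqrt (t n))\<^sup>2 / 2) + R n)) \<longlonglongrightarrow>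
            exp (\<i> * of_real 0 - of_real (v\<^sup>2 / 2) + 0)"
          by (intro tendsto_exp tendsto_add tendsto_diff tendsto_mult tendsto_const tendsto_of_real m0 s0 R0)
        moreover have "exp (\<i> * of_real 0 - of_real (v\<^sup>2 / 2) + 0) = complex_of_real (exp (- v\<^sup>2 / 2))"
          by (simp flip: exp_of_real)
        moreover have "eventually (\<lambda>n. exp (\<i> * of_real (v / sqrt (t n) * m n) - of_real (\<sigma> n * (v / sqrt (t n))\<^sup>2 / 2) + R n) = char (M n) (v / sqrt (t n))) sequentially"
          using ev by eventually_elim (rule R(1)[symmetric])
        ultimately show "(\<lambda>n. char (M n) (v / sqrt (t n))) \<longlonglongrightarrow> of_real (exp (- v\<^sup>2 / 2))"
          by (elim Lim_transform_eventually[THEN tendsto_eq_rhs])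
      qed
      then show "AE v in lborel. (\<lambda>n. interval_kernel 0 y (v / sqrt (t n)) * char (M n) (v / sqrt (t n))) \<longlonglongrightarrow> of_real y * of_real (exp (- v\<^sup>2 / 2))"
        using AE_lborel_singleton[of "0::real"] by (auto elim!: eventually_mono)
    qed measurable
    also have "(LINT v|lborel. of_real y * of_real (exp (- v\<^sup>2 / 2)) :: complex) = of_real (y * (LINT v|lborel. exp (- v\<^sup>2 / 2)))"
      by (simp add: integral_complex_of_real)
    finally show ?thesis unfolding gaussian_integral .
  qed
  let ?F = "\<lambda>n y. indicator {0..} y * (x * exp (- (x * y)) * (sqrt (2 * pi * t n) * measure (M n) {0..y}))"
  define D where "D = (LINT v|lborel. w v) / sqrt (2 * pi)"
  have exp_lim: "(LINT y|lborel. indicator {0..} y * (x * exp (- (x * y)) * y)) = 1 / x" and exp_int: "integrable lborel (\<lambda>y. indicator {0..} y * (x * exp (- (x * y)) * y))"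
  proof -
    have d: "indicator {0..} y * (x * exp (- (x * y)) * y) = erlang_density 0 x y * y ^ 1" for y
      by (auto simp: indicator_def erlang_density_def)
    have "has_bochner_integral lborel (\<lambda>y. erlang_density 0 x y * y ^ 1) (1 / x)"
    proof (rule has_bochner_integral_nn_integral)
      show "(\<integral>\<^sup>+y. ennreal (erlang_density 0 x y * y ^ 1) \<partial>lborel) = ennreal (1 / x)"
        using nn_integral_erlang_ith_moment[OF x, of 0 1] by simp
    qed (use x in \<open>auto simp: erlang_density_def\<close>)
    then show "(LINT y|lborel. indicator {0..} y * (x * exp (- (x * y)) * y)) = 1 / x" "integrable lborel (\<lambda>y. indicator {0..} y * (x * exp (- (x * y)) * y))"
      unfolding d using has_bochner_integral_integral_eq integrable.intros by auto
  qed
  have "(\<lambda>n. LINT y|lborel. ?F n y) \<longlonglongrightarrow> (LINT y|lborel. indicator {0..} y * (x * exp (- (x * y)) * y))"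
  proof (rule integral_dominated_convergence[where w = "\<lambda>y. D * (indicator {0..} y * (x * exp (- (x * y)) * y))"])
    show "integrable lborel (\<lambda>y. D * (indicator {0..} y * (x * exp (- (x * y)) * y)))" using exp_int by simp
    have mm: "(\<lambda>y. measure (M n) {0..y}) \<in> borel_measurable borel" for n
    proof -
      interpret real_distribution "M n" by (rule M)
      have "mono (\<lambda>y. prob {0..y})" by (intro monoI finite_measure_mono) auto
      then show ?thesis by (rule borel_measurable_mono)
    qed
    note [measurable] = mm
    show "?F n \<in> borel_measurable lborel" for n by measurable
    have re: "sqrt (2 * pi * t n) * measure (M n) {0..y} = Re (G n y) / sqrt (2 * pi)" if "0 \<le> y" for n y
      using arg_cong[OF prob[OF that, of n], of Re] by simp
    show "AE y in lborel. norm (?F n y) \<le> D * (indicator {0..} y * (x * exp (- (x * y)) * y))" for n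
    proof (rule AE_I2)
      fix y
      show "norm (?F n y) \<le> D * (indicator {0..} y * (x * exp (- (x * y)) * y))"
      proof (cases "0 \<le> y")
        case True
        have "norm (complex_of_real (sqrt (2 * pi * t n) * measure (M n) {0..y})) \<le> y * (LINT v|lborel. w v) / sqrt (2 * pi)"
          unfolding prob[OF True] norm_divide using G_le[OF True, of n] by (simp add: divide_right_mono)
        then have "\<bar>sqrt (2 * pi * t n) * measure (M n) {0..y}\<bar> \<le> D * y" unfolding D_def by (simp only: norm_of_real) (simp add: mult.commute)
        then have "x * exp (- (x * y)) * \<bar>sqrt (2 * pi * t n) * measure (M n) {0..y}\<bar> \<le> x * exp (- (x * y)) * (D * y)"
          using x by (intro mult_left_mono) auto
        then show ?thesis using True x by (simp add: abs_mult mult_ac)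
      qed simp
    qed
    have "(\<lambda>n. ?F n y) \<longlonglongrightarrow> indicator {0..} y * (x * exp (- (x * y)) * y)" for y
    proof (cases "0 \<le> y")
      case True
      have "(\<lambda>n. Re (G n y) / sqrt (2 * pi)) \<longlonglongrightarrow> Re (of_real (y * sqrt (2 * pi))) / sqrt (2 * pi)"
        by (intro tendsto_divide tendsto_const tendsto_Re G_lim True) simp
      then have "(\<lambda>n. sqrt (2 * pi * t n) * measure (M n) {0..y}) \<longlonglongrightarrow> y" unfolding re[OF True] by simp
      then show ?thesis using True by (intro tendsto_mult tendsto_const)
    qed simp
    then show "AE y in lborel. (\<lambda>n. ?F n y) \<longlonglongrightarrow> indicator {0..} y * (x * exp (- (x * y)) * y)" by simp
  qed measurable
  moreover have "(LINT y|lborel. ?F n y) = sqrt (2 * pi * t n) * (LINT z|M n. indicator {0..} z * exp (- (x * z)))" for n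
  proof -
    interpret real_distribution "M n" by (rule M)
    have "(LINT y|lborel. ?F n y) = (LINT y|lborel. sqrt (2 * pi * t n) * (indicator {0..} y * (x * exp (- (x * y)) * prob {0..y})))"
      by (intro Bochner_Integration.integral_cong) (auto simp: mult_ac)
    then show ?thesis unfolding laplace_half_line[OF x] by simp
  qed
  ultimately show ?thesis unfolding exp_lim by simp
qed

section \<open>The Mellin transform on the real axis\<close>

text \<open>The sum over the factors of the Mellin transform of \<open>f\<close> at the numerator point minus \<open>f\<close> at the denominator point. The
logarithm of the Mellin transform and its derivatives are all of this form.\<close>

definition gamma_sum :: "ensemble \<Rightarrow> real \<Rightarrow> real \<Rightarrow> real \<Rightarrow> nat \<Rightarrow> (real \<Rightarrow> 'a::ab_group_add) \<Rightarrow> 'a" where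
  "gamma_sum i \<beta> \<tau>1 \<tau>2 n f = (\<Sum>k=1..det_size i \<tau>1 \<tau>2 n.
     f (\<beta> / 2 * real k) - (case det_den i \<beta> \<tau>1 \<tau>2 n k of None \<Rightarrow> 0 | Some c \<Rightarrow> f c))"

definition log_mellin :: "ensemble \<Rightarrow> real \<Rightarrow> real \<Rightarrow> real \<Rightarrow> nat \<Rightarrow> real \<Rightarrow> real" where
  "log_mellin i \<beta> \<tau>1 \<tau>2 n z = z * det_scale i n + gamma_sum i \<beta> \<tau>1 \<tau>2 n (\<lambda>a. ln_Gamma (a + z) - ln_Gamma a)"

text \<open>The product has \<open>n - 1\<close> factors, but a factor for \<open>k = n\<close> would contribute \<open>0\<close>.\<close>

lemma gamma_sum_Gram:
  fixes f :: "real \<Rightarrow> real"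
  assumes "1 \<le> n"
  shows "gamma_sum Gram \<beta> \<tau>1 \<tau>2 n f = (\<Sum>k=1..n. f (\<beta> / 2 * real k)) - real n * f (\<beta> / 2 * real n)"
proof -
  have "{1..n} = insert n {1..n-1}" using assms by auto
  then have "(\<Sum>k=1..n. f (\<beta> / 2 * real k)) = f (\<beta> / 2 * real n) + (\<Sum>k=1..n-1. f (\<beta> / 2 * real k))"
    using assms by simp
  then show ?thesis using assms by (simp add: gamma_sum_def sum_subtractf of_nat_diff algebra_simps)
qed

text \<open>The denominator points continue the numerator points of the larger dimension. In this form the result is
symmetric in the two dimensions.\<close>

lemma gamma_sum_Jacobi:
  fixes f :: "real \<Rightarrow> real" and \<beta> :: real
  defines "S \<equiv> \<lambda>n. \<Sum>k=1..n. f (\<beta> / 2 * real k)"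
  shows "gamma_sum Jacobi \<beta> \<tau>1 \<tau>2 n f = S (floor_dim \<tau>1 n) + S (floor_dim \<tau>2 n) - S (floor_dim \<tau>1 n + floor_dim \<tau>2 n)"
proof -
  have aux: "(\<Sum>k=1..a. f (\<beta> / 2 * real k) - f (\<beta> / 2 * (real b + real k))) = S a + S b - S (a + b)" for a b
  proof -
    have "{1..a + b} = {1..b} \<union> {1 + b..a + b}" by auto
    then have "S (a + b) = S b + (\<Sum>k=1 + b..a + b. f (\<beta> / 2 * real k))"
      unfolding S_def by (subst sum.union_disjoint[symmetric]) auto
    also have "(\<Sum>k=1 + b..a + b. f (\<beta> / 2 * real k)) = (\<Sum>k=1..a. f (\<beta> / 2 * real (k + b)))"
      by (rule sum.shift_bounds_cl_nat_ivl)
    finally show ?thesis by (simp add: sum_subtractf S_def add.commute)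
  qed
  show ?thesis
  proof (cases "floor_dim \<tau>1 n \<le> floor_dim \<tau>2 n")
    case True
    then show ?thesis using aux[where a = "floor_dim \<tau>1 n" and b = "floor_dim \<tau>2 n"] by (simp add: gamma_sum_def min_def max_def)
  next
    case False
    then show ?thesis using aux[where a = "floor_dim \<tau>2 n" and b = "floor_dim \<tau>1 n"] by (simp add: gamma_sum_def min_def max_def add.commute)
  qed
qed

lemma floor_dim_ratio_LIMSEQ:
  assumes "0 < \<tau>"
  shows "(\<lambda>n. real (floor_dim \<tau> n) / real n) \<longlonglongrightarrow> \<tau>"
proof (rule tendsto_sandwich[of "\<lambda>n. \<tau> - 1 / real n" _ _ "\<lambda>n. \<tau>"])
  have e: "real (floor_dim \<tau> n) = of_int \<lfloor>real n * \<tau>\<rfloor>" for n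
    using assms by (simp add: floor_dim_def)
  have "real (floor_dim \<tau> n) \<le> real n * \<tau>" "real n * \<tau> - 1 \<le> real (floor_dim \<tau> n)" for n
    unfolding e by linarith+
  then show "eventually (\<lambda>n. \<tau> - 1 / real n \<le> real (floor_dim \<tau> n) / real n) sequentially"
    "eventually (\<lambda>n. real (floor_dim \<tau> n) / real n \<le> \<tau>) sequentially"
    by (auto intro!: eventually_mono[OF eventually_gt_at_top[of 0]] simp: field_simps)
  show "(\<lambda>n. \<tau> - 1 / real n) \<longlonglongrightarrow> \<tau>"
    using tendsto_diff[OF tendsto_const[of \<tau>] lim_1_over_n[where 'a = real]] by simp
qed simp

lemma floor_dim_at_top:
  assumes "0 < \<tau>"
  shows "filterlim (floor_dim \<tau>) at_top sequentially"
proof -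
  have "filterlim (\<lambda>n. real (floor_dim \<tau> n) / real n * real n) at_top sequentially"
    by (rule filterlim_tendsto_pos_mult_at_top[OF floor_dim_ratio_LIMSEQ assms filterlim_real_sequentially]) (rule assms)
  moreover have "eventually (\<lambda>n. real (floor_dim \<tau> n) / real n * real n = real (floor_dim \<tau> n)) sequentially"
    using eventually_gt_at_top[of 0] by eventually_elim simp
  ultimately have "filterlim (\<lambda>n. real (floor_dim \<tau> n)) at_top sequentially"
    by (rule filterlim_mono_eventually[OF _ order_refl order_refl])
  then show ?thesis by (simp add: filterlim_sequentially_iff_filterlim_real)
qed

text \<open>The exponential moments of \<open>X\<close>: \<open>psi\<close> is what remains after removing the centering and the Gaussian factor. For the
Gram ensemble the denominator and the term \<open>1/\<beta>\<close> of the centering contribute \<open>- z\<^sup>2 / \<beta>\<close>. For the Jacobi ensemble the asymptotics are applied at the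
dimensions \<open>p\<close>, \<open>q\<close> and \<open>p + q\<close>: the terms \<open>p ln p\<close> form the functions \<open>eps\<close> of the centering, and the logarithms of
\<open>p\<close>, \<open>q\<close>, \<open>p + q\<close> combine to \<open>ln n + ln (\<tau>1 \<tau>2 / (\<tau>1 + \<tau>2))\<close>.\<close>

lemma log_mellin_LIMSEQ:
  assumes \<beta>: "0 < \<beta>" and \<tau>: "0 < \<tau>1" "0 < \<tau>2" and z: "- \<beta> / 2 < z"
  shows "(\<lambda>n. log_mellin i \<beta> \<tau>1 \<tau>2 n z - z * centering i \<beta> \<tau>1 \<tau>2 n - z\<^sup>2 / \<beta> * ln (real n))
    \<longlonglongrightarrow> ln (psi i \<beta> \<tau>1 \<tau>2 z)"
proof -
  let ?q = "z\<^sup>2 / \<beta> + (1 / 2 - 1 / \<beta>) * z"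
  define r where "r = (\<lambda>n. ln_Gamma_sum \<beta> n z - (real n * z * ln (\<beta> / 2) - real n * z + z * real n * ln (real n)
      + ?q * ln (real n)))"
  have r: "r \<longlonglongrightarrow> Upsilon \<beta> z" unfolding r_def by (rule ln_Gamma_sum_LIMSEQ[OF \<beta> z])
  show ?thesis
  proof (cases i)
    case Laguerre
    have "eventually (\<lambda>n. r n = log_mellin i \<beta> \<tau>1 \<tau>2 n z - z * centering i \<beta> \<tau>1 \<tau>2 n - z\<^sup>2 / \<beta> * ln (real n)) sequentially"
      using eventually_gt_at_top[of 0]
    proof eventually_elim
      case (elim n)
      have "ln (\<beta> * real n) = ln (\<beta> / 2) + ln 2 + ln (real n)" using \<beta> elim by (simp add: ln_mult ln_div)
      then show ?case unfolding r_def Laguerre by (simp add: log_mellin_def gamma_sum_def ln_Gamma_sum_def algebra_simps)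
    qed
    then show ?thesis using r Lim_transform_eventually unfolding Laguerre by fastforce
  next
    case Gram
    define d where "d = (\<lambda>n. real n * (ln_Gamma (\<beta> / 2 * real n + z) - ln_Gamma (\<beta> / 2 * real n)) - real n * z * ln (\<beta> / 2 * real n))"
    have d: "d \<longlonglongrightarrow> (z\<^sup>2 - z) / \<beta>" unfolding d_def by (rule Gram_denominator_LIMSEQ[OF \<beta> z])
    have ev: "eventually (\<lambda>n. r n - d n - z / \<beta> = log_mellin i \<beta> \<tau>1 \<tau>2 n z - z * centering i \<beta> \<tau>1 \<tau>2 n - z\<^sup>2 / \<beta> * ln (real n)) sequentially"
      using eventually_gt_at_top[of 0]
    proof eventually_elim
      case (elim n)
      have l: "ln (\<beta> / 2 * real n) = ln (\<beta> / 2) + ln (real n)" using \<beta> elim by (simp add: ln_mult ln_div)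
      show ?case unfolding r_def d_def Gram l log_mellin_def using elim
        by (simp add: gamma_sum_Gram ln_Gamma_sum_def algebra_simps)
    qed
    have "(\<lambda>n. r n - d n - z / \<beta>) \<longlonglongrightarrow> Upsilon \<beta> z - (z\<^sup>2 - z) / \<beta> - z / \<beta>"
      by (intro tendsto_diff r d tendsto_const)
    moreover have "Upsilon \<beta> z - (z\<^sup>2 - z) / \<beta> - z / \<beta> = ln (psi i \<beta> \<tau>1 \<tau>2 z)"
      unfolding Gram by (simp add: diff_divide_distrib)
    ultimately show ?thesis using Lim_transform_eventually[OF _ ev] by simp
  next
    case Jacobi
    define p where "p = floor_dim \<tau>1"
    define q where "q = floor_dim \<tau>2"
    have p: "filterlim p sequentially sequentially" and q: "filterlim q sequentially sequentially"
      unfolding p_def q_def using floor_dim_at_top \<tau> by auto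
    have pq: "filterlim (\<lambda>n. p n + q n) sequentially sequentially"
      by (rule filterlim_at_top_mono[OF p]) simp
    let ?T = "\<tau>1 * \<tau>2 / (\<tau>1 + \<tau>2)"
    define h where "h = (\<lambda>n. ln ((real (p n) / real n) * (real (q n) / real n) / (real (p n) / real n + real (q n) / real n)))"
    have h: "h \<longlonglongrightarrow> ln ?T"
      unfolding h_def p_def q_def
      using \<tau> by (intro tendsto_ln tendsto_divide tendsto_mult tendsto_add floor_dim_ratio_LIMSEQ) auto
    have ev: "eventually (\<lambda>n. r (p n) + r (q n) - r (p n + q n) + ?q * h n - (1 / 2 - 1 / \<beta>) * z * ln ?T =
        log_mellin i \<beta> \<tau>1 \<tau>2 n z - z * centering i \<beta> \<tau>1 \<tau>2 n - z\<^sup>2 / \<beta> * ln (real n)) sequentially"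
      using eventually_gt_at_top[of 0] filterlim_at_top[THEN iffD1, OF p, rule_format, of 1]
        filterlim_at_top[THEN iffD1, OF q, rule_format, of 1]
    proof eventually_elim
      case (elim n)
      have e: "real (p n) * ln (1 + real (q n) / real (p n)) = real (p n) * (ln (real (p n + q n)) - ln (real (p n)))"
        "real (q n) * ln (1 + real (p n) / real (q n)) = real (q n) * (ln (real (p n + q n)) - ln (real (q n)))"
      proof -
        have "1 + real (q n) / real (p n) = real (p n + q n) / real (p n)" "1 + real (p n) / real (q n) = real (p n + q n) / real (q n)"
          using elim by (simp_all add: field_simps)
        then show "real (p n) * ln (1 + real (q n) / real (p n)) = real (p n) * (ln (real (p n + q n)) - ln (real (p n)))"
        "real (q n) * ln (1 + real (p n) / real (q n)) = real (q n) * (ln (real (p n + q n)) - ln (real (q n)))"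
          using elim by (simp_all add: ln_div del: of_nat_add)
      qed
      have ratio: "(real (p n) / real n) * (real (q n) / real n) / (real (p n) / real n + real (q n) / real n) =
          real (p n) * real (q n) / (real n * real (p n + q n))"
      proof -
        have "real (p n) / real n + real (q n) / real n = real (p n + q n) / real n" by (simp add: add_divide_distrib)
        then show ?thesis by (simp only:) simp
      qed
      have hn: "h n = ln (real (p n)) + ln (real (q n)) - ln (real (p n + q n)) - ln (real n)"
        unfolding h_def ratio using elim by (simp add: ln_div ln_mult del: of_nat_add)
      have lm: "log_mellin i \<beta> \<tau>1 \<tau>2 n z = ln_Gamma_sum \<beta> (p n) z + ln_Gamma_sum \<beta> (q n) z - ln_Gamma_sum \<beta> (p n + q n) z"
        unfolding log_mellin_def Jacobi gamma_sum_Jacobi p_def q_def ln_Gamma_sum_def by simp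
      have ce: "centering i \<beta> \<tau>1 \<tau>2 n = (1 / 2 - 1 / \<beta>) * ln (real n) + (1 / 2 - 1 / \<beta>) * ln ?T
          - real (p n) * (ln (real (p n + q n)) - ln (real (p n))) - real (q n) * (ln (real (p n + q n)) - ln (real (q n)))"
        unfolding Jacobi centering.simps eps_def p_def[symmetric] q_def[symmetric] e by simp
      \<comment> \<open>\<open>A1\<close>, \<open>A2\<close>, \<open>A3\<close> are the sums for the dimensions \<open>P\<close>, \<open>Q\<close>, \<open>P + Q\<close>, with logarithms \<open>lp\<close>, \<open>lq\<close>, \<open>ls\<close>.\<close>
      have poly: "A1 - (P * z * lb - P * z + z * P * lp + Q0 * lp) + (A2 - (Q * z * lb - Q * z + z * Q * lq + Q0 * lq))
         - (A3 - ((P + Q) * z * lb - (P + Q) * z + z * (P + Q) * ls + Q0 * ls)) + Q0 * (lp + lq - ls - l) - g * z * lT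
         = A1 + A2 - A3 - z * (g * l + g * lT - P * (ls - lp) - Q * (ls - lq)) - Q1 * l"
        if "Q0 = Q1 + g * z" for A1 A2 A3 P Q lb lp lq ls l g lT Q0 Q1 :: real
        unfolding that by (simp add: algebra_simps)
      show ?case unfolding lm ce hn r_def
        using poly[OF refl, of "ln_Gamma_sum \<beta> (p n) z" "real (p n)" "ln (\<beta> / 2)" "ln (real (p n))" "z\<^sup>2 / \<beta>" "1 / 2 - 1 / \<beta>"
          "ln_Gamma_sum \<beta> (q n) z" "real (q n)" "ln (real (q n))" "ln_Gamma_sum \<beta> (p n + q n) z" "ln (real (p n + q n))" "ln (real n)" "ln ?T"]
        by (simp only: of_nat_add)
    qed
    have "(\<lambda>n. r (p n) + r (q n) - r (p n + q n) + ?q * h n - (1 / 2 - 1 / \<beta>) * z * ln ?T) \<longlonglongrightarrow>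
        Upsilon \<beta> z + Upsilon \<beta> z - Upsilon \<beta> z + ?q * ln ?T - (1 / 2 - 1 / \<beta>) * z * ln ?T"
      by (intro tendsto_diff tendsto_add tendsto_mult tendsto_const h filterlim_compose[OF r] p q pq)
    moreover have "Upsilon \<beta> z + Upsilon \<beta> z - Upsilon \<beta> z + ?q * ln ?T - (1 / 2 - 1 / \<beta>) * z * ln ?T = ln (psi i \<beta> \<tau>1 \<tau>2 z)"
      unfolding Jacobi by (simp add: algebra_simps)
    ultimately show ?thesis using Lim_transform_eventually[OF _ ev] by simp
  qed
qed

section \<open>Second order expansion around a real point\<close>

definition cubic_const :: "real \<Rightarrow> real" where
  "cubic_const c = (\<Sum>j. real (Suc j) powr (- 3 / 2)) / c ^ 3"

lemma summable_three_halves: "summable (\<lambda>j. real (Suc j) powr (- 3 / 2))"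
  using summable_real_powr_iff[of "- 3 / 2"] by (subst summable_Suc_iff[of "\<lambda>j. real j powr (- 3 / 2)"]) simp

lemma cubic_const_nonneg: "0 < c \<Longrightarrow> 0 \<le> cubic_const c"
  unfolding cubic_const_def by (intro divide_nonneg_nonneg suminf_nonneg summable_three_halves) auto

text \<open>In the series \<open>2 \<Sum> 1 / (y + j)\<^sup>3\<close> use \<open>\<bar>y + j\<bar> \<ge> c (k + j) \<ge> c sqrt (k (j + 1))\<close>. The bound is then a product of a
function of \<open>j\<close> and a function of \<open>k\<close>, both summable.\<close>

lemma norm_Polygamma_2_le:
  fixes y :: complex
  assumes c: "0 < c" "c \<le> 1" and k: "1 \<le> k" and y: "c * real k \<le> Re y"
  shows "norm (Polygamma 2 y) \<le> 2 * (cubic_const c * real k powr (- 3 / 2))"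
proof -
  have Re: "0 < Re y" using c k y by (smt (verit) mult_pos_pos of_nat_0_less_iff zero_less_one le_less_trans less_le_trans of_nat_1 of_nat_mono)
  then have y0: "y \<noteq> 0" by auto
  have term_le: "norm (inverse ((y + of_nat j) ^ Suc 2)) \<le> real k powr (- 3 / 2) / c ^ 3 * real (Suc j) powr (- 3 / 2)" for j
  proof -
    have "c * (real k * real (Suc j)) powr (1 / 2) \<le> c * (real k + real j)"
    proof (intro mult_left_mono)
      have "(real k * real (Suc j)) powr (1 / 2) = sqrt (real k * real (Suc j))"
        by (simp add: powr_half_sqrt)
      also have "\<dots> \<le> (real k + real (Suc j)) / 2" by (rule arith_geo_mean_sqrt) auto
      also have "\<dots> \<le> real k + real j" using k by simp
      finally show "(real k * real (Suc j)) powr (1 / 2) \<le> real k + real j" .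
    qed (use c in auto)
    also have "\<dots> \<le> c * real k + real j" using c by (simp add: distrib_left mult_left_le_one_le)
    also have "\<dots> \<le> Re (y + of_nat j)" using y by simp
    also have "\<dots> \<le> norm (y + of_nat j)" by (rule complex_Re_le_cmod)
    finally have "(c * (real k * real (Suc j)) powr (1 / 2)) ^ 3 \<le> norm (y + of_nat j) ^ 3"
      using c by (intro power_mono) auto
    moreover have "(c * (real k * real (Suc j)) powr (1 / 2)) ^ 3 = c ^ 3 * (real k * real (Suc j)) powr (3 / 2)"
      unfolding power_mult_distrib using k by (subst powr_power) auto
    moreover have "0 < c ^ 3 * (real k * real (Suc j)) powr (3 / 2)" using c k by simp
    ultimately have "inverse (norm (y + of_nat j) ^ 3) \<le> inverse (c ^ 3 * (real k * real (Suc j)) powr (3 / 2))"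
      by (intro le_imp_inverse_le) auto
    also have "\<dots> = real k powr (- 3 / 2) / c ^ 3 * real (Suc j) powr (- 3 / 2)"
    proof -
      have m: "t powr (- 3 / 2) = inverse (t powr (3 / 2))" for t :: real
        using powr_minus[of t "3 / 2"] by simp
      show ?thesis unfolding m powr_mult[of "real k"] by (simp only: divide_inverse[of _ "c ^ 3"] inverse_mult_distrib mult_ac)
    qed
    also have "inverse (norm (y + of_nat j) ^ 3) = norm (inverse ((y + of_nat j) ^ Suc 2))"
      by (simp only: norm_inverse norm_power numeral_2_eq_2 numeral_3_eq_3)
    finally show ?thesis .
  qed
  have "(\<lambda>j. inverse ((y + of_nat j) ^ Suc 2)) sums ((-1) ^ Suc 2 * Polygamma 2 y / fact 2)"
    by (rule Polygamma_LIMSEQ[OF y0]) simp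
  then have e: "(-1) ^ Suc 2 * Polygamma 2 y / fact 2 = (\<Sum>j. inverse ((y + of_nat j) ^ Suc 2))"
    by (rule sums_unique)
  have s: "summable (\<lambda>j. real k powr (- 3 / 2) / c ^ 3 * real (Suc j) powr (- 3 / 2))"
    by (intro summable_mult summable_three_halves)
  have "norm (Polygamma 2 y) / 2 = norm ((-1) ^ Suc 2 * Polygamma 2 y / fact 2)"
    by (simp add: norm_divide norm_mult)
  also have "\<dots> \<le> (\<Sum>j. real k powr (- 3 / 2) / c ^ 3 * real (Suc j) powr (- 3 / 2))"
    unfolding e by (rule norm_suminf_le[OF term_le s])
  also have "\<dots> = real k powr (- 3 / 2) / c ^ 3 * (\<Sum>j. real (Suc j) powr (- 3 / 2))"
    by (rule suminf_mult[OF summable_three_halves])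
  also have "\<dots> = cubic_const c * real k powr (- 3 / 2)" unfolding cubic_const_def by simp
  finally show ?thesis by simp
qed

lemma right_half_plane_not_nonpos_Real: "0 < Re z \<Longrightarrow> z \<notin> \<real>\<^sub>\<le>\<^sub>0"
  by (auto simp: complex_nonpos_Reals_iff)

text \<open>Taylor's formula on the half-plane \<open>Re \<ge> y - \<delta>\<close>, where the third derivative is bounded. It is used for imaginary
\<open>w\<close> and for the real values \<open>\<plusminus> \<delta>\<close>.\<close>

lemma ln_Gamma_cubic_Taylor:
  fixes w :: complex
  assumes c: "0 < c" "c \<le> 1" and k: "1 \<le> k" and y: "c * real k \<le> y - \<delta>" and \<delta>: "0 \<le> \<delta>" "- \<delta> \<le> Re w"
  shows "norm (ln_Gamma (of_real y + w) - ln_Gamma (of_real y)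
     - (of_real (Digamma y) * w + of_real (Polygamma 1 y) * w\<^sup>2 / 2)) \<le> cubic_const c * real k powr (- 3 / 2) * norm w ^ 3"
proof -
  define f :: "nat \<Rightarrow> complex \<Rightarrow> complex" where "f = (\<lambda>i. if i = 0 then ln_Gamma else Polygamma (i - 1))"
  define S where "S = {s. y - \<delta> \<le> Re s}"
  have p: "0 < y - \<delta>" using c k y by (smt (verit) mult_pos_pos of_nat_0_less_iff zero_less_one le_less_trans less_le_trans of_nat_1 of_nat_mono)
  have "norm (f 0 (of_real y + w) - (\<Sum>i\<le>2. f i (of_real y) * (of_real y + w - of_real y) ^ i / fact i)) \<le>
     2 * (cubic_const c * real k powr (- 3 / 2)) * norm (of_real y + w - of_real y) ^ Suc 2 / fact 2"
  proof (rule complex_Taylor[where S = S])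
    show "convex S" unfolding S_def by (rule convex_halfspace_Re_ge)
    show "(f i has_field_derivative f (Suc i) s) (at s within S)" if "s \<in> S" for i s
    proof (rule has_field_derivative_at_within)
      have s: "0 < Re s" using that p unfolding S_def by simp
      have "(ln_Gamma has_field_derivative Digamma s) (at s)"
        by (rule has_field_derivative_ln_Gamma_complex[OF right_half_plane_not_nonpos_Real[OF s]])
      moreover have "(Polygamma j has_field_derivative Polygamma (Suc j) s) (at s)" for j
        by (rule has_field_derivative_Polygamma[OF right_half_plane_not_nonpos_Int[OF s]])
      ultimately show "(f i has_field_derivative f (Suc i) s) (at s)"
        unfolding f_def by (cases i) auto
    qed
    show "norm (f (Suc 2) s) \<le> 2 * (cubic_const c * real k powr (- 3 / 2))" if "s \<in> S" for s
    proof -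
      have "c * real k \<le> Re s" using y that unfolding S_def by simp
      from norm_Polygamma_2_le[OF c k this] show ?thesis unfolding f_def by simp
    qed
  qed (use \<delta> in \<open>auto simp: S_def\<close>)
  moreover have "(\<Sum>i\<le>2. f i (of_real y) * (of_real y + w - of_real y) ^ i / fact i) =
      ln_Gamma (of_real y) + (of_real (Digamma y) * w + of_real (Polygamma 1 y) * w\<^sup>2 / 2)"
  proof -
    have "y \<noteq> 0" using p \<delta> by auto
    then have "Polygamma j (complex_of_real y) = of_real (Polygamma j y)" for j by (rule Polygamma_of_real)
    then show ?thesis by (simp add: f_def numeral_2_eq_2)
  qed
  ultimately show ?thesis by (simp add: f_def numeral_eq_Suc algebra_simps)
qed

text \<open>Bounds for the \<open>k\<close>-th factor are proved for all points \<open>a \<ge> \<beta> k / 2\<close> and so cover numerators and denominators at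
once.\<close>

lemma det_den_ge:
  assumes "0 < \<beta>" "k \<in> {1..det_size i \<tau>1 \<tau>2 n}" "det_den i \<beta> \<tau>1 \<tau>2 n k = Some c"
  shows "\<beta> / 2 * real k \<le> c"
proof -
  have "\<beta> / 2 * real k \<le> \<beta> / 2 * y" if "real k \<le> y" for y using that assms(1) by (intro mult_left_mono) auto
  note mono = this
  show ?thesis
  proof (cases i)
    case Gram
    then show ?thesis using assms(2,3) mono[of "real n"] by auto
  next
    case Jacobi
    then show ?thesis using assms(2,3) mono[of "real (max (floor_dim \<tau>1 n) (floor_dim \<tau>2 n)) + real k"] by auto
  qed (use assms in simp)
qed

lemma gamma_sum_diff:
  "gamma_sum i \<beta> \<tau>1 \<tau>2 n f - gamma_sum i \<beta> \<tau>1 \<tau>2 n g = gamma_sum i \<beta> \<tau>1 \<tau>2 n (\<lambda>a. f a - g a)"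
  unfolding gamma_sum_def sum_subtractf[symmetric] by (intro sum.cong) (auto split: option.split)

lemma gamma_sum_add:
  "gamma_sum i \<beta> \<tau>1 \<tau>2 n f + gamma_sum i \<beta> \<tau>1 \<tau>2 n g = gamma_sum i \<beta> \<tau>1 \<tau>2 n (\<lambda>a. f a + g a)"
  unfolding gamma_sum_def sum.distrib[symmetric] by (intro sum.cong) (auto split: option.split)

lemma gamma_sum_mult_right:
  fixes f :: "real \<Rightarrow> 'a::ring"
  shows "gamma_sum i \<beta> \<tau>1 \<tau>2 n f * w = gamma_sum i \<beta> \<tau>1 \<tau>2 n (\<lambda>a. f a * w)"
  unfolding gamma_sum_def sum_distrib_right by (intro sum.cong) (auto simp: left_diff_distrib split: option.split)

lemma gamma_sum_of_real:
  "complex_of_real (gamma_sum i \<beta> \<tau>1 \<tau>2 n f) = gamma_sum i \<beta> \<tau>1 \<tau>2 n (\<lambda>a. of_real (f a))"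
  unfolding gamma_sum_def of_real_sum by (intro sum.cong) (auto split: option.split)

lemma gamma_sum_cong:
  assumes "0 < \<beta>" "\<And>a. \<beta> / 2 \<le> a \<Longrightarrow> f a = g a"
  shows "gamma_sum i \<beta> \<tau>1 \<tau>2 n f = gamma_sum i \<beta> \<tau>1 \<tau>2 n g"
  unfolding gamma_sum_def
proof (intro sum.cong refl)
  fix k assume k: "k \<in> {1..det_size i \<tau>1 \<tau>2 n}"
  then have b: "\<beta> / 2 \<le> \<beta> / 2 * real k" using assms(1) by simp
  have "\<beta> / 2 \<le> c" if "det_den i \<beta> \<tau>1 \<tau>2 n k = Some c" for c
    using det_den_ge[OF assms(1) k that] b by linarith
  then show "f (\<beta> / 2 * real k) - (case det_den i \<beta> \<tau>1 \<tau>2 n k of None \<Rightarrow> 0 | Some c \<Rightarrow> f c) =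
      g (\<beta> / 2 * real k) - (case det_den i \<beta> \<tau>1 \<tau>2 n k of None \<Rightarrow> 0 | Some c \<Rightarrow> g c)"
    using assms(2) b by (auto split: option.split)
qed

lemma norm_gamma_sum_le:
  fixes f :: "real \<Rightarrow> complex"
  assumes \<beta>: "0 < \<beta>" and le: "\<And>k a. 1 \<le> k \<Longrightarrow> \<beta> / 2 * real k \<le> a \<Longrightarrow> norm (f a) \<le> T k"
  shows "norm (gamma_sum i \<beta> \<tau>1 \<tau>2 n f) \<le> (\<Sum>k=1..det_size i \<tau>1 \<tau>2 n. 2 * T k)"
  unfolding gamma_sum_def
proof (rule sum_norm_le)
  fix k assume k: "k \<in> {1..det_size i \<tau>1 \<tau>2 n}"
  have a: "norm (f (\<beta> / 2 * real k)) \<le> T k" using k by (intro le) auto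
  have T: "0 \<le> T k" using a norm_ge_zero order_trans by blast
  show "norm (f (\<beta> / 2 * real k) - (case det_den i \<beta> \<tau>1 \<tau>2 n k of None \<Rightarrow> 0 | Some c \<Rightarrow> f c)) \<le> 2 * T k"
  proof (cases "det_den i \<beta> \<tau>1 \<tau>2 n k")
    case None
    then show ?thesis using a T by simp
  next
    case (Some c)
    have "norm (f c) \<le> T k" using k det_den_ge[OF \<beta> k Some] by (intro le) auto
    then show ?thesis using a norm_triangle_ineq4[of "f (\<beta> / 2 * real k)" "f c"] Some by simp
  qed
qed

definition complex_log_mellin :: "ensemble \<Rightarrow> real \<Rightarrow> real \<Rightarrow> real \<Rightarrow> nat \<Rightarrow> complex \<Rightarrow> complex" where
  "complex_log_mellin i \<beta> \<tau>1 \<tau>2 n z = z * of_real (det_scale i n) +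
     gamma_sum i \<beta> \<tau>1 \<tau>2 n (\<lambda>a. ln_Gamma (of_real a + z) - ln_Gamma (of_real a))"

lemma complex_log_mellin_of_real:
  assumes "0 < \<beta>" "- \<beta> / 2 < z"
  shows "complex_log_mellin i \<beta> \<tau>1 \<tau>2 n (of_real z) = of_real (log_mellin i \<beta> \<tau>1 \<tau>2 n z)"
proof -
  have "gamma_sum i \<beta> \<tau>1 \<tau>2 n (\<lambda>a. ln_Gamma (of_real a + of_real z) - ln_Gamma (complex_of_real a)) =
     gamma_sum i \<beta> \<tau>1 \<tau>2 n (\<lambda>a. complex_of_real (ln_Gamma (a + z) - ln_Gamma a))"
  proof (rule gamma_sum_cong[OF assms(1)])
    fix a assume "\<beta> / 2 \<le> a"
    then have "0 < a" "0 < a + z" using assms by auto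
    then show "ln_Gamma (of_real a + of_real z) - ln_Gamma (complex_of_real a) = complex_of_real (ln_Gamma (a + z) - ln_Gamma a)"
      unfolding of_real_add[symmetric] of_real_diff by (simp only: ln_Gamma_complex_of_real)
  qed
  then show ?thesis unfolding complex_log_mellin_def log_mellin_def by (simp only: gamma_sum_of_real of_real_add of_real_mult)
qed

lemma Gamma_eq_exp_ln_Gamma: "0 < Re z \<Longrightarrow> Gamma z = exp (ln_Gamma z)"
  using right_half_plane_not_nonpos_Int by (simp add: Gamma_complex_altdef)

lemma det_mellin_eq_exp:
  assumes \<beta>: "0 < \<beta>" and z: "- \<beta> / 2 < Re z"
  shows "det_mellin i \<beta> \<tau>1 \<tau>2 n z = exp (complex_log_mellin i \<beta> \<tau>1 \<tau>2 n z)"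
proof -
  have g: "Gamma (of_real a + z) / Gamma (of_real a) = exp (ln_Gamma (of_real a + z) - ln_Gamma (of_real a))" if "\<beta> / 2 \<le> a" for a
    using that \<beta> z by (simp add: Gamma_eq_exp_ln_Gamma exp_diff)
  have "(\<Prod>k=1..det_size i \<tau>1 \<tau>2 n. gamma_factor (\<beta> / 2 * real k) (det_den i \<beta> \<tau>1 \<tau>2 n k) z) =
     exp (gamma_sum i \<beta> \<tau>1 \<tau>2 n (\<lambda>a. ln_Gamma (of_real a + z) - ln_Gamma (of_real a)))"
    unfolding gamma_sum_def exp_sum[OF finite_atLeastAtMost]
  proof (rule prod.cong[OF refl])
    fix k assume k: "k \<in> {1..det_size i \<tau>1 \<tau>2 n}"
    then have b: "\<beta> / 2 \<le> \<beta> / 2 * real k" using \<beta> by simp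
    show "gamma_factor (\<beta> / 2 * real k) (det_den i \<beta> \<tau>1 \<tau>2 n k) z = exp (ln_Gamma (of_real (\<beta> / 2 * real k) + z) - ln_Gamma (of_real (\<beta> / 2 * real k)) -
       (case det_den i \<beta> \<tau>1 \<tau>2 n k of None \<Rightarrow> 0 | Some a \<Rightarrow> ln_Gamma (of_real a + z) - ln_Gamma (of_real a)))"
    proof (cases "det_den i \<beta> \<tau>1 \<tau>2 n k")
      case None
      then show ?thesis unfolding gamma_factor_def g[OF b] by simp
    next
      case (Some c)
      have c: "\<beta> / 2 \<le> c" using det_den_ge[OF \<beta> k Some] b by linarith
      show ?thesis unfolding gamma_factor_def Some option.case g[OF b] g[OF c] by (rule exp_diff[symmetric])
    qed
  qed
  then show ?thesis unfolding det_mellin_def complex_log_mellin_def exp_add by simp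
qed

text \<open>The first two derivatives at \<open>x\<close> of the logarithm of the Mellin transform: the mean and the variance of the
logarithm of the determinant under the law tilted by \<open>x\<close>.\<close>

definition mellin_mean :: "ensemble \<Rightarrow> real \<Rightarrow> real \<Rightarrow> real \<Rightarrow> nat \<Rightarrow> real \<Rightarrow> real" where
  "mellin_mean i \<beta> \<tau>1 \<tau>2 n x = det_scale i n + gamma_sum i \<beta> \<tau>1 \<tau>2 n (\<lambda>a. Digamma (a + x))"

definition mellin_variance :: "ensemble \<Rightarrow> real \<Rightarrow> real \<Rightarrow> real \<Rightarrow> nat \<Rightarrow> real \<Rightarrow> real" where
  "mellin_variance i \<beta> \<tau>1 \<tau>2 n x = gamma_sum i \<beta> \<tau>1 \<tau>2 n (\<lambda>a. Polygamma 1 (a + x))"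

text \<open>The \<open>k\<close>-th factor contributes \<open>O(k powr (- 3/2))\<close> to the constant, so \<open>B\<close> does not depend on \<open>n\<close>. All points
\<open>a + x - \<delta>\<close> with \<open>a \<ge> \<beta> k / 2\<close> are at least \<open>c k\<close>, also for negative \<open>x - \<delta>\<close>, because \<open>k \<ge> 1\<close>.\<close>

lemma complex_log_mellin_cubic_Taylor:
  assumes \<beta>: "0 < \<beta>" and x: "- \<beta> / 2 < x - \<delta>" and \<delta>: "0 \<le> \<delta>"
  obtains B where "0 \<le> B" "\<And>n w. - \<delta> \<le> Re w \<Longrightarrow>
    norm (complex_log_mellin i \<beta> \<tau>1 \<tau>2 n (of_real x + w) - complex_log_mellin i \<beta> \<tau>1 \<tau>2 n (of_real x)
      - (of_real (mellin_mean i \<beta> \<tau>1 \<tau>2 n x) * w + of_real (mellin_variance i \<beta> \<tau>1 \<tau>2 n x) * w\<^sup>2 / 2)) \<le> B * norm w ^ 3"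
proof -
  define c where "c = min 1 (\<beta> / 2 + min 0 (x - \<delta>))"
  have c: "0 < c" "c \<le> 1" using \<beta> x unfolding c_def by auto
  define T where "T = (\<lambda>k::nat. cubic_const c * real k powr (- 3 / 2))"
  have T: "0 \<le> T k" for k unfolding T_def using cubic_const_nonneg[OF c(1)] by simp
  define B where "B = 2 * (\<Sum>k. T (Suc k))"
  have sT: "summable (\<lambda>k. T (Suc k))" unfolding T_def by (intro summable_mult summable_three_halves)
  have TB: "(\<Sum>k=1..N. 2 * T k) \<le> B" for N
  proof -
    have "(\<Sum>k=1..N. 2 * T k) = 2 * (\<Sum>k<N. T (Suc k))"
      by (simp add: sum_distrib_left sum.atLeast1_atMost_eq)
    also have "\<dots> \<le> B" unfolding B_def using sT T by (intro mult_left_mono sum_le_suminf) auto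
    finally show ?thesis .
  qed
  show ?thesis
  proof (rule that)
    show "0 \<le> B" unfolding B_def using suminf_nonneg[OF sT] T by simp
    fix n and w :: complex assume w: "- \<delta> \<le> Re w"
    let ?S = "gamma_sum i \<beta> \<tau>1 \<tau>2 n :: (real \<Rightarrow> complex) \<Rightarrow> complex"
    let ?E = "\<lambda>a. ln_Gamma (of_real (a + x) + w) - ln_Gamma (of_real (a + x))
     - (of_real (Digamma (a + x)) * w + of_real (Polygamma 1 (a + x)) * (w\<^sup>2 / 2)) :: complex"
    have e: "complex_log_mellin i \<beta> \<tau>1 \<tau>2 n (of_real x + w) - complex_log_mellin i \<beta> \<tau>1 \<tau>2 n (of_real x)
      - (of_real (mellin_mean i \<beta> \<tau>1 \<tau>2 n x) * w + of_real (mellin_variance i \<beta> \<tau>1 \<tau>2 n x) * w\<^sup>2 / 2) = ?S ?E"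
    proof -
      have "complex_log_mellin i \<beta> \<tau>1 \<tau>2 n (of_real x + w) - complex_log_mellin i \<beta> \<tau>1 \<tau>2 n (of_real x)
      - (of_real (mellin_mean i \<beta> \<tau>1 \<tau>2 n x) * w + of_real (mellin_variance i \<beta> \<tau>1 \<tau>2 n x) * w\<^sup>2 / 2) =
        (?S (\<lambda>a. ln_Gamma (of_real a + (of_real x + w)) - ln_Gamma (of_real a)) - ?S (\<lambda>a. ln_Gamma (of_real a + of_real x) - ln_Gamma (of_real a)))
        - (?S (\<lambda>a. of_real (Digamma (a + x))) * w + ?S (\<lambda>a. of_real (Polygamma 1 (a + x))) * (w\<^sup>2 / 2))"
        unfolding complex_log_mellin_def mellin_mean_def mellin_variance_def of_real_add gamma_sum_of_real
        by (simp add: algebra_simps)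
      also have "\<dots> = ?S ?E"
        unfolding gamma_sum_diff gamma_sum_mult_right gamma_sum_add
        by (intro arg_cong[where f = ?S] ext) (simp add: algebra_simps)
      finally show ?thesis .
    qed
    have "norm (?S ?E) \<le> (\<Sum>k=1..det_size i \<tau>1 \<tau>2 n. 2 * (T k * norm w ^ 3))"
    proof (rule norm_gamma_sum_le[OF \<beta>])
      fix k :: nat and a assume k: "1 \<le> k" "\<beta> / 2 * real k \<le> a"
      have "c * real k \<le> (\<beta> / 2 + min 0 (x - \<delta>)) * real k"
        unfolding c_def by (intro mult_right_mono) auto
      also have "\<dots> \<le> \<beta> / 2 * real k + (x - \<delta>)"
      proof -
        have "(\<beta> / 2 + q) * real k \<le> \<beta> / 2 * real k + (x - \<delta>)" if "q \<le> 0" "q \<le> x - \<delta>" for q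
        proof -
          have "q * real k \<le> q * 1" using k that by (intro mult_left_mono_neg) auto
          then show ?thesis using that unfolding distrib_right by linarith
        qed
        then show ?thesis by simp
      qed
      finally have "c * real k \<le> a + x - \<delta>" using k by linarith
      from ln_Gamma_cubic_Taylor[OF c k(1) this \<delta> w]
      show "norm (?E a) \<le> T k * norm w ^ 3" unfolding T_def by simp
    qed
    also have "\<dots> = (\<Sum>k=1..det_size i \<tau>1 \<tau>2 n. 2 * T k) * norm w ^ 3"
      by (simp add: sum_distrib_right mult.assoc)
    also have "\<dots> \<le> B * norm w ^ 3" by (intro mult_right_mono TB) auto
    finally show "norm (complex_log_mellin i \<beta> \<tau>1 \<tau>2 n (of_real x + w) - complex_log_mellin i \<beta> \<tau>1 \<tau>2 n (of_real x)
      - (of_real (mellin_mean i \<beta> \<tau>1 \<tau>2 n x) * w + of_real (mellin_variance i \<beta> \<tau>1 \<tau>2 n x) * w\<^sup>2 / 2)) \<le> B * norm w ^ 3"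
      unfolding e .
  qed
qed

text \<open>On the real axis the logarithm of the Mellin transform is \<open>\<mu> z + t z\<^sup>2 / 2 + O(1)\<close> at each of the three points \<open>x\<close>,
\<open>x + \<delta>\<close> and \<open>x - \<delta>\<close>. Comparing with the Taylor expansion around \<open>x\<close>, the difference of the values at \<open>x \<plusminus> \<delta>\<close> determines
the first derivative up to \<open>O(1)\<close>, and their second difference determines the second derivative.\<close>

lemma mellin_mean_variance_bounded:
  assumes \<beta>: "0 < \<beta>" and \<tau>: "0 < \<tau>1" "0 < \<tau>2" and x: "- \<beta> / 2 < x"
  obtains B where "0 \<le> B"
    "\<And>n. \<bar>mellin_mean i \<beta> \<tau>1 \<tau>2 n x - (centering i \<beta> \<tau>1 \<tau>2 n + 2 * ln (real n) / \<beta> * x)\<bar> \<le> B"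
    "\<And>n. \<bar>mellin_variance i \<beta> \<tau>1 \<tau>2 n x - 2 * ln (real n) / \<beta>\<bar> \<le> B"
proof -
  \<comment> \<open>Half the distance of \<open>x\<close> from the boundary of the domain of the Mellin transform.\<close>
  define \<delta> where "\<delta> = (x + \<beta> / 2) / 2"
  have \<delta>: "0 < \<delta>" "- \<beta> / 2 < x - \<delta>" using x unfolding \<delta>_def by (auto simp: field_simps)
  obtain B where B: "0 \<le> B" "\<And>n w. - \<delta> \<le> Re w \<Longrightarrow>
    norm (complex_log_mellin i \<beta> \<tau>1 \<tau>2 n (of_real x + w) - complex_log_mellin i \<beta> \<tau>1 \<tau>2 n (of_real x)
      - (of_real (mellin_mean i \<beta> \<tau>1 \<tau>2 n x) * w + of_real (mellin_variance i \<beta> \<tau>1 \<tau>2 n x) * w\<^sup>2 / 2)) \<le> B * norm w ^ 3"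
    using complex_log_mellin_cubic_Taylor[OF \<beta> \<delta>(2) less_imp_le[OF \<delta>(1)]] by blast
  define t where "t = (\<lambda>n. 2 * ln (real n) / \<beta>)"
  define m where "m = (\<lambda>n. mellin_mean i \<beta> \<tau>1 \<tau>2 n x)"
  define v where "v = (\<lambda>n. mellin_variance i \<beta> \<tau>1 \<tau>2 n x)"
  define \<mu> where "\<mu> = centering i \<beta> \<tau>1 \<tau>2"
  define \<Lambda> where "\<Lambda> = (\<lambda>n z. log_mellin i \<beta> \<tau>1 \<tau>2 n z)"
  have taylor: "\<bar>\<Lambda> n (x + h) - \<Lambda> n x - (m n * h + v n * h\<^sup>2 / 2)\<bar> \<le> B * \<bar>h\<bar> ^ 3" if h: "- \<delta> \<le> h" for n h
  proof -
    have "norm (complex_of_real (\<Lambda> n (x + h) - \<Lambda> n x - (m n * h + v n * h\<^sup>2 / 2))) \<le> B * norm (complex_of_real h) ^ 3"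
      using B(2)[of "of_real h" n] h \<delta> x
        complex_log_mellin_of_real[OF \<beta>, of x i \<tau>1 \<tau>2 n] complex_log_mellin_of_real[OF \<beta>, of "x + h" i \<tau>1 \<tau>2 n]
      by (simp add: m_def v_def \<Lambda>_def)
    then show ?thesis by (simp only: norm_of_real)
  qed
  have bounded: "\<exists>K. \<forall>n. \<bar>\<Lambda> n z - z * \<mu> n - z\<^sup>2 / 2 * t n\<bar> \<le> K" if z: "- \<beta> / 2 < z" for z
  proof -
    have "Bseq (\<lambda>n. \<Lambda> n z - z * \<mu> n - z\<^sup>2 / \<beta> * ln (real n))"
      unfolding \<Lambda>_def \<mu>_def by (intro convergent_imp_Bseq convergentI[OF log_mellin_LIMSEQ[OF \<beta> \<tau> z]])
    then show ?thesis unfolding Bseq_def t_def by (auto simp: field_simps)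
  qed
  obtain K0 where K0: "\<And>n. \<bar>\<Lambda> n x - x * \<mu> n - x\<^sup>2 / 2 * t n\<bar> \<le> K0" using bounded[OF x] by blast
  obtain K1 where K1: "\<And>n. \<bar>\<Lambda> n (x + \<delta>) - (x + \<delta>) * \<mu> n - (x + \<delta>)\<^sup>2 / 2 * t n\<bar> \<le> K1" using bounded[of "x + \<delta>"] x \<delta> by auto
  obtain K2 where K2: "\<And>n. \<bar>\<Lambda> n (x - \<delta>) - (x - \<delta>) * \<mu> n - (x - \<delta>)\<^sup>2 / 2 * t n\<bar> \<le> K2" using bounded[of "x - \<delta>"] x \<delta> by auto
  define K where "K = K1 + K2 + 2 * K0 + 2 * (B * \<delta> ^ 3)"
  have main: "\<bar>(m n - (\<mu> n + t n * x)) * (2 * \<delta>)\<bar> \<le> K \<and> \<bar>(v n - t n) * \<delta>\<^sup>2\<bar> \<le> K" for n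
  proof -
    have e1: "(m n - (\<mu> n + t n * x)) * (2 * \<delta>) =
      (\<Lambda> n (x + \<delta>) - (x + \<delta>) * \<mu> n - (x + \<delta>)\<^sup>2 / 2 * t n) - (\<Lambda> n (x - \<delta>) - (x - \<delta>) * \<mu> n - (x - \<delta>)\<^sup>2 / 2 * t n)
      - (\<Lambda> n (x + \<delta>) - \<Lambda> n x - (m n * \<delta> + v n * \<delta>\<^sup>2 / 2)) + (\<Lambda> n (x + - \<delta>) - \<Lambda> n x - (m n * (- \<delta>) + v n * (- \<delta>)\<^sup>2 / 2))"
      by (simp add: power2_eq_square field_simps)
    have e2: "(v n - t n) * \<delta>\<^sup>2 =
      (\<Lambda> n (x + \<delta>) - (x + \<delta>) * \<mu> n - (x + \<delta>)\<^sup>2 / 2 * t n) + (\<Lambda> n (x - \<delta>) - (x - \<delta>) * \<mu> n - (x - \<delta>)\<^sup>2 / 2 * t n)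
      - 2 * (\<Lambda> n x - x * \<mu> n - x\<^sup>2 / 2 * t n)
      - (\<Lambda> n (x + \<delta>) - \<Lambda> n x - (m n * \<delta> + v n * \<delta>\<^sup>2 / 2)) - (\<Lambda> n (x + - \<delta>) - \<Lambda> n x - (m n * (- \<delta>) + v n * (- \<delta>)\<^sup>2 / 2))"
      by (simp add: power2_eq_square field_simps)
    have t1: "\<bar>\<Lambda> n (x + \<delta>) - \<Lambda> n x - (m n * \<delta> + v n * \<delta>\<^sup>2 / 2)\<bar> \<le> B * \<delta> ^ 3"
      using taylor[of \<delta> n] \<delta> by simp
    have t2: "\<bar>\<Lambda> n (x + - \<delta>) - \<Lambda> n x - (m n * (- \<delta>) + v n * (- \<delta>)\<^sup>2 / 2)\<bar> \<le> B * \<delta> ^ 3"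
      using taylor[of "- \<delta>" n] \<delta> by simp
    have tri: "\<bar>a - b - d + e\<bar> \<le> K \<and> \<bar>a + b - 2 * c - d - e\<bar> \<le> K"
      if "\<bar>a\<bar> \<le> K1" "\<bar>b\<bar> \<le> K2" "\<bar>c\<bar> \<le> K0" "\<bar>d\<bar> \<le> B * \<delta> ^ 3" "\<bar>e\<bar> \<le> B * \<delta> ^ 3" for a b c d e
      using that unfolding K_def by linarith
    show ?thesis unfolding e1 e2 by (rule tri[OF K1 K2 K0 t1 t2])
  qed
  define C where "C = K / (2 * \<delta>) + K / \<delta>\<^sup>2"
  have K: "0 \<le> K" using main[of 0] by linarith
  show ?thesis
  proof (rule that[of C])
    have Kp: "0 \<le> K / (2 * \<delta>)" "0 \<le> K / \<delta>\<^sup>2" using K \<delta> by auto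
    show "0 \<le> C" unfolding C_def using Kp by simp
    fix n
    have "\<bar>m n - (\<mu> n + t n * x)\<bar> \<le> K / (2 * \<delta>)"
      using main[of n] \<delta> by (simp add: abs_mult pos_le_divide_eq)
    then show "\<bar>mellin_mean i \<beta> \<tau>1 \<tau>2 n x - (centering i \<beta> \<tau>1 \<tau>2 n + 2 * ln (real n) / \<beta> * x)\<bar> \<le> C"
      unfolding C_def m_def \<mu>_def t_def using Kp by linarith
    have "\<bar>v n - t n\<bar> \<le> K / \<delta>\<^sup>2"
      using main[of n] \<delta> by (simp add: abs_mult pos_le_divide_eq)
    then show "\<bar>mellin_variance i \<beta> \<tau>1 \<tau>2 n x - 2 * ln (real n) / \<beta>\<bar> \<le> C"
      unfolding C_def v_def t_def using Kp by linarith
  qed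
qed

section \<open>Decay along vertical lines\<close>

definition gamma_ratio :: "real \<Rightarrow> real \<Rightarrow> real" where
  "gamma_ratio a u = norm (Gamma (Complex a u)) / Gamma a"

text \<open>By Euler's product, \<open>gamma_ratio a u\<close> is the product of these factors at \<open>y = a, a + 1, a + 2, \<dots>\<close>. The monotonicity
statements below hold factor by factor.\<close>

definition gamma_ratio_factor :: "real \<Rightarrow> real \<Rightarrow> real" where
  "gamma_ratio_factor y u = y / norm (Complex y u)"

lemma gamma_ratio_factor_power2: "(gamma_ratio_factor y u)\<^sup>2 = y\<^sup>2 / (y\<^sup>2 + u\<^sup>2)"
  by (simp add: gamma_ratio_factor_def power_divide cmod_power2)

lemma gamma_ratio_factor_pos: "0 < y \<Longrightarrow> 0 < gamma_ratio_factor y u"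
  unfolding gamma_ratio_factor_def by (intro divide_pos_pos) (auto simp: complex_eq_iff)

lemma gamma_ratio_LIMSEQ:
  assumes a: "0 < a"
  shows "(\<lambda>n. \<Prod>j\<le>n. gamma_ratio_factor (a + real j) u) \<longlonglongrightarrow> gamma_ratio a u"
proof -
  have G: "Gamma a \<noteq> 0" using Gamma_real_pos[OF a] by simp
  have "(\<lambda>n. norm (Gamma_series (Complex a u) n) / Gamma_series a n) \<longlonglongrightarrow> norm (Gamma (Complex a u)) / Gamma a"
    by (intro tendsto_divide tendsto_norm Gamma_series_LIMSEQ G)
  moreover have "norm (Gamma_series (Complex a u) n) / Gamma_series a n = (\<Prod>j\<le>n. gamma_ratio_factor (a + real j) u)" for n
  proof -
    have p: "pochhammer a (n + 1) = (\<Prod>j\<le>n. a + real j)"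
      by (simp add: pochhammer_prod lessThan_Suc_atMost[symmetric] atLeast0LessThan)
    have q: "norm (pochhammer (Complex a u) (n + 1)) = (\<Prod>j\<le>n. norm (Complex (a + real j) u))"
    proof -
      have "Complex a u + of_nat j = Complex (a + real j) u" for j by (simp add: complex_eq_iff)
      then show ?thesis by (simp add: pochhammer_prod lessThan_Suc_atMost[symmetric] atLeast0LessThan prod_norm[symmetric] norm_mult)
    qed
    have e: "norm (exp (Complex a u * of_real (ln (real n)))) = exp (a * ln (real n))"
      by simp
    have "norm (Gamma_series (Complex a u) n) = fact n * exp (a * ln (real n)) / (\<Prod>j\<le>n. norm (Complex (a + real j) u))"
      unfolding Gamma_series_def norm_divide norm_mult q[unfolded] using e by (simp add: norm_mult)
    moreover have "Gamma_series a n = fact n * exp (a * ln (real n)) / (\<Prod>j\<le>n. a + real j)"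
      unfolding Gamma_series_def p by simp
    ultimately show ?thesis
      unfolding gamma_ratio_factor_def by (simp add: prod_dividef)
  qed
  ultimately show ?thesis unfolding gamma_ratio_def by simp
qed

lemma gamma_ratio_pos:
  assumes "0 < a"
  shows "0 < gamma_ratio a u"
proof -
  have "Gamma (Complex a u) \<noteq> 0" using assms by (intro Gamma_nonzero_right_half_plane) simp
  then show ?thesis unfolding gamma_ratio_def using Gamma_real_pos[OF assms] by simp
qed

lemma gamma_ratio_mono:
  assumes "0 < a" "a \<le> c"
  shows "gamma_ratio a u \<le> gamma_ratio c u"
proof (rule LIMSEQ_le[OF gamma_ratio_LIMSEQ gamma_ratio_LIMSEQ])
  have "gamma_ratio_factor (a + real j) u \<le> gamma_ratio_factor (c + real j) u" for j
  proof (rule power2_le_imp_le)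
    let ?a = "a + real j" and ?c = "c + real j"
    have "?a\<^sup>2 \<le> ?c\<^sup>2" using assms by (intro power_mono) auto
    moreover have "0 < ?a\<^sup>2" "0 < ?c\<^sup>2" using assms by auto
    ultimately have "?a\<^sup>2 * (?c\<^sup>2 + u\<^sup>2) \<le> ?c\<^sup>2 * (?a\<^sup>2 + u\<^sup>2)"
      using mult_right_mono[of "?a\<^sup>2" "?c\<^sup>2" "u\<^sup>2"] by (simp add: algebra_simps)
    then show "(gamma_ratio_factor ?a u)\<^sup>2 \<le> (gamma_ratio_factor ?c u)\<^sup>2"
      unfolding gamma_ratio_factor_power2 using \<open>0 < ?a\<^sup>2\<close> \<open>0 < ?c\<^sup>2\<close> by (intro frac_le_eq[THEN iffD2] | simp add: divide_simps add_pos_nonneg)+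
    show "0 \<le> gamma_ratio_factor ?c u" using assms by (intro less_imp_le gamma_ratio_factor_pos) simp
  qed
  then show "\<exists>N. \<forall>n\<ge>N. (\<Prod>j\<le>n. gamma_ratio_factor (a + real j) u) \<le> (\<Prod>j\<le>n. gamma_ratio_factor (c + real j) u)"
    using assms by (intro exI allI impI prod_mono conjI less_imp_le[OF gamma_ratio_factor_pos]) auto
qed (use assms in auto)

text \<open>The square of a factor of the quotient is a constant times \<open>(c\<^sup>2 + u\<^sup>2) / (a\<^sup>2 + u\<^sup>2)\<close>, which decreases in \<open>\<bar>u\<bar>\<close> as \<open>a \<le> c\<close>.\<close>

lemma gamma_ratio_quotient_antimono:
  assumes a: "0 < a" "a \<le> c" and uv: "\<bar>u\<bar> \<le> \<bar>v\<bar>"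
  shows "gamma_ratio a v / gamma_ratio c v \<le> gamma_ratio a u / gamma_ratio c u"
proof -
  have c: "0 < c" using a by simp
  have L: "(\<lambda>n. (\<Prod>j\<le>n. gamma_ratio_factor (a + real j) u / gamma_ratio_factor (c + real j) u)) \<longlonglongrightarrow> gamma_ratio a u / gamma_ratio c u" for u
    unfolding prod_dividef using gamma_ratio_pos[OF c, of u]
    by (intro tendsto_divide gamma_ratio_LIMSEQ a c) auto
  show ?thesis
  proof (rule LIMSEQ_le[OF L L])
    have "gamma_ratio_factor (a + real j) v / gamma_ratio_factor (c + real j) v \<le>
        gamma_ratio_factor (a + real j) u / gamma_ratio_factor (c + real j) u" for j
    proof (rule power2_le_imp_le)
      let ?a = "a + real j" and ?c = "c + real j"
      have p: "0 < ?a" "0 < ?c" using a by auto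
      have sq: "u\<^sup>2 \<le> v\<^sup>2" using uv by (simp add: abs_le_square_iff)
      have ac: "?a\<^sup>2 \<le> ?c\<^sup>2" using a by (intro power_mono) auto
      have "(?c\<^sup>2 - ?a\<^sup>2) * u\<^sup>2 \<le> (?c\<^sup>2 - ?a\<^sup>2) * v\<^sup>2" using ac sq by (intro mult_left_mono) auto
      then have k: "(?c\<^sup>2 + v\<^sup>2) * (?a\<^sup>2 + u\<^sup>2) \<le> (?c\<^sup>2 + u\<^sup>2) * (?a\<^sup>2 + v\<^sup>2)" by (simp add: algebra_simps)
      have q: "0 < ?a\<^sup>2 + w\<^sup>2" "0 < ?c\<^sup>2 + w\<^sup>2" for w using p by (auto intro: add_pos_nonneg)
      have f: "(gamma_ratio_factor ?a w / gamma_ratio_factor ?c w)\<^sup>2 = ?a\<^sup>2 / ?c\<^sup>2 * ((?c\<^sup>2 + w\<^sup>2) / (?a\<^sup>2 + w\<^sup>2))" for w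
        unfolding power_divide gamma_ratio_factor_power2 by simp
      have "(?c\<^sup>2 + v\<^sup>2) / (?a\<^sup>2 + v\<^sup>2) \<le> (?c\<^sup>2 + u\<^sup>2) / (?a\<^sup>2 + u\<^sup>2)"
        using k q[of u] q[of v] by (simp add: divide_le_eq le_divide_eq mult.commute)
      then show "(gamma_ratio_factor ?a v / gamma_ratio_factor ?c v)\<^sup>2 \<le> (gamma_ratio_factor ?a u / gamma_ratio_factor ?c u)\<^sup>2"
        unfolding f by (rule mult_left_mono) auto
      show "0 \<le> gamma_ratio_factor ?a u / gamma_ratio_factor ?c u"
        using p by (intro divide_nonneg_nonneg less_imp_le[OF gamma_ratio_factor_pos])
    qed
    then show "\<exists>N. \<forall>n\<ge>N. (\<Prod>j\<le>n. gamma_ratio_factor (a + real j) v / gamma_ratio_factor (c + real j) v) \<le>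
       (\<Prod>j\<le>n. gamma_ratio_factor (a + real j) u / gamma_ratio_factor (c + real j) u)"
      using a by (intro exI allI impI prod_mono conjI divide_nonneg_nonneg less_imp_le[OF gamma_ratio_factor_pos]) auto
  qed
qed

lemma gamma_ratio_antimono:
  assumes a: "0 < a" and uv: "\<bar>u\<bar> \<le> \<bar>v\<bar>"
  shows "gamma_ratio a v \<le> gamma_ratio a u"
proof (rule LIMSEQ_le[OF gamma_ratio_LIMSEQ gamma_ratio_LIMSEQ])
  have "gamma_ratio_factor (a + real j) v \<le> gamma_ratio_factor (a + real j) u" for j
  proof -
    have "0 < norm (Complex (a + real j) w)" for w using a by (auto simp: complex_eq_iff)
    moreover have "norm (Complex (a + real j) u) \<le> norm (Complex (a + real j) v)"
      using uv by (simp add: cmod_def abs_le_square_iff)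
    ultimately show ?thesis unfolding gamma_ratio_factor_def using a by (intro divide_left_mono mult_pos_pos) auto
  qed
  then show "\<exists>N. \<forall>n\<ge>N. (\<Prod>j\<le>n. gamma_ratio_factor (a + real j) v) \<le> (\<Prod>j\<le>n. gamma_ratio_factor (a + real j) u)"
    using a by (intro exI allI impI prod_mono conjI less_imp_le[OF gamma_ratio_factor_pos]) auto
qed (use a in auto)

lemma gamma_ratio_0: "0 < a \<Longrightarrow> gamma_ratio a 0 = 1"
  using Gamma_real_pos[of a, THEN less_imp_neq] by (auto simp: gamma_ratio_def complex_of_real_def[symmetric] Gamma_complex_of_real)

lemma gamma_ratio_le_1: "0 < a \<Longrightarrow> gamma_ratio a u \<le> 1"
  using gamma_ratio_antimono[of a 0 u] gamma_ratio_0[of a] by simp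

lemma gamma_ratio_plus_one:
  assumes a: "0 < a"
  shows "gamma_ratio a u = gamma_ratio_factor a u * gamma_ratio (a + 1) u"
proof -
  have "Gamma (Complex a u + 1) = Complex a u * Gamma (Complex a u)"
    using a by (intro Gamma_plus_one_right_half_plane) simp
  moreover have "Complex a u + 1 = Complex (a + 1) u" by (simp add: complex_eq_iff)
  ultimately have "norm (Gamma (Complex (a + 1) u)) = norm (Complex a u) * norm (Gamma (Complex a u))"
    by (simp add: norm_mult)
  moreover have "Gamma (a + 1) = a * Gamma a" using a by (intro Gamma_plus1) (auto simp: nonpos_Ints_def)
  moreover have "norm (Complex a u) \<noteq> 0" using a by (auto simp: complex_eq_iff)
  ultimately show ?thesis using a unfolding gamma_ratio_def gamma_ratio_factor_def by simp
qed

text \<open>By monotonicity in \<open>c\<close> it is enough to treat \<open>c = a + 2\<close>, where two factors of the product remain.\<close>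

lemma gamma_ratio_quotient_le:
  assumes a: "0 < a" "a + 2 \<le> c"
  shows "gamma_ratio a u / gamma_ratio c u \<le> (a + 1)\<^sup>2 / (1 + u\<^sup>2)"
proof -
  have le: "gamma_ratio_factor y u \<le> (a + 1) / sqrt (1 + u\<^sup>2)" if "0 < y" "y \<le> a + 1" for y
  proof (rule power2_le_imp_le)
    have "y\<^sup>2 \<le> (a + 1)\<^sup>2" "1 \<le> (a + 1)\<^sup>2" using that a by (auto intro!: power_mono one_le_power)
    then have "y\<^sup>2 * 1 \<le> (a + 1)\<^sup>2 * y\<^sup>2" "y\<^sup>2 * u\<^sup>2 \<le> (a + 1)\<^sup>2 * u\<^sup>2"
      using mult_right_mono[of 1 "(a + 1)\<^sup>2" "y\<^sup>2"] by (auto intro: mult_right_mono)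
    then have "y\<^sup>2 * (1 + u\<^sup>2) \<le> (a + 1)\<^sup>2 * (y\<^sup>2 + u\<^sup>2)" by (simp add: algebra_simps)
    moreover have "0 < y\<^sup>2 + u\<^sup>2" "0 < 1 + u\<^sup>2" using that by (auto intro: add_pos_nonneg)
    ultimately have "y\<^sup>2 / (y\<^sup>2 + u\<^sup>2) \<le> (a + 1)\<^sup>2 / (1 + u\<^sup>2)" by (simp add: divide_le_eq le_divide_eq mult.commute)
    then show "(gamma_ratio_factor y u)\<^sup>2 \<le> ((a + 1) / sqrt (1 + u\<^sup>2))\<^sup>2"
      unfolding gamma_ratio_factor_power2 power_divide by (simp add: add_nonneg_nonneg)
  qed (use a in \<open>auto intro!: divide_nonneg_nonneg\<close>)
  have c: "0 < gamma_ratio c u" by (rule gamma_ratio_pos) (use a in auto)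
  have "gamma_ratio a u = gamma_ratio_factor a u * gamma_ratio_factor (a + 1) u * gamma_ratio (a + 2) u"
    using gamma_ratio_plus_one[of a u] gamma_ratio_plus_one[of "a + 1" u] a by (simp add: add.assoc)
  also have "\<dots> \<le> ((a + 1) / sqrt (1 + u\<^sup>2)) * ((a + 1) / sqrt (1 + u\<^sup>2)) * gamma_ratio c u"
    using a by (intro mult_mono le gamma_ratio_mono mult_nonneg_nonneg divide_nonneg_nonneg)
      (auto intro!: less_imp_le[OF gamma_ratio_factor_pos] less_imp_le[OF gamma_ratio_pos])
  also have "\<dots> = (a + 1)\<^sup>2 / (1 + u\<^sup>2) * gamma_ratio c u"
    by (simp add: power2_eq_square[of "a + 1"] add_nonneg_nonneg)
  finally show ?thesis using c by (simp add: pos_divide_le_eq)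
qed

lemma norm_gamma_factor_vertical:
  assumes a: "0 < a + x" and c: "\<And>c'. c = Some c' \<Longrightarrow> 0 < c' + x"
  shows "norm (gamma_factor a c (Complex x u)) = norm (gamma_factor a c (of_real x)) *
    (gamma_ratio (a + x) u / (case c of None \<Rightarrow> 1 | Some c \<Rightarrow> gamma_ratio (c + x) u))"
proof -
  have g: "norm (Gamma (of_real a + Complex x u)) = norm (Gamma (of_real a + of_real x :: complex)) * gamma_ratio (a + x) u"
    if "0 < a + x" for a
  proof -
    have "of_real a + Complex x u = Complex (a + x) u" by (simp add: complex_eq_iff)
    moreover have "norm (Gamma (of_real a + of_real x :: complex)) = Gamma (a + x)"
      unfolding of_real_add[symmetric] Gamma_complex_of_real using Gamma_real_pos[OF that] by (simp del: of_real_add)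
    ultimately show ?thesis unfolding gamma_ratio_def using Gamma_real_pos[OF that] by simp
  qed
  show ?thesis unfolding gamma_factor_def norm_divide norm_mult g[OF a]
    by (cases c) (use g[OF c] in \<open>simp_all add: norm_divide mult_ac\<close>)
qed

text \<open>The modulus is the value at \<open>x\<close> times the product of the factors \<open>h k u\<close>, each decreasing in \<open>\<bar>u\<bar>\<close>. The factor with
\<open>k = 1\<close> is spent on the decay \<open>1 / (1 + u\<^sup>2)\<close>, for which its denominator has to exceed its numerator by at least
\<open>2\<close>; this holds for large \<open>n\<close>. The others are replaced by their values at \<open>1\<close>.\<close>

lemma det_mellin_vertical_decay:
  assumes \<beta>: "0 < \<beta>" and \<tau>: "0 < \<tau>1" "0 < \<tau>2" and x: "- \<beta> / 2 < x"
  obtains C where "eventually (\<lambda>n. \<forall>u. 1 \<le> \<bar>u\<bar> \<longrightarrow>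
    norm (det_mellin i \<beta> \<tau>1 \<tau>2 n (Complex x u)) \<le> C / (1 + u\<^sup>2) * norm (det_mellin i \<beta> \<tau>1 \<tau>2 n (Complex x 1))) sequentially"
proof -
  define a where "a = \<beta> / 2 + x"
  have a: "0 < a" using x unfolding a_def by simp
  \<comment> \<open>The denominator is a lower bound, uniform in \<open>n\<close>, for the first factor at \<open>1\<close>, which has to be put back after it was spent on the decay.\<close>
  define C where "C = (a + 1)\<^sup>2 / gamma_ratio a 1"
  have size: "eventually (\<lambda>n. 1 \<le> det_size i \<tau>1 \<tau>2 n) sequentially"
  proof (cases i)
    case Laguerre
    then show ?thesis using eventually_ge_at_top[of 1] by simp
  next
    case Gram
    show ?thesis using eventually_ge_at_top[of 2] unfolding Gram by eventually_elim simp
  next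
    case Jacobi
    have "eventually (\<lambda>n. 1 \<le> floor_dim \<tau>1 n) sequentially" "eventually (\<lambda>n. 1 \<le> floor_dim \<tau>2 n) sequentially"
      using floor_dim_at_top[OF \<tau>(1)] floor_dim_at_top[OF \<tau>(2)] unfolding filterlim_at_top by auto
    then show ?thesis unfolding Jacobi by eventually_elim simp
  qed
  have gap: "eventually (\<lambda>n. \<forall>c. det_den i \<beta> \<tau>1 \<tau>2 n 1 = Some c \<longrightarrow> a + 2 \<le> c + x) sequentially"
  proof -
    have big: "eventually (\<lambda>n. 1 + 4 / \<beta> \<le> real (f n)) sequentially" if "filterlim f at_top sequentially" for f :: "nat \<Rightarrow> nat"
      using filterlim_compose[OF filterlim_real_sequentially that] unfolding filterlim_at_top by blast
    have le: "a + 2 \<le> \<beta> / 2 * y + x" if "1 + 4 / \<beta> \<le> y" for y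
    proof -
      have "\<beta> / 2 * (1 + 4 / \<beta>) \<le> \<beta> / 2 * y" using that \<beta> by (intro mult_left_mono) auto
      then show ?thesis unfolding a_def using \<beta> by (simp add: distrib_left)
    qed
    show ?thesis
    proof (cases i)
      case Gram
      show ?thesis using big[OF filterlim_ident] unfolding Gram by eventually_elim (use le in force)
    next
      case Jacobi
      have "filterlim (\<lambda>n. max (floor_dim \<tau>1 n) (floor_dim \<tau>2 n) + 1) at_top sequentially"
        by (rule filterlim_at_top_mono[OF floor_dim_at_top[OF \<tau>(1)]]) (intro always_eventually allI, simp)
      from big[OF this] show ?thesis unfolding Jacobi
      proof eventually_elim
        case (elim n)
        then show ?case using le[of "real (max (floor_dim \<tau>1 n) (floor_dim \<tau>2 n)) + 1"] by auto
      qed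
    qed simp
  qed
  show ?thesis
  proof (rule that[of C])
    show "eventually (\<lambda>n. \<forall>u. 1 \<le> \<bar>u\<bar> \<longrightarrow>
    norm (det_mellin i \<beta> \<tau>1 \<tau>2 n (Complex x u)) \<le> C / (1 + u\<^sup>2) * norm (det_mellin i \<beta> \<tau>1 \<tau>2 n (Complex x 1))) sequentially"
      using size gap
    proof eventually_elim
      case (elim n)
      define N where "N = det_size i \<tau>1 \<tau>2 n"
      define h where "h = (\<lambda>k u. gamma_ratio (\<beta> / 2 * real k + x) u /
        (case det_den i \<beta> \<tau>1 \<tau>2 n k of None \<Rightarrow> 1 | Some c \<Rightarrow> gamma_ratio (c + x) u))"
      have N: "1 \<le> N" using elim unfolding N_def by simp
      have pos: "0 < \<beta> / 2 * real k + x" if "k \<in> {1..N}" for k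
      proof -
        have "\<beta> / 2 * 1 \<le> \<beta> / 2 * real k" using that \<beta> by (intro mult_left_mono) auto
        then show ?thesis using x by linarith
      qed
      have den: "\<beta> / 2 * real k + x \<le> c + x" if "k \<in> {1..N}" "det_den i \<beta> \<tau>1 \<tau>2 n k = Some c" for k c
        using det_den_ge[OF \<beta> _ that(2)] that(1) unfolding N_def by simp
      have den_pos: "0 < c + x" if "k \<in> {1..N}" "det_den i \<beta> \<tau>1 \<tau>2 n k = Some c" for k c
        using den[OF that] pos[OF that(1)] by linarith
      have h_pos: "0 < h k u" if "k \<in> {1..N}" for k u
        unfolding h_def using pos[OF that] den_pos[OF that] by (auto intro!: divide_pos_pos gamma_ratio_pos split: option.split)
      have h_antimono: "h k u \<le> h k 1" if k: "k \<in> {1..N}" and u: "1 \<le> \<bar>u\<bar>" for k u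
      proof (cases "det_den i \<beta> \<tau>1 \<tau>2 n k")
        case None
        then show ?thesis unfolding h_def using gamma_ratio_antimono[OF pos[OF k], of 1 u] u by simp
      next
        case (Some c)
        then show ?thesis unfolding h_def using gamma_ratio_quotient_antimono[OF pos[OF k] den[OF k Some], of 1 u] u by simp
      qed
      have norm_eq: "norm (det_mellin i \<beta> \<tau>1 \<tau>2 n (Complex x u)) = norm (det_mellin i \<beta> \<tau>1 \<tau>2 n (of_real x)) * (\<Prod>k=1..N. h k u)" for u
      proof -
        have "norm (\<Prod>k=1..N. gamma_factor (\<beta> / 2 * real k) (det_den i \<beta> \<tau>1 \<tau>2 n k) (Complex x u)) =
            (\<Prod>k=1..N. norm (gamma_factor (\<beta> / 2 * real k) (det_den i \<beta> \<tau>1 \<tau>2 n k) (of_real x)) * h k u)"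
          unfolding prod_norm[symmetric] h_def
          by (intro prod.cong refl norm_gamma_factor_vertical pos den_pos) auto
        then show ?thesis unfolding det_mellin_def N_def[symmetric] norm_mult
          by (simp add: prod.distrib prod_norm)
      qed
      have h1_le: "h 1 u \<le> (a + 1)\<^sup>2 / (1 + u\<^sup>2)" for u
      proof (cases "det_den i \<beta> \<tau>1 \<tau>2 n 1")
        case None
        have "gamma_ratio a u * 1 \<le> gamma_ratio a u * (1 / gamma_ratio (a + 2) u)"
          using gamma_ratio_le_1[of "a + 2" u] gamma_ratio_pos[of "a + 2" u] gamma_ratio_pos[OF a, of u] a
          by (intro mult_left_mono) auto
        then show ?thesis unfolding h_def None using gamma_ratio_quotient_le[OF a order_refl, of u] by (simp add: a_def)
      next
        case (Some c)
        then have "a + 2 \<le> c + x" using elim by blast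
        from gamma_ratio_quotient_le[OF a this, of u] show ?thesis unfolding h_def Some by (simp add: a_def)
      qed
      have h1_ge: "gamma_ratio a 1 \<le> h 1 1"
      proof (cases "det_den i \<beta> \<tau>1 \<tau>2 n 1")
        case None
        then show ?thesis unfolding h_def by (simp add: a_def)
      next
        case (Some c)
        then have c: "0 < c + x" using den_pos[of 1] N by simp
        have "gamma_ratio a 1 * 1 \<le> gamma_ratio a 1 * (1 / gamma_ratio (c + x) 1)"
          using gamma_ratio_le_1[OF c, of 1] gamma_ratio_pos[OF c, of 1] gamma_ratio_pos[OF a, of 1]
          by (intro mult_left_mono) auto
        then show ?thesis unfolding h_def Some by (simp add: a_def)
      qed
      have split: "(\<Prod>k=1..N. h k u) = h 1 u * (\<Prod>k=2..N. h k u)" for u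
      proof -
        have "{1..N} = insert 1 {2..N}" using N by auto
        then show ?thesis by simp
      qed
      show ?case
      proof (intro allI impI)
        fix u :: real assume u: "1 \<le> \<bar>u\<bar>"
        have g: "0 < gamma_ratio a 1" by (rule gamma_ratio_pos[OF a])
        have rest: "0 \<le> (\<Prod>k=2..N. h k v)" for v by (intro prod_nonneg ballI less_imp_le h_pos) auto
        have up: "0 < 1 + u\<^sup>2" by (simp add: add_pos_nonneg)
        have "(\<Prod>k=1..N. h k u) \<le> (a + 1)\<^sup>2 / (1 + u\<^sup>2) * (\<Prod>k=2..N. h k 1)"
          unfolding split using up by (intro mult_mono h1_le prod_mono conjI h_antimono less_imp_le[OF h_pos] u rest) auto
        also have "(\<Prod>k=2..N. h k 1) \<le> (\<Prod>k=1..N. h k 1) / gamma_ratio a 1"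
          unfolding split using mult_right_mono[OF h1_ge rest[of 1]] g by (simp add: pos_le_divide_eq mult.commute)
        then have "(a + 1)\<^sup>2 / (1 + u\<^sup>2) * (\<Prod>k=2..N. h k 1) \<le> (a + 1)\<^sup>2 / (1 + u\<^sup>2) * ((\<Prod>k=1..N. h k 1) / gamma_ratio a 1)"
          using up by (intro mult_left_mono) auto
        also have "\<dots> = C / (1 + u\<^sup>2) * (\<Prod>k=1..N. h k 1)" unfolding C_def by simp
        finally have "(\<Prod>k=1..N. h k u) \<le> C / (1 + u\<^sup>2) * (\<Prod>k=1..N. h k 1)" .
        from mult_left_mono[OF this norm_ge_zero[of "det_mellin i \<beta> \<tau>1 \<tau>2 n (of_real x)"]]
        show "norm (det_mellin i \<beta> \<tau>1 \<tau>2 n (Complex x u)) \<le> C / (1 + u\<^sup>2) * norm (det_mellin i \<beta> \<tau>1 \<tau>2 n (Complex x 1))"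
          unfolding norm_eq by (simp only: mult_ac)
      qed
    qed
  qed
qed

section \<open>Exponential tilting\<close>

text \<open>The law of \<open>sg (ln y - s)\<close> if \<open>y\<close> has the density \<open>y powr x / m0\<close> with respect to \<open>D\<close>; \<open>sg\<close> is a sign, so that lower tails
become upper tails.\<close>

definition tilted_law :: "real measure \<Rightarrow> real \<Rightarrow> real \<Rightarrow> real \<Rightarrow> real \<Rightarrow> real measure" where
  "tilted_law D x m0 sg s = distr (density D (\<lambda>y. ennreal (exp (x * ln y) / m0))) borel (\<lambda>y. sg * (ln y - s))"

context
  fixes D :: "real measure" and a x m0 sg s :: real and F :: "complex \<Rightarrow> complex"
  assumes mellin: "has_mellin D a F" and x: "- a < x" and m0: "0 < m0" "F (of_real x) = of_real m0"
    and sg: "sg = 1 \<or> sg = -1"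
begin

lemma tilt_basics:
  shows "prob_space D" "sets D = sets borel" "AE y in D. 0 < y"
    "\<And>z. - a < Re z \<Longrightarrow> integrable D (\<lambda>y. exp (z * of_real (ln y)))"
    "\<And>z. - a < Re z \<Longrightarrow> (LINT y|D. exp (z * of_real (ln y))) = F z"
  using mellin unfolding has_mellin_def by auto

lemma tilt_measurable [measurable]: "(\<lambda>y. f (ln y)) \<in> borel_measurable D" if "f \<in> borel_measurable borel"
proof -
  have [measurable_cong]: "sets D = sets borel" by (rule tilt_basics)
  note that [measurable]
  show ?thesis by measurable
qed

lemma tilt_density_integral:
  fixes f :: "real \<Rightarrow> 'b::{banach, second_countable_topology}"
  assumes f: "f \<in> borel_measurable borel"
  shows "(LINT z|tilted_law D x m0 sg s. f z) = (LINT y|D. (exp (x * ln y) / m0) *\<^sub>R f (sg * (ln y - s)))"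
proof -
  have [measurable_cong]: "sets D = sets borel" by (rule tilt_basics)
  note f [measurable]
  have "(LINT z|tilted_law D x m0 sg s. f z) = (LINT y|density D (\<lambda>y. ennreal (exp (x * ln y) / m0)). f (sg * (ln y - s)))"
    unfolding tilted_law_def by (rule integral_distr) measurable
  also have "\<dots> = (LINT y|D. (exp (x * ln y) / m0) *\<^sub>R f (sg * (ln y - s)))"
    using m0 by (intro integral_density) auto
  finally show ?thesis .
qed

lemma tilt_normalised: "integrable D (\<lambda>y. exp (x * ln y))" "(LINT y|D. exp (x * ln y)) = m0"
proof -
  have e: "exp (of_real x * of_real (ln y)) = complex_of_real (exp (x * ln y))" for y
    by (simp only: of_real_mult[symmetric] exp_of_real)
  have i: "integrable D (\<lambda>y. complex_of_real (exp (x * ln y)))"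
    using tilt_basics(4)[of "of_real x"] x unfolding e by simp
  then show "integrable D (\<lambda>y. exp (x * ln y))" by (simp only: complex_of_real_integrable_eq)
  have "complex_of_real (LINT y|D. exp (x * ln y)) = of_real m0"
    using tilt_basics(5)[of "of_real x"] x m0(2) unfolding e by (simp add: integral_complex_of_real)
  then show "(LINT y|D. exp (x * ln y)) = m0" by (simp only: of_real_eq_iff)
qed

lemma tilted_real_distribution: "real_distribution (tilted_law D x m0 sg s)"
proof -
  have [measurable_cong]: "sets D = sets borel" by (rule tilt_basics)
  have "(\<integral>\<^sup>+y. ennreal (exp (x * ln y) / m0) \<partial>D) = ennreal (LINT y|D. exp (x * ln y) / m0)"
    using m0 tilt_normalised by (intro nn_integral_eq_integral) auto
  also have "\<dots> = 1" using m0 tilt_normalised by simp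
  finally have "prob_space (density D (\<lambda>y. ennreal (exp (x * ln y) / m0)))"
    by (intro prob_spaceI) (simp add: emeasure_density)
  then interpret Q: prob_space "density D (\<lambda>y. ennreal (exp (x * ln y) / m0))" .
  have "prob_space (tilted_law D x m0 sg s)"
    unfolding tilted_law_def by (rule Q.prob_space_distr) measurable
  then show ?thesis by (auto simp: real_distribution_def real_distribution_axioms_def tilted_law_def)
qed

lemma char_tilted:
  "char (tilted_law D x m0 sg s) u = F (Complex x (sg * u)) / of_real m0 * exp (- (\<i> * of_real (sg * u * s)))"
proof -
  have "char (tilted_law D x m0 sg s) u = (LINT y|D. (exp (x * ln y) / m0) *\<^sub>R exp (\<i> * of_real (u * (sg * (ln y - s)))))"
    unfolding char_def by (rule tilt_density_integral) measurable
  also have "\<dots> = (LINT y|D. (exp (- (\<i> * of_real (sg * u * s))) / of_real m0) * exp (Complex x (sg * u) * of_real (ln y)))"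
  proof (intro Bochner_Integration.integral_cong refl)
    fix y
    have "complex_of_real (exp (x * ln y)) * exp (\<i> * of_real (u * (sg * (ln y - s)))) =
       exp (of_real (x * ln y) + \<i> * of_real (u * (sg * (ln y - s))))"
      by (simp only: exp_of_real exp_add)
    also have "of_real (x * ln y) + \<i> * of_real (u * (sg * (ln y - s))) =
        - (\<i> * of_real (sg * u * s)) + Complex x (sg * u) * of_real (ln y)"
      by (simp add: complex_eq_iff algebra_simps)
    finally have "complex_of_real (exp (x * ln y)) * exp (\<i> * of_real (u * (sg * (ln y - s)))) =
        exp (- (\<i> * of_real (sg * u * s))) * exp (Complex x (sg * u) * of_real (ln y))"
      by (simp only: exp_add)
    then show "(exp (x * ln y) / m0) *\<^sub>R exp (\<i> * of_real (u * (sg * (ln y - s)))) =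
      (exp (- (\<i> * of_real (sg * u * s))) / of_real m0) * exp (Complex x (sg * u) * of_real (ln y))"
      by (simp only: scaleR_conv_of_real of_real_divide times_divide_eq_left)
  qed
  also have "\<dots> = (exp (- (\<i> * of_real (sg * u * s))) / of_real m0) * F (Complex x (sg * u))"
    using tilt_basics(5)[of "Complex x (sg * u)"] x by simp
  finally show ?thesis by simp
qed

text \<open>On the half-line, removing the density costs \<open>m0 exp (- x ln y)\<close>, and \<open>x ln y = x s + x sg z\<close> for \<open>z = sg (ln y - s)\<close>.\<close>

lemma half_line_prob_tilted:
  "measure D {y. 0 \<le> sg * (ln y - s)} = m0 * exp (- (x * s)) *
     (LINT z|tilted_law D x m0 sg s. indicator {0..} z * exp (- (x * sg * z)))"
proof -
  have [measurable_cong]: "sets D = sets borel" by (rule tilt_basics)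
  interpret D: prob_space D by (rule tilt_basics)
  have sp: "space D = UNIV" using sets_eq_imp_space_eq[OF tilt_basics(2)] by simp
  have "(LINT z|tilted_law D x m0 sg s. indicator {0..} z * exp (- (x * sg * z))) =
    (LINT y|D. (exp (x * ln y) / m0) *\<^sub>R (indicator {0..} (sg * (ln y - s)) * exp (- (x * sg * (sg * (ln y - s))))))"
    by (rule tilt_density_integral) measurable
  also have "\<dots> = (LINT y|D. exp (x * s) / m0 * indicator {y. 0 \<le> sg * (ln y - s)} y)"
  proof (intro Bochner_Integration.integral_cong refl)
    fix y
    have "exp (x * ln y) * exp (- (x * sg * (sg * (ln y - s)))) = exp (x * s)"
      unfolding exp_add[symmetric] using sg by (auto simp: algebra_simps)
    then show "(exp (x * ln y) / m0) *\<^sub>R (indicator {0..} (sg * (ln y - s)) * exp (- (x * sg * (sg * (ln y - s))))) =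
      exp (x * s) / m0 * indicator {y. 0 \<le> sg * (ln y - s)} y"
      by (simp add: indicator_def)
  qed
  also have "\<dots> = exp (x * s) / m0 * measure D {y. 0 \<le> sg * (ln y - s)}"
    using sp by simp
  finally show ?thesis using m0 by (simp add: exp_minus)
qed

end

section \<open>Tails of the determinants\<close>

lemma psi_pos: "0 < psi i \<beta> \<tau>1 \<tau>2 z"
  by (cases i) auto

lemma det_mellin_vertical_Taylor:
  assumes \<beta>: "0 < \<beta>" and x: "- \<beta> / 2 < x"
  obtains B where "0 \<le> B" "\<And>n v. \<exists>R. det_mellin i \<beta> \<tau>1 \<tau>2 n (Complex x v) =
    of_real (exp (log_mellin i \<beta> \<tau>1 \<tau>2 n x)) *
      exp (\<i> * of_real (v * mellin_mean i \<beta> \<tau>1 \<tau>2 n x) - of_real (mellin_variance i \<beta> \<tau>1 \<tau>2 n x * v\<^sup>2 / 2) + R) \<and> norm R \<le> B * \<bar>v\<bar> ^ 3"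
proof -
  obtain B where B: "0 \<le> B" "\<And>n w. - 0 \<le> Re w \<Longrightarrow>
    norm (complex_log_mellin i \<beta> \<tau>1 \<tau>2 n (of_real x + w) - complex_log_mellin i \<beta> \<tau>1 \<tau>2 n (of_real x)
      - (of_real (mellin_mean i \<beta> \<tau>1 \<tau>2 n x) * w + of_real (mellin_variance i \<beta> \<tau>1 \<tau>2 n x) * w\<^sup>2 / 2)) \<le> B * norm w ^ 3"
    using complex_log_mellin_cubic_Taylor[OF \<beta> _ order_refl, of x i \<tau>1 \<tau>2] x by (metis diff_zero)
  show ?thesis
  proof (rule that[OF B(1)])
    fix n v
    define w where "w = \<i> * complex_of_real v"
    define R where "R = complex_log_mellin i \<beta> \<tau>1 \<tau>2 n (of_real x + w) - complex_log_mellin i \<beta> \<tau>1 \<tau>2 n (of_real x)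
      - (of_real (mellin_mean i \<beta> \<tau>1 \<tau>2 n x) * w + of_real (mellin_variance i \<beta> \<tau>1 \<tau>2 n x) * w\<^sup>2 / 2)"
    have R: "norm R \<le> B * \<bar>v\<bar> ^ 3" unfolding R_def using B(2)[of w n] by (simp add: w_def norm_mult)
    have xv: "Complex x v = of_real x + w" by (simp add: w_def complex_eq_iff)
    have w2: "w\<^sup>2 = - of_real (v\<^sup>2)" unfolding w_def by (simp add: power_mult_distrib)
    have "complex_log_mellin i \<beta> \<tau>1 \<tau>2 n (Complex x v) = of_real (log_mellin i \<beta> \<tau>1 \<tau>2 n x) +
      (\<i> * of_real (v * mellin_mean i \<beta> \<tau>1 \<tau>2 n x) - of_real (mellin_variance i \<beta> \<tau>1 \<tau>2 n x * v\<^sup>2 / 2) + R)"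
      unfolding xv R_def w2 complex_log_mellin_of_real[OF \<beta> x] by (simp add: w_def algebra_simps)
    moreover have "det_mellin i \<beta> \<tau>1 \<tau>2 n (Complex x v) = exp (complex_log_mellin i \<beta> \<tau>1 \<tau>2 n (Complex x v))"
      using x by (intro det_mellin_eq_exp \<beta>) simp
    ultimately have "det_mellin i \<beta> \<tau>1 \<tau>2 n (Complex x v) = of_real (exp (log_mellin i \<beta> \<tau>1 \<tau>2 n x)) *
      exp (\<i> * of_real (v * mellin_mean i \<beta> \<tau>1 \<tau>2 n x) - of_real (mellin_variance i \<beta> \<tau>1 \<tau>2 n x * v\<^sup>2 / 2) + R)"
      by (simp only: exp_add exp_of_real)
    then show "\<exists>R. det_mellin i \<beta> \<tau>1 \<tau>2 n (Complex x v) = of_real (exp (log_mellin i \<beta> \<tau>1 \<tau>2 n x)) *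
      exp (\<i> * of_real (v * mellin_mean i \<beta> \<tau>1 \<tau>2 n x) - of_real (mellin_variance i \<beta> \<tau>1 \<tau>2 n x * v\<^sup>2 / 2) + R) \<and> norm R \<le> B * \<bar>v\<bar> ^ 3"
      using R by blast
  qed
qed

text \<open>The constants required by \<open>tilted_tail_LIMSEQ\<close> are available only for large \<open>n\<close>, so it is applied to the shifted
sequence. The exponential smallness in the far range comes from the quadratic expansion at \<open>u = 1\<close>.\<close>

lemma tilted_det_tail_LIMSEQ:
  fixes \<beta> \<tau>1 \<tau>2 x :: real and i :: ensemble
  defines "t \<equiv> \<lambda>n. 2 * ln (real n) / \<beta>"
  defines "Q \<equiv> \<lambda>n. tilted_law (det_law i \<beta> \<tau>1 \<tau>2 n) x (exp (log_mellin i \<beta> \<tau>1 \<tau>2 n x)) (sgn x)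
     (centering i \<beta> \<tau>1 \<tau>2 n + t n * x)"
  assumes \<beta>: "0 < \<beta>" and \<tau>: "0 < \<tau>1" "0 < \<tau>2" and x: "- \<beta> / 2 < x" "x \<noteq> 0"
  shows "(\<lambda>n. sqrt (2 * pi * t n) * (LINT z|Q n. indicator {0..} z * exp (- (\<bar>x\<bar> * z)))) \<longlonglongrightarrow> 1 / \<bar>x\<bar>"
proof -
  define m0 where "m0 = (\<lambda>n. exp (log_mellin i \<beta> \<tau>1 \<tau>2 n x))"
  define sg where "sg = sgn x"
  define s where "s = (\<lambda>n. centering i \<beta> \<tau>1 \<tau>2 n + t n * x)"
  define F where "F = det_mellin i \<beta> \<tau>1 \<tau>2"
  define mm where "mm = (\<lambda>n. mellin_mean i \<beta> \<tau>1 \<tau>2 n x)"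
  define vv where "vv = (\<lambda>n. mellin_variance i \<beta> \<tau>1 \<tau>2 n x)"
  have sg: "sg = 1 \<or> sg = -1" unfolding sg_def using x by (auto simp: sgn_if)
  then have sg2: "(sg * u)\<^sup>2 = u\<^sup>2" "\<bar>sg * u\<bar> = \<bar>u\<bar>" for u by auto
  obtain B1 where B1: "0 \<le> B1" "\<And>n. \<bar>mm n - s n\<bar> \<le> B1" "\<And>n. \<bar>vv n - t n\<bar> \<le> B1"
    using mellin_mean_variance_bounded[OF \<beta> \<tau> x(1), of i] unfolding mm_def vv_def s_def t_def by blast
  obtain B2 where B2: "0 \<le> B2" "\<And>n v. \<exists>R. F n (Complex x v) = of_real (m0 n) *
      exp (\<i> * of_real (v * mm n) - of_real (vv n * v\<^sup>2 / 2) + R) \<and> norm R \<le> B2 * \<bar>v\<bar> ^ 3"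
    using det_mellin_vertical_Taylor[OF \<beta> x(1), of i \<tau>1 \<tau>2] unfolding F_def m0_def mm_def vv_def by blast
  obtain C0 where C0: "eventually (\<lambda>n. \<forall>u. 1 \<le> \<bar>u\<bar> \<longrightarrow>
    norm (F n (Complex x u)) \<le> C0 / (1 + u\<^sup>2) * norm (F n (Complex x 1))) sequentially"
    using det_mellin_vertical_decay[OF \<beta> \<tau> x(1), of i] unfolding F_def by blast
  define B where "B = max B1 B2"
  define C where "C = max C0 0 * exp (3 * B / 2)"
  have B: "0 \<le> B" "B1 \<le> B" "B2 \<le> B" unfolding B_def using B1 B2 by auto
  have m0: "0 < m0 n" for n unfolding m0_def by simp
  have t_top: "filterlim t at_top sequentially"
  proof -
    have "filterlim (\<lambda>n. 2 / \<beta> * ln (real n)) at_top sequentially"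
      using \<beta> by (intro filterlim_tendsto_pos_mult_at_top[OF tendsto_const] filterlim_compose[OF ln_at_top filterlim_real_sequentially]) simp
    then show ?thesis unfolding t_def by simp
  qed
  have "eventually (\<lambda>n. 1 \<le> n \<and> 1 \<le> t n \<and> 6 * B \<le> t n \<and> (\<forall>u. 1 \<le> \<bar>u\<bar> \<longrightarrow>
    norm (F n (Complex x u)) \<le> C0 / (1 + u\<^sup>2) * norm (F n (Complex x 1)))) sequentially"
    using C0 t_top unfolding filterlim_at_top by (auto intro!: eventually_conj eventually_ge_at_top)
  then obtain N where N: "\<And>n. N \<le> n \<Longrightarrow> 1 \<le> n \<and> 1 \<le> t n \<and> 6 * B \<le> t n \<and> (\<forall>u. 1 \<le> \<bar>u\<bar> \<longrightarrow>
    norm (F n (Complex x u)) \<le> C0 / (1 + u\<^sup>2) * norm (F n (Complex x 1)))"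
    unfolding eventually_sequentially by blast
  have mellin: "has_mellin (det_law i \<beta> \<tau>1 \<tau>2 n) (\<beta> / 2) (F n)" if "N \<le> n" for n
    unfolding F_def using N[OF that] by (intro det_law_has_mellin \<beta>) simp
  have F0: "F n (of_real x) = of_real (m0 n)" for n
    unfolding F_def m0_def using det_mellin_eq_exp[OF \<beta>, of "of_real x" i \<tau>1 \<tau>2 n] complex_log_mellin_of_real[OF \<beta> x(1)] x(1)
    by (simp add: exp_of_real)
  have Q: "Q n = tilted_law (det_law i \<beta> \<tau>1 \<tau>2 n) x (m0 n) sg (s n)" for n
    unfolding Q_def m0_def sg_def s_def ..
  have xb: "- (\<beta> / 2) < x" using x by simp
  have char: "char (Q n) u = F n (Complex x (sg * u)) / of_real (m0 n) * exp (- (\<i> * of_real (sg * u * s n)))" if "N \<le> n" for n u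
    unfolding Q by (rule char_tilted[OF mellin[OF that] xb m0 F0 sg])
  have "(\<lambda>n. sqrt (2 * pi * t (n + N)) * (LINT z|Q (n + N). indicator {0..} z * exp (- (\<bar>x\<bar> * z)))) \<longlonglongrightarrow> 1 / \<bar>x\<bar>"
  proof (rule tilted_tail_LIMSEQ[where B = B and C = C and c = "1 / 2" and m = "\<lambda>n. sg * (mm (n + N) - s (n + N))" and \<sigma> = "\<lambda>n. vv (n + N)"])
    show "real_distribution (Q (n + N))" for n
      unfolding Q by (rule tilted_real_distribution[OF mellin xb m0 F0 sg]) simp
    show "filterlim (\<lambda>n. t (n + N)) at_top sequentially"
      by (rule filterlim_compose[OF t_top filterlim_add_const_nat_at_top])
    show "1 \<le> t (n + N)" "6 * B \<le> t (n + N)" for n using N[of "n + N"] by auto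
    show "\<bar>sg * (mm (n + N) - s (n + N))\<bar> \<le> B" for n unfolding sg2 using B1(2)[of "n + N"] B by linarith
    show "\<bar>vv (n + N) - t (n + N)\<bar> \<le> B" for n using B1(3)[of "n + N"] B by linarith
    show "\<exists>R. char (Q (n + N)) u = exp (\<i> * of_real (u * (sg * (mm (n + N) - s (n + N)))) - of_real (vv (n + N) * u\<^sup>2 / 2) + R) \<and> norm R \<le> B * \<bar>u\<bar> ^ 3" for n u
    proof -
      obtain R where R: "F (n + N) (Complex x (sg * u)) = of_real (m0 (n + N)) *
          exp (\<i> * of_real (sg * u * mm (n + N)) - of_real (vv (n + N) * (sg * u)\<^sup>2 / 2) + R)" "norm R \<le> B2 * \<bar>sg * u\<bar> ^ 3"
        using B2(2)[of "n + N" "sg * u"] by blast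
      have "char (Q (n + N)) u = exp (\<i> * of_real (sg * u * mm (n + N)) - of_real (vv (n + N) * u\<^sup>2 / 2) + R) * exp (- (\<i> * of_real (sg * u * s (n + N))))"
        using char[of "n + N" u] R(1) m0[of "n + N"] unfolding sg2 by simp
      also have "\<dots> = exp (\<i> * of_real (u * (sg * (mm (n + N) - s (n + N)))) - of_real (vv (n + N) * u\<^sup>2 / 2) + R)"
        unfolding exp_add[symmetric] by (simp add: algebra_simps)
      finally have "char (Q (n + N)) u = exp (\<i> * of_real (u * (sg * (mm (n + N) - s (n + N)))) - of_real (vv (n + N) * u\<^sup>2 / 2) + R)" .
      moreover have "norm R \<le> B * \<bar>u\<bar> ^ 3"
        using R(2) mult_right_mono[OF B(3), of "\<bar>u\<bar> ^ 3"] unfolding sg2 by simp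
      ultimately show ?thesis by blast
    qed
    show "norm (char (Q (n + N)) u) \<le> C * exp (- (1 / 2) * t (n + N)) / (1 + u\<^sup>2)" if u: "1 \<le> \<bar>u\<bar>" for n u
    proof -
      let ?n = "n + N"
      obtain R where R: "F ?n (Complex x 1) = of_real (m0 ?n) * exp (\<i> * of_real (1 * mm ?n) - of_real (vv ?n * 1\<^sup>2 / 2) + R)"
          "norm R \<le> B2 * \<bar>1\<bar> ^ 3"
        using B2(2)[of ?n 1] by blast
      have "norm (F ?n (Complex x 1)) = m0 ?n * exp (Re R - vv ?n / 2)"
        unfolding R(1) norm_mult norm_exp_eq_Re using m0[of ?n] by simp
      also have "\<dots> \<le> m0 ?n * exp (3 * B / 2 - t ?n / 2)"
      proof (intro mult_left_mono less_imp_le[OF m0] iffD2[OF exp_le_cancel_iff])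
        show "Re R - vv ?n / 2 \<le> 3 * B / 2 - t ?n / 2"
          using R(2) complex_Re_le_cmod[of R] B1(3)[of ?n] B by simp
      qed
      finally have F1: "norm (F ?n (Complex x 1)) / m0 ?n \<le> exp (3 * B / 2) * exp (- (1 / 2) * t ?n)"
        using m0[of ?n] by (simp add: pos_divide_le_eq mult_exp_exp mult.commute)
      have up: "0 < 1 + u\<^sup>2" by (simp add: add_pos_nonneg)
      have "norm (char (Q ?n) u) = norm (F ?n (Complex x (sg * u))) / m0 ?n"
      proof -
        have "norm (exp (- (\<i> * complex_of_real (sg * u * s ?n)))) = 1" by (simp add: norm_exp_eq_Re)
        then show ?thesis using m0[of ?n] char[of ?n u] by (simp add: norm_mult norm_divide)
      qed
      also have "\<dots> \<le> C0 / (1 + u\<^sup>2) * norm (F ?n (Complex x 1)) / m0 ?n"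
      proof (rule divide_right_mono)
        show "norm (F ?n (Complex x (sg * u))) \<le> C0 / (1 + u\<^sup>2) * norm (F ?n (Complex x 1))"
          using N[of ?n] u sg2[of u] by (metis le_add2)
      qed (use m0[of ?n] in simp)
      also have "\<dots> = C0 / (1 + u\<^sup>2) * (norm (F ?n (Complex x 1)) / m0 ?n)" by simp
      also have "\<dots> \<le> max C0 0 / (1 + u\<^sup>2) * (exp (3 * B / 2) * exp (- (1 / 2) * t ?n))"
        using up m0[of ?n] by (intro mult_mono F1 divide_right_mono divide_nonneg_pos) auto
      also have "\<dots> = C * exp (- (1 / 2) * t ?n) / (1 + u\<^sup>2)" unfolding C_def by simp
      finally show ?thesis .
    qed
  qed (use B x in auto)
  then show ?thesis by (rule LIMSEQ_offset)
qed

text \<open>Both tails in one statement: for \<open>x > 0\<close> the event is \<open>X \<ge> t x\<close>, for \<open>x < 0\<close> it is \<open>X \<le> t x\<close>.\<close>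

theorem det_law_tail_asymp_equiv:
  fixes \<beta> \<tau>1 \<tau>2 x :: real and i :: ensemble
  assumes \<beta>: "0 < \<beta>" and \<tau>: "0 < \<tau>1" "0 < \<tau>2" and x: "- \<beta> / 2 < x" "x \<noteq> 0"
  shows "(\<lambda>n. measure (det_law i \<beta> \<tau>1 \<tau>2 n) {y. 0 \<le> sgn x * (ln y - (centering i \<beta> \<tau>1 \<tau>2 n + 2 * ln (real n) / \<beta> * x))})
    \<sim>[at_top] (\<lambda>n. exp (- (x\<^sup>2 * ln (real n) / \<beta>)) / (\<bar>x\<bar> * sqrt (4 * pi * ln (real n) / \<beta>)) * psi i \<beta> \<tau>1 \<tau>2 x)"
    (is "?p \<sim>[at_top] ?q")
proof (rule asymp_equivI')
  define I where "I = (\<lambda>n. LINT z|tilted_law (det_law i \<beta> \<tau>1 \<tau>2 n) x (exp (log_mellin i \<beta> \<tau>1 \<tau>2 n x)) (sgn x)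
     (centering i \<beta> \<tau>1 \<tau>2 n + 2 * ln (real n) / \<beta> * x). indicator {0..} z * exp (- (\<bar>x\<bar> * z)))"
  define l where "l = (\<lambda>n. log_mellin i \<beta> \<tau>1 \<tau>2 n x - x * centering i \<beta> \<tau>1 \<tau>2 n - x\<^sup>2 / \<beta> * ln (real n))"
  have I: "(\<lambda>n. sqrt (2 * pi * (2 * ln (real n) / \<beta>)) * I n) \<longlonglongrightarrow> 1 / \<bar>x\<bar>"
    unfolding I_def by (rule tilted_det_tail_LIMSEQ[OF \<beta> \<tau> x])
  have l: "l \<longlonglongrightarrow> ln (psi i \<beta> \<tau>1 \<tau>2 x)" unfolding l_def by (rule log_mellin_LIMSEQ[OF \<beta> \<tau> x(1)])
  have "(\<lambda>n. exp (l n) / psi i \<beta> \<tau>1 \<tau>2 x * (\<bar>x\<bar> * (sqrt (2 * pi * (2 * ln (real n) / \<beta>)) * I n))) \<longlonglongrightarrow>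
      exp (ln (psi i \<beta> \<tau>1 \<tau>2 x)) / psi i \<beta> \<tau>1 \<tau>2 x * (\<bar>x\<bar> * (1 / \<bar>x\<bar>))"
    using psi_pos[of i \<beta> \<tau>1 \<tau>2 x] by (intro tendsto_mult tendsto_divide tendsto_exp l tendsto_const I) simp
  moreover have "exp (ln (psi i \<beta> \<tau>1 \<tau>2 x)) / psi i \<beta> \<tau>1 \<tau>2 x * (\<bar>x\<bar> * (1 / \<bar>x\<bar>)) = 1"
    using psi_pos[of i \<beta> \<tau>1 \<tau>2 x] x by simp
  moreover have "eventually (\<lambda>n. exp (l n) / psi i \<beta> \<tau>1 \<tau>2 x * (\<bar>x\<bar> * (sqrt (2 * pi * (2 * ln (real n) / \<beta>)) * I n)) = ?p n / ?q n) sequentially"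
    using eventually_ge_at_top[of 2]
  proof eventually_elim
    case (elim n)
    let ?s = "centering i \<beta> \<tau>1 \<tau>2 n + 2 * ln (real n) / \<beta> * x"
    let ?m = "exp (log_mellin i \<beta> \<tau>1 \<tau>2 n x)"
    have F: "det_mellin i \<beta> \<tau>1 \<tau>2 n (of_real x) = of_real ?m"
      using det_mellin_eq_exp[OF \<beta>, of "of_real x" i \<tau>1 \<tau>2 n] complex_log_mellin_of_real[OF \<beta> x(1)] x(1)
      by (simp add: exp_of_real)
    have sg: "sgn x = 1 \<or> sgn x = -1" using x by (auto simp: sgn_if)
    have mellin: "has_mellin (det_law i \<beta> \<tau>1 \<tau>2 n) (\<beta> / 2) (det_mellin i \<beta> \<tau>1 \<tau>2 n)"
      using elim by (intro det_law_has_mellin \<beta>) simp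
    have xb: "- (\<beta> / 2) < x" using x by simp
    have "?p n = ?m * exp (- (x * ?s)) *
       (LINT z|tilted_law (det_law i \<beta> \<tau>1 \<tau>2 n) x ?m (sgn x) ?s. indicator {0..} z * exp (- (x * sgn x * z)))"
      by (rule half_line_prob_tilted[OF mellin xb exp_gt_zero F sg])
    also have "x * sgn x = \<bar>x\<bar>" by (simp add: sgn_if)
    also have "?m * exp (- (x * ?s)) = exp (l n) * exp (- (x\<^sup>2 * ln (real n) / \<beta>))"
      unfolding exp_add[symmetric] l_def by (simp add: power2_eq_square field_simps)
    finally have p: "?p n = exp (l n) * exp (- (x\<^sup>2 * ln (real n) / \<beta>)) * I n" unfolding I_def .
    have "0 < ln (real n)" using elim by simp
    then have sq: "0 < sqrt (4 * pi * ln (real n) / \<beta>)" using \<beta> by simp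
    have r: "E * K * J / (K / (X * S) * P) = E / P * (X * (S * J))" if "K \<noteq> 0" "X \<noteq> 0" "S \<noteq> 0" "P \<noteq> 0" for E K J X S P :: real
      using that by (simp add: field_simps)
    have "2 * pi * (2 * ln (real n) / \<beta>) = 4 * pi * ln (real n) / \<beta>" by simp
    then show ?case unfolding p using r[of "exp (- (x\<^sup>2 * ln (real n) / \<beta>))" "\<bar>x\<bar>" "sqrt (4 * pi * ln (real n) / \<beta>)" "psi i \<beta> \<tau>1 \<tau>2 x" "exp (l n)" "I n"]
        x sq psi_pos[of i \<beta> \<tau>1 \<tau>2 x] by simp
  qed
  ultimately show "(\<lambda>n. ?p n / ?q n) \<longlonglongrightarrow> 1" using Lim_transform_eventually by simp
qed

theorem theorem4p9:
  fixes \<beta> \<tau>1 \<tau>2 :: real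
    and i :: ensemble
    and P :: "nat \<Rightarrow> 'a measure"
    and D X :: "nat \<Rightarrow> 'a \<Rightarrow> real"
  assumes "\<beta> > 0" and "\<tau>1 > 0" and "\<tau>2 > 0"
    and "\<And>n. n \<ge> 1 \<Longrightarrow> prob_space (P n)"
    and "\<And>n. n \<ge> 1 \<Longrightarrow> D n \<in> borel_measurable (P n)"
    and "\<And>n. n \<ge> 1 \<Longrightarrow> distr (P n) borel (D n) = det_law i \<beta> \<tau>1 \<tau>2 n"
    and "\<And>n \<omega>. X n \<omega> = ln (D n \<omega>) - centering i \<beta> \<tau>1 \<tau>2 n"
  shows "(\<forall>x>0.
           (\<lambda>n. \<P>(\<omega> in P n. X n \<omega> \<ge> 2 * x * ln (real n) / \<beta>))
           \<sim>[at_top]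
           (\<lambda>n. exp (- (x\<^sup>2 * ln (real n) / \<beta>)) / (x * sqrt (4 * pi * ln (real n) / \<beta>))
                  * psi i \<beta> \<tau>1 \<tau>2 x)) \<and>
         (\<forall>x. -\<beta>/2 < x \<and> x < 0 \<longrightarrow>
           (\<lambda>n. \<P>(\<omega> in P n. X n \<omega> \<le> 2 * x * ln (real n) / \<beta>))
           \<sim>[at_top]
           (\<lambda>n. exp (- (x\<^sup>2 * ln (real n) / \<beta>)) / (\<bar>x\<bar> * sqrt (4 * pi * ln (real n) / \<beta>))
                  * psi i \<beta> \<tau>1 \<tau>2 x))"
proof -
  let ?A = "\<lambda>x n. {y. 0 \<le> sgn x * (ln y - (centering i \<beta> \<tau>1 \<tau>2 n + 2 * ln (real n) / \<beta> * x))}"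
  have law: "measure (det_law i \<beta> \<tau>1 \<tau>2 n) (?A x n) = \<P>(\<omega> in P n. 0 \<le> sgn x * (X n \<omega> - 2 * x * ln (real n) / \<beta>))"
    if n: "1 \<le> n" for x n
  proof -
    have "?A x n \<in> sets borel" by measurable
    then have "measure (det_law i \<beta> \<tau>1 \<tau>2 n) (?A x n) = measure (P n) (D n -` ?A x n \<inter> space (P n))"
      unfolding assms(6)[OF n, symmetric] by (intro measure_distr assms(5)[OF n])
    also have "D n -` ?A x n \<inter> space (P n) = {\<omega> \<in> space (P n). 0 \<le> sgn x * (X n \<omega> - 2 * x * ln (real n) / \<beta>)}"
      by (auto simp: assms(7) algebra_simps)
    finally show ?thesis .
  qed
  have main: "(\<lambda>n. \<P>(\<omega> in P n. 0 \<le> sgn x * (X n \<omega> - 2 * x * ln (real n) / \<beta>))) \<sim>[at_top]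
      (\<lambda>n. exp (- (x\<^sup>2 * ln (real n) / \<beta>)) / (\<bar>x\<bar> * sqrt (4 * pi * ln (real n) / \<beta>)) * psi i \<beta> \<tau>1 \<tau>2 x)"
    if "- \<beta> / 2 < x" "x \<noteq> 0" for x
  proof (rule asymp_equiv_transfer[OF det_law_tail_asymp_equiv[OF assms(1-3) that, of i]])
    show "eventually (\<lambda>n. measure (det_law i \<beta> \<tau>1 \<tau>2 n) (?A x n) = \<P>(\<omega> in P n. 0 \<le> sgn x * (X n \<omega> - 2 * x * ln (real n) / \<beta>))) sequentially"
      using eventually_ge_at_top[of 1] by eventually_elim (rule law)
  qed simp
  show ?thesis
  proof (intro conjI allI impI)
    fix x :: real assume x: "0 < x"
    then have "- \<beta> / 2 < x" using assms(1) by (simp add: field_simps)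
    from main[OF this] show "(\<lambda>n. \<P>(\<omega> in P n. X n \<omega> \<ge> 2 * x * ln (real n) / \<beta>)) \<sim>[at_top]
      (\<lambda>n. exp (- (x\<^sup>2 * ln (real n) / \<beta>)) / (x * sqrt (4 * pi * ln (real n) / \<beta>)) * psi i \<beta> \<tau>1 \<tau>2 x)"
      using x by simp
  next
    fix x :: real assume x: "- \<beta> / 2 < x \<and> x < 0"
    from main[of x] x show "(\<lambda>n. \<P>(\<omega> in P n. X n \<omega> \<le> 2 * x * ln (real n) / \<beta>)) \<sim>[at_top]
      (\<lambda>n. exp (- (x\<^sup>2 * ln (real n) / \<beta>)) / (\<bar>x\<bar> * sqrt (4 * pi * ln (real n) / \<beta>)) * psi i \<beta> \<tau>1 \<tau>2 x)"
      by simp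
  qed
qed

end
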